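(* Let $\Omega\subset\mathbb{R}^3$ be an exterior Lipschitz domain. Let $\varepsilon>0$ be a number such that, with $n=3$: for every $p\in(1,\infty)$ with $|\frac1p-\frac12|<\frac16+\varepsilon$, $-A_p$ generates a bounded analytic semigroup $(T(t))_{t\ge0}$ on $L^p_\sigma(\Omega)$ and $\mathcal{D}(A_p)\subset W^{1,p}_{0,\sigma}(\Omega)$ continuously; for all such $p\le q$ there is a constant $C$ with $$\|T(t)f\|_{L^q_\sigma(\Omega)}\le Ct^{-\frac32(\frac1p-\frac1q)}\|f\|_{L^p_\sigma(\Omega)}\quad (t>0,\ f\in L^p_\sigma(\Omega));\qquad(\mathrm{E1})$$ and for all such $p\le q$ with additionally $p\le2$ and $q<3$ there is a constant $C$ with $$\|\nabla T(t)f\|_{L^q(\Omega;\mathbb{C}^{9})}\le Ct^{-\frac12-\frac32(\frac1p-\frac1q)}\|f\|_{L^p_\sigma(\Omega)}\quad (t>0,\ f\in L^p_\sigma(\Omega)).\qquad(\mathrm{E2})$$ Let $3\le r<\min\{3+\varepsilon,4\}$ and $a\in L^r_\sigma(\Omega)$. Then the following hold. (1) There exist a number $T_0>0$ and a mild solution $u$ on $[0,T_0)$ to the Navier–Stokes equations with initial value $a$ such that for all $p$ with $r\le p<\min\{3+\varepsilon,4\}$ $$t\mapsto t^{\frac32(\frac1r-\frac1p)}u(t)\in BC([0,T_0);L^p_\sigma(\Omega))\qquad\text{and}\qquad\|u(t)-a\|_{L^r_\sigma(\Omega)}\to0\ \text{ as } t\searrow0.$$ Moreover, if $p>r$, then $t^{\frac32(\frac1r-\frac1p)}\|u(t)\|_{L^p_\sigma(\Omega)}\to0$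 as $t\searrow0$. (2) If $r>3$, there exists a constant $C>0$, depending only on $r$, $p$ (with $p$ as in (1)), and the constants in the estimates (E1) and (E2), such that $$T_0\ge C\|a\|_{L^r_\sigma(\Omega)}^{-\frac{2r}{r-3}}.$$ (3) For all $3\le p<\min\{3+\varepsilon,4\}$ there are constants $C_1,C_2>0$, depending only on $p$ and the constants in the estimates (E1) and (E2), such that if $\|a\|_{L^3_\sigma(\Omega)}<C_1$, then the solution obtained in (1) is global in time, i.e. $T_0=\infty$, and it satisfies $$\|u(t)\|_{L^p_\sigma(\Omega)}\le C_2\,t^{-\frac32(\frac13-\frac1p)}\qquad(0<t<\infty).$$
   Context: A bounded Lipschitz domain is a bounded, open, connected subset of $\mathbb{R}^n$ which near each boundary point, in a suitable coordinate system $(x',x_n)$, coincides with $\{x_n>\zeta(x')\}$ for some Lipschitz function $\zeta:\mathbb{R}^{n-1}\to\mathbb{R}$ (and whose boundary coincides there with the graph of $\zeta$). An exterior Lipschitz domain is $\Omega=\mathbb{R}^n\setminus\overline{\mathcal{O}}$ with $\mathcal{O}$ a bounded Lipschitz domain. $C^\infty_{c,\sigma}(\Omega)=\{\varphi\in C_c^\infty(\Omega;\mathbb{C}^n):\operatorname{div}\varphi=0\}$; $L^p_\sigma(\Omega)$ and $W^{1,p}_{0,\sigma}(\Omega)$ are its closures in $L^p(\Omega;\mathbb{C}^n)$ and $W^{1,p}(\Omega;\mathbb{C}^n)$. $BC([0,T);X)$ denotes the bounded continuous functions on $[0,T)$ with values in $X$. Stokes operator: $A_2$ is the operator in $L^2_\sigma(\Omega)$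 associated with the sesquilinear form $(u,v)\mapsto\int_\Omega\nabla u\cdot\overline{\nabla v}\,dx$ on $W^{1,2}_{0,\sigma}(\Omega)$. The part of $A_2$ in $L^p_\sigma(\Omega)$ has domain $\{u\in\mathcal{D}(A_2)\cap L^p_\sigma(\Omega):A_2u\in L^p_\sigma(\Omega)\}$, and $A_p$ is its closure in $L^p_\sigma(\Omega)$. A number $\varepsilon$ as required in the statement exists for every exterior Lipschitz domain. The Navier–Stokes equations are: $\partial_tu-\Delta u+(u\cdot\nabla)u+\nabla\pi=0$ and $\operatorname{div}u=0$ in $(0,T)\times\Omega$, $u=0$ on $(0,T)\times\partial\Omega$, $u(0)=a$ in $\Omega$. For $a\in L^r_\sigma(\Omega)$, a mild solution on $[0,T)$ is a function $u\in C([0,T);L^r_\sigma(\Omega))$ with $u(0)=a$ and $$u(t)=T(t)a-\int_0^tT(t-s)\mathbb{P}\operatorname{div}(u(s)\otimes u(s))\,ds\qquad(0<t<T),$$ where $\mathbb{P}$ is the Helmholtz projection (the orthogonal projection of $L^2(\Omega;\mathbb{C}^3)$ onto $L^2_\sigma(\Omega)$, extended to $L^p$). For $\tau>0$ the operator $T(\tau)\mathbb{P}\operatorname{div}$ acting on matrix fields is understood as the bounded extension defined by duality, $\langle T(\tau)\mathbb{P}\operatorname{div}F,\varphi\rangle=-\langle F,\nabla T(\tau)\varphi\rangle$ for solenoidal test functions $\varphi$. *)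

theory Defs
  imports "HOL-Analysis.Analysis"
begin

section \<open>Lipschitz domains\<close>

text \<open>
  Near a boundary point \<open>x0\<close> the coordinates of \<open>x\<close> are \<open>Q (x - x0)\<close> with \<open>Q\<close> orthogonal, and
  \<open>\<zeta>\<close> is a function of the first two of them.  No nonemptiness is required: \<open>\<O> = {}\<close> is allowed,
  so the whole space counts as an exterior domain.
\<close>

definition bounded_lipschitz_domain :: "(real^3) set \<Rightarrow> bool" where
  "bounded_lipschitz_domain D \<longleftrightarrow> bounded D \<and> open D \<and> connected D \<and>
     (\<forall>x0\<in>frontier D. \<exists>(Q :: real^3 \<Rightarrow> real^3) (\<zeta> :: real^2 \<Rightarrow> real) L U.
        orthogonal_transformation Q \<and> L-lipschitz_on UNIV \<zeta> \<and> open U \<and> x0 \<in> U \<and>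
        D \<inter> U = {x\<in>U. let y = Q (x - x0) in y $ 3 > \<zeta> (vector [y $ 1, y $ 2])} \<and>
        frontier D \<inter> U = {x\<in>U. let y = Q (x - x0) in y $ 3 = \<zeta> (vector [y $ 1, y $ 2])})"

definition exterior_lipschitz_domain :: "(real^3) set \<Rightarrow> bool" where
  "exterior_lipschitz_domain \<Omega> \<longleftrightarrow> (\<exists>D. bounded_lipschitz_domain D \<and> \<Omega> = - closure D)"


section \<open>Test functions\<close>

definition partial_deriv :: "'n \<Rightarrow> (real^'n \<Rightarrow> 'b) \<Rightarrow> real^'n \<Rightarrow> 'b::real_normed_vector" where
  "partial_deriv i f x = frechet_derivative f (at x) (axis i 1)"

text \<open>All iterated partial derivatives exist and are differentiable, hence continuous.\<close>

definition smooth :: "(real^'n \<Rightarrow> 'b::real_normed_vector) \<Rightarrow> bool" where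
  "smooth f \<longleftrightarrow> (\<forall>is. foldr partial_deriv is f differentiable_on UNIV)"

text \<open>Elements of \<open>C\<^sub>c\<^sup>\<infinity>(\<Omega>)\<close> are extended by zero to the whole space.\<close>

definition test_functions :: "(real^'n) set \<Rightarrow> (real^'n \<Rightarrow> 'b::real_normed_vector) set" where
  "test_functions \<Omega> =
     {\<phi>. smooth \<phi> \<and> compact (closure {x. \<phi> x \<noteq> 0}) \<and> closure {x. \<phi> x \<noteq> 0} \<subseteq> \<Omega>}"

type_synonym 'n field = "real^'n \<Rightarrow> complex^'n"

definition divergence :: "'n::finite field \<Rightarrow> real^'n \<Rightarrow> complex" where
  "divergence \<phi> x = (\<Sum>i\<in>UNIV. partial_deriv i \<phi> x $ i)"

definition solenoidal_tests :: "(real^'n::finite) set \<Rightarrow> 'n field set" where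
  "solenoidal_tests \<Omega> = {\<phi> \<in> test_functions \<Omega>. \<forall>x. divergence \<phi> x = 0}"


section \<open>Lebesgue and Sobolev spaces\<close>

text \<open>
  Elements of function spaces on \<open>\<Omega>\<close> are represented by functions on the whole space, whose values
  off \<open>\<Omega>\<close> play no role; equality of elements is \<open>ae_eq\<close>.
\<close>

definition ae_eq :: "'a::euclidean_space set \<Rightarrow> ('a \<Rightarrow> 'b) \<Rightarrow> ('a \<Rightarrow> 'b) \<Rightarrow> bool" where
  "ae_eq \<Omega> f g \<longleftrightarrow> (AE x in lebesgue_on \<Omega>. f x = g x)"

definition Lp :: "real \<Rightarrow> 'a::euclidean_space set \<Rightarrow> ('a \<Rightarrow> 'b::euclidean_space) set" where
  "Lp p \<Omega> = {f \<in> borel_measurable (lebesgue_on \<Omega>).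
                integrable (lebesgue_on \<Omega>) (\<lambda>x. norm (f x) powr p)}"

definition Lp_norm :: "real \<Rightarrow> 'a::euclidean_space set \<Rightarrow> ('a \<Rightarrow> 'b::euclidean_space) \<Rightarrow> real" where
  "Lp_norm p \<Omega> f = (LINT x|lebesgue_on \<Omega>. norm (f x) powr p) powr (1 / p)"

definition locally_integrable :: "'a::euclidean_space set \<Rightarrow> ('a \<Rightarrow> 'b::euclidean_space) \<Rightarrow> bool" where
  "locally_integrable \<Omega> f \<longleftrightarrow> (\<forall>K. compact K \<and> K \<subseteq> \<Omega> \<longrightarrow> integrable (lebesgue_on K) f)"

text \<open>In a gradient \<open>G\<close>, the entry \<open>G x $ i $ j\<close> is \<open>\<partial>\<^sub>i u\<^sub>j\<close>.\<close>

definition has_weak_gradient ::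
    "(real^'n::finite) set \<Rightarrow> 'n field \<Rightarrow> (real^'n \<Rightarrow> complex^'n^'n) \<Rightarrow> bool" where
  "has_weak_gradient \<Omega> u G \<longleftrightarrow> locally_integrable \<Omega> u \<and> locally_integrable \<Omega> G \<and>
     (\<forall>\<psi> :: real^'n \<Rightarrow> real. \<psi> \<in> test_functions \<Omega> \<longrightarrow>
        (\<forall>i. (LINT x|lebesgue_on \<Omega>. partial_deriv i \<psi> x *\<^sub>R u x) =
              - (LINT x|lebesgue_on \<Omega>. \<psi> x *\<^sub>R (G x $ i))))"

definition weak_gradient :: "(real^'n::finite) set \<Rightarrow> 'n field \<Rightarrow> real^'n \<Rightarrow> complex^'n^'n" where
  "weak_gradient \<Omega> u = (SOME G. has_weak_gradient \<Omega> u G)"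

definition W1p :: "real \<Rightarrow> (real^'n::finite) set \<Rightarrow> 'n field set" where
  "W1p p \<Omega> = {u \<in> Lp p \<Omega>. \<exists>G \<in> Lp p \<Omega>. has_weak_gradient \<Omega> u G}"

definition W1p_norm :: "real \<Rightarrow> (real^'n::finite) set \<Rightarrow> 'n field \<Rightarrow> real" where
  "W1p_norm p \<Omega> u = Lp_norm p \<Omega> u + Lp_norm p \<Omega> (weak_gradient \<Omega> u)"

definition Lp_sigma :: "real \<Rightarrow> (real^'n::finite) set \<Rightarrow> 'n field set" where
  "Lp_sigma p \<Omega> = {u \<in> Lp p \<Omega>. \<exists>\<phi>. (\<forall>k::nat. \<phi> k \<in> solenoidal_tests \<Omega>) \<and>
       (\<lambda>k. Lp_norm p \<Omega> (\<lambda>x. \<phi> k x - u x)) \<longlonglongrightarrow> 0}"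

definition W1p_0_sigma :: "real \<Rightarrow> (real^'n::finite) set \<Rightarrow> 'n field set" where
  "W1p_0_sigma p \<Omega> = {u \<in> W1p p \<Omega>. \<exists>\<phi>. (\<forall>k::nat. \<phi> k \<in> solenoidal_tests \<Omega>) \<and>
       (\<lambda>k. W1p_norm p \<Omega> (\<lambda>x. \<phi> k x - u x)) \<longlonglongrightarrow> 0}"


section \<open>The Stokes operator\<close>

definition cdot :: "complex^'n::finite \<Rightarrow> complex^'n \<Rightarrow> complex" where
  "cdot v w = (\<Sum>i\<in>UNIV. v $ i * cnj (w $ i))"

definition mat_cdot :: "complex^'n^'n::finite \<Rightarrow> complex^'n^'n \<Rightarrow> complex" where
  "mat_cdot A B = (\<Sum>i\<in>UNIV. \<Sum>j\<in>UNIV. A $ i $ j * cnj (B $ i $ j))"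

text \<open>Operators with domain are represented by their graphs.\<close>

definition stokes_2 :: "(real^'n::finite) set \<Rightarrow> ('n field \<times> 'n field) set" where
  "stokes_2 \<Omega> = {(u, f). u \<in> W1p_0_sigma 2 \<Omega> \<and> f \<in> Lp_sigma 2 \<Omega> \<and>
     (\<forall>v \<in> W1p_0_sigma 2 \<Omega>.
        (LINT x|lebesgue_on \<Omega>. mat_cdot (weak_gradient \<Omega> u x) (weak_gradient \<Omega> v x)) =
        (LINT x|lebesgue_on \<Omega>. cdot (f x) (v x)))}"

definition stokes_part :: "real \<Rightarrow> (real^'n::finite) set \<Rightarrow> ('n field \<times> 'n field) set" where
  "stokes_part p \<Omega> = stokes_2 \<Omega> \<inter> Lp_sigma p \<Omega> \<times> Lp_sigma p \<Omega>"

definition stokes :: "real \<Rightarrow> (real^'n::finite) set \<Rightarrow> ('n field \<times> 'n field) set" where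
  "stokes p \<Omega> = {(u, f). u \<in> Lp_sigma p \<Omega> \<and> f \<in> Lp_sigma p \<Omega> \<and>
     (\<exists>v g. (\<forall>k::nat. (v k, g k) \<in> stokes_part p \<Omega>) \<and>
        (\<lambda>k. Lp_norm p \<Omega> (\<lambda>x. v k x - u x)) \<longlonglongrightarrow> 0 \<and>
        (\<lambda>k. Lp_norm p \<Omega> (\<lambda>x. g k x - f x)) \<longlonglongrightarrow> 0)}"

definition stokes_domain_embeds :: "real \<Rightarrow> (real^'n::finite) set \<Rightarrow> bool" where
  "stokes_domain_embeds p \<Omega> \<longleftrightarrow> (\<exists>M. \<forall>(u, f) \<in> stokes p \<Omega>.
     u \<in> W1p_0_sigma p \<Omega> \<and> W1p_norm p \<Omega> u \<le> M * (Lp_norm p \<Omega> u + Lp_norm p \<Omega> f))"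


section \<open>Bounded analytic semigroups on \<open>L\<^sup>p\<^sub>\<sigma>\<close>\<close>

definition bounded_operator :: "real \<Rightarrow> (real^'n::finite) set \<Rightarrow> ('n field \<Rightarrow> 'n field) \<Rightarrow> bool" where
  "bounded_operator p \<Omega> B \<longleftrightarrow>
     (\<forall>f \<in> Lp_sigma p \<Omega>. B f \<in> Lp_sigma p \<Omega>) \<and>
     (\<forall>f \<in> Lp_sigma p \<Omega>. \<forall>g \<in> Lp_sigma p \<Omega>.
        ae_eq \<Omega> (B (\<lambda>x. f x + g x)) (\<lambda>x. B f x + B g x)) \<and>
     (\<forall>c. \<forall>f \<in> Lp_sigma p \<Omega>. ae_eq \<Omega> (B (\<lambda>x. c *s f x)) (\<lambda>x. c *s B f x)) \<and>
     (\<exists>M. \<forall>f \<in> Lp_sigma p \<Omega>. Lp_norm p \<Omega> (B f) \<le> M * Lp_norm p \<Omega> f)"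

definition sector :: "real \<Rightarrow> complex set" where
  "sector \<theta> = {z. z \<noteq> 0 \<and> \<bar>Arg z\<bar> < \<theta>}"

text \<open>
  \<open>S\<close> is a bounded analytic semigroup of angle \<open>\<theta>\<close>; analyticity is complex differentiability
  in the operator norm.
\<close>

definition bounded_analytic_semigroup ::
    "real \<Rightarrow> (real^'n::finite) set \<Rightarrow> real \<Rightarrow> (complex \<Rightarrow> 'n field \<Rightarrow> 'n field) \<Rightarrow> bool" where
  "bounded_analytic_semigroup p \<Omega> \<theta> S \<longleftrightarrow>
     (\<forall>z \<in> insert 0 (sector \<theta>). bounded_operator p \<Omega> (S z)) \<and>
     (\<forall>f \<in> Lp_sigma p \<Omega>. ae_eq \<Omega> (S 0 f) f) \<and>
     (\<forall>z \<in> sector \<theta>. \<forall>w \<in> sector \<theta>. \<forall>f \<in> Lp_sigma p \<Omega>. ae_eq \<Omega> (S (z + w) f) (S z (S w f))) \<and>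
     (\<forall>z \<in> sector \<theta>. \<exists>D. (\<forall>f \<in> Lp_sigma p \<Omega>. D f \<in> Lp_sigma p \<Omega>) \<and>
        (\<forall>e>0. \<exists>d>0. \<forall>h. norm h < d \<and> z + h \<in> sector \<theta> \<longrightarrow>
           (\<forall>f \<in> Lp_sigma p \<Omega>.
              Lp_norm p \<Omega> (\<lambda>x. S (z + h) f x - S z f x - h *s D f x) \<le> e * norm h * Lp_norm p \<Omega> f))) \<and>
     (\<forall>\<theta>'. 0 < \<theta>' \<and> \<theta>' < \<theta> \<longrightarrow>
        (\<forall>f \<in> Lp_sigma p \<Omega>.
           ((\<lambda>z. Lp_norm p \<Omega> (\<lambda>x. S z f x - f x)) \<longlongrightarrow> 0) (at 0 within sector \<theta>')) \<and>
        (\<exists>M. \<forall>z \<in> sector \<theta>'. \<forall>f \<in> Lp_sigma p \<Omega>. Lp_norm p \<Omega> (S z f) \<le> M * Lp_norm p \<Omega> f))"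

text \<open>
  \<open>-A\<close> generates \<open>(T(t))\<^sub>t\<^sub>\<ge>\<^sub>0\<close>, and \<open>T\<close> extends to a bounded analytic semigroup.  The last
  conjunct says that \<open>-A\<close> is exactly the infinitesimal generator of \<open>T\<close>.
\<close>

definition neg_generates_bounded_analytic ::
    "real \<Rightarrow> (real^'n::finite) set \<Rightarrow> ('n field \<times> 'n field) set \<Rightarrow>
     (real \<Rightarrow> 'n field \<Rightarrow> 'n field) \<Rightarrow> bool" where
  "neg_generates_bounded_analytic p \<Omega> A T \<longleftrightarrow>
     (\<exists>\<theta> S. 0 < \<theta> \<and> \<theta> \<le> pi / 2 \<and> bounded_analytic_semigroup p \<Omega> \<theta> S \<and>
        (\<forall>t\<ge>0. \<forall>f \<in> Lp_sigma p \<Omega>. ae_eq \<Omega> (S (complex_of_real t) f) (T t f))) \<and>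
     (\<forall>u \<in> Lp_sigma p \<Omega>. \<forall>f \<in> Lp_sigma p \<Omega>. (u, f) \<in> A \<longleftrightarrow>
        ((\<lambda>h. Lp_norm p \<Omega> (\<lambda>x. (1 / h) *\<^sub>R (T h u x - u x) + f x)) \<longlongrightarrow> 0) (at_right 0))"


section \<open>The standing estimates in dimension three\<close>

definition admissible_exponent :: "real \<Rightarrow> real \<Rightarrow> bool" where
  "admissible_exponent \<epsilon> p \<longleftrightarrow> 1 < p \<and> \<bar>1 / p - 1 / 2\<bar> < 1 / 6 + \<epsilon>"

text \<open>
  The constants of each family of estimates form a map whose domain is precisely the set of
  exponent pairs for which the estimate is stated.
\<close>

type_synonym constants = "real \<times> real \<rightharpoonup> real"

definition estimate_E1 ::
    "real \<Rightarrow> (real^3) set \<Rightarrow> (real \<Rightarrow> 3 field \<Rightarrow> 3 field) \<Rightarrow> constants \<Rightarrow> bool" where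
  "estimate_E1 \<epsilon> \<Omega> T K \<longleftrightarrow>
     dom K = {(p, q). admissible_exponent \<epsilon> p \<and> admissible_exponent \<epsilon> q \<and> p \<le> q} \<and>
     (\<forall>(p, q) \<in> dom K. \<forall>t>0. \<forall>f \<in> Lp_sigma p \<Omega>. T t f \<in> Lp_sigma q \<Omega> \<and>
        Lp_norm q \<Omega> (T t f)
          \<le> the (K (p, q)) * t powr (- (3/2) * (1/p - 1/q)) * Lp_norm p \<Omega> f)"

definition estimate_E2 ::
    "real \<Rightarrow> (real^3) set \<Rightarrow> (real \<Rightarrow> 3 field \<Rightarrow> 3 field) \<Rightarrow> constants \<Rightarrow> bool" where
  "estimate_E2 \<epsilon> \<Omega> T K \<longleftrightarrow>
     dom K = {(p, q). admissible_exponent \<epsilon> p \<and> admissible_exponent \<epsilon> q \<and> p \<le> q \<and> p \<le> 2 \<and> q < 3} \<and>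
     (\<forall>(p, q) \<in> dom K. \<forall>t>0. \<forall>f \<in> Lp_sigma p \<Omega>.
        \<exists>G \<in> Lp q \<Omega>. has_weak_gradient \<Omega> (T t f) G \<and>
        Lp_norm q \<Omega> G
          \<le> the (K (p, q)) * t powr (- (1/2) - (3/2) * (1/p - 1/q)) * Lp_norm p \<Omega> f)"


section \<open>Mild solutions\<close>

definition time_interval :: "ereal \<Rightarrow> real set" where
  "time_interval T0 = {t. 0 \<le> t \<and> ereal t < T0}"

definition continuous_Lp_sigma ::
    "real \<Rightarrow> (real^'n::finite) set \<Rightarrow> ereal \<Rightarrow> (real \<Rightarrow> 'n field) \<Rightarrow> bool" where
  "continuous_Lp_sigma p \<Omega> T0 v \<longleftrightarrow> (\<forall>t \<in> time_interval T0. v t \<in> Lp_sigma p \<Omega> \<and>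
     ((\<lambda>s. Lp_norm p \<Omega> (\<lambda>x. v s x - v t x)) \<longlongrightarrow> 0) (at t within time_interval T0))"

definition BC_Lp_sigma ::
    "real \<Rightarrow> (real^'n::finite) set \<Rightarrow> ereal \<Rightarrow> (real \<Rightarrow> 'n field) \<Rightarrow> bool" where
  "BC_Lp_sigma p \<Omega> T0 v \<longleftrightarrow> continuous_Lp_sigma p \<Omega> T0 v \<and>
     (\<exists>M. \<forall>t \<in> time_interval T0. Lp_norm p \<Omega> (v t) \<le> M)"

text \<open>The power \<open>t\<^sup>\<alpha>\<close> with \<open>0\<^sup>0 = 1\<close>; in contrast, \<open>0 powr 0 = 0\<close>.\<close>

definition time_weight :: "real \<Rightarrow> real \<Rightarrow> real" where
  "time_weight \<alpha> t = (if \<alpha> = 0 then 1 else t powr \<alpha>)"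

text \<open>
  Bochner integral over \<open>I\<close> of an \<open>L\<^sup>p(\<Omega>)\<close>-valued function \<open>g\<close>, as the limit of the integrals of
  simple functions approximating \<open>g\<close> in \<open>L\<^sup>1(I; L\<^sup>p(\<Omega>))\<close>.  (The library's Bochner integral needs
  the target space to be a type.)
\<close>

definition has_Lp_bochner_integral ::
    "real \<Rightarrow> (real^'n::finite) set \<Rightarrow> real set \<Rightarrow> (real \<Rightarrow> 'n field) \<Rightarrow> 'n field \<Rightarrow> bool" where
  "has_Lp_bochner_integral p \<Omega> I g w \<longleftrightarrow> w \<in> Lp p \<Omega> \<and> (\<forall>s\<in>I. g s \<in> Lp p \<Omega>) \<and>
     (\<exists>(m :: nat \<Rightarrow> nat) (E :: nat \<Rightarrow> nat \<Rightarrow> real set) (c :: nat \<Rightarrow> nat \<Rightarrow> 'n field).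
        (\<forall>k j. E k j \<in> lmeasurable \<and> E k j \<subseteq> I \<and> c k j \<in> Lp p \<Omega>) \<and>
        (\<forall>k. integrable (lebesgue_on I)
           (\<lambda>s. Lp_norm p \<Omega> (\<lambda>x. g s x - (\<Sum>j<m k. indicat_real (E k j) s *\<^sub>R c k j x)))) \<and>
        (\<lambda>k. LINT s|lebesgue_on I.
           Lp_norm p \<Omega> (\<lambda>x. g s x - (\<Sum>j<m k. indicat_real (E k j) s *\<^sub>R c k j x))) \<longlonglongrightarrow> 0 \<and>
        (\<lambda>k. Lp_norm p \<Omega> (\<lambda>x. w x - (\<Sum>j<m k. measure lebesgue (E k j) *\<^sub>R c k j x))) \<longlonglongrightarrow> 0)"

text \<open>
  \<open>g = T(\<tau>) \<P> div F\<close> in \<open>L\<^sup>r\<^sub>\<sigma>(\<Omega>)\<close>, defined by duality: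
  \<open>\<langle>g, \<phi>\<rangle> = - \<langle>F, \<nabla> T(\<tau>) \<phi>\<rangle>\<close> for all solenoidal test functions \<open>\<phi>\<close>.  The row-wise divergence
  \<open>(div F)\<^sub>j = \<Sum>\<^sub>i \<partial>\<^sub>i F\<^sub>i\<^sub>j\<close> matches the index order of \<open>has_weak_gradient\<close>.
\<close>

definition semigroup_proj_div ::
    "real \<Rightarrow> (real^'n::finite) set \<Rightarrow> (real \<Rightarrow> 'n field \<Rightarrow> 'n field) \<Rightarrow> real \<Rightarrow>
     (real^'n \<Rightarrow> complex^'n^'n) \<Rightarrow> 'n field \<Rightarrow> bool" where
  "semigroup_proj_div r \<Omega> T \<tau> F g \<longleftrightarrow> g \<in> Lp_sigma r \<Omega> \<and>
     (\<forall>\<phi> \<in> solenoidal_tests \<Omega>. \<exists>G. has_weak_gradient \<Omega> (T \<tau> \<phi>) G \<and>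
        integrable (lebesgue_on \<Omega>) (\<lambda>x. mat_cdot (F x) (G x)) \<and>
        (LINT x|lebesgue_on \<Omega>. cdot (g x) (\<phi> x)) =
          - (LINT x|lebesgue_on \<Omega>. mat_cdot (F x) (G x)))"

definition tensor :: "complex^'n \<Rightarrow> complex^'n \<Rightarrow> complex^'n^'n" where
  "tensor v w = (\<chi> i j. v $ i * w $ j)"

definition mild_solution ::
    "(real^'n::finite) set \<Rightarrow> (real \<Rightarrow> 'n field \<Rightarrow> 'n field) \<Rightarrow> real \<Rightarrow> 'n field \<Rightarrow>
     ereal \<Rightarrow> (real \<Rightarrow> 'n field) \<Rightarrow> bool" where
  "mild_solution \<Omega> T r a T0 u \<longleftrightarrow>
     continuous_Lp_sigma r \<Omega> T0 u \<and> ae_eq \<Omega> (u 0) a \<and>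
     (\<forall>t. 0 < t \<and> ereal t < T0 \<longrightarrow>
        (\<exists>g w. (\<forall>s. 0 < s \<and> s < t \<longrightarrow>
             semigroup_proj_div r \<Omega> T (t - s) (\<lambda>x. tensor (u s x) (u s x)) (g s)) \<and>
           has_Lp_bochner_integral r \<Omega> {0<..<t} g w \<and>
           ae_eq \<Omega> (u t) (\<lambda>x. T t a x - w x)))"

end

theory Submission
  imports Defs
begin

text \<open>
  The solution is obtained by Picard iteration for \<open>u(t) = T(t)a - \<integral>\<^sub>0\<^sup>t T(t-s)\<P>div(u(s) \<otimes> u(s)) ds\<close> in
  one auxiliary space \<open>L\<^sup>q\<^sub>\<sigma>\<close>, \<open>3 < q < 4\<close>, with norm \<open>sup t\<^sup>\<alpha> \<parallel>u(t)\<parallel>\<^sub>q\<close>.  The operator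
  \<open>T(\<tau>)\<P>div = T(\<tau>/2) T(\<tau>/2)\<P>div\<close> maps \<open>L\<^sup>q\<^sup>/\<^sup>2\<close> to \<open>L\<^sup>p\<^sub>\<sigma>\<close>: its right factor is the \<open>L\<^sup>2\<close>-dual of
  \<open>\<nabla>T(\<tau>/2) : L\<^sup>2\<^sub>\<sigma> \<rightarrow> L\<^sup>(\<^sup>q\<^sup>/\<^sup>2\<^sup>)\<^sup>'\<close>, which (E2) controls since \<open>(q/2)' < 3\<close>, and (E1) with
  \<open>2 \<le> p\<close> handles the left one.  All the \<open>L\<^sup>p\<close> bounds follow by inserting the \<open>L\<^sup>q\<close> bounds of \<open>u\<close> into the
  integral.  The exponent \<open>q\<close> is taken so close to \<open>3\<close> that the kernel \<open>(t-s)\<^sup>-\<^sup>\<beta>\<close>,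
  \<open>\<beta> = 1/2 + 3/q - 3/(2p)\<close>, is integrable for every \<open>p\<close> in the range of the theorem.
\<close>

section \<open>Lebesgue spaces\<close>

text \<open>Scaling dictates all time powers. For data in L^r the Picard condition carries the
  factor t^(1/2 - 3/(2r)): for r > 3 a short time makes it small, and the time needed is the lower
  bound in (2). At r = 3 the factor is constant, so smallness must come from the data: either the
  norm is small, which serves all times, or t^\<alpha> times the L^q norm of T(t)a is small near t =
  0, because it tends to 0 for test functions and these are dense. The obstacle is that one and the
  same u must satisfy all three parts. For data small in L^3, u is the global solution built with
  the L^3 weights, which do not show its behaviour at t = 0 in the L^r scale. So the iteration
  carries along every bound with a weaker singularity that T(t)a satisfies; in the quadratic term
  one factor keeps its small bound while the other keeps the bound to be propagated. Elements of L^p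
  are represented by functions. Hence operators are linear only almost everywhere, and integrals
  with values in L^p are estimated by testing with functions of the dual exponent, which turns each
  estimate into one for a scalar integral.\<close>

lemma LpD:
  assumes "f \<in> Lp p \<Omega>"
  shows Lp_measurable: "f \<in> borel_measurable (lebesgue_on \<Omega>)"
    and Lp_integrable: "integrable (lebesgue_on \<Omega>) (\<lambda>x. norm (f x) powr p)"
  using assms by (auto simp: Lp_def)

lemma Lp_norm_nonneg [simp]: "0 \<le> Lp_norm p \<Omega> f"
  by (simp add: Lp_norm_def)

lemma Lp_norm_powr:
  assumes "p > 0"
  shows "Lp_norm p \<Omega> f powr p = (LINT x|lebesgue_on \<Omega>. norm (f x) powr p)"
  using assms by (simp add: Lp_norm_def powr_powr integral_nonneg_AE)

lemma Lp_norm_le_iff: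
  assumes "p > 0" "B \<ge> 0"
  shows "Lp_norm p \<Omega> f \<le> B \<longleftrightarrow> (LINT x|lebesgue_on \<Omega>. norm (f x) powr p) \<le> B powr p"
proof -
  have "Lp_norm p \<Omega> f \<le> B \<longleftrightarrow> Lp_norm p \<Omega> f powr p \<le> B powr p"
    using assms powr_mono2[of p "Lp_norm p \<Omega> f" B] powr_less_mono2[of p B "Lp_norm p \<Omega> f"]
    by (meson Lp_norm_nonneg less_eq_real_def not_le)
  then show ?thesis using assms by (simp add: Lp_norm_powr)
qed

lemma ae_eq_sym: "ae_eq \<Omega> f g \<Longrightarrow> ae_eq \<Omega> g f"
  unfolding ae_eq_def by (auto elim: eventually_mono)

lemma ae_eq_refl [simp]: "ae_eq \<Omega> f f"
  unfolding ae_eq_def by simp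

lemma ae_eq_trans [trans]: "ae_eq \<Omega> f g \<Longrightarrow> ae_eq \<Omega> g h \<Longrightarrow> ae_eq \<Omega> f h"
  unfolding ae_eq_def by (auto elim: eventually_elim2)

lemma Lp_norm_cong:
  assumes "ae_eq \<Omega> f g" "f \<in> borel_measurable (lebesgue_on \<Omega>)" "g \<in> borel_measurable (lebesgue_on \<Omega>)"
  shows "Lp_norm p \<Omega> f = Lp_norm p \<Omega> g"
proof -
  have "(LINT x|lebesgue_on \<Omega>. norm (f x) powr p) = (LINT x|lebesgue_on \<Omega>. norm (g x) powr p)"
    using assms by (intro integral_cong_AE) (auto simp: ae_eq_def elim: eventually_mono)
  then show ?thesis by (simp add: Lp_norm_def)
qed

lemma Lp_cong:
  assumes "ae_eq \<Omega> f g" "f \<in> Lp p \<Omega>" "g \<in> borel_measurable (lebesgue_on \<Omega>)"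
  shows "g \<in> Lp p \<Omega>"
proof -
  have "integrable (lebesgue_on \<Omega>) (\<lambda>x. norm (g x) powr p)"
    using assms LpD[OF assms(2)]
    by (subst integrable_cong_AE[of _ _ "\<lambda>x. norm (f x) powr p"])
       (auto simp: ae_eq_def elim: eventually_mono)
  then show ?thesis using assms by (simp add: Lp_def)
qed

lemma Lp_norm_eq_0_iff:
  assumes "f \<in> Lp p \<Omega>" "p > 0"
  shows "Lp_norm p \<Omega> f = 0 \<longleftrightarrow> ae_eq \<Omega> f (\<lambda>_. 0)"
proof -
  have "Lp_norm p \<Omega> f = 0 \<longleftrightarrow> (LINT x|lebesgue_on \<Omega>. norm (f x) powr p) = 0"
    using assms Lp_norm_powr[of p \<Omega> f] by (auto simp: Lp_norm_def)
  also have "\<dots> \<longleftrightarrow> (AE x in lebesgue_on \<Omega>. norm (f x) powr p = 0)"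
    using LpD[OF assms(1)] by (intro integral_nonneg_eq_0_iff_AE) auto
  finally show ?thesis using assms by (simp add: ae_eq_def)
qed

lemma Lp_zero [simp]: "(\<lambda>_. 0) \<in> Lp p \<Omega>"
  by (simp add: Lp_def)

lemma Lp_norm_zero [simp]: "Lp_norm p \<Omega> (\<lambda>_. 0) = 0"
  by (simp add: Lp_norm_def)

lemma Lp_scaleR:
  assumes "f \<in> Lp p \<Omega>"
  shows "(\<lambda>x. c *\<^sub>R f x) \<in> Lp p \<Omega>"
  using LpD[OF assms] by (auto simp: Lp_def powr_mult)

lemma Lp_norm_scaleR:
  assumes "p > 0"
  shows "Lp_norm p \<Omega> (\<lambda>x. c *\<^sub>R f x) = \<bar>c\<bar> * Lp_norm p \<Omega> f"
  using assms by (simp add: Lp_norm_def powr_mult powr_powr integral_nonneg_AE)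

text \<open>Convexity of x^p is applied where both arguments are positive. If one of them is 0, the
  claim reduces to (w z)^p \<le> w z^p, which holds because w^p \<le> w for w in [0,1].\<close>

lemma powr_convex_combination:
  fixes x y u v p :: real
  assumes "x \<ge> 0" "y \<ge> 0" "u \<ge> 0" "v \<ge> 0" "u + v = 1" "p \<ge> 1"
  shows "(u * x + v * y) powr p \<le> u * x powr p + v * y powr p"
proof -
  have *: "(w * z) powr p \<le> w * z powr p" if "0 \<le> w" "w \<le> 1" "z \<ge> 0" for w z :: real
  proof -
    have "w powr p \<le> w"
      using that assms powr_mono'[of 1 p w] by auto
    then show ?thesis using that by (simp add: powr_mult mult_right_mono)
  qed
  show ?thesis
  proof (cases "x = 0 \<or> y = 0")
    case True
    then show ?thesis using *[of u x] *[of v y] assms by auto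
  next
    case False
    then show ?thesis
      using powr_convex[OF assms(6)] assms unfolding convex_on_def by simp
  qed
qed

text \<open>s + t is (a + b) times the convex combination of s/a and t/b with weights a/(a+b) and
  b/(a+b). With the norms of f and g as a and b, integration turns this into Minkowski's
  inequality.\<close>

lemma powr_add_le_weighted:
  fixes s t a b p :: real
  assumes "s \<ge> 0" "t \<ge> 0" "a > 0" "b > 0" "p \<ge> 1"
  shows "(s + t) powr p \<le> (a + b) powr p * (a / (a + b) * (s powr p / a powr p) + b / (a + b) * (t powr p / b powr p))"
proof -
  have "s + t = (a + b) * (a / (a + b) * (s / a) + b / (a + b) * (t / b))"
  proof -
    have "a + b \<noteq> 0" "a / (a + b) * (s / a) + b / (a + b) * (t / b) = (s + t) / (a + b)"
      using assms by (simp_all add: add_divide_distrib)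
    then show ?thesis by simp
  qed
  then have "(s + t) powr p = (a + b) powr p * (a / (a + b) * (s / a) + b / (a + b) * (t / b)) powr p"
    using assms by (metis powr_mult)
  also have "\<dots> \<le> (a + b) powr p * (a / (a + b) * (s / a) powr p + b / (a + b) * (t / b) powr p)"
  proof (intro mult_left_mono powr_convex_combination)
    have "a + b \<noteq> 0" using assms by simp
    then show "a / (a + b) + b / (a + b) = 1" by (simp flip: add_divide_distrib)
  qed (use assms in auto)
  finally show ?thesis using assms by (simp add: powr_divide)
qed

lemma Lp_add:
  assumes "f \<in> Lp p \<Omega>" "g \<in> Lp p \<Omega>" "p \<ge> 1"
  shows "(\<lambda>x. f x + g x) \<in> Lp p \<Omega>"
proof -
  have m[measurable]: "f \<in> borel_measurable (lebesgue_on \<Omega>)" "g \<in> borel_measurable (lebesgue_on \<Omega>)"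
    using assms by (blast intro: Lp_measurable)+
  have "norm (f x + g x) powr p \<le> 2 powr p * (norm (f x) powr p + norm (g x) powr p)" for x
  proof -
    have "norm (f x + g x) powr p \<le> (norm (f x) + norm (g x)) powr p"
      using assms by (intro powr_mono2 norm_triangle_ineq) auto
    also have "\<dots> \<le> 2 powr p * (norm (f x) powr p / 2 + norm (g x) powr p / 2)"
      using powr_add_le_weighted[of "norm (f x)" "norm (g x)" 1 1 p] assms by auto
    also have "\<dots> \<le> 2 powr p * (norm (f x) powr p + norm (g x) powr p)"
      by (intro mult_left_mono add_mono) auto
    finally show ?thesis .
  qed
  moreover have "integrable (lebesgue_on \<Omega>) (\<lambda>x. 2 powr p * (norm (f x) powr p + norm (g x) powr p))"
    using Lp_integrable[OF assms(1)] Lp_integrable[OF assms(2)] by auto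
  ultimately have "integrable (lebesgue_on \<Omega>) (\<lambda>x. norm (f x + g x) powr p)"
    by (elim Bochner_Integration.integrable_bound) (auto intro!: AE_I2 simp: order_trans)
  then show ?thesis by (simp add: Lp_def)
qed

text \<open>With a and b the two norms, both quotients under the integral have integral 1, so the
  weighted sum integrates to (a + b)^p. A vanishing norm cannot be divided by, but then the function
  is almost everywhere 0.\<close>

lemma Lp_norm_triangle:
  assumes "f \<in> Lp p \<Omega>" "g \<in> Lp p \<Omega>" "p \<ge> 1"
  shows "Lp_norm p \<Omega> (\<lambda>x. f x + g x) \<le> Lp_norm p \<Omega> f + Lp_norm p \<Omega> g"
proof -
  have m[measurable]: "f \<in> borel_measurable (lebesgue_on \<Omega>)" "g \<in> borel_measurable (lebesgue_on \<Omega>)"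
    using assms by (blast intro: Lp_measurable)+
  define a b where "a = Lp_norm p \<Omega> f" and "b = Lp_norm p \<Omega> g"
  consider "a = 0" | "b = 0" | "a > 0" "b > 0"
    unfolding a_def b_def using Lp_norm_nonneg by (metis less_eq_real_def)
  then show ?thesis
  proof cases
    case 1
    then have "ae_eq \<Omega> f (\<lambda>_. 0)"
      using assms Lp_norm_eq_0_iff[of f p \<Omega>] by (simp add: a_def)
    then have "ae_eq \<Omega> (\<lambda>x. f x + g x) g" by (auto simp: ae_eq_def elim: eventually_mono)
    then show ?thesis using Lp_norm_cong[of \<Omega> "\<lambda>x. f x + g x" g p] by (simp add: m)
  next
    case 2
    then have "ae_eq \<Omega> g (\<lambda>_. 0)"
      using assms Lp_norm_eq_0_iff[of g p \<Omega>] by (simp add: b_def)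
    then have "ae_eq \<Omega> (\<lambda>x. f x + g x) f" by (auto simp: ae_eq_def elim: eventually_mono)
    then show ?thesis using Lp_norm_cong[of \<Omega> "\<lambda>x. f x + g x" f p] by (simp add: m)
  next
    case 3
    have i: "integrable (lebesgue_on \<Omega>) (\<lambda>x. norm (f x) powr p)"
            "integrable (lebesgue_on \<Omega>) (\<lambda>x. norm (g x) powr p)"
      using assms by (blast intro: Lp_integrable)+
    have A: "a powr p = (LINT x|lebesgue_on \<Omega>. norm (f x) powr p)"
      "b powr p = (LINT x|lebesgue_on \<Omega>. norm (g x) powr p)"
      using assms by (simp_all add: a_def b_def Lp_norm_powr)
    have "(LINT x|lebesgue_on \<Omega>. norm (f x + g x) powr p) \<le>
       (LINT x|lebesgue_on \<Omega>. (a + b) powr p * (a / (a + b) * (norm (f x) powr p / a powr p) + b / (a + b) * (norm (g x) powr p / b powr p)))"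
    proof (intro integral_mono)
      show "norm (f x + g x) powr p \<le> (a + b) powr p * (a / (a + b) * (norm (f x) powr p / a powr p) + b / (a + b) * (norm (g x) powr p / b powr p))" for x
      proof -
        have "norm (f x + g x) powr p \<le> (norm (f x) + norm (g x)) powr p"
          using assms by (intro powr_mono2 norm_triangle_ineq) auto
        also have "\<dots> \<le> (a + b) powr p * (a / (a + b) * (norm (f x) powr p / a powr p) + b / (a + b) * (norm (g x) powr p / b powr p))"
          using 3 assms by (intro powr_add_le_weighted) auto
        finally show ?thesis .
      qed
    qed (use Lp_add[OF assms] i in \<open>auto simp: Lp_def\<close>)
    also have "\<dots> = (a + b) powr p * (a / (a + b) * (a powr p / a powr p) + b / (a + b) * (b powr p / b powr p))"
      using i by (simp add: A)
    also have "\<dots> = (a + b) powr p * ((a + b) / (a + b))"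
      unfolding add_divide_distrib using 3 by simp
    also have "\<dots> = (a + b) powr p"
      using 3 by simp
    finally show ?thesis
      using 3 assms by (subst Lp_norm_le_iff) (auto simp: a_def b_def)
  qed
qed

lemma Lp_uminus: "f \<in> Lp p \<Omega> \<Longrightarrow> (\<lambda>x. - f x) \<in> Lp p \<Omega>"
  using Lp_scaleR[of f p \<Omega> "-1"] by simp

lemma Lp_norm_uminus [simp]: "Lp_norm p \<Omega> (\<lambda>x. - f x) = Lp_norm p \<Omega> f"
  by (simp add: Lp_norm_def)

lemma Lp_norm_minus_commute: "Lp_norm p \<Omega> (\<lambda>x. f x - g x) = Lp_norm p \<Omega> (\<lambda>x. g x - f x)"
  by (simp add: Lp_norm_def norm_minus_commute)

lemma Lp_diff:
  assumes "f \<in> Lp p \<Omega>" "g \<in> Lp p \<Omega>" "p \<ge> 1"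
  shows "(\<lambda>x. f x - g x) \<in> Lp p \<Omega>"
  using Lp_add[OF assms(1) Lp_uminus[OF assms(2)] assms(3)] by simp

lemma Lp_norm_diff_le:
  assumes "f \<in> Lp p \<Omega>" "g \<in> Lp p \<Omega>" "p \<ge> 1"
  shows "Lp_norm p \<Omega> (\<lambda>x. f x - g x) \<le> Lp_norm p \<Omega> f + Lp_norm p \<Omega> g"
  using Lp_norm_triangle[OF assms(1) Lp_uminus[OF assms(2)] assms(3)] by simp

lemma Lp_norm_triangle_sub:
  assumes "f \<in> Lp p \<Omega>" "g \<in> Lp p \<Omega>" "p \<ge> 1"
  shows "Lp_norm p \<Omega> f \<le> Lp_norm p \<Omega> g + Lp_norm p \<Omega> (\<lambda>x. f x - g x)"
  using Lp_norm_triangle[OF assms(2) Lp_diff[OF assms] assms(3)] by simp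

lemma Lp_norm_triangle_via:
  assumes "f \<in> Lp p \<Omega>" "g \<in> Lp p \<Omega>" "h \<in> Lp p \<Omega>" "p \<ge> 1"
  shows "Lp_norm p \<Omega> (\<lambda>x. f x - g x) \<le> Lp_norm p \<Omega> (\<lambda>x. f x - h x) + Lp_norm p \<Omega> (\<lambda>x. h x - g x)"
  using Lp_norm_triangle[OF Lp_diff[OF assms(1,3,4)] Lp_diff[OF assms(3,2,4)] assms(4)] by simp

lemma Lp_sum:
  assumes "\<And>i. i \<in> I \<Longrightarrow> f i \<in> Lp p \<Omega>" "p \<ge> 1"
  shows "(\<lambda>x. \<Sum>i\<in>I. f i x) \<in> Lp p \<Omega>"
  using assms(1)
proof (induction I rule: infinite_finite_induct)
  case (insert i I)
  then have "(\<lambda>x. f i x + (\<Sum>i\<in>I. f i x)) \<in> Lp p \<Omega>"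
    by (intro Lp_add) (use assms in auto)
  then show ?case using insert by simp
qed auto

lemma Lp_norm_sum_le:
  assumes "\<And>i. i \<in> I \<Longrightarrow> f i \<in> Lp p \<Omega>" "p \<ge> 1"
  shows "Lp_norm p \<Omega> (\<lambda>x. \<Sum>i\<in>I. f i x) \<le> (\<Sum>i\<in>I. Lp_norm p \<Omega> (f i))"
  using assms(1)
proof (induction I rule: infinite_finite_induct)
  case (insert i I)
  then have "Lp_norm p \<Omega> (\<lambda>x. f i x + (\<Sum>i\<in>I. f i x)) \<le> Lp_norm p \<Omega> (f i) + Lp_norm p \<Omega> (\<lambda>x. \<Sum>i\<in>I. f i x)"
    by (intro Lp_norm_triangle Lp_sum) (use assms in auto)
  then show ?case using insert by simp
qed auto

section \<open>Fatou's lemma and completeness of L^p\<close>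

lemma Lp_fatou:
  assumes "\<And>k. g k \<in> Lp p \<Omega>" "h \<in> borel_measurable (lebesgue_on \<Omega>)" "p > 0" "B \<ge> 0"
    "AE x in lebesgue_on \<Omega>. (\<lambda>k. g k x) \<longlonglongrightarrow> h x"
    "\<forall>\<^sub>F k in sequentially. Lp_norm p \<Omega> (g k) \<le> B"
  shows "h \<in> Lp p \<Omega>" "Lp_norm p \<Omega> h \<le> B"
proof -
  have gm[measurable]: "g k \<in> borel_measurable (lebesgue_on \<Omega>)" for k using assms by (blast intro: Lp_measurable)
  note [measurable] = assms(2)
  have "(\<integral>\<^sup>+x. ennreal (norm (h x) powr p) \<partial>lebesgue_on \<Omega>) =
      (\<integral>\<^sup>+x. liminf (\<lambda>k. ennreal (norm (g k x) powr p)) \<partial>lebesgue_on \<Omega>)"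
    using assms(5)
  proof (intro nn_integral_cong_AE, eventually_elim)
    case (elim x)
    have "(\<lambda>k. ennreal (norm (g k x) powr p)) \<longlonglongrightarrow> ennreal (norm (h x) powr p)"
      using elim assms(3) by (intro tendsto_ennrealI tendsto_powr2 tendsto_intros) auto
    then show ?case using lim_imp_Liminf[OF trivial_limit_sequentially] by metis
  qed
  also have "\<dots> \<le> liminf (\<lambda>k. \<integral>\<^sup>+x. ennreal (norm (g k x) powr p) \<partial>lebesgue_on \<Omega>)"
    by (intro nn_integral_liminf) auto
  also have "\<dots> = liminf (\<lambda>k. ennreal (Lp_norm p \<Omega> (g k) powr p))"
    using assms Lp_integrable[OF assms(1)] by (simp add: Lp_norm_powr nn_integral_eq_integral)
  also have "\<dots> \<le> ennreal (B powr p)"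
  proof -
    have "\<forall>\<^sub>F k in sequentially. ennreal (Lp_norm p \<Omega> (g k) powr p) \<le> ennreal (B powr p)"
      using assms(6) by eventually_elim (use assms in \<open>auto intro!: ennreal_leI powr_mono2\<close>)
    then have "limsup (\<lambda>k. ennreal (Lp_norm p \<Omega> (g k) powr p)) \<le> ennreal (B powr p)"
      by (rule Limsup_bounded)
    moreover have "liminf (\<lambda>k. ennreal (Lp_norm p \<Omega> (g k) powr p)) \<le> limsup (\<lambda>k. ennreal (Lp_norm p \<Omega> (g k) powr p))"
      by (intro Liminf_le_Limsup) simp
    ultimately show ?thesis by (rule order_trans[rotated])
  qed
  finally have *: "(\<integral>\<^sup>+x. ennreal (norm (h x) powr p) \<partial>lebesgue_on \<Omega>) \<le> ennreal (B powr p)" .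
  have int: "integrable (lebesgue_on \<Omega>) (\<lambda>x. norm (h x) powr p)"
    by (rule integrableI_bounded) (use * in \<open>auto simp: less_top[symmetric] top_unique\<close>)
  then show "h \<in> Lp p \<Omega>" using assms by (simp add: Lp_def)
  have "ennreal (LINT x|lebesgue_on \<Omega>. norm (h x) powr p) \<le> ennreal (B powr p)"
    using * int by (simp add: nn_integral_eq_integral)
  then show "Lp_norm p \<Omega> h \<le> B"
    using assms by (subst Lp_norm_le_iff) auto
qed

text \<open>Riesz-Fischer: a subsequence with summable increments converges almost everywhere, and
  Fatou's lemma gives at once that the limit lies in L^p and that the whole sequence converges to
  it.\<close>

lemma Lp_complete:
  fixes f :: "nat \<Rightarrow> 'a::euclidean_space \<Rightarrow> 'b::euclidean_space"
  assumes "\<And>n. f n \<in> Lp p \<Omega>" "p \<ge> 1"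
    and Cauchy: "\<And>e. e > 0 \<Longrightarrow> \<exists>K. \<forall>m\<ge>K. \<forall>n\<ge>K. Lp_norm p \<Omega> (\<lambda>x. f m x - f n x) < e"
  shows "\<exists>F \<in> Lp p \<Omega>. (\<lambda>n. Lp_norm p \<Omega> (\<lambda>x. f n x - F x)) \<longlonglongrightarrow> 0"
proof -
  have m[measurable]: "f n \<in> borel_measurable (lebesgue_on \<Omega>)" for n using assms by (blast intro: Lp_measurable)
  have "\<exists>K. \<forall>m\<ge>K. \<forall>n\<ge>K. Lp_norm p \<Omega> (\<lambda>x. f m x - f n x) < (1/2)^k" for k :: nat
    by (rule Cauchy) simp
  then obtain K where K: "\<And>k m n. m \<ge> K k \<Longrightarrow> n \<ge> K k \<Longrightarrow> Lp_norm p \<Omega> (\<lambda>x. f m x - f n x) < (1/2)^k"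
    by metis
  \<comment> \<open>Summing the thresholds gives an index beyond K j for all j \<le> k at once, so
    consecutive terms along r differ by at most 2^-k in norm.\<close>
  define r where "r k = (\<Sum>i\<le>k. K i)" for k
  have rK: "r k \<ge> K j" if "j \<le> k" for j k
    unfolding r_def using that by (intro member_le_sum) auto
  define d where "d k x = norm (f (r (Suc k)) x - f (r k) x)" for k x
  have [measurable]: "d k \<in> borel_measurable (lebesgue_on \<Omega>)" for k
    unfolding d_def by measurable
  have dLp: "d k \<in> Lp p \<Omega>" for k
    using Lp_diff[OF assms(1) assms(1) assms(2)] by (auto simp: Lp_def d_def)
  have dN: "Lp_norm p \<Omega> (d k) \<le> (1/2)^k" for k
  proof -
    have "Lp_norm p \<Omega> (d k) = Lp_norm p \<Omega> (\<lambda>x. f (r (Suc k)) x - f (r k) x)"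
      by (simp add: Lp_norm_def d_def)
    then show ?thesis using K[of k "r (Suc k)" "r k"] rK[of k k] rK[of k "Suc k"] by simp
  qed
  define S where "S n x = (\<Sum>k<n. d k x)" for n x
  have SLp: "S n \<in> Lp p \<Omega>" for n
    unfolding S_def by (rule Lp_sum) (use dLp assms in auto)
  have S0: "0 \<le> S n x" for n x by (simp add: S_def d_def sum_nonneg)
  have Sm[measurable]: "S n \<in> borel_measurable (lebesgue_on \<Omega>)" for n using SLp by (blast intro: Lp_measurable)
  have SN: "Lp_norm p \<Omega> (S n) \<le> 2" for n
  proof -
    have "Lp_norm p \<Omega> (S n) \<le> (\<Sum>k<n. Lp_norm p \<Omega> (d k))"
      unfolding S_def by (rule Lp_norm_sum_le) (use dLp assms in auto)
    also have "\<dots> \<le> (\<Sum>k<n. (1/2)^k)" by (intro sum_mono dN)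
    also have "\<dots> \<le> (\<Sum>k. (1/2)^k)" by (intro sum_le_suminf) (auto intro: summable_geometric)
    also have "\<dots> = 2" by (subst suminf_geometric) auto
    finally show ?thesis .
  qed
  have "(\<integral>\<^sup>+x. (SUP n. ennreal (S n x powr p)) \<partial>lebesgue_on \<Omega>) =
     (SUP n. \<integral>\<^sup>+x. ennreal (S n x powr p) \<partial>lebesgue_on \<Omega>)"
  proof (intro nn_integral_monotone_convergence_SUP incseq_SucI le_funI)
    show "ennreal (S n x powr p) \<le> ennreal (S (Suc n) x powr p)" for n x
      using assms S0[of n x] by (intro ennreal_leI powr_mono2) (auto simp: S_def d_def)
  qed auto
  also have "\<dots> \<le> ennreal (2 powr p)"
  proof (rule SUP_least)
    fix n
    have "(\<integral>\<^sup>+x. ennreal (S n x powr p) \<partial>lebesgue_on \<Omega>) = ennreal (Lp_norm p \<Omega> (S n) powr p)"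
      using Lp_integrable[OF SLp[of n]] S0 assms by (simp add: Lp_norm_powr nn_integral_eq_integral)
    also have "\<dots> \<le> ennreal (2 powr p)"
      using SN assms by (intro ennreal_leI powr_mono2) auto
    finally show "(\<integral>\<^sup>+x. ennreal (S n x powr p) \<partial>lebesgue_on \<Omega>) \<le> ennreal (2 powr p)" .
  qed
  finally have "(\<integral>\<^sup>+x. (SUP n. ennreal (S n x powr p)) \<partial>lebesgue_on \<Omega>) \<noteq> \<infinity>"
    by (auto simp: top_unique)
  then have "AE x in lebesgue_on \<Omega>. (SUP n. ennreal (S n x powr p)) \<noteq> \<infinity>"
    by (intro nn_integral_PInf_AE) auto
  then have conv: "AE x in lebesgue_on \<Omega>. convergent (\<lambda>k. f (r k) x)"
  proof eventually_elim
    case (elim x)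
    then obtain B where B: "B \<ge> 0" "(SUP n. ennreal (S n x powr p)) = ennreal B"
      by (metis ennreal_cases infinity_ennreal_def)
    have SB: "S n x \<le> B powr (1/p)" for n
    proof -
      have "ennreal (S n x powr p) \<le> ennreal B" by (metis B(2) SUP_upper UNIV_I)
      then have "S n x powr p \<le> B" using B by simp
      then have "(S n x powr p) powr (1/p) \<le> B powr (1/p)" using assms by (intro powr_mono2) auto
      then show ?thesis using assms S0[of n x] by (simp add: powr_powr)
    qed
    have "summable (\<lambda>k. d k x)"
    proof (rule bounded_imp_summable)
      show "(\<Sum>k\<le>n. d k x) \<le> B powr (1/p)" for n
        using SB[of "Suc n"] by (simp only: S_def lessThan_Suc_atMost)
    qed (simp add: d_def)
    then have "summable (\<lambda>k. f (r (Suc k)) x - f (r k) x)"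
      unfolding d_def by (rule summable_norm_cancel)
    then have "convergent (\<lambda>n. \<Sum>k<n. f (r (Suc k)) x - f (r k) x)"
      by (simp add: summable_iff_convergent)
    then have "convergent (\<lambda>n. (f (r n) x - f (r 0) x) + f (r 0) x)"
      by (subst (asm) sum_lessThan_telescope) (intro convergent_add convergent_const)
    then show ?case by simp
  qed
  define F where "F x = lim (\<lambda>k. f (r k) x)" for x
  have Fm[measurable]: "F \<in> borel_measurable (lebesgue_on \<Omega>)"
    unfolding F_def by measurable
  \<comment> \<open>Fatou is applied to f n - f (r k) with n fixed and k growing; these norms are at
    most 2^-j as soon as k \<ge> j.\<close>
  have *: "(\<lambda>x. f n x - F x) \<in> Lp p \<Omega> \<and> Lp_norm p \<Omega> (\<lambda>x. f n x - F x) \<le> (1/2)^j" if "n \<ge> K j" for n j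
  proof -
    have A: "AE x in lebesgue_on \<Omega>. (\<lambda>k. f n x - f (r k) x) \<longlonglongrightarrow> f n x - F x"
      using conv by eventually_elim (auto intro!: tendsto_intros simp: F_def convergent_LIMSEQ_iff)
    have B: "\<forall>\<^sub>F k in sequentially. Lp_norm p \<Omega> (\<lambda>x. f n x - f (r k) x) \<le> (1/2)^j"
      using eventually_ge_at_top[of j]
    proof eventually_elim
      case (elim k)
      then show ?case using K[OF that rK[OF elim]] by simp
    qed
    show ?thesis
      using Lp_fatou[OF Lp_diff[OF assms(1) assms(1) assms(2)] _ _ _ A B] assms(2) by auto
  qed
  have FLp: "F \<in> Lp p \<Omega>"
    using Lp_diff[OF assms(1)[of "K 0"] conjunct1[OF *[of 0 "K 0"]] assms(2)] by simp
  moreover have "(\<lambda>n. Lp_norm p \<Omega> (\<lambda>x. f n x - F x)) \<longlonglongrightarrow> 0"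
  proof (rule LIMSEQ_I)
    fix e :: real assume "e > 0"
    then obtain j where j: "(1/2::real)^j < e"
      using real_arch_pow_inv[of e "1/2"] by auto
    show "\<exists>no. \<forall>n\<ge>no. norm (Lp_norm p \<Omega> (\<lambda>x. f n x - F x) - 0) < e"
      using * j by (intro exI[of _ "K j"]) fastforce
  qed
  ultimately show ?thesis by blast
qed

section \<open>Hoelder's inequality and duality of Lebesgue spaces\<close>

definition pairing :: "'a::euclidean_space set \<Rightarrow> ('a \<Rightarrow> 'b::euclidean_space) \<Rightarrow> ('a \<Rightarrow> 'b) \<Rightarrow> real" where
  "pairing \<Omega> f g = (LINT x|lebesgue_on \<Omega>. f x \<bullet> g x)"

text \<open>Young's inequality for f and g: as it stands it gives integrability, and after division
  by the norms it gives the bound.\<close>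

lemma Hoelder_norm:
  assumes "f \<in> Lp p \<Omega>" "g \<in> Lp q \<Omega>" "p > 1" "q > 1" "1/p + 1/q = 1"
  shows "integrable (lebesgue_on \<Omega>) (\<lambda>x. norm (f x) * norm (g x))"
    and "(LINT x|lebesgue_on \<Omega>. norm (f x) * norm (g x)) \<le> Lp_norm p \<Omega> f * Lp_norm q \<Omega> g"
proof -
  note [measurable] = LpD(1)[OF assms(1)] LpD(1)[OF assms(2)]
  have i: "integrable (lebesgue_on \<Omega>) (\<lambda>x. norm (f x) powr p)"
          "integrable (lebesgue_on \<Omega>) (\<lambda>x. norm (g x) powr q)"
    using assms by (blast intro: Lp_integrable)+
  show int: "integrable (lebesgue_on \<Omega>) (\<lambda>x. norm (f x) * norm (g x))"
  proof (rule Bochner_Integration.integrable_bound)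
    show "integrable (lebesgue_on \<Omega>) (\<lambda>x. norm (f x) powr p / p + norm (g x) powr q / q)" using i by auto
    show "AE x in lebesgue_on \<Omega>. norm (norm (f x) * norm (g x)) \<le> norm (norm (f x) powr p / p + norm (g x) powr q / q)"
    proof (rule AE_I2)
      fix x
      have "norm (f x) * norm (g x) \<le> norm (f x) powr p / p + norm (g x) powr q / q"
        using assms by (intro Youngs_inequality) auto
      also have "\<dots> \<le> \<bar>norm (f x) powr p / p + norm (g x) powr q / q\<bar>" by simp
      finally show "norm (norm (f x) * norm (g x)) \<le> norm (norm (f x) powr p / p + norm (g x) powr q / q)"
        by (simp add: abs_mult)
    qed
  qed auto
  define a b where "a = Lp_norm p \<Omega> f" and "b = Lp_norm q \<Omega> g"
  consider "a = 0" | "b = 0" | "a > 0" "b > 0"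
    unfolding a_def b_def using Lp_norm_nonneg by (metis less_eq_real_def)
  then have "(LINT x|lebesgue_on \<Omega>. norm (f x) * norm (g x)) \<le> a * b"
  proof cases
    case 1
    then have "ae_eq \<Omega> f (\<lambda>_. 0)" using assms Lp_norm_eq_0_iff[of f p \<Omega>] by (simp add: a_def)
    then have "(LINT x|lebesgue_on \<Omega>. norm (f x) * norm (g x)) = 0"
      by (intro integral_eq_zero_AE) (auto simp: ae_eq_def elim: eventually_mono)
    then show ?thesis using 1 by simp
  next
    case 2
    then have "ae_eq \<Omega> g (\<lambda>_. 0)" using assms Lp_norm_eq_0_iff[of g q \<Omega>] by (simp add: b_def)
    then have "(LINT x|lebesgue_on \<Omega>. norm (f x) * norm (g x)) = 0"
      by (intro integral_eq_zero_AE) (auto simp: ae_eq_def elim: eventually_mono)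
    then show ?thesis using 2 by simp
  next
    case 3
    have A: "a powr p = (LINT x|lebesgue_on \<Omega>. norm (f x) powr p)"
      "b powr q = (LINT x|lebesgue_on \<Omega>. norm (g x) powr q)"
      using assms by (simp_all add: a_def b_def Lp_norm_powr)
    have "(LINT x|lebesgue_on \<Omega>. norm (f x) * norm (g x)) \<le>
      (LINT x|lebesgue_on \<Omega>. a * b * (norm (f x) powr p / a powr p / p + norm (g x) powr q / b powr q / q))"
    proof (intro integral_mono int)
      fix x
      have "norm (f x) / a * (norm (g x) / b) \<le> (norm (f x) / a) powr p / p + (norm (g x) / b) powr q / q"
        using assms 3 by (intro Youngs_inequality) auto
      then have "a * b * (norm (f x) / a * (norm (g x) / b)) \<le> a * b * ((norm (f x) / a) powr p / p + (norm (g x) / b) powr q / q)"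
        using 3 by (intro mult_left_mono) auto
      then show "norm (f x) * norm (g x) \<le> a * b * (norm (f x) powr p / a powr p / p + norm (g x) powr q / b powr q / q)"
        using 3 by (simp add: powr_divide)
    qed (use i in auto)
    also have "\<dots> = a * b * (a powr p / a powr p / p + b powr q / b powr q / q)"
      using i by (simp add: A)
    also have "\<dots> = a * b" using 3 assms by simp
    finally show ?thesis .
  qed
  then show "(LINT x|lebesgue_on \<Omega>. norm (f x) * norm (g x)) \<le> Lp_norm p \<Omega> f * Lp_norm q \<Omega> g"
    by (simp add: a_def b_def)
qed

locale conjugate_exponents =
  fixes p q :: real
  assumes p1: "p > 1" and q1: "q > 1" and conj: "1/p + 1/q = 1"
begin

lemma integrable_inner:
  assumes "f \<in> Lp p \<Omega>" "g \<in> Lp q \<Omega>"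
  shows "integrable (lebesgue_on \<Omega>) (\<lambda>x. f x \<bullet> g x)"
  using Hoelder_norm(1)[OF assms p1 q1 conj] LpD(1)[OF assms(1)] LpD(1)[OF assms(2)]
  by (elim Bochner_Integration.integrable_bound) (auto simp: Cauchy_Schwarz_ineq2)

lemma pairing_le:
  assumes "f \<in> Lp p \<Omega>" "g \<in> Lp q \<Omega>"
  shows "\<bar>pairing \<Omega> f g\<bar> \<le> Lp_norm p \<Omega> f * Lp_norm q \<Omega> g"
proof -
  have "\<bar>pairing \<Omega> f g\<bar> \<le> (LINT x|lebesgue_on \<Omega>. \<bar>f x \<bullet> g x\<bar>)"
    unfolding pairing_def by (rule integral_abs_bound)
  also have "\<dots> \<le> (LINT x|lebesgue_on \<Omega>. norm (f x) * norm (g x))"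
    using integrable_inner[OF assms] Hoelder_norm(1)[OF assms p1 q1 conj]
    by (intro integral_mono) (auto simp: Cauchy_Schwarz_ineq2)
  also have "\<dots> \<le> Lp_norm p \<Omega> f * Lp_norm q \<Omega> g"
    using Hoelder_norm(2)[OF assms p1 q1 conj] .
  finally show ?thesis .
qed

lemma pairing_add_left:
  assumes "f \<in> Lp p \<Omega>" "f' \<in> Lp p \<Omega>" "g \<in> Lp q \<Omega>"
  shows "pairing \<Omega> (\<lambda>x. f x + f' x) g = pairing \<Omega> f g + pairing \<Omega> f' g"
  unfolding pairing_def using integrable_inner[OF assms(1,3)] integrable_inner[OF assms(2,3)]
  by (simp add: inner_add_left)

lemma pairing_diff_left:
  assumes "f \<in> Lp p \<Omega>" "f' \<in> Lp p \<Omega>" "g \<in> Lp q \<Omega>"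
  shows "pairing \<Omega> (\<lambda>x. f x - f' x) g = pairing \<Omega> f g - pairing \<Omega> f' g"
  unfolding pairing_def using integrable_inner[OF assms(1,3)] integrable_inner[OF assms(2,3)]
  by (simp add: inner_diff_left)

lemma pairing_add_right:
  assumes "f \<in> Lp p \<Omega>" "g \<in> Lp q \<Omega>" "g' \<in> Lp q \<Omega>"
  shows "pairing \<Omega> f (\<lambda>x. g x + g' x) = pairing \<Omega> f g + pairing \<Omega> f g'"
  unfolding pairing_def using integrable_inner[OF assms(1,2)] integrable_inner[OF assms(1,3)]
  by (simp add: inner_add_right)

lemma pairing_diff_right:
  assumes "f \<in> Lp p \<Omega>" "g \<in> Lp q \<Omega>" "g' \<in> Lp q \<Omega>"
  shows "pairing \<Omega> f (\<lambda>x. g x - g' x) = pairing \<Omega> f g - pairing \<Omega> f g'"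
  unfolding pairing_def using integrable_inner[OF assms(1,2)] integrable_inner[OF assms(1,3)]
  by (simp add: inner_diff_right)

lemma pairing_sum_left:
  assumes "\<And>i. i \<in> I \<Longrightarrow> f i \<in> Lp p \<Omega>" "g \<in> Lp q \<Omega>"
  shows "pairing \<Omega> (\<lambda>x. \<Sum>i\<in>I. f i x) g = (\<Sum>i\<in>I. pairing \<Omega> (f i) g)"
  unfolding pairing_def using integrable_inner[OF assms(1) assms(2)]
  by (simp add: inner_sum_left)

text \<open>The equality case of Hoelder's inequality: g is |f|^(p-2) f divided by the (p-1)-st
  power of the norm of f. At zeros of f the factor \<open>norm (f x) powr (p - 2)\<close> is 0 also
  for p < 2.\<close>

lemma norming_function:
  assumes "f \<in> Lp p \<Omega>"
  shows "\<exists>g \<in> Lp q \<Omega>. Lp_norm q \<Omega> g \<le> 1 \<and> pairing \<Omega> f g = Lp_norm p \<Omega> f"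
proof (cases "Lp_norm p \<Omega> f = 0")
  case True
  then show ?thesis by (intro bexI[of _ "\<lambda>_. 0"]) (auto simp: pairing_def)
next
  case False
  define N where "N = Lp_norm p \<Omega> f"
  have N: "N > 0" using False by (simp add: N_def order_less_le)
  note [measurable] = LpD(1)[OF assms]
  define g where "g x = (norm (f x) powr (p - 2) / N powr (p - 1)) *\<^sub>R f x" for x
  have gm[measurable]: "g \<in> borel_measurable (lebesgue_on \<Omega>)" unfolding g_def by measurable
  have pq: "(p - 1) * q = p" using p1 q1 conj by (simp add: field_simps)
  have ng: "norm (g x) = norm (f x) powr (p - 1) / N powr (p - 1)" for x
    using powr_add[of "norm (f x)" "p - 2" 1] by (cases "f x = 0") (auto simp: g_def)
  have ngq: "norm (g x) powr q = norm (f x) powr p / N powr p" for x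
    using pq by (simp add: ng powr_divide powr_powr)
  have gL: "g \<in> Lp q \<Omega>"
    using LpD(2)[OF assms] by (simp add: Lp_def ngq)
  have "(LINT x|lebesgue_on \<Omega>. norm (g x) powr q) = N powr p / N powr p"
    using Lp_norm_powr[of p \<Omega> f] p1 by (simp add: ngq N_def)
  then have gN: "Lp_norm q \<Omega> g \<le> 1"
    using q1 N by (subst Lp_norm_le_iff) auto
  have fg: "f x \<bullet> g x = norm (f x) powr p / N powr (p - 1)" for x
    using powr_add[of "norm (f x)" "p - 2" 2]
    by (cases "f x = 0") (auto simp: g_def dot_square_norm)
  have "pairing \<Omega> f g = N powr p / N powr (p - 1)"
    using Lp_norm_powr[of p \<Omega> f] p1 by (simp add: pairing_def fg N_def)
  also have "\<dots> = N" using N by (simp add: powr_diff[symmetric])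
  finally show ?thesis using gL gN by (auto simp: N_def)
qed

text \<open>This is how integrals with values in L^p are estimated later: tested with a fixed
  function they become scalar integrals.\<close>

lemma Lp_norm_le_by_duality:
  assumes "f \<in> Lp p \<Omega>" "\<And>g. g \<in> Lp q \<Omega> \<Longrightarrow> Lp_norm q \<Omega> g \<le> 1 \<Longrightarrow> pairing \<Omega> f g \<le> B"
  shows "Lp_norm p \<Omega> f \<le> B"
  using norming_function[OF assms(1)] assms(2) by metis

text \<open>The filter is arbitrary because the lemma serves sequences, difference quotients and
  one-sided limits in time.\<close>

lemma tendsto_pairing:
  assumes "f \<in> Lp p \<Omega>" "g \<in> Lp q \<Omega>" "\<forall>\<^sub>F k in \<F>. F k \<in> Lp p \<Omega>" "\<forall>\<^sub>F k in \<F>. G k \<in> Lp q \<Omega>"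
    "((\<lambda>k. Lp_norm p \<Omega> (\<lambda>x. F k x - f x)) \<longlongrightarrow> 0) \<F>" "((\<lambda>k. Lp_norm q \<Omega> (\<lambda>x. G k x - g x)) \<longlongrightarrow> 0) \<F>"
  shows "((\<lambda>k. pairing \<Omega> (F k) (G k)) \<longlongrightarrow> pairing \<Omega> f g) \<F>"
proof -
  have p: "p \<ge> 1" and q: "q \<ge> 1" using p1 q1 by auto
  have *: "\<forall>\<^sub>F k in \<F>. norm (pairing \<Omega> (F k) (G k) - pairing \<Omega> f g) \<le>
     Lp_norm p \<Omega> (\<lambda>x. F k x - f x) * (Lp_norm q \<Omega> g + Lp_norm q \<Omega> (\<lambda>x. G k x - g x)) +
     Lp_norm p \<Omega> f * Lp_norm q \<Omega> (\<lambda>x. G k x - g x)"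
    using assms(3,4)
  proof eventually_elim
    case (elim k)
    have "pairing \<Omega> (F k) (G k) - pairing \<Omega> f g =
       pairing \<Omega> (\<lambda>x. F k x - f x) (G k) + pairing \<Omega> f (\<lambda>x. G k x - g x)"
      using elim assms p q by (simp add: pairing_diff_left pairing_diff_right)
    moreover have "\<bar>pairing \<Omega> (\<lambda>x. F k x - f x) (G k)\<bar> \<le> Lp_norm p \<Omega> (\<lambda>x. F k x - f x) * Lp_norm q \<Omega> (G k)"
      using elim assms p by (intro pairing_le Lp_diff) auto
    moreover have "\<dots> \<le> Lp_norm p \<Omega> (\<lambda>x. F k x - f x) * (Lp_norm q \<Omega> g + Lp_norm q \<Omega> (\<lambda>x. G k x - g x))"
      using elim assms q by (intro mult_left_mono Lp_norm_triangle_sub) auto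
    moreover have "\<bar>pairing \<Omega> f (\<lambda>x. G k x - g x)\<bar> \<le> Lp_norm p \<Omega> f * Lp_norm q \<Omega> (\<lambda>x. G k x - g x)"
      using elim assms q by (intro pairing_le Lp_diff) auto
    ultimately show ?case unfolding real_norm_def by linarith
  qed
  have "((\<lambda>k. Lp_norm p \<Omega> (\<lambda>x. F k x - f x) * (Lp_norm q \<Omega> g + Lp_norm q \<Omega> (\<lambda>x. G k x - g x)) +
     Lp_norm p \<Omega> f * Lp_norm q \<Omega> (\<lambda>x. G k x - g x)) \<longlongrightarrow> 0 * (Lp_norm q \<Omega> g + 0) + Lp_norm p \<Omega> f * 0) \<F>"
    by (intro tendsto_intros assms)
  then have lim0: "((\<lambda>k. Lp_norm p \<Omega> (\<lambda>x. F k x - f x) * (Lp_norm q \<Omega> g + Lp_norm q \<Omega> (\<lambda>x. G k x - g x)) +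
     Lp_norm p \<Omega> f * Lp_norm q \<Omega> (\<lambda>x. G k x - g x)) \<longlongrightarrow> 0) \<F>"
    by simp
  have "((\<lambda>k. pairing \<Omega> (F k) (G k) - pairing \<Omega> f g) \<longlongrightarrow> 0) \<F>"
    by (rule Lim_null_comparison[OF * lim0])
  then show ?thesis by (rule LIM_zero_cancel)
qed

end

lemma conjugate_two: "conjugate_exponents 2 2"
  by unfold_locales auto

lemma pairing_cong:
  assumes "ae_eq \<Omega> f f'" "ae_eq \<Omega> g g'"
    "f \<in> borel_measurable (lebesgue_on \<Omega>)" "f' \<in> borel_measurable (lebesgue_on \<Omega>)"
    "g \<in> borel_measurable (lebesgue_on \<Omega>)" "g' \<in> borel_measurable (lebesgue_on \<Omega>)"
  shows "pairing \<Omega> f g = pairing \<Omega> f' g'"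
  unfolding pairing_def using assms
  by (intro integral_cong_AE) (auto simp: ae_eq_def elim: eventually_elim2)

lemma pairing_commute: "pairing \<Omega> f g = pairing \<Omega> g f"
  by (simp add: pairing_def inner_commute)

lemma pairing_scaleR [simp]:
  "pairing \<Omega> (\<lambda>x. c *\<^sub>R f x) g = c * pairing \<Omega> f g"
  "pairing \<Omega> f (\<lambda>x. c *\<^sub>R g x) = c * pairing \<Omega> f g"
  by (simp_all add: pairing_def)

lemma pairing_uminus [simp]:
  "pairing \<Omega> (\<lambda>x. - f x) g = - pairing \<Omega> f g"
  "pairing \<Omega> f (\<lambda>x. - g x) = - pairing \<Omega> f g"
  by (simp_all add: pairing_def)

text \<open>Norm convergence gives convergence almost everywhere along a subsequence; thinning that
  subsequence for the second exponent yields both limits at once. This identifies one integral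
  computed in two different spaces.\<close>

lemma Lp_limit_unique:
  assumes "\<And>k. f k \<in> Lp p \<Omega>" "\<And>k. f k \<in> Lp q \<Omega>" "g \<in> Lp p \<Omega>" "h \<in> Lp q \<Omega>" "p \<ge> 1" "q \<ge> 1"
    "(\<lambda>k. Lp_norm p \<Omega> (\<lambda>x. f k x - g x)) \<longlonglongrightarrow> 0" "(\<lambda>k. Lp_norm q \<Omega> (\<lambda>x. f k x - h x)) \<longlonglongrightarrow> 0"
  shows "ae_eq \<Omega> g h"
proof -
  have sub: "\<exists>r::nat\<Rightarrow>nat. strict_mono r \<and> (AE x in lebesgue_on \<Omega>. (\<lambda>n. f' (r n) x) \<longlonglongrightarrow> g' x)"
    if f': "\<And>k. f' k \<in> Lp s \<Omega>" and g': "g' \<in> Lp s \<Omega>" and s: "s \<ge> 1"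
      and lim: "(\<lambda>k. Lp_norm s \<Omega> (\<lambda>x. f' k x - g' x)) \<longlonglongrightarrow> 0"
    for f' :: "nat \<Rightarrow> _" and g' s
  proof -
    have "(\<lambda>k. Lp_norm s \<Omega> (\<lambda>x. f' k x - g' x) powr s) \<longlonglongrightarrow> 0 powr s"
      using lim s by (intro tendsto_powr2 tendsto_intros) auto
    then have "(\<lambda>k. LINT x|lebesgue_on \<Omega>. norm (norm (f' k x - g' x) powr s)) \<longlonglongrightarrow> 0"
      using s by (simp add: Lp_norm_powr)
    then obtain r :: "nat \<Rightarrow> nat" where r: "strict_mono r"
      "AE x in lebesgue_on \<Omega>. (\<lambda>n. norm (f' (r n) x - g' x) powr s) \<longlonglongrightarrow> 0"
      using tendsto_L1_AE_subseq[of "lebesgue_on \<Omega>" "\<lambda>k x. norm (f' k x - g' x) powr s"]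
        LpD(2)[OF Lp_diff[OF f' g' s]] by auto
    from r(2) have "AE x in lebesgue_on \<Omega>. (\<lambda>n. f' (r n) x) \<longlonglongrightarrow> g' x"
    proof eventually_elim
      case (elim x)
      then have "(\<lambda>n. (norm (f' (r n) x - g' x) powr s) powr (1/s)) \<longlonglongrightarrow> 0 powr (1/s)"
        using s by (intro tendsto_powr2 tendsto_intros) auto
      then have "(\<lambda>n. norm (f' (r n) x - g' x)) \<longlonglongrightarrow> 0" using s by (simp add: powr_powr)
      then show ?case using LIM_zero_cancel tendsto_norm_zero_iff by blast
    qed
    then show ?thesis using r by blast
  qed
  from sub[OF assms(1,3,5,7)] obtain r where r: "strict_mono r"
    "AE x in lebesgue_on \<Omega>. (\<lambda>n. f (r n) x) \<longlonglongrightarrow> g x" by blast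
  have "(\<lambda>k. Lp_norm q \<Omega> (\<lambda>x. f (r k) x - h x)) \<longlonglongrightarrow> 0"
    using LIMSEQ_subseq_LIMSEQ[OF assms(8) r(1)] by (simp add: o_def)
  from sub[OF assms(2) assms(4,6) this] obtain r' where r': "strict_mono r'"
    "AE x in lebesgue_on \<Omega>. (\<lambda>n. f (r (r' n)) x) \<longlonglongrightarrow> h x" by blast
  show ?thesis
    unfolding ae_eq_def using r(2) r'(2)
  proof eventually_elim
    case (elim x)
    have "(\<lambda>n. f (r (r' n)) x) \<longlonglongrightarrow> g x"
      using LIMSEQ_subseq_LIMSEQ[OF elim(1) r'(1)] by (simp add: o_def)
    then show ?case using elim(2) LIMSEQ_unique by blast
  qed
qed

text \<open>Cauchy-Schwarz for the (p/2)-th powers of |f| and |g|. It is what puts the tensor square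
  of an L^q field into L^(q/2).\<close>

lemma Lp_Hoelder_product:
  assumes "f \<in> Lp p \<Omega>" "g \<in> Lp p \<Omega>" "p > 0" "h \<in> borel_measurable (lebesgue_on \<Omega>)"
    "\<And>x. norm (h x) \<le> norm (f x) * norm (g x)"
  shows "h \<in> Lp (p/2) \<Omega>" "Lp_norm (p/2) \<Omega> h \<le> Lp_norm p \<Omega> f * Lp_norm p \<Omega> g"
proof -
  note [measurable] = LpD(1)[OF assms(1)] LpD(1)[OF assms(2)] assms(4)
  define f' where "f' x = norm (f x) powr (p/2)" for x
  define g' where "g' x = norm (g x) powr (p/2)" for x
  have [measurable]: "f' \<in> borel_measurable (lebesgue_on \<Omega>)" "g' \<in> borel_measurable (lebesgue_on \<Omega>)"
    unfolding f'_def g'_def by measurable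
  have sq: "f' x powr 2 = norm (f x) powr p" "g' x powr 2 = norm (g x) powr p" for x
    by (simp_all add: f'_def g'_def powr_powr)
  have L: "f' \<in> Lp 2 \<Omega>" "g' \<in> Lp 2 \<Omega>"
    using LpD(2)[OF assms(1)] LpD(2)[OF assms(2)] sq by (simp_all add: Lp_def del: powr_numeral) (simp_all add: f'_def g'_def)
  have N: "Lp_norm 2 \<Omega> f' = Lp_norm p \<Omega> f powr (p/2)" "Lp_norm 2 \<Omega> g' = Lp_norm p \<Omega> g powr (p/2)"
    using assms(3) by (simp_all add: Lp_norm_def f'_def g'_def powr_powr)
  note H = Hoelder_norm[OF L]
  have b: "norm (h x) powr (p/2) \<le> norm (f' x) * norm (g' x)" for x
  proof -
    have "norm (h x) powr (p/2) \<le> (norm (f x) * norm (g x)) powr (p/2)"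
      using assms by (intro powr_mono2) auto
    then show ?thesis by (simp add: powr_mult f'_def g'_def)
  qed
  have int: "integrable (lebesgue_on \<Omega>) (\<lambda>x. norm (h x) powr (p/2))"
    by (rule Bochner_Integration.integrable_bound[OF H(1)]) (use b in auto)
  then show "h \<in> Lp (p/2) \<Omega>" using assms by (simp add: Lp_def)
  have "(LINT x|lebesgue_on \<Omega>. norm (h x) powr (p/2)) \<le> (LINT x|lebesgue_on \<Omega>. norm (f' x) * norm (g' x))"
    by (intro integral_mono int H b) auto
  also have "\<dots> \<le> Lp_norm p \<Omega> f powr (p/2) * Lp_norm p \<Omega> g powr (p/2)"
    using H(2) by (simp add: N)
  finally show "Lp_norm (p/2) \<Omega> h \<le> Lp_norm p \<Omega> f * Lp_norm p \<Omega> g"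
    using assms(3) by (subst Lp_norm_le_iff) (auto simp: powr_mult)
qed

section \<open>Test functions\<close>

lemma partial_deriv_eq:
  "(f has_derivative f') (at x) \<Longrightarrow> partial_deriv i f x = f' (axis i 1)"
  by (metis partial_deriv_def frechet_derivative_at)

lemma smooth_has_derivative:
  assumes "smooth f"
  shows "(foldr partial_deriv is f has_derivative frechet_derivative (foldr partial_deriv is f) (at x)) (at x)"
  using assms frechet_derivative_works unfolding smooth_def differentiable_on_def by blast

lemma iterated_partial_deriv_linear:
  assumes "bounded_linear L" "smooth f"
  shows "foldr partial_deriv is (\<lambda>x. L (f x)) = (\<lambda>x. L (foldr partial_deriv is f x))"
proof (induction "is")
  case (Cons i "is")
  let ?g = "foldr partial_deriv is f"
  have "partial_deriv i (\<lambda>x. L (?g x)) x = L (partial_deriv i ?g x)" for x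
    using partial_deriv_eq[OF bounded_linear.has_derivative[OF assms(1) smooth_has_derivative[OF assms(2)]], of i "is" x]
    by (simp add: partial_deriv_def)
  then show ?case by (simp add: Cons fun_eq_iff)
qed simp

lemma iterated_partial_deriv_add:
  assumes "smooth f" "smooth g"
  shows "foldr partial_deriv is (\<lambda>x. f x + g x) = (\<lambda>x. foldr partial_deriv is f x + foldr partial_deriv is g x)"
proof (induction "is")
  case (Cons i "is")
  let ?f = "foldr partial_deriv is f" and ?g = "foldr partial_deriv is g"
  have "partial_deriv i (\<lambda>x. ?f x + ?g x) x = partial_deriv i ?f x + partial_deriv i ?g x" for x
    using partial_deriv_eq[OF has_derivative_add[OF smooth_has_derivative[OF assms(1)] smooth_has_derivative[OF assms(2)]], of i "is" "is" x]
    by (simp add: partial_deriv_def)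
  then show ?case by (simp add: Cons fun_eq_iff)
qed simp

lemma smooth_linear:
  assumes "bounded_linear L" "smooth f"
  shows "smooth (\<lambda>x. L (f x))"
  unfolding smooth_def iterated_partial_deriv_linear[OF assms] differentiable_on_def
  using bounded_linear.has_derivative[OF assms(1) smooth_has_derivative[OF assms(2)]]
  by (auto simp: differentiable_def)

lemma smooth_add:
  assumes "smooth f" "smooth g"
  shows "smooth (\<lambda>x. f x + g x)"
  using assms unfolding smooth_def iterated_partial_deriv_add[OF assms] by (auto intro: differentiable_on_add)

lemma smooth_partial_deriv:
  assumes "smooth f"
  shows "smooth (partial_deriv i f)"
proof -
  \<comment> \<open>\<open>foldr\<close> applies the last entry of the list first, so a derivative
    taken beforehand is appended at the end.\<close>
  have "foldr partial_deriv is (partial_deriv i f) = foldr partial_deriv (is @ [i]) f" for "is" by simp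
  then show ?thesis using assms unfolding smooth_def by presburger
qed

lemma smooth_continuous:
  assumes "smooth f"
  shows "continuous_on UNIV f"
proof -
  have "foldr partial_deriv [] f differentiable_on UNIV" using assms unfolding smooth_def by blast
  then show ?thesis by (simp add: differentiable_imp_continuous_on)
qed

lemma test_functionsI:
  assumes "smooth \<phi>" "compact K" "K \<subseteq> \<Omega>" "\<And>x. x \<notin> K \<Longrightarrow> \<phi> x = 0"
  shows "\<phi> \<in> test_functions \<Omega>"
proof -
  have "closure {x. \<phi> x \<noteq> 0} \<subseteq> K"
    using assms by (intro closure_minimal) (auto simp: compact_imp_closed)
  then show ?thesis
    using assms bounded_subset[OF compact_imp_bounded[OF assms(2)], of "closure {x. \<phi> x \<noteq> 0}"]
    by (auto simp: test_functions_def compact_eq_bounded_closed)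
qed

lemma test_functionsE:
  assumes "\<phi> \<in> test_functions \<Omega>"
  obtains K where "smooth \<phi>" "compact K" "K \<subseteq> \<Omega>" "\<And>x. x \<notin> K \<Longrightarrow> \<phi> x = 0"
proof
  show "smooth \<phi>" "compact (closure {x. \<phi> x \<noteq> 0})" "closure {x. \<phi> x \<noteq> 0} \<subseteq> \<Omega>"
    using assms by (auto simp: test_functions_def)
  show "\<phi> x = 0" if "x \<notin> closure {x. \<phi> x \<noteq> 0}" for x
    using that closure_subset[of "{x. \<phi> x \<noteq> 0}"] by auto
qed

lemma test_functions_linear:
  assumes "bounded_linear L" "\<phi> \<in> test_functions \<Omega>"
  shows "(\<lambda>x. L (\<phi> x)) \<in> test_functions \<Omega>"
proof -
  obtain K where "smooth \<phi>" "compact K" "K \<subseteq> \<Omega>" "\<And>x. x \<notin> K \<Longrightarrow> \<phi> x = 0"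
    using test_functionsE[OF assms(2)] by blast
  then show ?thesis
    by (intro test_functionsI[of _ K]) (auto intro: smooth_linear[OF assms(1)] simp: linear_0[OF bounded_linear.linear[OF assms(1)]])
qed

lemma test_functions_add:
  assumes "\<phi> \<in> test_functions \<Omega>" "\<psi> \<in> test_functions \<Omega>"
  shows "(\<lambda>x. \<phi> x + \<psi> x) \<in> test_functions \<Omega>"
proof -
  obtain K where K: "smooth \<phi>" "compact K" "K \<subseteq> \<Omega>" "\<And>x. x \<notin> K \<Longrightarrow> \<phi> x = 0"
    using test_functionsE[OF assms(1)] by blast
  obtain L where L: "smooth \<psi>" "compact L" "L \<subseteq> \<Omega>" "\<And>x. x \<notin> L \<Longrightarrow> \<psi> x = 0"
    using test_functionsE[OF assms(2)] by blast
  show ?thesis using K L by (intro test_functionsI[of _ "K \<union> L"] smooth_add) auto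
qed

lemma partial_deriv_test_function:
  assumes "\<phi> \<in> test_functions \<Omega>"
  shows "partial_deriv i \<phi> \<in> test_functions \<Omega>"
proof -
  obtain K where K: "smooth \<phi>" "compact K" "K \<subseteq> \<Omega>" "\<And>x. x \<notin> K \<Longrightarrow> \<phi> x = 0"
    using test_functionsE[OF assms] by blast
  have "partial_deriv i \<phi> x = 0" if "x \<notin> K" for x
  proof -
    have "open (- K)" using K by (simp add: compact_imp_closed open_Compl)
    then have "(\<phi> has_derivative (\<lambda>_. 0)) (at x)"
      by (rule has_derivative_transform_within_open[OF has_derivative_const]) (use K that in auto)
    then show ?thesis using partial_deriv_eq by metis
  qed
  then show ?thesis using K by (intro test_functionsI[of _ K] smooth_partial_deriv) auto
qed

lemma solenoidal_tests_add:
  assumes "\<phi> \<in> solenoidal_tests \<Omega>" "\<psi> \<in> solenoidal_tests \<Omega>"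
  shows "(\<lambda>x. \<phi> x + \<psi> x) \<in> solenoidal_tests \<Omega>"
proof -
  have s: "smooth \<phi>" "smooth \<psi>" using assms by (auto simp: solenoidal_tests_def test_functions_def)
  have "partial_deriv i (\<lambda>x. \<phi> x + \<psi> x) x = partial_deriv i \<phi> x + partial_deriv i \<psi> x" for i x
    using fun_cong[OF iterated_partial_deriv_add[OF s, of "[i]"]] by simp
  then show ?thesis
    using assms by (auto simp: solenoidal_tests_def divergence_def sum.distrib test_functions_add)
qed

lemma bounded_linear_vector_scale: "bounded_linear (\<lambda>v :: complex^'n::finite. c *s v)"
proof (rule bounded_linear_intro[where K = "cmod c"])
  show "norm (c *s v) \<le> norm v * cmod c" for v :: "complex^'n"
    by (simp add: norm_vec_def L2_set_def norm_mult power_mult_distrib flip: sum_distrib_left)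
       (simp add: real_sqrt_mult)
qed (auto simp: vec_eq_iff algebra_simps)

lemma norm_vector_scale: "norm (c *s v) = cmod c * norm (v :: complex^'n::finite)"
  by (simp add: norm_vec_def L2_set_def norm_mult power_mult_distrib flip: sum_distrib_left)
     (simp add: real_sqrt_mult)

lemma solenoidal_tests_vector_scale:
  assumes "\<phi> \<in> solenoidal_tests \<Omega>"
  shows "(\<lambda>x. c *s \<phi> x) \<in> solenoidal_tests \<Omega>"
proof -
  have s: "smooth \<phi>" using assms by (auto simp: solenoidal_tests_def test_functions_def)
  have "partial_deriv i (\<lambda>x. c *s \<phi> x) x = c *s partial_deriv i \<phi> x" for i x
    using fun_cong[OF iterated_partial_deriv_linear[OF bounded_linear_vector_scale s, of "[i]"]] by simp
  then show ?thesis
    using assms by (auto simp: solenoidal_tests_def divergence_def test_functions_linear bounded_linear_vector_scale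
        simp flip: sum_distrib_left)
qed

lemma continuous_measurable_lebesgue_on:
  assumes "continuous_on UNIV (f :: 'a::euclidean_space \<Rightarrow> 'b::euclidean_space)"
  shows "f \<in> borel_measurable (lebesgue_on S)"
  using borel_measurable_continuous_onI[OF assms]
  by (intro measurable_restrict_space1 measurable_completion) simp

lemma continuous_bounded_compact_support:
  assumes "continuous_on UNIV w" "compact K" "\<And>x. x \<notin> K \<Longrightarrow> w x = 0"
  obtains B where "B > 0" "\<And>x. norm (w x) \<le> B"
proof -
  have "bounded (w ` K)"
    using assms by (intro compact_imp_bounded compact_continuous_image continuous_on_subset[OF assms(1)]) auto
  then obtain B where "B > 0" "\<And>x. x \<in> K \<Longrightarrow> norm (w x) \<le> B"
    unfolding bounded_pos by auto
  then show ?thesis using assms that by (metis norm_zero less_eq_real_def)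
qed

lemma
  fixes \<Omega> :: "'a::euclidean_space set" and f :: "'a \<Rightarrow> 'b::euclidean_space"
  assumes "\<Omega> \<in> sets lebesgue" "compact K" "K \<subseteq> \<Omega>" "\<And>x. x \<notin> K \<Longrightarrow> f x = 0"
  shows integrable_supported_iff: "integrable (lebesgue_on \<Omega>) f \<longleftrightarrow> integrable (lebesgue_on K) f"
    and integral_supported: "(LINT x|lebesgue_on \<Omega>. f x) = (LINT x|lebesgue_on K. f x)"
proof -
  have K: "K \<in> sets lebesgue" using assms(2) by (simp add: lmeasurable_compact fmeasurableD)
  have e: "indicat_real \<Omega> x *\<^sub>R f x = indicat_real K x *\<^sub>R f x" for x
    using assms by (auto simp: indicator_def)
  show "integrable (lebesgue_on \<Omega>) f \<longleftrightarrow> integrable (lebesgue_on K) f"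
    using assms(1) K by (simp add: integrable_restrict_space e)
  show "(LINT x|lebesgue_on \<Omega>. f x) = (LINT x|lebesgue_on K. f x)"
    using assms(1) K by (simp add: integral_restrict_space e)
qed

lemma integrable_weight:
  fixes f :: "'a::euclidean_space \<Rightarrow> 'b::euclidean_space"
  assumes "\<Omega> \<in> sets lebesgue" "compact K" "K \<subseteq> \<Omega>" "continuous_on UNIV (w :: 'a \<Rightarrow> real)" "\<And>x. x \<notin> K \<Longrightarrow> w x = 0"
    "integrable (lebesgue_on K) f"
  shows "integrable (lebesgue_on \<Omega>) (\<lambda>x. w x *\<^sub>R f x)"
proof (subst integrable_supported_iff[OF assms(1-3)])
  obtain B where B: "B > 0" "\<And>x. norm (w x) \<le> B"
    using continuous_bounded_compact_support[OF assms(4,2,5)] by metis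
  have [measurable]: "f \<in> borel_measurable (lebesgue_on K)" "w \<in> borel_measurable (lebesgue_on K)"
    using assms(6) continuous_measurable_lebesgue_on[OF assms(4)] by auto
  show "integrable (lebesgue_on K) (\<lambda>x. w x *\<^sub>R f x)"
  proof (rule Bochner_Integration.integrable_bound)
    show "integrable (lebesgue_on K) (\<lambda>x. B *\<^sub>R f x)" using assms(6) by simp
    show "AE x in lebesgue_on K. norm (w x *\<^sub>R f x) \<le> norm (B *\<^sub>R f x)"
      using B by (intro AE_I2) (auto intro!: mult_right_mono)
  qed measurable
qed (use assms in auto)

lemma test_functions_Lp:
  fixes \<phi> :: "real^'n::finite \<Rightarrow> 'b::euclidean_space"
  assumes "\<phi> \<in> test_functions \<Omega>" "\<Omega> \<in> sets lebesgue" "p \<ge> 0"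
  shows "\<phi> \<in> Lp p \<Omega>"
proof -
  obtain K where K: "smooth \<phi>" "compact K" "K \<subseteq> \<Omega>" "\<And>x. x \<notin> K \<Longrightarrow> \<phi> x = 0"
    using test_functionsE[OF assms(1)] by blast
  obtain B where B: "B > 0" "\<And>x. norm (\<phi> x) \<le> B"
    using continuous_bounded_compact_support[OF smooth_continuous[OF K(1)] K(2,4)] by metis
  have m[measurable]: "\<phi> \<in> borel_measurable (lebesgue_on S)" for S
    using continuous_measurable_lebesgue_on[OF smooth_continuous[OF K(1)]] .
  have KL: "K \<in> lmeasurable" using K(2) by (simp add: lmeasurable_compact)
  interpret finite_measure "lebesgue_on K" by (rule finite_measure_lebesgue_on[OF KL])
  have "integrable (lebesgue_on K) (\<lambda>x. norm (\<phi> x) powr p)"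
    by (rule integrable_const_bound[where B = "B powr p"]) (use B assms(3) in \<open>auto intro!: powr_mono2\<close>)
  then have "integrable (lebesgue_on \<Omega>) (\<lambda>x. norm (\<phi> x) powr p)"
    using K by (subst integrable_supported_iff[OF assms(2) K(2,3)]) auto
  then show ?thesis by (simp add: Lp_def)
qed


section \<open>Smooth bump functions\<close>

text \<open>One-variable counterpart of \<open>smooth\<close>. Counting the derivatives permits
  induction; smoothness is the property for all n.\<close>

fun times_differentiable :: "nat \<Rightarrow> (real \<Rightarrow> real) \<Rightarrow> bool" where
  "times_differentiable 0 h = True"
| "times_differentiable (Suc n) h =
     (\<exists>h'. (\<forall>x. (h has_real_derivative h' x) (at x)) \<and> times_differentiable n h')"

lemma times_differentiable_SucI:
  "(\<And>x. (h has_real_derivative h' x) (at x)) \<Longrightarrow> times_differentiable n h' \<Longrightarrow> times_differentiable (Suc n) h"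
  by auto

lemma times_differentiable_Suc: "times_differentiable (Suc n) h \<Longrightarrow> times_differentiable n h"
  by (induction n arbitrary: h) (simp, metis times_differentiable.simps(2))

lemma times_differentiable_add:
  "times_differentiable n f \<Longrightarrow> times_differentiable n g \<Longrightarrow> times_differentiable n (\<lambda>x. f x + g x)"
proof (induction n arbitrary: f g)
  case (Suc n)
  then obtain f' g' where "\<And>x. (f has_real_derivative f' x) (at x)" "times_differentiable n f'"
      "\<And>x. (g has_real_derivative g' x) (at x)" "times_differentiable n g'" by auto
  then show ?case using Suc.IH by (auto intro!: exI[of _ "\<lambda>x. f' x + g' x"] DERIV_add)
qed simp

lemma times_differentiable_mult:
  "times_differentiable n f \<Longrightarrow> times_differentiable n g \<Longrightarrow> times_differentiable n (\<lambda>x. f x * g x)"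
proof (induction n arbitrary: f g)
  case (Suc n)
  then obtain f' g' where fg: "\<And>x. (f has_real_derivative f' x) (at x)" "times_differentiable n f'"
      "\<And>x. (g has_real_derivative g' x) (at x)" "times_differentiable n g'" by auto
  have "times_differentiable n (\<lambda>x. f' x * g x + f x * g' x)"
    by (intro times_differentiable_add Suc.IH fg Suc.prems[THEN times_differentiable_Suc])
  moreover have "((\<lambda>x. f x * g x) has_real_derivative f' x * g x + f x * g' x) (at x)" for x
    using DERIV_mult'[OF fg(1) fg(3), of x] by (simp add: algebra_simps)
  ultimately show ?case by (rule times_differentiable_SucI[rotated])
qed simp

lemma times_differentiable_const: "times_differentiable n (\<lambda>_. c)"
proof (induction n arbitrary: c)
  case (Suc n)
  then show ?case by (auto intro!: exI[of _ "\<lambda>_. 0"])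
qed simp

lemma times_differentiable_affine:
  "times_differentiable n h \<Longrightarrow> times_differentiable n (\<lambda>x. h (c * x + d))"
proof (induction n arbitrary: h)
  case (Suc n)
  then obtain h' where h': "\<And>x. (h has_real_derivative h' x) (at x)" "times_differentiable n h'" by auto
  have "((\<lambda>x. h (c * x + d)) has_real_derivative h' (c * x + d) * c) (at x)" for x
    by (rule DERIV_chain2[OF h'(1)]) (auto intro!: derivative_eq_intros)
  then show ?case
    by (rule times_differentiable_SucI) (intro times_differentiable_mult Suc.IH[OF h'(2)] times_differentiable_const)
qed simp

text \<open>The derivatives obtained for the various n coincide by uniqueness, so this one function
  is again differentiable any number of times.\<close>

lemma all_times_differentiableE:
  assumes "\<And>n. times_differentiable n h"
  obtains h' where "\<And>x. (h has_real_derivative h' x) (at x)" "\<And>n. times_differentiable n h'"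
proof -
  obtain h' where h': "\<And>x. (h has_real_derivative h' x) (at x)" using assms[of 1] by auto
  have "times_differentiable n h'" for n
  proof -
    obtain k where "\<And>x. (h has_real_derivative k x) (at x)" "times_differentiable n k"
      using assms[of "Suc n"] by auto
    moreover have "k = h'" using h' calculation(1) DERIV_unique by blast
    ultimately show ?thesis by simp
  qed
  then show ?thesis using h' that by blast
qed

text \<open>The extra factor y^k lets the induction along the coefficients pass: y^k (a + y P) is a
  y^k plus y^(k+1) P.\<close>

lemma poly_times_exp_decay:
  fixes P :: "real poly"
  assumes "c > 0"
  shows "((\<lambda>y. y ^ k * poly P y * exp (- (c * y))) \<longlongrightarrow> 0) at_top"
proof (induction P arbitrary: k)
  case 0
  then show ?case by simp
next
  case (pCons a P)
  have "((\<lambda>y. (c * y) ^ k / exp (c * y)) \<longlongrightarrow> 0) at_top"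
    by (rule filterlim_compose[OF tendsto_power_div_exp_0])
       (use assms in \<open>auto intro!: filterlim_tendsto_pos_mult_at_top[OF tendsto_const] filterlim_ident\<close>)
  then have "((\<lambda>y. a / c ^ k * ((c * y) ^ k / exp (c * y))) \<longlongrightarrow> a / c ^ k * 0) at_top"
    by (intro tendsto_intros)
  from tendsto_add[OF this pCons.IH[of "Suc k"]]
  have "((\<lambda>y. a / c ^ k * ((c * y) ^ k / exp (c * y)) + y ^ Suc k * poly P y * exp (- (c * y))) \<longlongrightarrow> 0) at_top"
    by simp
  moreover have "(\<lambda>y. a / c ^ k * ((c * y) ^ k / exp (c * y)) + y ^ Suc k * poly P y * exp (- (c * y)))
      = (\<lambda>y. y ^ k * poly (pCons a P) y * exp (- (c * y)))"
    using assms by (auto simp: fun_eq_iff power_mult_distrib exp_minus field_simps)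
  ultimately show ?case by simp
qed

text \<open>Functions P(1/t) exp(-c/t), continued by 0 to t \<le> 0, form a class closed under
  differentiation, also at t = 0, where they are flat.\<close>

lemma times_differentiable_flat:
  assumes "c > 0"
  shows "times_differentiable n (\<lambda>t. if t > 0 then poly P (1/t) * exp (- (c / t)) else 0)"
proof (induction n arbitrary: P)
  case (Suc n)
  define h where "h Q t = (if t > 0 then poly Q (1/t) * exp (- (c / t)) else 0)" for Q t
  \<comment> \<open>Differentiating P(1/t) exp(-c/t) turns P into the polynomial y^2 (c P - P') in y
    = 1/t.\<close>
  define Q where "Q = [:0, 0, 1:] * (smult c P - pderiv P)"
  have "(h P has_real_derivative h Q t) (at t)" for t
  proof -
    consider "t > 0" | "t < 0" | "t = 0" by linarith
    then show ?thesis
    proof cases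
      case 1
      have "((\<lambda>t. poly P (1/t) * exp (- (c / t))) has_real_derivative h Q t) (at t)"
        using 1 by (auto intro!: derivative_eq_intros simp: h_def Q_def field_simps power2_eq_square)
      then show ?thesis
        by (rule has_field_derivative_transform_within_open[where S = "{0<..}"]) (use 1 in \<open>auto simp: h_def\<close>)
    next
      case 2
      have "((\<lambda>t. 0) has_real_derivative 0) (at t)" by simp
      then have "(h P has_real_derivative 0) (at t)"
        by (rule has_field_derivative_transform_within_open[where S = "{..<0}"]) (use 2 in \<open>auto simp: h_def\<close>)
      then show ?thesis using 2 by (simp add: h_def)
    next
      case 3
      \<comment> \<open>The power 1 accounts for the division by t in the difference quotient at
        0.\<close>
      have "((\<lambda>y. y ^ 1 * poly P y * exp (- (c * y))) \<longlongrightarrow> 0) at_top"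
        by (rule poly_times_exp_decay[OF assms])
      then have "((\<lambda>t. inverse t ^ 1 * poly P (inverse t) * exp (- (c * inverse t))) \<longlongrightarrow> 0) (at_right (0::real))"
        by (rule filterlim_compose) (rule filterlim_inverse_at_top_right)
      then have R: "((\<lambda>t. (h P t - h P 0) / (t - 0)) \<longlongrightarrow> 0) (at_right (0::real))"
        by (rule Lim_transform_eventually)
           (auto simp: h_def field_simps intro!: eventually_at_rightI[of 0 1])
      have L: "((\<lambda>t. (h P t - h P 0) / (t - 0)) \<longlongrightarrow> 0) (at_left (0::real))"
        by (rule Lim_transform_eventually[OF tendsto_const])
           (auto simp: h_def intro!: eventually_at_leftI[of "-1"])
      have "(h P has_real_derivative 0) (at 0)"
        unfolding has_field_derivative_iff using filterlim_split_at[OF L R] by simp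
      then show ?thesis using 3 by (simp add: h_def)
    qed
  qed
  from times_differentiable_SucI[OF this] Suc.IH[of Q] show ?case unfolding h_def by blast
qed simp

lemma
  fixes h :: "'n::finite \<Rightarrow> real \<Rightarrow> real"
  assumes "\<And>i y. (h i has_real_derivative h' i y) (at y)"
  shows partial_deriv_product:
      "partial_deriv j (\<lambda>x::real^'n. \<Prod>i\<in>UNIV. h i (x $ i)) = (\<lambda>x. \<Prod>i\<in>UNIV. (h(j := h' j)) i (x $ i))"
    and differentiable_product: "(\<lambda>x::real^'n. \<Prod>i\<in>UNIV. h i (x $ i)) differentiable_on UNIV"
proof -
  have d1: "((\<lambda>x. h i (x $ i)) has_derivative (\<lambda>v. h' i (x $ i) * v $ i)) (at x)" for i and x :: "real^'n"
    by (rule has_derivative_compose[OF bounded_linear_imp_has_derivative[OF bounded_linear_vec_nth]])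
       (use assms in \<open>simp add: has_field_derivative_def\<close>)
  have d: "((\<lambda>x. \<Prod>i\<in>UNIV. h i (x $ i)) has_derivative
      (\<lambda>v. \<Sum>i\<in>UNIV. h' i (x $ i) * v $ i * (\<Prod>k\<in>UNIV - {i}. h k (x $ k)))) (at x)" for x :: "real^'n"
    by (rule has_derivative_prod) (rule d1)
  then show "(\<lambda>x::real^'n. \<Prod>i\<in>UNIV. h i (x $ i)) differentiable_on UNIV"
    by (auto simp: differentiable_on_def differentiable_def)
  show "partial_deriv j (\<lambda>x::real^'n. \<Prod>i\<in>UNIV. h i (x $ i)) = (\<lambda>x. \<Prod>i\<in>UNIV. (h(j := h' j)) i (x $ i))"
  proof
    fix x :: "real^'n"
    have "partial_deriv j (\<lambda>x::real^'n. \<Prod>i\<in>UNIV. h i (x $ i)) x =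
        (\<Sum>i\<in>UNIV. h' i (x $ i) * axis j 1 $ i * (\<Prod>k\<in>UNIV - {i}. h k (x $ k)))"
      by (rule partial_deriv_eq[OF d])
    also have "\<dots> = (\<Sum>i\<in>UNIV. if i = j then h' j (x $ j) * (\<Prod>k\<in>UNIV - {j}. h k (x $ k)) else 0)"
      by (intro sum.cong) (auto simp: axis_def)
    also have "\<dots> = h' j (x $ j) * (\<Prod>k\<in>UNIV - {j}. h k (x $ k))" by simp
    also have "\<dots> = (\<Prod>i\<in>UNIV. (h(j := h' j)) i (x $ i))"
      by (subst prod.remove[of UNIV j]) (auto intro!: prod.cong)
    finally show "partial_deriv j (\<lambda>x::real^'n. \<Prod>i\<in>UNIV. h i (x $ i)) x = (\<Prod>i\<in>UNIV. (h(j := h' j)) i (x $ i))" .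
  qed
qed

text \<open>A partial derivative replaces one factor by its derivative, so all iterated partial
  derivatives stay products of smooth functions of single coordinates.\<close>

lemma smooth_product:
  fixes h :: "'n::finite \<Rightarrow> real \<Rightarrow> real"
  assumes "\<And>i n. times_differentiable n (h i)"
  shows "smooth (\<lambda>x::real^'n. \<Prod>i\<in>UNIV. h i (x $ i))"
proof -
  have "\<exists>g. (\<forall>i n. times_differentiable n (g i)) \<and>
     foldr partial_deriv is (\<lambda>x::real^'n. \<Prod>i\<in>UNIV. h i (x $ i)) = (\<lambda>x. \<Prod>i\<in>UNIV. g i (x $ i))" for "is"
  proof (induction "is")
    case Nil
    show ?case using assms by (intro exI[of _ h]) simp
  next
    case (Cons j "is")
    then obtain g where g: "\<And>i n. times_differentiable n (g i)"
      "foldr partial_deriv is (\<lambda>x::real^'n. \<Prod>i\<in>UNIV. h i (x $ i)) = (\<lambda>x. \<Prod>i\<in>UNIV. g i (x $ i))" by auto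
    have "\<exists>k. (\<forall>y. (g i has_real_derivative k y) (at y)) \<and> (\<forall>n. times_differentiable n k)" for i
      using all_times_differentiableE[OF g(1), of i] by metis
    then obtain g' where g': "\<And>i y. (g i has_real_derivative g' i y) (at y)" "\<And>i n. times_differentiable n (g' i)"
      by metis
    show ?case
      using g g' by (intro exI[of _ "g(j := g' j)"]) (auto simp: partial_deriv_product[OF g'(1)])
  qed
  note main = this
  show ?thesis unfolding smooth_def
  proof
    fix "is"
    obtain g where g: "\<And>i n. times_differentiable n (g i)"
      "foldr partial_deriv is (\<lambda>x::real^'n. \<Prod>i\<in>UNIV. h i (x $ i)) = (\<lambda>x. \<Prod>i\<in>UNIV. g i (x $ i))"
      using main by blast
    have "\<exists>k. \<forall>y. (g i has_real_derivative k y) (at y)" for i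
      using all_times_differentiableE[OF g(1), of i] by metis
    then obtain g' where g': "\<And>i y. (g i has_real_derivative g' i y) (at y)"
      by metis
    show "foldr partial_deriv is (\<lambda>x::real^'n. \<Prod>i\<in>UNIV. h i (x $ i)) differentiable_on UNIV"
      unfolding g(2) by (rule differentiable_product[OF g'])
  qed
qed

text \<open>The indicator of an open box becomes a bounded pointwise limit of test functions that
  vanish off the closed box, which is what dominated convergence needs.\<close>

lemma exists_bump:
  fixes a b :: "real^'n::finite"
  assumes "cbox a b \<subseteq> \<Omega>"
  shows "\<exists>\<psi> :: nat \<Rightarrow> real^'n \<Rightarrow> real. (\<forall>k. \<psi> k \<in> test_functions \<Omega>) \<and> (\<forall>k x. \<bar>\<psi> k x\<bar> \<le> 1) \<and>
     (\<forall>k. \<forall>x. x \<notin> cbox a b \<longrightarrow> \<psi> k x = 0) \<and> (\<forall>x. (\<lambda>k. \<psi> k x) \<longlonglongrightarrow> indicat_real (box a b) x)"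
proof -
  \<comment> \<open>This is exp(-1/((k+1) t)) for t > 0; as k grows it tends to the indicator of the
    positive half-line.\<close>
  define f :: "nat \<Rightarrow> real \<Rightarrow> real" where "f k t = (if t > 0 then poly 1 (1/t) * exp (- (inverse (real (Suc k)) / t)) else 0)" for k t
  have f: "times_differentiable n (f k)" for n k
    unfolding f_def by (rule times_differentiable_flat) simp
  have f01: "0 \<le> f k t" "f k t \<le> 1" for k t by (auto simp: f_def)
  have flim: "(\<lambda>k. f k t) \<longlonglongrightarrow> (if t > 0 then 1 else 0)" for t
  proof (cases "t > 0")
    case True
    have "(\<lambda>k. exp (- (inverse (real (Suc k)) / t))) \<longlonglongrightarrow> exp (- (0 / t))"
      by (intro tendsto_intros LIMSEQ_inverse_real_of_nat) (use True in auto)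
    then show ?thesis using True by (simp add: f_def)
  qed (simp add: f_def)
  \<comment> \<open>One factor switches off below a_i, the other above b_i; both arguments are in
    the form of \<open>times_differentiable_affine\<close>.\<close>
  define h where "h k i t = f k (1 * t + (- (a $ i))) * f k ((-1) * t + b $ i)" for k i t
  have h: "times_differentiable n (h k i)" for n k i
    unfolding h_def by (intro times_differentiable_mult times_differentiable_affine f)
  define \<psi> where "\<psi> k x = (\<Prod>i\<in>UNIV. h k i (x $ i))" for k and x :: "real^'n"
  have h01: "0 \<le> h k i t" "h k i t \<le> 1" for k i t
    using f01 by (auto simp: h_def intro!: mult_le_one)
  have z: "\<psi> k x = 0" if x: "x \<notin> cbox a b" for k x
  proof -
    obtain i where "x $ i < a $ i \<or> x $ i > b $ i" using x unfolding mem_box_cart not_le[symmetric] by blast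
    then have "h k i (x $ i) = 0" by (auto simp: h_def f_def)
    then show ?thesis unfolding \<psi>_def by (intro prod_zero) auto
  qed
  have sm: "smooth (\<psi> k)" for k
    unfolding \<psi>_def by (rule smooth_product) (rule h)
  have "\<psi> k \<in> test_functions \<Omega>" for k
    using z assms sm by (intro test_functionsI[of _ "cbox a b"]) auto
  moreover have "\<bar>\<psi> k x\<bar> \<le> 1" for k x
  proof -
    have "0 \<le> \<psi> k x" "\<psi> k x \<le> 1"
      unfolding \<psi>_def by (intro prod_nonneg prod_le_1 conjI h01 ballI)+
    then show ?thesis by simp
  qed
  moreover have "(\<lambda>k. \<psi> k x) \<longlonglongrightarrow> indicat_real (box a b) x" for x
  proof -
    have "(\<lambda>k. \<psi> k x) \<longlonglongrightarrow> (\<Prod>i\<in>UNIV. (if 1 * x $ i + (- (a $ i)) > 0 then 1 else 0::real) * (if (-1) * x $ i + b $ i > 0 then 1 else 0))"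
      unfolding \<psi>_def h_def by (intro tendsto_intros flim)
    also have "(\<Prod>i\<in>UNIV. (if 1 * x $ i + (- (a $ i)) > 0 then 1 else 0::real) * (if (-1) * x $ i + b $ i > 0 then 1 else 0)) = indicat_real (box a b) x"
    proof (cases "x \<in> box a b")
      case True
      then show ?thesis by (auto simp: mem_box_cart intro!: prod.neutral)
    next
      case False
      then obtain i where "\<not> (x $ i > a $ i) \<or> \<not> (x $ i < b $ i)" using False unfolding mem_box_cart by blast
      then have "(\<Prod>i\<in>UNIV. (if 1 * x $ i + (- (a $ i)) > 0 then 1 else (0::real)) * (if (-1) * x $ i + b $ i > 0 then 1 else 0)) = 0"
        by (intro prod_zero bexI[of _ i]) auto
      then show ?thesis using False by simp
    qed
    finally show ?thesis .
  qed
  ultimately show ?thesis using z by (intro exI[of _ \<psi>]) blast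
qed


section \<open>Weak gradients\<close>

text \<open>Dominated convergence with the functions of \<open>exists_bump\<close>. Their limit sees
  the open box only, and the boundary of a box is a null set.\<close>

lemma integral_cbox_eq_0:
  fixes f :: "real^'n::finite \<Rightarrow> 'b::euclidean_space"
  assumes "\<Omega> \<in> sets lebesgue" "locally_integrable \<Omega> f"
    "\<And>\<psi> :: real^'n \<Rightarrow> real. \<psi> \<in> test_functions \<Omega> \<Longrightarrow> (LINT x|lebesgue_on \<Omega>. \<psi> x *\<^sub>R f x) = 0"
    "cbox a b \<subseteq> \<Omega>"
  shows "integral (cbox a b) f = 0"
proof -
  obtain \<psi> :: "nat \<Rightarrow> real^'n \<Rightarrow> real" where \<psi>: "\<And>k. \<psi> k \<in> test_functions \<Omega>" "\<And>k x. \<bar>\<psi> k x\<bar> \<le> 1"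
     "\<And>k x. x \<notin> cbox a b \<Longrightarrow> \<psi> k x = 0" "\<And>x. (\<lambda>k. \<psi> k x) \<longlonglongrightarrow> indicator (box a b) x"
    using exists_bump[OF assms(4)] by metis
  have int: "integrable (lebesgue_on (cbox a b)) f"
    using assms(2,4) unfolding locally_integrable_def by auto
  have [measurable]: "f \<in> borel_measurable (lebesgue_on (cbox a b))" using int by auto
  have [measurable]: "\<psi> k \<in> borel_measurable (lebesgue_on (cbox a b))" for k
    using \<psi>(1) by (intro continuous_measurable_lebesgue_on smooth_continuous) (auto simp: test_functions_def)
  have [measurable]: "box a b \<in> sets (lebesgue_on (cbox a b))"
    by (simp add: sets_restrict_space_iff box_subset_cbox)
  have "(\<lambda>k. LINT x|lebesgue_on (cbox a b). \<psi> k x *\<^sub>R f x) \<longlonglongrightarrow>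
     (LINT x|lebesgue_on (cbox a b). indicat_real (box a b) x *\<^sub>R f x)"
  proof (rule integral_dominated_convergence)
    show "integrable (lebesgue_on (cbox a b)) (\<lambda>x. norm (f x))" using int by simp
    show "AE x in lebesgue_on (cbox a b). (\<lambda>k. \<psi> k x *\<^sub>R f x) \<longlonglongrightarrow> indicat_real (box a b) x *\<^sub>R f x"
      by (intro AE_I2 tendsto_intros \<psi>)
    show "AE x in lebesgue_on (cbox a b). norm (\<psi> k x *\<^sub>R f x) \<le> norm (f x)" for k
      using \<psi>(2)[of k] by (intro AE_I2) (auto intro: mult_left_le_one_le)
  qed measurable
  moreover have "(LINT x|lebesgue_on (cbox a b). \<psi> k x *\<^sub>R f x) = 0" for k
    using integral_supported[OF assms(1) compact_cbox assms(4), of "\<lambda>x. \<psi> k x *\<^sub>R f x"] \<psi>(3) assms(3)[OF \<psi>(1)]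
    by auto
  ultimately have "(LINT x|lebesgue_on (cbox a b). indicat_real (box a b) x *\<^sub>R f x) = 0"
    by (simp add: LIMSEQ_const_iff)
  also have "(LINT x|lebesgue_on (cbox a b). indicat_real (box a b) x *\<^sub>R f x) = (LINT x|lebesgue_on (box a b). f x)"
    using box_subset_cbox[of a b] by (simp add: integral_restrict_space)
      (intro Bochner_Integration.integral_cong, auto simp: indicator_def)
  also have "\<dots> = integral (box a b) f"
  proof (rule lebesgue_integral_eq_integral)
    have "set_integrable lebesgue (cbox a b) f"
      using int by (simp add: set_integrable_def integrable_restrict_space)
    then have "set_integrable lebesgue (box a b) f"
      by (rule set_integrable_subset) (auto simp: box_subset_cbox)
    then show "integrable (lebesgue_on (box a b)) f"
      by (simp add: set_integrable_def integrable_restrict_space)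
  qed auto
  finally show ?thesis by (simp add: integral_open_interval)
qed

text \<open>Vanishing integrals over small cubes force f = 0 almost everywhere on each box by
  Lebesgue differentiation, and by Lindelof countably many boxes cover \<Omega>.\<close>

lemma fundamental_lemma:
  fixes f :: "real^'n::finite \<Rightarrow> 'b::euclidean_space"
  assumes "open \<Omega>" "locally_integrable \<Omega> f"
    "\<And>\<psi> :: real^'n \<Rightarrow> real. \<psi> \<in> test_functions \<Omega> \<Longrightarrow> (LINT x|lebesgue_on \<Omega>. \<psi> x *\<^sub>R f x) = 0"
  shows "ae_eq \<Omega> f (\<lambda>_. 0)"
proof -
  have \<Omega>: "\<Omega> \<in> sets lebesgue" using assms(1) by auto
  have box: "\<exists>N. negligible N \<and> (\<forall>x \<in> box a b - N. f x = 0)" if ab: "cbox a b \<subseteq> \<Omega>" for a b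
  proof -
    \<comment> \<open>Cutting off outside the box makes the function integrable over every box, as
      the differentiation theorem demands.\<close>
    define F where "F x = (if x \<in> cbox a b then f x else 0)" for x
    have "f integrable_on cbox a b"
      using assms(2) ab unfolding locally_integrable_def by (auto intro: integrable_on_lebesgue_on)
    then have "F integrable_on UNIV"
      unfolding F_def by (simp add: integrable_restrict_UNIV)
    then have "F integrable_on cbox c d" for c d
      by (rule integrable_on_subcbox) simp
    then obtain N where N: "negligible N"
       "\<And>x e. \<lbrakk>x \<notin> N; 0 < e\<rbrakk> \<Longrightarrow> \<exists>d>0. \<forall>h. 0 < h \<and> h < d \<longrightarrow>
                norm(integral (cbox x (x + h *\<^sub>R One)) F /\<^sub>R h ^ DIM(real^'n) - F x) < e"
      using integrable_ccontinuous_explicit by blast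
    have "f x = 0" if x: "x \<in> box a b" "x \<notin> N" for x
    proof (rule ccontr)
      assume nz: "f x \<noteq> 0"
      obtain r where r: "r > 0" "cball x r \<subseteq> box a b"
        using x(1) open_contains_cball[of "box a b"] open_box by blast
      obtain d where d: "d > 0" "\<And>h. 0 < h \<Longrightarrow> h < d \<Longrightarrow>
          norm(integral (cbox x (x + h *\<^sub>R One)) F /\<^sub>R h ^ DIM(real^'n) - F x) < norm (f x)"
        using N(2)[OF x(2), of "norm (f x)"] nz by auto
      \<comment> \<open>Below d, so that the average over the cube is close to F x, and so small
        that the far corner of the cube stays in the ball of radius r.\<close>
      define h where "h = min (d/2) (r / (norm (One :: real^'n) + 1))"
      have h: "0 < h" "h < d" "h * norm (One :: real^'n) \<le> r"
      proof -
        show "0 < h" "h < d" using d r by (auto simp: h_def add_nonneg_pos)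
        have "h * norm (One :: real^'n) \<le> r / (norm (One :: real^'n) + 1) * (norm (One :: real^'n) + 1)"
          unfolding h_def using r by (intro mult_mono) (auto simp: add_nonneg_pos)
        also have "\<dots> = r"
          using norm_ge_zero[of "One :: real^'n"] by (simp add: field_simps add_nonneg_eq_0_iff)
        finally show "h * norm (One :: real^'n) \<le> r" .
      qed
      have "x + h *\<^sub>R One \<in> cball x r" using h by (simp add: dist_norm)
      then have "x \<in> cbox a b" "x + h *\<^sub>R One \<in> cbox a b" using r x(1) box_subset_cbox[of a b] by auto
      then have sub: "cbox x (x + h *\<^sub>R One) \<subseteq> cbox a b"
        by (auto simp: mem_box) (meson order_trans)+
      have "integral (cbox x (x + h *\<^sub>R One)) F = integral (cbox x (x + h *\<^sub>R One)) f"
        using sub by (intro integral_cong) (auto simp: F_def)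
      also have "\<dots> = 0"
        using integral_cbox_eq_0[OF \<Omega> assms(2,3)] sub ab by blast
      finally have "norm (F x) < norm (f x)" using d(2)[OF h(1,2)] by simp
      then show False using \<open>x \<in> cbox a b\<close> by (simp add: F_def)
    qed
    then show ?thesis using N(1) by blast
  qed
  define \<F> where "\<F> = {box a b | a b. cbox a b \<subseteq> \<Omega>}"
  have U: "\<Union>\<F> = \<Omega>"
  proof
    show "\<Union>\<F> \<subseteq> \<Omega>" using box_subset_cbox unfolding \<F>_def by blast
    show "\<Omega> \<subseteq> \<Union>\<F>"
    proof
      fix x assume "x \<in> \<Omega>"
      then obtain a b where "x \<in> box a b" "cbox a b \<subseteq> \<Omega>"
        using open_contains_cbox[OF assms(1)] by metis
      then show "x \<in> \<Union>\<F>" unfolding \<F>_def by blast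
    qed
  qed
  obtain \<F>' where \<F>': "\<F>' \<subseteq> \<F>" "countable \<F>'" "\<Union>\<F>' = \<Omega>"
    using Lindelof[of \<F>] U unfolding \<F>_def by (smt (verit) mem_Collect_eq open_box)
  have "\<forall>B\<in>\<F>'. \<exists>N. negligible N \<and> (\<forall>x \<in> B - N. f x = 0)"
  proof
    fix B assume "B \<in> \<F>'"
    then obtain a b where "B = box a b" "cbox a b \<subseteq> \<Omega>" using \<F>'(1) unfolding \<F>_def by blast
    then show "\<exists>N. negligible N \<and> (\<forall>x \<in> B - N. f x = 0)" using box by simp
  qed
  then obtain N where N: "\<And>B. B \<in> \<F>' \<Longrightarrow> negligible (N B)" "\<And>B x. B \<in> \<F>' \<Longrightarrow> x \<in> B - N B \<Longrightarrow> f x = 0"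
    by metis
  have "negligible (\<Union>B\<in>\<F>'. N B)"
    using \<F>'(2) N(1) by (intro negligible_countable_Union) auto
  then have "(\<Union>B\<in>\<F>'. N B) \<in> null_sets lebesgue" by (simp add: negligible_iff_null_sets)
  then have "AE x in lebesgue. x \<in> \<Omega> \<longrightarrow> f x = 0"
    by (rule AE_I') (use N(2) \<F>'(3) in blast)
  then show ?thesis
    using \<Omega> by (simp add: ae_eq_def AE_restrict_space_iff)
qed

lemma locally_integrable_add:
  "locally_integrable \<Omega> f \<Longrightarrow> locally_integrable \<Omega> g \<Longrightarrow> locally_integrable \<Omega> (\<lambda>x. f x + g x)"
  by (auto simp: locally_integrable_def)

lemma locally_integrable_diff:
  "locally_integrable \<Omega> f \<Longrightarrow> locally_integrable \<Omega> g \<Longrightarrow> locally_integrable \<Omega> (\<lambda>x. f x - g x)"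
  by (auto simp: locally_integrable_def)

lemma locally_integrable_linear:
  "bounded_linear L \<Longrightarrow> locally_integrable \<Omega> f \<Longrightarrow> locally_integrable \<Omega> (\<lambda>x. L (f x))"
  by (auto simp: locally_integrable_def integrable_bounded_linear)

lemma integrable_test_function_weight:
  fixes f :: "real^'n::finite \<Rightarrow> 'b::euclidean_space"
  assumes "\<Omega> \<in> sets lebesgue" "locally_integrable \<Omega> f" "\<psi> \<in> test_functions \<Omega>"
  shows "integrable (lebesgue_on \<Omega>) (\<lambda>x. \<psi> x *\<^sub>R f x)"
proof -
  obtain K where K: "smooth \<psi>" "compact K" "K \<subseteq> \<Omega>" "\<And>x. x \<notin> K \<Longrightarrow> \<psi> x = 0"
    using test_functionsE[OF assms(3)] by blast
  show ?thesis
    using assms(2) K unfolding locally_integrable_def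
    by (intro integrable_weight[OF assms(1) K(2,3) smooth_continuous[OF K(1)]]) auto
qed

lemma has_weak_gradient_locally_integrable:
  assumes "has_weak_gradient \<Omega> u G"
  shows "locally_integrable \<Omega> u" "locally_integrable \<Omega> G" "locally_integrable \<Omega> (\<lambda>x. G x $ i)"
proof -
  show *: "locally_integrable \<Omega> u" "locally_integrable \<Omega> G" using assms by (auto simp: has_weak_gradient_def)
  show "locally_integrable \<Omega> (\<lambda>x. G x $ i)"
    by (rule locally_integrable_linear[OF bounded_linear_vec_nth *(2)])
qed

text \<open>Gradients enter through choices, and the semigroup is linear only almost everywhere. So
  gradients of functions that agree merely almost everywhere have to be compared; the fundamental
  lemma does this row by row.\<close>

lemma has_weak_gradient_unique:
  assumes "open \<Omega>" "has_weak_gradient \<Omega> u G" "has_weak_gradient \<Omega> v H" "ae_eq \<Omega> u v"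
    "u \<in> borel_measurable (lebesgue_on \<Omega>)" "v \<in> borel_measurable (lebesgue_on \<Omega>)"
  shows "ae_eq \<Omega> G H"
proof -
  have \<Omega>: "\<Omega> \<in> sets lebesgue" using assms(1) by auto
  have li: "locally_integrable \<Omega> (\<lambda>x. G x $ i)" "locally_integrable \<Omega> (\<lambda>x. H x $ i)" for i
    using assms(2,3) by (blast intro: has_weak_gradient_locally_integrable)+
  have "ae_eq \<Omega> (\<lambda>x. G x $ i - H x $ i) (\<lambda>_. 0)" for i
  proof (rule fundamental_lemma[OF assms(1)])
    show "locally_integrable \<Omega> (\<lambda>x. G x $ i - H x $ i)" by (rule locally_integrable_diff[OF li])
    fix \<psi> :: "real^'a \<Rightarrow> real" assume \<psi>: "\<psi> \<in> test_functions \<Omega>"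
    have m: "partial_deriv i \<psi> \<in> borel_measurable (lebesgue_on \<Omega>)"
      using \<psi> by (intro continuous_measurable_lebesgue_on smooth_continuous smooth_partial_deriv) (auto simp: test_functions_def)
    have "(LINT x|lebesgue_on \<Omega>. \<psi> x *\<^sub>R (G x $ i - H x $ i)) =
        (LINT x|lebesgue_on \<Omega>. \<psi> x *\<^sub>R (G x $ i)) - (LINT x|lebesgue_on \<Omega>. \<psi> x *\<^sub>R (H x $ i))"
      using integrable_test_function_weight[OF \<Omega> li(1) \<psi>] integrable_test_function_weight[OF \<Omega> li(2) \<psi>]
      by (simp add: scaleR_diff_right)
    also have "\<dots> = - (LINT x|lebesgue_on \<Omega>. partial_deriv i \<psi> x *\<^sub>R u x) + (LINT x|lebesgue_on \<Omega>. partial_deriv i \<psi> x *\<^sub>R v x)"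
      using assms(2,3) \<psi> by (simp add: has_weak_gradient_def)
    also have "(LINT x|lebesgue_on \<Omega>. partial_deriv i \<psi> x *\<^sub>R u x) = (LINT x|lebesgue_on \<Omega>. partial_deriv i \<psi> x *\<^sub>R v x)"
      using assms(4-6) m by (intro integral_cong_AE) (auto simp: ae_eq_def elim: eventually_mono)
    finally show "(LINT x|lebesgue_on \<Omega>. \<psi> x *\<^sub>R (G x $ i - H x $ i)) = 0" by simp
  qed
  then have "AE x in lebesgue_on \<Omega>. \<forall>i\<in>UNIV. G x $ i - H x $ i = 0"
    by (intro AE_finite_allI) (auto simp: ae_eq_def)
  then show ?thesis by (auto simp: ae_eq_def vec_eq_iff elim: eventually_mono)
qed

lemma has_weak_gradient_add:
  assumes "has_weak_gradient \<Omega> u G" "has_weak_gradient \<Omega> v H" "\<Omega> \<in> sets lebesgue"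
  shows "has_weak_gradient \<Omega> (\<lambda>x. u x + v x) (\<lambda>x. G x + H x)"
proof -
  have li: "locally_integrable \<Omega> (\<lambda>x. G x $ i)" "locally_integrable \<Omega> (\<lambda>x. H x $ i)"
      "locally_integrable \<Omega> u" "locally_integrable \<Omega> v" for i
    using assms(1,2) by (blast intro: has_weak_gradient_locally_integrable)+
  note int = integrable_test_function_weight[OF assms(3)]
  show ?thesis
    using assms int[OF li(1)] int[OF li(2)] int[OF li(3) partial_deriv_test_function] int[OF li(4) partial_deriv_test_function]
    by (simp add: has_weak_gradient_def locally_integrable_add scaleR_add_right)
qed

text \<open>L acts on values and leaves the derivative index alone, so it acts on the rows of the
  gradient. The cases of interest are real multiples and multiplication by \<i>.\<close>

lemma has_weak_gradient_linear:
  fixes L :: "complex^'n::finite \<Rightarrow> complex^'n"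
  assumes "has_weak_gradient \<Omega> u G" "bounded_linear L" "\<Omega> \<in> sets lebesgue"
  shows "has_weak_gradient \<Omega> (\<lambda>x. L (u x)) (\<lambda>x. \<chi> i. L (G x $ i))"
proof -
  interpret bounded_linear L by fact
  have li: "locally_integrable \<Omega> (\<lambda>x. G x $ i)" "locally_integrable \<Omega> u" for i
    using assms(1) by (blast intro: has_weak_gradient_locally_integrable)+
  note int = integrable_test_function_weight[OF assms(3)]
  have "bounded_linear (\<lambda>A :: complex^'n^'n. \<chi> i. L (A $ i))"
    by (intro linear_conv_bounded_linear[THEN iffD1] linearI) (simp_all add: vec_eq_iff add scaleR)
  then have "locally_integrable \<Omega> (\<lambda>x. \<chi> i. L (G x $ i))"
    using assms(1) locally_integrable_linear[of "\<lambda>A. \<chi> i. L (A $ i)" \<Omega> G] by (simp add: has_weak_gradient_def)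
  moreover have "(LINT x|lebesgue_on \<Omega>. w x *\<^sub>R L (f x)) = L (LINT x|lebesgue_on \<Omega>. w x *\<^sub>R f x)"
    if "integrable (lebesgue_on \<Omega>) (\<lambda>x. w x *\<^sub>R f x)" for w :: "real^'n \<Rightarrow> real" and f
    using integral_bounded_linear[OF assms(2) that] by (simp add: scaleR)
  ultimately show ?thesis
    using assms(1) int[OF li(1)] int[OF li(2) partial_deriv_test_function]
    by (simp add: has_weak_gradient_def locally_integrable_linear[OF assms(2)] linear_neg[OF bounded_linear.linear[OF assms(2)]])
qed

section \<open>Solenoidal Lebesgue spaces\<close>

lemma vector_scale_of_real: "complex_of_real c *s v = c *\<^sub>R (v :: complex^'n::finite)"
  by (simp add: vec_eq_iff) (simp add: scaleR_conv_of_real)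

lemma Lp_vector_scale:
  fixes c :: complex
  assumes "f \<in> Lp p \<Omega>"
  shows "(\<lambda>x. c *s f x) \<in> Lp p (\<Omega> :: (real^'n::finite) set)"
proof -
  have "(\<lambda>x. c *s f x) \<in> borel_measurable (lebesgue_on \<Omega>)"
    using Lp_measurable[OF assms] borel_measurable_continuous_onI[OF linear_continuous_on[OF bounded_linear_vector_scale[of c]]]
    by (rule measurable_compose)
  then show ?thesis
    using LpD[OF assms] by (auto simp: Lp_def norm_vector_scale powr_mult)
qed

lemma Lp_norm_vector_scale:
  fixes c :: complex
  assumes "p > 0"
  shows "Lp_norm p \<Omega> (\<lambda>x. c *s f x) = cmod c * Lp_norm p (\<Omega> :: (real^'n::finite) set) f"
  using assms by (simp add: Lp_norm_def norm_vector_scale powr_mult powr_powr integral_nonneg_AE)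

lemma Lp_sigma_Lp: "f \<in> Lp_sigma p \<Omega> \<Longrightarrow> f \<in> Lp p \<Omega>"
  by (simp add: Lp_sigma_def)

lemma Lp_sigma_measurable: "f \<in> Lp_sigma p \<Omega> \<Longrightarrow> f \<in> borel_measurable (lebesgue_on \<Omega>)"
  by (blast intro: Lp_sigma_Lp Lp_measurable)

lemma solenoidal_tests_Lp:
  assumes "\<phi> \<in> solenoidal_tests \<Omega>" "\<Omega> \<in> sets lebesgue" "p \<ge> 0"
  shows "\<phi> \<in> Lp p \<Omega>"
  using assms test_functions_Lp[of \<phi> \<Omega> p] by (simp add: solenoidal_tests_def)

lemma Lp_sigma_approx:
  assumes "u \<in> Lp_sigma p \<Omega>" "e > 0"
  shows "\<exists>\<phi> \<in> solenoidal_tests \<Omega>. Lp_norm p \<Omega> (\<lambda>x. \<phi> x - u x) < e"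
proof -
  obtain \<phi> where \<phi>: "\<And>k::nat. \<phi> k \<in> solenoidal_tests \<Omega>" "(\<lambda>k. Lp_norm p \<Omega> (\<lambda>x. \<phi> k x - u x)) \<longlonglongrightarrow> 0"
    using assms(1) by (auto simp: Lp_sigma_def)
  have "\<forall>\<^sub>F k in sequentially. Lp_norm p \<Omega> (\<lambda>x. \<phi> k x - u x) < e"
    using order_tendstoD(2)[OF \<phi>(2) assms(2)] .
  then show ?thesis using \<phi>(1) eventually_happens'[OF sequentially_bot] by blast
qed

lemma Lp_sigmaI:
  assumes "u \<in> Lp p \<Omega>" "\<And>e. e > 0 \<Longrightarrow> \<exists>\<phi> \<in> solenoidal_tests \<Omega>. Lp_norm p \<Omega> (\<lambda>x. \<phi> x - u x) < e"
  shows "u \<in> Lp_sigma p \<Omega>"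
proof -
  have "\<exists>\<phi> \<in> solenoidal_tests \<Omega>. Lp_norm p \<Omega> (\<lambda>x. \<phi> x - u x) < inverse (real (Suc k))" for k
    by (rule assms(2)) simp
  then obtain \<phi> where \<phi>: "\<And>k. \<phi> k \<in> solenoidal_tests \<Omega>"
      "\<And>k. Lp_norm p \<Omega> (\<lambda>x. \<phi> k x - u x) < inverse (real (Suc k))"
    by metis
  have "(\<lambda>k. Lp_norm p \<Omega> (\<lambda>x. \<phi> k x - u x)) \<longlonglongrightarrow> 0"
    by (rule Lim_null_comparison[OF _ LIMSEQ_inverse_real_of_nat])
       (use \<phi>(2) in \<open>auto intro!: always_eventually less_imp_le\<close>)
  then show ?thesis using assms(1) \<phi>(1) by (auto simp: Lp_sigma_def)
qed

locale solenoidal_Lp =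
  fixes p :: real and \<Omega> :: "(real^'n::finite) set"
  assumes \<Omega>: "\<Omega> \<in> sets lebesgue" and p1: "p > 1"
begin

lemma p_ge_1: "p \<ge> 1" and p_pos: "p > 0"
  using p1 by auto

lemma tests_Lp: "\<phi> \<in> solenoidal_tests \<Omega> \<Longrightarrow> \<phi> \<in> Lp p \<Omega>"
  using solenoidal_tests_Lp[OF _ \<Omega>] p1 by simp

lemma tests_Lp_sigma: "\<phi> \<in> solenoidal_tests \<Omega> \<Longrightarrow> \<phi> \<in> Lp_sigma p \<Omega>"
  by (rule Lp_sigmaI) (auto simp: tests_Lp intro!: bexI[of _ \<phi>])

lemma closed:
  assumes "u \<in> Lp p \<Omega>" "\<And>e. e > 0 \<Longrightarrow> \<exists>v \<in> Lp_sigma p \<Omega>. Lp_norm p \<Omega> (\<lambda>x. v x - u x) < e"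
  shows "u \<in> Lp_sigma p \<Omega>"
proof (rule Lp_sigmaI[OF assms(1)])
  fix e :: real assume "e > 0"
  then obtain v where v: "v \<in> Lp_sigma p \<Omega>" "Lp_norm p \<Omega> (\<lambda>x. v x - u x) < e/2"
    using assms(2)[of "e/2"] by auto
  obtain \<phi> where \<phi>: "\<phi> \<in> solenoidal_tests \<Omega>" "Lp_norm p \<Omega> (\<lambda>x. \<phi> x - v x) < e/2"
    using Lp_sigma_approx[OF v(1)] \<open>e > 0\<close> by (meson half_gt_zero)
  have "Lp_norm p \<Omega> (\<lambda>x. \<phi> x - u x) \<le> Lp_norm p \<Omega> (\<lambda>x. \<phi> x - v x) + Lp_norm p \<Omega> (\<lambda>x. v x - u x)"
    by (intro Lp_norm_triangle_via tests_Lp \<phi> assms Lp_sigma_Lp v p_ge_1)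
  then show "\<exists>\<phi> \<in> solenoidal_tests \<Omega>. Lp_norm p \<Omega> (\<lambda>x. \<phi> x - u x) < e"
    using v \<phi> by (intro bexI[of _ \<phi>]) auto
qed

lemma limit_Lp_sigma:
  assumes "u \<in> Lp p \<Omega>" "\<And>k::nat. v k \<in> Lp_sigma p \<Omega>" "(\<lambda>k. Lp_norm p \<Omega> (\<lambda>x. v k x - u x)) \<longlonglongrightarrow> 0"
  shows "u \<in> Lp_sigma p \<Omega>"
proof (rule closed[OF assms(1)])
  fix e :: real assume "e > 0"
  then have "\<forall>\<^sub>F k in sequentially. Lp_norm p \<Omega> (\<lambda>x. v k x - u x) < e"
    using order_tendstoD(2)[OF assms(3)] by auto
  then show "\<exists>v \<in> Lp_sigma p \<Omega>. Lp_norm p \<Omega> (\<lambda>x. v x - u x) < e"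
    using assms(2) eventually_happens'[OF sequentially_bot] by blast
qed

lemma add:
  assumes "u \<in> Lp_sigma p \<Omega>" "v \<in> Lp_sigma p \<Omega>"
  shows "(\<lambda>x. u x + v x) \<in> Lp_sigma p \<Omega>"
proof (rule Lp_sigmaI)
  show "(\<lambda>x. u x + v x) \<in> Lp p \<Omega>" by (intro Lp_add Lp_sigma_Lp assms p_ge_1)
  fix e :: real assume e: "e > 0"
  obtain \<phi> where \<phi>: "\<phi> \<in> solenoidal_tests \<Omega>" "Lp_norm p \<Omega> (\<lambda>x. \<phi> x - u x) < e/2"
    using Lp_sigma_approx[OF assms(1)] e by (meson half_gt_zero)
  obtain \<psi> where \<psi>: "\<psi> \<in> solenoidal_tests \<Omega>" "Lp_norm p \<Omega> (\<lambda>x. \<psi> x - v x) < e/2"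
    using Lp_sigma_approx[OF assms(2)] e by (meson half_gt_zero)
  have "Lp_norm p \<Omega> (\<lambda>x. (\<phi> x - u x) + (\<psi> x - v x)) \<le> Lp_norm p \<Omega> (\<lambda>x. \<phi> x - u x) + Lp_norm p \<Omega> (\<lambda>x. \<psi> x - v x)"
    by (intro Lp_norm_triangle Lp_diff tests_Lp \<phi> \<psi> Lp_sigma_Lp assms p_ge_1)
  moreover have "(\<lambda>x. (\<phi> x - u x) + (\<psi> x - v x)) = (\<lambda>x. (\<phi> x + \<psi> x) - (u x + v x))" by auto
  ultimately show "\<exists>\<phi> \<in> solenoidal_tests \<Omega>. Lp_norm p \<Omega> (\<lambda>x. \<phi> x - (u x + v x)) < e"
    using \<phi> \<psi> by (intro bexI[of _ "\<lambda>x. \<phi> x + \<psi> x"] solenoidal_tests_add) auto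
qed

lemma vector_scale:
  assumes "u \<in> Lp_sigma p \<Omega>"
  shows "(\<lambda>x. c *s u x) \<in> Lp_sigma p \<Omega>"
proof (rule Lp_sigmaI)
  show "(\<lambda>x. c *s u x) \<in> Lp p \<Omega>" by (intro Lp_vector_scale Lp_sigma_Lp assms)
  fix e :: real assume e: "e > 0"
  then have "e / (cmod c + 1) > 0" by (simp add: add_nonneg_pos)
  then obtain \<phi> where \<phi>: "\<phi> \<in> solenoidal_tests \<Omega>" "Lp_norm p \<Omega> (\<lambda>x. \<phi> x - u x) < e / (cmod c + 1)"
    using Lp_sigma_approx[OF assms] by blast
  have "(\<lambda>x. c *s \<phi> x - c *s u x) = (\<lambda>x. c *s (\<phi> x - u x))"
    by (simp add: vector_sub_rdistrib vec_eq_iff algebra_simps)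
  then have "Lp_norm p \<Omega> (\<lambda>x. c *s \<phi> x - c *s u x) = cmod c * Lp_norm p \<Omega> (\<lambda>x. \<phi> x - u x)"
    using Lp_norm_vector_scale[OF p_pos, of \<Omega> c "\<lambda>x. \<phi> x - u x"] by simp
  also have "\<dots> \<le> (cmod c + 1) * Lp_norm p \<Omega> (\<lambda>x. \<phi> x - u x)" by (intro mult_right_mono) auto
  also have "\<dots> < e" using \<phi>(2) by (simp add: pos_less_divide_eq add_nonneg_pos mult.commute)
  finally show "\<exists>\<phi> \<in> solenoidal_tests \<Omega>. Lp_norm p \<Omega> (\<lambda>x. \<phi> x - c *s u x) < e"
    using \<phi> by (intro bexI[of _ "\<lambda>x. c *s \<phi> x"] solenoidal_tests_vector_scale) auto
qed

lemma scaleR: "u \<in> Lp_sigma p \<Omega> \<Longrightarrow> (\<lambda>x. c *\<^sub>R u x) \<in> Lp_sigma p \<Omega>"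
  using vector_scale[of u "complex_of_real c"] by (simp add: vector_scale_of_real)

lemma uminus: "u \<in> Lp_sigma p \<Omega> \<Longrightarrow> (\<lambda>x. - u x) \<in> Lp_sigma p \<Omega>"
  using scaleR[of u "-1"] by simp

lemma diff: "u \<in> Lp_sigma p \<Omega> \<Longrightarrow> v \<in> Lp_sigma p \<Omega> \<Longrightarrow> (\<lambda>x. u x - v x) \<in> Lp_sigma p \<Omega>"
  using add[of u "\<lambda>x. - v x"] uminus by simp

lemma sum:
  assumes "\<And>i. i \<in> I \<Longrightarrow> f i \<in> Lp_sigma p \<Omega>" "finite I" "I \<noteq> {}"
  shows "(\<lambda>x. \<Sum>i\<in>I. f i x) \<in> Lp_sigma p \<Omega>"
  using assms(2,3,1) by (induction I rule: finite_ne_induct) (auto intro: add)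

lemma cong:
  assumes "ae_eq \<Omega> u v" "u \<in> Lp_sigma p \<Omega>" "v \<in> borel_measurable (lebesgue_on \<Omega>)"
  shows "v \<in> Lp_sigma p \<Omega>"
proof (rule closed)
  have v: "v \<in> Lp p \<Omega>" using Lp_cong[OF assms(1) Lp_sigma_Lp[OF assms(2)] assms(3)] .
  then show "v \<in> Lp p \<Omega>" .
  have "ae_eq \<Omega> (\<lambda>x. u x - v x) (\<lambda>_. 0)" using assms(1) by (auto simp: ae_eq_def elim: eventually_mono)
  then have "Lp_norm p \<Omega> (\<lambda>x. u x - v x) = 0"
    using Lp_norm_eq_0_iff[OF Lp_diff[OF Lp_sigma_Lp[OF assms(2)] v p_ge_1] p_pos] by simp
  then show "\<exists>v' \<in> Lp_sigma p \<Omega>. Lp_norm p \<Omega> (\<lambda>x. v' x - v x) < e" if "e > 0" for e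
    using that assms(2) by (intro bexI[of _ u]) auto
qed

lemma norm_cong:
  assumes "ae_eq \<Omega> u v" "u \<in> Lp p \<Omega>" "v \<in> Lp p \<Omega>"
  shows "Lp_norm p \<Omega> u = Lp_norm p \<Omega> v"
  using assms Lp_norm_cong Lp_measurable by blast

lemma norm_diff_eq_0:
  assumes "u \<in> Lp p \<Omega>" "v \<in> Lp p \<Omega>"
  shows "Lp_norm p \<Omega> (\<lambda>x. u x - v x) = 0 \<longleftrightarrow> ae_eq \<Omega> u v"
  using Lp_norm_eq_0_iff[OF Lp_diff[OF assms p_ge_1] p_pos] by (simp add: ae_eq_def)

lemma complete:
  assumes "\<And>n::nat. f n \<in> Lp_sigma p \<Omega>"
    and "\<And>e. e > 0 \<Longrightarrow> \<exists>K. \<forall>m\<ge>K. \<forall>n\<ge>K. Lp_norm p \<Omega> (\<lambda>x. f m x - f n x) < e"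
  shows "\<exists>F \<in> Lp_sigma p \<Omega>. (\<lambda>n. Lp_norm p \<Omega> (\<lambda>x. f n x - F x)) \<longlonglongrightarrow> 0"
proof -
  have "\<exists>F \<in> Lp p \<Omega>. (\<lambda>n. Lp_norm p \<Omega> (\<lambda>x. f n x - F x)) \<longlonglongrightarrow> 0"
    by (rule Lp_complete) (use assms p_ge_1 in \<open>auto intro: Lp_sigma_Lp\<close>)
  then show ?thesis using limit_Lp_sigma assms(1) by blast
qed

end

section \<open>Complex and real inner products\<close>

text \<open>\<open>cdot\<close> is conjugate-linear in w, so its imaginary part is its real part
  with w replaced by \<i> w. Complex identities therefore reduce to the real \<open>pairing\<close>,
  tested with \<phi> and with \<i> \<phi>.\<close>

lemma cdot_eq_inner: "cdot v w = complex_of_real (v \<bullet> w) + \<i> * complex_of_real (v \<bullet> (\<i> *s w))"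
  by (simp add: complex_eq_iff cdot_def inner_vec_def inner_complex_def Re_sum Im_sum)

lemma mat_cdot_eq_inner:
  "mat_cdot A B = complex_of_real (A \<bullet> B) + \<i> * complex_of_real (A \<bullet> (\<chi> i. \<i> *s B $ i))"
  by (simp add: complex_eq_iff mat_cdot_def inner_vec_def inner_complex_def Re_sum Im_sum)

context conjugate_exponents
begin

lemma integral_cdot:
  fixes \<Omega> :: "(real^'n::finite) set"
  assumes "f \<in> Lp p \<Omega>" "g \<in> Lp q \<Omega>"
  shows "(LINT x|lebesgue_on \<Omega>. cdot (f x) (g x)) =
     complex_of_real (pairing \<Omega> f g) + \<i> * complex_of_real (pairing \<Omega> f (\<lambda>x. \<i> *s g x))"
  using integrable_inner[OF assms] integrable_inner[OF assms(1) Lp_vector_scale[OF assms(2), of \<i>]]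
  by (simp add: cdot_eq_inner pairing_def)

lemma
  fixes \<Omega> :: "(real^'n::finite) set" and F G :: "real^'n \<Rightarrow> complex^'m::finite^'m"
  assumes "F \<in> Lp p \<Omega>" "G \<in> Lp q \<Omega>" "(\<lambda>x. \<chi> i. \<i> *s G x $ i) \<in> Lp q \<Omega>"
  shows integrable_mat_cdot: "integrable (lebesgue_on \<Omega>) (\<lambda>x. mat_cdot (F x) (G x))"
    and integral_mat_cdot: "(LINT x|lebesgue_on \<Omega>. mat_cdot (F x) (G x)) =
     complex_of_real (pairing \<Omega> F G) + \<i> * complex_of_real (pairing \<Omega> F (\<lambda>x. \<chi> i. \<i> *s G x $ i))"
  using integrable_inner[OF assms(1,2)] integrable_inner[OF assms(1,3)]
  by (simp_all add: mat_cdot_eq_inner pairing_def)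

end

lemma Lp_rows_vector_scale:
  fixes G :: "real^'n::finite \<Rightarrow> complex^'m::finite^'m"
  assumes "G \<in> Lp p \<Omega>"
  shows "(\<lambda>x. \<chi> i. \<i> *s G x $ i) \<in> Lp p \<Omega>"
proof -
  have n: "norm (\<chi> i. \<i> *s A $ i) = norm A" for A :: "complex^'m^'m"
    unfolding norm_vec_def[of A] norm_vec_def[of "\<chi> i. \<i> *s A $ i"] by (simp add: norm_vector_scale)
  have "linear (\<lambda>A :: complex^'m^'m. \<chi> i. \<i> *s A $ i)"
    by (rule linearI) (simp_all add: vec_eq_iff algebra_simps)
  then have "continuous_on UNIV (\<lambda>A :: complex^'m^'m. \<chi> i. \<i> *s A $ i)"
    by (simp add: linear_continuous_on linear_conv_bounded_linear)
  then have "(\<lambda>x. \<chi> i. \<i> *s G x $ i) \<in> borel_measurable (lebesgue_on \<Omega>)"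
    using measurable_compose[OF Lp_measurable[OF assms] borel_measurable_continuous_onI] by blast
  then show ?thesis
    using LpD[OF assms] by (auto simp: Lp_def n)
qed


section \<open>The Stokes semigroup\<close>

text \<open>The form is hermitian, and \<open>pairing\<close> is the real part of the complex inner
  product.\<close>

lemma stokes_2_symmetric:
  assumes "(u, f) \<in> stokes_2 \<Omega>" "(v, g) \<in> stokes_2 \<Omega>"
  shows "pairing \<Omega> f v = pairing \<Omega> u g"
proof -
  interpret conjugate_exponents 2 2 by (rule conjugate_two)
  have L: "u \<in> Lp 2 \<Omega>" "v \<in> Lp 2 \<Omega>" "f \<in> Lp 2 \<Omega>" "g \<in> Lp 2 \<Omega>"
    using assms by (auto simp: stokes_2_def W1p_0_sigma_def W1p_def Lp_sigma_def)
  have m: "mat_cdot A B = cnj (mat_cdot B A)" for A B :: "complex^'a^'a"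
    by (simp add: mat_cdot_def mult.commute)
  have "(LINT x|lebesgue_on \<Omega>. cdot (f x) (v x)) = (LINT x|lebesgue_on \<Omega>. mat_cdot (weak_gradient \<Omega> u x) (weak_gradient \<Omega> v x))"
    using assms by (simp add: stokes_2_def)
  also have "\<dots> = (LINT x|lebesgue_on \<Omega>. cnj (mat_cdot (weak_gradient \<Omega> v x) (weak_gradient \<Omega> u x)))"
    using m by metis
  also have "\<dots> = cnj (LINT x|lebesgue_on \<Omega>. mat_cdot (weak_gradient \<Omega> v x) (weak_gradient \<Omega> u x))"
    by simp
  also have "\<dots> = cnj (LINT x|lebesgue_on \<Omega>. cdot (g x) (u x))"
    using assms by (simp add: stokes_2_def)
  finally have "Re (LINT x|lebesgue_on \<Omega>. cdot (f x) (v x)) = Re (LINT x|lebesgue_on \<Omega>. cdot (g x) (u x))"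
    by simp
  then show ?thesis using L by (simp add: integral_cdot pairing_commute)
qed

text \<open>Symmetry survives the closure because the pairing is continuous in both
  arguments.\<close>

lemma stokes_symmetric:
  assumes "(u, f) \<in> stokes 2 \<Omega>" "(v, g) \<in> stokes 2 \<Omega>"
  shows "pairing \<Omega> f v = pairing \<Omega> u g"
proof -
  interpret conjugate_exponents 2 2 by (rule conjugate_two)
  obtain u' f' where uf: "\<And>k::nat. (u' k, f' k) \<in> stokes_part 2 \<Omega>"
      "(\<lambda>k. Lp_norm 2 \<Omega> (\<lambda>x. u' k x - u x)) \<longlonglongrightarrow> 0" "(\<lambda>k. Lp_norm 2 \<Omega> (\<lambda>x. f' k x - f x)) \<longlonglongrightarrow> 0"
    using assms(1) by (auto simp: stokes_def)
  obtain v' g' where vg: "\<And>k::nat. (v' k, g' k) \<in> stokes_part 2 \<Omega>"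
      "(\<lambda>k. Lp_norm 2 \<Omega> (\<lambda>x. v' k x - v x)) \<longlonglongrightarrow> 0" "(\<lambda>k. Lp_norm 2 \<Omega> (\<lambda>x. g' k x - g x)) \<longlonglongrightarrow> 0"
    using assms(2) by (auto simp: stokes_def)
  have L: "u \<in> Lp 2 \<Omega>" "f \<in> Lp 2 \<Omega>" "v \<in> Lp 2 \<Omega>" "g \<in> Lp 2 \<Omega>"
    "u' k \<in> Lp 2 \<Omega>" "f' k \<in> Lp 2 \<Omega>" "v' k \<in> Lp 2 \<Omega>" "g' k \<in> Lp 2 \<Omega>" for k
    using assms uf(1) vg(1) by (auto simp: stokes_def stokes_part_def Lp_sigma_def)
  have "(\<lambda>k. pairing \<Omega> (f' k) (v' k)) \<longlonglongrightarrow> pairing \<Omega> f v"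
    by (intro tendsto_pairing L always_eventually allI uf vg)
  moreover have "(\<lambda>k. pairing \<Omega> (u' k) (g' k)) \<longlonglongrightarrow> pairing \<Omega> u g"
    by (intro tendsto_pairing L always_eventually allI uf vg)
  moreover have "pairing \<Omega> (f' k) (v' k) = pairing \<Omega> (u' k) (g' k)" for k
    using stokes_2_symmetric[of "u' k" "f' k" \<Omega> "v' k" "g' k"] uf(1) vg(1) by (auto simp: stokes_part_def)
  ultimately show ?thesis using LIMSEQ_unique by auto
qed

context solenoidal_Lp
begin

lemma bounded_operator_add:
  "bounded_operator p \<Omega> B \<Longrightarrow> f \<in> Lp_sigma p \<Omega> \<Longrightarrow> g \<in> Lp_sigma p \<Omega> \<Longrightarrow>
    ae_eq \<Omega> (B (\<lambda>x. f x + g x)) (\<lambda>x. B f x + B g x)"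
  by (simp add: bounded_operator_def)

lemma bounded_operator_diff:
  assumes "bounded_operator p \<Omega> B" "f \<in> Lp_sigma p \<Omega>" "g \<in> Lp_sigma p \<Omega>"
  shows "ae_eq \<Omega> (B (\<lambda>x. f x - g x)) (\<lambda>x. B f x - B g x)"
proof -
  have "ae_eq \<Omega> (B (\<lambda>x. (f x - g x) + g x)) (\<lambda>x. B (\<lambda>x. f x - g x) x + B g x)"
    by (rule bounded_operator_add[OF assms(1) diff[OF assms(2,3)] assms(3)])
  then show ?thesis by (auto simp: ae_eq_def elim: eventually_mono)
qed

text \<open>Operators act on representatives. Boundedness applied to f - g, which has norm 0, makes
  them respect equality almost everywhere.\<close>

lemma bounded_operator_cong:
  assumes "bounded_operator p \<Omega> B" "f \<in> Lp_sigma p \<Omega>" "g \<in> Lp_sigma p \<Omega>" "ae_eq \<Omega> f g"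
  shows "ae_eq \<Omega> (B f) (B g)"
proof -
  have fg: "(\<lambda>x. f x - g x) \<in> Lp_sigma p \<Omega>" using assms diff by blast
  obtain M where "\<And>f. f \<in> Lp_sigma p \<Omega> \<Longrightarrow> Lp_norm p \<Omega> (B f) \<le> M * Lp_norm p \<Omega> f"
    using assms(1) unfolding bounded_operator_def by blast
  from this[OF fg] have "Lp_norm p \<Omega> (B (\<lambda>x. f x - g x)) \<le> 0"
    using norm_diff_eq_0[OF Lp_sigma_Lp[OF assms(2)] Lp_sigma_Lp[OF assms(3)]] assms(4) by simp
  then have "Lp_norm p \<Omega> (B (\<lambda>x. f x - g x)) = 0" by (intro antisym) auto
  moreover have BL: "B (\<lambda>x. f x - g x) \<in> Lp p \<Omega>"
    using assms(1) fg Lp_sigma_Lp unfolding bounded_operator_def by blast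
  ultimately have "ae_eq \<Omega> (B (\<lambda>x. f x - g x)) (\<lambda>_. 0)" using Lp_norm_eq_0_iff p_pos by blast
  with bounded_operator_diff[OF assms(1-3)] show ?thesis
    by (auto simp: ae_eq_def elim: eventually_elim2)
qed

text \<open>The analytic extension agrees with T only almost everywhere, so its operator properties
  have to be carried over to T.\<close>

lemma bounded_operator_transfer:
  assumes "bounded_operator p \<Omega> B" "\<And>f. f \<in> Lp_sigma p \<Omega> \<Longrightarrow> ae_eq \<Omega> (B f) (B' f)"
    "\<And>f. f \<in> Lp_sigma p \<Omega> \<Longrightarrow> B' f \<in> Lp_sigma p \<Omega>"
  shows "bounded_operator p \<Omega> B'"
  unfolding bounded_operator_def
proof (intro conjI ballI allI)
  fix f g assume fg: "f \<in> Lp_sigma p \<Omega>" "g \<in> Lp_sigma p \<Omega>"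
  have 1: "ae_eq \<Omega> (B (\<lambda>x. f x + g x)) (\<lambda>x. B f x + B g x)"
    using assms(1) fg unfolding bounded_operator_def by blast
  show "ae_eq \<Omega> (B' (\<lambda>x. f x + g x)) (\<lambda>x. B' f x + B' g x)"
    using 1 assms(2)[OF fg(1)] assms(2)[OF fg(2)] assms(2)[OF add[OF fg]]
    unfolding ae_eq_def by eventually_elim auto
next
  fix c f assume f: "f \<in> Lp_sigma p \<Omega>"
  have 1: "ae_eq \<Omega> (B (\<lambda>x. c *s f x)) (\<lambda>x. c *s B f x)"
    using assms(1) f unfolding bounded_operator_def by blast
  show "ae_eq \<Omega> (B' (\<lambda>x. c *s f x)) (\<lambda>x. c *s B' f x)"
    using 1 assms(2)[OF f] assms(2)[OF vector_scale[OF f, of c]]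
    unfolding ae_eq_def by eventually_elim auto
next
  obtain M where M: "\<And>f. f \<in> Lp_sigma p \<Omega> \<Longrightarrow> Lp_norm p \<Omega> (B f) \<le> M * Lp_norm p \<Omega> f"
    using assms(1) unfolding bounded_operator_def by blast
  have "Lp_norm p \<Omega> (B' f) \<le> M * Lp_norm p \<Omega> f" if "f \<in> Lp_sigma p \<Omega>" for f
  proof -
    have "B f \<in> Lp_sigma p \<Omega>" using assms(1) that unfolding bounded_operator_def by blast
    then have "Lp_norm p \<Omega> (B f) = Lp_norm p \<Omega> (B' f)"
      using assms(2,3) that by (intro norm_cong) (auto intro: Lp_sigma_Lp)
    then show ?thesis using M[OF that] by simp
  qed
  then show "\<exists>M. \<forall>f \<in> Lp_sigma p \<Omega>. Lp_norm p \<Omega> (B' f) \<le> M * Lp_norm p \<Omega> f" by blast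
qed (use assms in auto)

end

text \<open>In the application \<open>invariant\<close> comes from (E1) with equal exponents. The
  semigroup is evaluated at positive times only.\<close>

locale Lp_semigroup = solenoidal_Lp p \<Omega> for p and \<Omega> :: "(real^'n::finite) set" +
  fixes T :: "real \<Rightarrow> 'n field \<Rightarrow> 'n field" and A
  assumes invariant: "\<And>t f. t > 0 \<Longrightarrow> f \<in> Lp_sigma p \<Omega> \<Longrightarrow> T t f \<in> Lp_sigma p \<Omega>"
    and generates: "neg_generates_bounded_analytic p \<Omega> A T"
begin

lemma extension:
  obtains \<theta> S where "0 < \<theta>" "bounded_analytic_semigroup p \<Omega> \<theta> S"
    "\<And>t f. t > 0 \<Longrightarrow> f \<in> Lp_sigma p \<Omega> \<Longrightarrow> ae_eq \<Omega> (S (complex_of_real t) f) (T t f)"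
    "\<And>t. t > 0 \<Longrightarrow> complex_of_real t \<in> sector \<theta>"
  using generates unfolding neg_generates_bounded_analytic_def
  by (auto simp: sector_def Arg_of_real)

lemma bounded_operator_T:
  assumes "t > 0"
  shows "bounded_operator p \<Omega> (T t)"
proof -
  obtain \<theta> S where S: "0 < \<theta>" "bounded_analytic_semigroup p \<Omega> \<theta> S"
    "\<And>t f. t > 0 \<Longrightarrow> f \<in> Lp_sigma p \<Omega> \<Longrightarrow> ae_eq \<Omega> (S (complex_of_real t) f) (T t f)"
    "\<And>t. t > 0 \<Longrightarrow> complex_of_real t \<in> sector \<theta>"
    using extension by blast
  then have "bounded_operator p \<Omega> (S (complex_of_real t))"
    using assms unfolding bounded_analytic_semigroup_def by blast
  then show ?thesis by (rule bounded_operator_transfer) (use S(3) invariant assms in auto)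
qed

lemma T_add:
  "t > 0 \<Longrightarrow> f \<in> Lp_sigma p \<Omega> \<Longrightarrow> g \<in> Lp_sigma p \<Omega> \<Longrightarrow> ae_eq \<Omega> (T t (\<lambda>x. f x + g x)) (\<lambda>x. T t f x + T t g x)"
  using bounded_operator_T unfolding bounded_operator_def by blast

lemma T_diff:
  "t > 0 \<Longrightarrow> f \<in> Lp_sigma p \<Omega> \<Longrightarrow> g \<in> Lp_sigma p \<Omega> \<Longrightarrow> ae_eq \<Omega> (T t (\<lambda>x. f x - g x)) (\<lambda>x. T t f x - T t g x)"
  using bounded_operator_T bounded_operator_diff by blast

lemma T_vector_scale:
  "t > 0 \<Longrightarrow> f \<in> Lp_sigma p \<Omega> \<Longrightarrow> ae_eq \<Omega> (T t (\<lambda>x. c *s f x)) (\<lambda>x. c *s T t f x)"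
  using bounded_operator_T unfolding bounded_operator_def by blast

lemma T_scaleR:
  "t > 0 \<Longrightarrow> f \<in> Lp_sigma p \<Omega> \<Longrightarrow> ae_eq \<Omega> (T t (\<lambda>x. c *\<^sub>R f x)) (\<lambda>x. c *\<^sub>R T t f x)"
  using T_vector_scale[of t f "complex_of_real c"] by (simp add: vector_scale_of_real)

lemma T_semigroup:
  assumes "t > 0" "s > 0" "f \<in> Lp_sigma p \<Omega>"
  shows "ae_eq \<Omega> (T (t + s) f) (T t (T s f))"
proof -
  obtain \<theta> S where S: "0 < \<theta>" "bounded_analytic_semigroup p \<Omega> \<theta> S"
    "\<And>t f. t > 0 \<Longrightarrow> f \<in> Lp_sigma p \<Omega> \<Longrightarrow> ae_eq \<Omega> (S (complex_of_real t) f) (T t f)"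
    "\<And>t. t > 0 \<Longrightarrow> complex_of_real t \<in> sector \<theta>"
    using extension by blast
  have b: "bounded_operator p \<Omega> (S (complex_of_real t))" "bounded_operator p \<Omega> (S (complex_of_real s))"
    using S(2,4) assms unfolding bounded_analytic_semigroup_def by blast+
  have Ss: "S (complex_of_real s) f \<in> Lp_sigma p \<Omega>" using b assms unfolding bounded_operator_def by blast
  have "ae_eq \<Omega> (T (t + s) f) (S (complex_of_real t + complex_of_real s) f)"
    using ae_eq_sym[OF S(3)[of "t + s" f]] assms by simp
  also have "ae_eq \<Omega> \<dots> (S (complex_of_real t) (S (complex_of_real s) f))"
    using S(2,4) assms unfolding bounded_analytic_semigroup_def by blast
  also have "ae_eq \<Omega> \<dots> (S (complex_of_real t) (T s f))"
    by (rule bounded_operator_cong[OF b(1) Ss invariant[OF assms(2,3)] S(3)[OF assms(2,3)]])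
  also have "ae_eq \<Omega> \<dots> (T t (T s f))"
    using S(3) invariant assms by blast
  finally show ?thesis .
qed

text \<open>Complex differentiability in the operator norm, restricted to real increments and to a
  single f.\<close>

lemma T_differentiable:
  assumes "t > 0" "f \<in> Lp_sigma p \<Omega>"
  shows "\<exists>D \<in> Lp_sigma p \<Omega>. ((\<lambda>h. Lp_norm p \<Omega> (\<lambda>x. (1 / h) *\<^sub>R (T (t + h) f x - T t f x) - D x)) \<longlongrightarrow> 0) (at 0)"
proof -
  obtain \<theta> S where S: "0 < \<theta>" "bounded_analytic_semigroup p \<Omega> \<theta> S"
    "\<And>t f. t > 0 \<Longrightarrow> f \<in> Lp_sigma p \<Omega> \<Longrightarrow> ae_eq \<Omega> (S (complex_of_real t) f) (T t f)"
    "\<And>t. t > 0 \<Longrightarrow> complex_of_real t \<in> sector \<theta>"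
    using extension by blast
  obtain D where D: "\<forall>f \<in> Lp_sigma p \<Omega>. D f \<in> Lp_sigma p \<Omega>"
     "\<forall>e>0. \<exists>d>0. \<forall>h. norm h < d \<and> complex_of_real t + h \<in> sector \<theta> \<longrightarrow>
           (\<forall>f \<in> Lp_sigma p \<Omega>. Lp_norm p \<Omega> (\<lambda>x. S (complex_of_real t + h) f x - S (complex_of_real t) f x - h *s D f x)
               \<le> e * norm h * Lp_norm p \<Omega> f)"
    using S(2) S(4)[OF assms(1)] unfolding bounded_analytic_semigroup_def by blast
  have "((\<lambda>h. Lp_norm p \<Omega> (\<lambda>x. (1 / h) *\<^sub>R (T (t + h) f x - T t f x) - D f x)) \<longlongrightarrow> 0) (at 0)"
  proof (rule tendstoI)
    fix e :: real assume e: "e > 0"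
    \<comment> \<open>The operator-norm estimate carries the factor norm of f; adding 1 covers f =
      0.\<close>
    define e' where "e' = e / (Lp_norm p \<Omega> f + 1)"
    have e': "e' > 0" "e' * Lp_norm p \<Omega> f < e"
    proof -
      have *: "Lp_norm p \<Omega> f + 1 > 0" using Lp_norm_nonneg[of p \<Omega> f] by linarith
      then show "e' > 0" using e by (simp add: e'_def)
      show "e' * Lp_norm p \<Omega> f < e" using e * by (simp add: e'_def pos_divide_less_eq)
    qed
    obtain d where d: "d > 0" "\<And>h f. norm h < d \<Longrightarrow> complex_of_real t + h \<in> sector \<theta> \<Longrightarrow> f \<in> Lp_sigma p \<Omega> \<Longrightarrow>
        Lp_norm p \<Omega> (\<lambda>x. S (complex_of_real t + h) f x - S (complex_of_real t) f x - h *s D f x)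
               \<le> e' * norm h * Lp_norm p \<Omega> f"
      using D(2) e'(1) by blast
    have "Lp_norm p \<Omega> (\<lambda>x. (1 / h) *\<^sub>R (T (t + h) f x - T t f x) - D f x) < e"
      if h: "h \<noteq> 0" "\<bar>h\<bar> < min d t" for h :: real
    proof -
      have th: "t + h > 0" using h by auto
      have "bounded_operator p \<Omega> (S (complex_of_real (t + h)))" "bounded_operator p \<Omega> (S (complex_of_real t))"
        using S(2,4) assms th unfolding bounded_analytic_semigroup_def by blast+
      then have SL: "S (complex_of_real (t + h)) f \<in> Lp p \<Omega>" "S (complex_of_real t) f \<in> Lp p \<Omega>"
        using assms Lp_sigma_Lp unfolding bounded_operator_def by blast+
      have TL: "T (t + h) f \<in> Lp p \<Omega>" "T t f \<in> Lp p \<Omega>" "D f \<in> Lp p \<Omega>"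
        using invariant assms th D(1) Lp_sigma_Lp by blast+
      have "ae_eq \<Omega> (\<lambda>x. (1/h) *\<^sub>R (T (t + h) f x - T t f x) - D f x)
          (\<lambda>x. (1/h) *\<^sub>R (S (complex_of_real (t + h)) f x - S (complex_of_real t) f x - complex_of_real h *s D f x))"
        using S(3)[OF th assms(2)] S(3)[OF assms] unfolding ae_eq_def
      proof eventually_elim
        case (elim x)
        then show ?case using h(1) by (simp add: vector_scale_of_real algebra_simps)
      qed
      then have "Lp_norm p \<Omega> (\<lambda>x. (1/h) *\<^sub>R (T (t + h) f x - T t f x) - D f x) =
         Lp_norm p \<Omega> (\<lambda>x. (1/h) *\<^sub>R (S (complex_of_real (t + h)) f x - S (complex_of_real t) f x - complex_of_real h *s D f x))"
        by (rule norm_cong) (intro Lp_diff Lp_scaleR Lp_vector_scale SL TL p_ge_1)+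
      also have "\<dots> = \<bar>1/h\<bar> * Lp_norm p \<Omega> (\<lambda>x. S (complex_of_real (t + h)) f x - S (complex_of_real t) f x - complex_of_real h *s D f x)"
        by (rule Lp_norm_scaleR[OF p_pos])
      also have "\<dots> \<le> \<bar>1/h\<bar> * (e' * norm (complex_of_real h) * Lp_norm p \<Omega> f)"
        using d(2)[of "complex_of_real h" f] h S(4)[OF th] assms by (intro mult_left_mono) auto
      also have "\<dots> = e' * Lp_norm p \<Omega> f" using h by simp
      finally show ?thesis using e' by simp
    qed
    then show "\<forall>\<^sub>F h in at 0. dist (Lp_norm p \<Omega> (\<lambda>x. (1 / h) *\<^sub>R (T (t + h) f x - T t f x) - D f x)) 0 < e"
      unfolding eventually_at using d(1) assms(1) by (intro exI[of _ "min d t"]) auto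
  qed
  then show ?thesis using D(1) assms by blast
qed

lemma T_continuous:
  assumes "t > 0" "f \<in> Lp_sigma p \<Omega>"
  shows "((\<lambda>s. Lp_norm p \<Omega> (\<lambda>x. T s f x - T t f x)) \<longlongrightarrow> 0) (at t)"
proof -
  obtain D where D: "D \<in> Lp_sigma p \<Omega>"
    "((\<lambda>h. Lp_norm p \<Omega> (\<lambda>x. (1 / h) *\<^sub>R (T (t + h) f x - T t f x) - D x)) \<longlongrightarrow> 0) (at 0)"
    using T_differentiable[OF assms] by blast
  have "((\<lambda>h. \<bar>h\<bar> * (Lp_norm p \<Omega> (\<lambda>x. (1 / h) *\<^sub>R (T (t + h) f x - T t f x) - D x) + Lp_norm p \<Omega> D)) \<longlongrightarrow> \<bar>0\<bar> * (0 + Lp_norm p \<Omega> D)) (at 0)"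
    by (intro tendsto_intros D)
  then have lim: "((\<lambda>h. \<bar>h\<bar> * (Lp_norm p \<Omega> (\<lambda>x. (1 / h) *\<^sub>R (T (t + h) f x - T t f x) - D x) + Lp_norm p \<Omega> D)) \<longlongrightarrow> 0) (at 0)"
    by simp
  have "\<forall>\<^sub>F h in at 0. norm (Lp_norm p \<Omega> (\<lambda>x. T (t + h) f x - T t f x)) \<le>
      \<bar>h\<bar> * (Lp_norm p \<Omega> (\<lambda>x. (1 / h) *\<^sub>R (T (t + h) f x - T t f x) - D x) + Lp_norm p \<Omega> D)"
    unfolding eventually_at
  proof (intro exI[of _ t] conjI ballI impI assms(1))
    fix h :: real assume h: "h \<noteq> 0 \<and> dist h 0 < t"
    then have "t + h > 0" by (auto simp: dist_real_def)
    then have L: "T (t + h) f \<in> Lp p \<Omega>" "T t f \<in> Lp p \<Omega>" "D \<in> Lp p \<Omega>"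
      using invariant assms D(1) Lp_sigma_Lp by blast+
    have "(\<lambda>x. T (t + h) f x - T t f x) = (\<lambda>x. h *\<^sub>R ((1 / h) *\<^sub>R (T (t + h) f x - T t f x)))"
      using h by auto
    then have "Lp_norm p \<Omega> (\<lambda>x. T (t + h) f x - T t f x) = \<bar>h\<bar> * Lp_norm p \<Omega> (\<lambda>x. (1 / h) *\<^sub>R (T (t + h) f x - T t f x))"
      using Lp_norm_scaleR[OF p_pos, of \<Omega> h "\<lambda>x. (1 / h) *\<^sub>R (T (t + h) f x - T t f x)"] by simp
    also have "\<dots> \<le> \<bar>h\<bar> * (Lp_norm p \<Omega> D + Lp_norm p \<Omega> (\<lambda>x. (1 / h) *\<^sub>R (T (t + h) f x - T t f x) - D x))"
      by (intro mult_left_mono Lp_norm_triangle_sub Lp_scaleR Lp_diff L p_ge_1) auto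
    finally show "norm (Lp_norm p \<Omega> (\<lambda>x. T (t + h) f x - T t f x)) \<le>
      \<bar>h\<bar> * (Lp_norm p \<Omega> (\<lambda>x. (1 / h) *\<^sub>R (T (t + h) f x - T t f x) - D x) + Lp_norm p \<Omega> D)"
      by (simp add: add.commute)
  qed
  from Lim_null_comparison[OF this lim] have "((\<lambda>h. Lp_norm p \<Omega> (\<lambda>x. T (t + h) f x - T t f x)) \<longlongrightarrow> 0) (at 0)" .
  then show ?thesis using LIM_offset_zero_iff[of t "\<lambda>s. Lp_norm p \<Omega> (\<lambda>x. T s f x - T t f x)" 0]
    by (simp add: LIM_offset_zero_cancel)
qed

lemma T_initial:
  assumes "f \<in> Lp_sigma p \<Omega>"
  shows "((\<lambda>t. Lp_norm p \<Omega> (\<lambda>x. T t f x - f x)) \<longlongrightarrow> 0) (at_right 0)"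
proof -
  obtain \<theta> S where S: "0 < \<theta>" "bounded_analytic_semigroup p \<Omega> \<theta> S"
    "\<And>t f. t > 0 \<Longrightarrow> f \<in> Lp_sigma p \<Omega> \<Longrightarrow> ae_eq \<Omega> (S (complex_of_real t) f) (T t f)"
    "\<And>t. t > 0 \<Longrightarrow> complex_of_real t \<in> sector \<theta>"
    using extension by blast
  \<comment> \<open>Strong continuity at 0 is given on proper subsectors only; the one of half the
    angle still contains the positive half-line.\<close>
  have "((\<lambda>z. Lp_norm p \<Omega> (\<lambda>x. S z f x - f x)) \<longlongrightarrow> 0) (at 0 within sector (\<theta>/2))"
    using S(1,2) assms unfolding bounded_analytic_semigroup_def by simp
  moreover have "filterlim complex_of_real (at 0 within sector (\<theta>/2)) (at_right 0)"
    unfolding filterlim_at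
    by (auto intro!: tendsto_eq_intros eventually_at_rightI[of 0 1] simp: sector_def Arg_of_real S(1))
  ultimately have "((\<lambda>t. Lp_norm p \<Omega> (\<lambda>x. S (complex_of_real t) f x - f x)) \<longlongrightarrow> 0) (at_right 0)"
    by (rule filterlim_compose)
  moreover have "\<forall>\<^sub>F t in at_right 0. Lp_norm p \<Omega> (\<lambda>x. S (complex_of_real t) f x - f x) = Lp_norm p \<Omega> (\<lambda>x. T t f x - f x)"
  proof (rule eventually_at_rightI[of 0 1])
    fix t :: real assume "t \<in> {0<..<1}"
    then have t: "t > 0" by simp
    have "bounded_operator p \<Omega> (S (complex_of_real t))"
      using S(2,4) t unfolding bounded_analytic_semigroup_def by blast
    then have L: "S (complex_of_real t) f \<in> Lp p \<Omega>" "T t f \<in> Lp p \<Omega>" "f \<in> Lp p \<Omega>"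
      using assms invariant[OF t] Lp_sigma_Lp unfolding bounded_operator_def by blast+
    have "ae_eq \<Omega> (\<lambda>x. S (complex_of_real t) f x - f x) (\<lambda>x. T t f x - f x)"
      using S(3)[OF t assms] by (auto simp: ae_eq_def elim: eventually_mono)
    then show "Lp_norm p \<Omega> (\<lambda>x. S (complex_of_real t) f x - f x) = Lp_norm p \<Omega> (\<lambda>x. T t f x - f x)"
      by (rule norm_cong) (intro Lp_diff L p_ge_1)+
  qed simp
  ultimately show ?thesis using tendsto_cong by fast
qed

end

section \<open>Symmetry of the Stokes semigroup\<close>

lemma (in Lp_semigroup) generator_T:
  assumes "t > 0" "f \<in> Lp_sigma p \<Omega>" "D \<in> Lp_sigma p \<Omega>"
    "((\<lambda>h. Lp_norm p \<Omega> (\<lambda>x. (1 / h) *\<^sub>R (T (t + h) f x - T t f x) - D x)) \<longlongrightarrow> 0) (at 0)"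
  shows "(T t f, \<lambda>x. - D x) \<in> A"
proof -
  have "((\<lambda>h. Lp_norm p \<Omega> (\<lambda>x. (1 / h) *\<^sub>R (T (t + h) f x - T t f x) - D x)) \<longlongrightarrow> 0) (at_right 0)"
    using assms(4) by (rule filterlim_mono) (auto simp: at_le)
  \<comment> \<open>By the semigroup law the right difference quotient of the orbit at time t is
    that of \<open>T t f\<close> at time 0, and the latter characterizes the generator.\<close>
  moreover have "\<forall>\<^sub>F h in at_right 0. Lp_norm p \<Omega> (\<lambda>x. (1 / h) *\<^sub>R (T (t + h) f x - T t f x) - D x) =
      Lp_norm p \<Omega> (\<lambda>x. (1 / h) *\<^sub>R (T h (T t f) x - T t f x) + - D x)"
  proof (rule eventually_at_rightI[of 0 1])
    fix h :: real assume "h \<in> {0<..<1}"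
    then have h: "h > 0" by simp
    have L: "T (t + h) f \<in> Lp p \<Omega>" "T h (T t f) \<in> Lp p \<Omega>" "T t f \<in> Lp p \<Omega>" "D \<in> Lp p \<Omega>"
      using invariant assms h Lp_sigma_Lp by (auto intro!: Lp_sigma_Lp invariant)
    have "ae_eq \<Omega> (\<lambda>x. (1 / h) *\<^sub>R (T (t + h) f x - T t f x) - D x) (\<lambda>x. (1 / h) *\<^sub>R (T h (T t f) x - T t f x) + - D x)"
      using T_semigroup[OF h assms(1,2)] by (auto simp: ae_eq_def add.commute elim: eventually_mono)
    then show "Lp_norm p \<Omega> (\<lambda>x. (1 / h) *\<^sub>R (T (t + h) f x - T t f x) - D x) =
      Lp_norm p \<Omega> (\<lambda>x. (1 / h) *\<^sub>R (T h (T t f) x - T t f x) + - D x)"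
      by (rule norm_cong) (intro Lp_diff Lp_add Lp_uminus Lp_scaleR L p_ge_1)+
  qed simp
  ultimately have "((\<lambda>h. Lp_norm p \<Omega> (\<lambda>x. (1 / h) *\<^sub>R (T h (T t f) x - T t f x) + - D x)) \<longlongrightarrow> 0) (at_right 0)"
    using tendsto_cong by fast
  then show ?thesis
    using generates invariant[OF assms(1,2)] uminus[OF assms(3)] unfolding neg_generates_bounded_analytic_def by blast
qed

text \<open>The function \<open>s \<mapsto> \<langle>T(s)u, T(t-s)v\<rangle>\<close> has zero derivative because the generator is symmetric.\<close>

lemma stokes_semigroup_symmetric:
  assumes "Lp_semigroup 2 \<Omega> T (stokes 2 \<Omega>)" "t > 0" "u \<in> Lp_sigma 2 \<Omega>" "v \<in> Lp_sigma 2 \<Omega>"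
  shows "pairing \<Omega> (T t u) v = pairing \<Omega> u (T t v)"
proof -
  interpret Lp_semigroup 2 \<Omega> T "stokes 2 \<Omega>" by fact
  interpret conjugate_exponents 2 2 by (rule conjugate_two)
  define f where "f s = pairing \<Omega> (T s u) (T (t - s) v)" for s
  have TL: "T s w \<in> Lp 2 \<Omega>" if "s > 0" "w \<in> Lp_sigma 2 \<Omega>" for s w
    using invariant that Lp_sigma_Lp by blast
  have deriv: "(f has_real_derivative 0) (at s)" if s: "0 < s" "s < t" for s
  proof -
    have ts: "t - s > 0" using s by simp
    obtain D where D: "D \<in> Lp_sigma 2 \<Omega>"
      "((\<lambda>h. Lp_norm 2 \<Omega> (\<lambda>x. (1 / h) *\<^sub>R (T (s + h) u x - T s u x) - D x)) \<longlongrightarrow> 0) (at 0)"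
      using T_differentiable[OF s(1) assms(3)] by blast
    obtain E where E: "E \<in> Lp_sigma 2 \<Omega>"
      "((\<lambda>h. Lp_norm 2 \<Omega> (\<lambda>x. (1 / h) *\<^sub>R (T (t - s + h) v x - T (t - s) v x) - E x)) \<longlongrightarrow> 0) (at 0)"
      using T_differentiable[OF ts assms(4)] by blast
    have "pairing \<Omega> (\<lambda>x. - D x) (T (t - s) v) = pairing \<Omega> (T s u) (\<lambda>x. - E x)"
      by (rule stokes_symmetric[OF generator_T[OF s(1) assms(3) D] generator_T[OF ts assms(4) E]])
    then have DE: "pairing \<Omega> D (T (t - s) v) = pairing \<Omega> (T s u) E" by simp
    have neg: "filterlim (\<lambda>h::real. - h) (at 0) (at 0)"
      by (auto simp: filterlim_at eventually_at_filter intro!: tendsto_eq_intros)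
    have E': "((\<lambda>h. Lp_norm 2 \<Omega> (\<lambda>x. (- (1 / h)) *\<^sub>R (T (t - (s + h)) v x - T (t - s) v x) - E x)) \<longlongrightarrow> 0) (at 0)"
      using filterlim_compose[OF E(2) neg] by (simp add: algebra_simps)
    have cont: "((\<lambda>h. Lp_norm 2 \<Omega> (\<lambda>x. T (t - (s + h)) v x - T (t - s) v x)) \<longlongrightarrow> 0) (at 0)"
    proof -
      have "filterlim (\<lambda>h::real. t - (s + h)) (at (t - s)) (at 0)"
        by (auto simp: filterlim_at eventually_at_filter intro!: tendsto_eq_intros)
      from filterlim_compose[OF T_continuous[OF ts assms(4)] this] show ?thesis .
    qed
    have small: "\<forall>\<^sub>F h in at 0. s + h > 0 \<and> t - (s + h) > 0"
      unfolding eventually_at using s by (intro exI[of _ "min s (t - s)"]) (auto simp: dist_real_def)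
    have A: "((\<lambda>h. pairing \<Omega> (\<lambda>x. (1 / h) *\<^sub>R (T (s + h) u x - T s u x)) (T (t - (s + h)) v)) \<longlongrightarrow> pairing \<Omega> D (T (t - s) v)) (at 0)"
    proof (rule tendsto_pairing[OF _ _ _ _ D(2) cont])
      show "\<forall>\<^sub>F h in at 0. (\<lambda>x. (1 / h) *\<^sub>R (T (s + h) u x - T s u x)) \<in> Lp 2 \<Omega>"
        using small by eventually_elim (intro Lp_scaleR Lp_diff TL, use s assms in auto)
      show "\<forall>\<^sub>F h in at 0. T (t - (s + h)) v \<in> Lp 2 \<Omega>"
        using small by eventually_elim (intro TL, use assms in auto)
    qed (use TL ts assms D Lp_sigma_Lp in auto)
    have B: "((\<lambda>h. pairing \<Omega> (T s u) (\<lambda>x. (- (1 / h)) *\<^sub>R (T (t - (s + h)) v x - T (t - s) v x))) \<longlongrightarrow> pairing \<Omega> (T s u) E) (at 0)"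
    proof (rule tendsto_pairing[OF _ _ _ _ _ E'])
      show "\<forall>\<^sub>F h in at 0. (\<lambda>x. (- (1 / h)) *\<^sub>R (T (t - (s + h)) v x - T (t - s) v x)) \<in> Lp 2 \<Omega>"
        using small by eventually_elim (intro Lp_scaleR Lp_diff TL, use s assms in auto)
    qed (use TL s assms E Lp_sigma_Lp in auto)
    \<comment> \<open>Product rule: one difference quotient for the first factor, with the second
      already moved to time t - s - h, and one for the second factor, with a minus sign from the
      reversed time.\<close>
    have "((\<lambda>h. pairing \<Omega> (\<lambda>x. (1 / h) *\<^sub>R (T (s + h) u x - T s u x)) (T (t - (s + h)) v) -
       pairing \<Omega> (T s u) (\<lambda>x. (- (1 / h)) *\<^sub>R (T (t - (s + h)) v x - T (t - s) v x))) \<longlongrightarrow> 0) (at 0)"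
      using tendsto_diff[OF A B] DE by simp
    moreover have "\<forall>\<^sub>F h in at 0. pairing \<Omega> (\<lambda>x. (1 / h) *\<^sub>R (T (s + h) u x - T s u x)) (T (t - (s + h)) v) -
       pairing \<Omega> (T s u) (\<lambda>x. (- (1 / h)) *\<^sub>R (T (t - (s + h)) v x - T (t - s) v x)) = (f (s + h) - f s) / h"
      using small
    proof eventually_elim
      case (elim h)
      have L: "T (s + h) u \<in> Lp 2 \<Omega>" "T s u \<in> Lp 2 \<Omega>" "T (t - (s + h)) v \<in> Lp 2 \<Omega>" "T (t - s) v \<in> Lp 2 \<Omega>"
        using elim by (auto intro!: TL s ts assms)
      show ?case unfolding pairing_scaleR f_def
        by (subst pairing_diff_left[OF L(1,2,3)], subst pairing_diff_right[OF L(2,3,4)]) (simp add: add_divide_distrib diff_divide_distrib)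
    qed
    ultimately have "((\<lambda>h. (f (s + h) - f s) / h) \<longlongrightarrow> 0) (at 0)"
      using tendsto_cong by fast
    then show ?thesis by (simp add: DERIV_def)
  qed
  have "\<exists>c. \<forall>s\<in>{0<..<t}. f s = c"
    by (rule has_field_derivative_zero_constant) (auto intro: has_field_derivative_at_within deriv)
  then obtain c where c: "\<And>s. 0 < s \<Longrightarrow> s < t \<Longrightarrow> f s = c" by auto
  \<comment> \<open>T is used at positive times only, so the two pairings of the claim are reached
    as limits of the constant value of f at the ends s = 0 and s = t.\<close>
  have fc: "(f \<longlongrightarrow> c) (at_right 0)"
    by (rule Lim_transform_eventually[OF tendsto_const]) (auto intro!: eventually_at_rightI[of 0 t] simp: c assms)
  have fc': "((\<lambda>s. f (t - s)) \<longlongrightarrow> c) (at_right 0)"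
    by (rule Lim_transform_eventually[OF tendsto_const]) (auto intro!: eventually_at_rightI[of 0 t] simp: c assms)
  have lim: "filterlim (\<lambda>s. t - s) (at t) (at_right 0)"
    by (auto simp: filterlim_at eventually_at_filter intro!: tendsto_eq_intros)
  have ev: "\<forall>\<^sub>F s in at_right 0. s > 0 \<and> t - s > 0"
    using assms(2) by (intro eventually_at_rightI[of 0 t]) auto
  have "(f \<longlongrightarrow> pairing \<Omega> u (T t v)) (at_right 0)"
    unfolding f_def
    by (rule tendsto_pairing[OF _ _ _ _ T_initial[OF assms(3)] filterlim_compose[OF T_continuous[OF assms(2,4)] lim]])
       (use ev in \<open>auto intro!: TL Lp_sigma_Lp[OF assms(3)] Lp_sigma_Lp[OF assms(4)] assms elim!: eventually_mono\<close>)
  moreover have "((\<lambda>s. f (t - s)) \<longlongrightarrow> pairing \<Omega> (T t u) v) (at_right 0)"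
    unfolding f_def diff_diff_eq2 diff_self
    by (rule tendsto_pairing[OF _ _ _ _ filterlim_compose[OF T_continuous[OF assms(2,3)] lim]])
       (use ev in \<open>auto intro!: TL Lp_sigma_Lp[OF assms(3)] Lp_sigma_Lp[OF assms(4)] T_initial assms elim!: eventually_mono\<close>)
  ultimately show ?thesis using fc fc' tendsto_unique[OF trivial_limit_at_right_real] by metis
qed

section \<open>Riesz representation in the solenoidal Hilbert space\<close>

lemma pairing_self: "pairing \<Omega> u u = (Lp_norm 2 \<Omega> u)\<^sup>2"
  using Lp_norm_powr[of 2 \<Omega> u] by (simp add: pairing_def dot_square_norm)

text \<open>The difference of u and v is itself an admissible test element. Identities for
  \<open>proj_div\<close> are proved through this, because its definition contains choices.\<close>

lemma (in solenoidal_Lp) uniqueness_L2: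
  assumes "p = 2" "u \<in> Lp_sigma p \<Omega>" "v \<in> Lp_sigma p \<Omega>"
    "\<And>\<phi>. \<phi> \<in> Lp_sigma p \<Omega> \<Longrightarrow> pairing \<Omega> u \<phi> = pairing \<Omega> v \<phi>"
  shows "ae_eq \<Omega> u v"
proof -
  interpret conjugate_exponents 2 2 by (rule conjugate_two)
  have L: "u \<in> Lp 2 \<Omega>" "v \<in> Lp 2 \<Omega>" using assms Lp_sigma_Lp by auto
  then have d: "(\<lambda>x. u x - v x) \<in> Lp 2 \<Omega>" by (intro Lp_diff) auto
  have "pairing \<Omega> (\<lambda>x. u x - v x) (\<lambda>x. u x - v x) = 0"
    using assms(4)[OF diff[OF assms(2,3)]] pairing_diff_left[OF L d] by simp
  then have "Lp_norm 2 \<Omega> (\<lambda>x. u x - v x) = 0" by (simp add: pairing_self)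
  then show ?thesis using norm_diff_eq_0[of u v] L assms(1) by simp
qed

lemma zero_solenoidal_test: "(\<lambda>_. 0) \<in> solenoidal_tests \<Omega>"
proof -
  have d: "partial_deriv i (\<lambda>_::real^'a. 0::complex^'a) = (\<lambda>_. 0)" for i
    by (rule ext) (simp add: partial_deriv_eq[OF has_derivative_const])
  have "foldr partial_deriv is (\<lambda>_::real^'a. 0::complex^'a) = (\<lambda>_. 0)" for "is"
    by (induction "is") (simp_all add: d)
  then have "smooth (\<lambda>_::real^'a. 0::complex^'a)" by (simp add: smooth_def)
  then have "(\<lambda>_. 0::complex^'a) \<in> test_functions \<Omega>" by (rule test_functionsI[of _ "{}"]) auto
  then show ?thesis by (simp add: solenoidal_tests_def divergence_def partial_deriv_eq[OF has_derivative_const])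
qed

text \<open>The representing element minimizes \<open>\<parallel>u\<parallel>\<^sup>2 / 2 - lf(u)\<close>.\<close>

lemma Riesz_L2_sigma:
  fixes \<Omega> :: "(real^'n::finite) set"
  assumes \<Omega>: "\<Omega> \<in> sets lebesgue"
    and add: "\<And>u v. u \<in> Lp_sigma 2 \<Omega> \<Longrightarrow> v \<in> Lp_sigma 2 \<Omega> \<Longrightarrow> lf (\<lambda>x. u x + v x) = lf u + lf v"
    and scale: "\<And>c u. u \<in> Lp_sigma 2 \<Omega> \<Longrightarrow> lf (\<lambda>x. c *\<^sub>R u x) = c * lf u"
    and bound: "\<And>u. u \<in> Lp_sigma 2 \<Omega> \<Longrightarrow> \<bar>lf u\<bar> \<le> C * Lp_norm 2 \<Omega> u"
    and "C \<ge> 0"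
  shows "\<exists>g \<in> Lp_sigma 2 \<Omega>. (\<forall>\<phi> \<in> Lp_sigma 2 \<Omega>. pairing \<Omega> g \<phi> = lf \<phi>) \<and> Lp_norm 2 \<Omega> g \<le> C"
proof -
  interpret conjugate_exponents 2 2 by (rule conjugate_two)
  interpret s: solenoidal_Lp 2 \<Omega> by unfold_locales (use \<Omega> in auto)
  define n :: "'n field \<Rightarrow> real" where "n = Lp_norm 2 \<Omega>"
  define J where "J u = (n u)\<^sup>2 / 2 - lf u" for u
  have L: "u \<in> Lp 2 \<Omega>" if "u \<in> Lp_sigma 2 \<Omega>" for u using that by (rule Lp_sigma_Lp)
  have expand: "(n (\<lambda>x. u x + c *\<^sub>R v x))\<^sup>2 = (n u)\<^sup>2 + 2 * c * pairing \<Omega> u v + c\<^sup>2 * (n v)\<^sup>2"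
    if "u \<in> Lp_sigma 2 \<Omega>" "v \<in> Lp_sigma 2 \<Omega>" for u v c
  proof -
    have cv: "(\<lambda>x. c *\<^sub>R v x) \<in> Lp 2 \<Omega>" using L that by (intro Lp_scaleR) auto
    have uv: "(\<lambda>x. u x + c *\<^sub>R v x) \<in> Lp 2 \<Omega>" using L that cv by (intro Lp_add) auto
    show ?thesis
      unfolding n_def pairing_self[symmetric]
      using pairing_add_left[OF L[OF that(1)] cv uv] pairing_add_right[OF L[OF that(1)] L[OF that(1)] cv]
        pairing_add_right[OF L[OF that(2)] L[OF that(1)] cv] pairing_commute[of \<Omega> u v]
      by (simp add: power2_eq_square algebra_simps)
  qed
  have lin: "lf (\<lambda>x. u x + c *\<^sub>R v x) = lf u + c * lf v"
    if "u \<in> Lp_sigma 2 \<Omega>" "v \<in> Lp_sigma 2 \<Omega>" for u v c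
    using add[OF that(1) s.scaleR[OF that(2)]] scale[OF that(2)] by simp
  \<comment> \<open>Completing the square: n^2/2 - C n is at least - C^2/2.\<close>
  have J_below: "J u \<ge> - (C\<^sup>2 / 2)" if "u \<in> Lp_sigma 2 \<Omega>" for u
  proof -
    have "lf u \<le> C * n u" using bound[OF that] by (simp add: n_def)
    moreover have "0 \<le> (n u - C)\<^sup>2" by simp
    ultimately show ?thesis unfolding J_def power2_diff by (simp add: field_simps)
  qed
  define m where "m = (INF u\<in>Lp_sigma 2 \<Omega>. J u)"
  have zero: "(\<lambda>_. 0) \<in> Lp_sigma 2 \<Omega>"
    by (rule s.tests_Lp_sigma[OF zero_solenoidal_test])
  have bdd: "bdd_below (J ` Lp_sigma 2 \<Omega>)" using J_below by (auto simp: bdd_below_def)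
  have m_le: "m \<le> J u" if "u \<in> Lp_sigma 2 \<Omega>" for u unfolding m_def using bdd that by (rule cINF_lower)
  have "\<exists>u \<in> Lp_sigma 2 \<Omega>. J u < m + inverse (real (Suc k))" for k
    using cInf_lessD[of "J ` Lp_sigma 2 \<Omega>" "m + inverse (real (Suc k))"] zero unfolding m_def by auto
  then obtain u where u: "\<And>k. u k \<in> Lp_sigma 2 \<Omega>" "\<And>k. J (u k) < m + inverse (real (Suc k))" by metis
  define a where "a k = inverse (real (Suc k))" for k
  \<comment> \<open>Parallelogram identity: the midpoint of two almost minimizers still has value at
    least m, which forces them to be close.\<close>
  have dist: "(n (\<lambda>x. u j x - u k x))\<^sup>2 \<le> 4 * (a j + a k)" for j k
  proof -
    have c: "(\<lambda>x. (1/2) *\<^sub>R u j x + (1/2) *\<^sub>R u k x) \<in> Lp_sigma 2 \<Omega>" by (intro s.add s.scaleR u)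
    have h: "(n (\<lambda>x. (1/2) *\<^sub>R u j x))\<^sup>2 = (n (u j))\<^sup>2 / 4"
    proof -
      have e: "n (\<lambda>x. (1/2) *\<^sub>R u j x) = n (u j) / 2"
        using Lp_norm_scaleR[of 2 \<Omega> "1/2" "u j"] by (simp add: n_def)
      show ?thesis unfolding e by (simp add: power_divide)
    qed
    have "m \<le> J (\<lambda>x. (1/2) *\<^sub>R u j x + (1/2) *\<^sub>R u k x)" by (rule m_le[OF c])
    also have "\<dots> = ((n (u j))\<^sup>2 / 4 + pairing \<Omega> (u j) (u k) / 2 + (n (u k))\<^sup>2 / 4) / 2 - (lf (u j) + lf (u k)) / 2"
      unfolding J_def expand[OF s.scaleR[OF u(1)] u(1)] lin[OF s.scaleR[OF u(1)] u(1)] scale[OF u(1)] h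
      by (simp add: power2_eq_square add_divide_distrib)
    finally have d1: "(n (u j))\<^sup>2 - 2 * pairing \<Omega> (u j) (u k) + (n (u k))\<^sup>2 \<le> 4 * (J (u j) + J (u k) - 2 * m)"
      unfolding J_def by (simp add: field_simps)
    have d2: "(n (\<lambda>x. u j x - u k x))\<^sup>2 = (n (u j))\<^sup>2 - 2 * pairing \<Omega> (u j) (u k) + (n (u k))\<^sup>2"
      using expand[OF u(1) u(1), of j "-1" k] by simp
    have d3: "4 * (J (u j) + J (u k) - 2 * m) \<le> 4 * (inverse (real (Suc j)) + inverse (real (Suc k)))"
    proof (rule mult_left_mono)
      show "J (u j) + J (u k) - 2 * m \<le> inverse (real (Suc j)) + inverse (real (Suc k))"
        using add_mono[OF less_imp_le[OF u(2)[of j]] less_imp_le[OF u(2)[of k]]] by (simp add: algebra_simps)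
    qed simp
    show ?thesis unfolding d2 a_def by (rule order_trans[OF d1 d3])
  qed
  have Cauchy: "\<exists>K. \<forall>j\<ge>K. \<forall>k\<ge>K. Lp_norm 2 \<Omega> (\<lambda>x. u j x - u k x) < e" if "e > 0" for e
  proof -
    have "e\<^sup>2 / 8 > 0" using that by simp
    then obtain K where K: "a K < e\<^sup>2 / 8" using reals_Archimedean unfolding a_def by blast
    have "n (\<lambda>x. u j x - u k x) < e" if "j \<ge> K" "k \<ge> K" for j k
    proof -
      have "a j \<le> a K" "a k \<le> a K"
        using that unfolding a_def by (auto intro!: le_imp_inverse_le)
      then have "4 * (a j + a k) \<le> 4 * (a K + a K)" by (intro mult_left_mono add_mono) auto
      also have "\<dots> < e\<^sup>2" using K by simp
      finally have "(n (\<lambda>x. u j x - u k x))\<^sup>2 < e\<^sup>2" by (rule order_le_less_trans[OF dist])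
      then show ?thesis by (rule power2_less_imp_less) (use \<open>e > 0\<close> in simp)
    qed
    then show ?thesis unfolding n_def by blast
  qed
  from s.complete[OF u(1) Cauchy]
  obtain g where g: "g \<in> Lp_sigma 2 \<Omega>" "(\<lambda>k. n (\<lambda>x. u k x - g x)) \<longlonglongrightarrow> 0"
    unfolding n_def by blast
  have gm: "J g \<le> m"
  proof -
    have n2: "(\<lambda>k. (n (u k))\<^sup>2) \<longlonglongrightarrow> (n g)\<^sup>2"
      unfolding n_def pairing_self[symmetric]
      by (intro tendsto_pairing L g u always_eventually allI) (use g(2) in \<open>simp_all add: n_def\<close>)
    have lfg: "(\<lambda>k. lf (u k)) \<longlonglongrightarrow> lf g"
    proof (rule LIM_zero_cancel, rule Lim_null_comparison)
      have "lf (u k) - lf g = lf (\<lambda>x. u k x - g x)" for k using lin[OF u(1) g(1), of k "-1"] by simp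
      then show "\<forall>\<^sub>F k in sequentially. norm (lf (u k) - lf g) \<le> C * n (\<lambda>x. u k x - g x)"
        using bound[OF s.diff[OF u(1) g(1)]] by (simp add: n_def)
      show "(\<lambda>k. C * n (\<lambda>x. u k x - g x)) \<longlonglongrightarrow> 0" using tendsto_mult_right_zero[OF g(2)] by simp
    qed
    have "(\<lambda>k. J (u k)) \<longlonglongrightarrow> J g" unfolding J_def
      by (rule tendsto_diff[OF tendsto_divide[OF n2 tendsto_const] lfg]) simp
    moreover have "(\<lambda>k. m + inverse (real (Suc k))) \<longlonglongrightarrow> m + 0" by (intro tendsto_intros LIMSEQ_inverse_real_of_nat)
    ultimately show ?thesis using u(2) by (intro LIMSEQ_le[of "\<lambda>k. J (u k)" _ "\<lambda>k. m + inverse (real (Suc k))"]) (auto intro: less_imp_le)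
  qed
  have eq: "pairing \<Omega> g \<phi> = lf \<phi>" if \<phi>: "\<phi> \<in> Lp_sigma 2 \<Omega>" for \<phi>
  proof -
    define d where "d = pairing \<Omega> g \<phi> - lf \<phi>"
    \<comment> \<open>First variation: g minimizes J along the line through g in direction
      \<phi>.\<close>
    have q: "0 \<le> c * d + c\<^sup>2 * (n \<phi>)\<^sup>2 / 2" for c
    proof -
      have "J g \<le> J (\<lambda>x. g x + c *\<^sub>R \<phi> x)" using gm m_le[OF s.add[OF g(1) s.scaleR[OF \<phi>]]] order_trans by blast
      then show ?thesis unfolding J_def expand[OF g(1) \<phi>] lin[OF g(1) \<phi>] d_def by (simp add: field_simps)
    qed
    \<comment> \<open>At c = - d/N the quadratic bound is at most - d^2/(2 N), so d = 0. The 1 keeps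
      N positive when \<phi> has norm 0.\<close>
    define N where "N = (n \<phi>)\<^sup>2 + 1"
    have N: "N > 0" "(n \<phi>)\<^sup>2 \<le> N" by (auto simp: N_def add_nonneg_pos)
    have "0 \<le> (- d / N) * d + (- d / N)\<^sup>2 * (n \<phi>)\<^sup>2 / 2" by (rule q)
    also have "\<dots> \<le> (- d / N) * d + (- d / N)\<^sup>2 * N / 2" using N by (intro add_left_mono divide_right_mono mult_left_mono) auto
    also have "\<dots> = - (d\<^sup>2 / (2 * N))" using N(1) by (simp add: field_simps power2_eq_square)
    finally have "d\<^sup>2 \<le> 0" using N(1) by (simp add: divide_le_0_iff)
    then show ?thesis by (simp add: d_def)
  qed
  \<comment> \<open>Testing the representation with g itself bounds the norm of g by C.\<close>
  have "(n g)\<^sup>2 \<le> C * n g" using eq[OF g(1)] bound[OF g(1)] by (simp add: n_def pairing_self)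
  then have "n g \<le> C"
    using Lp_norm_nonneg[of 2 \<Omega> g] \<open>C \<ge> 0\<close> mult_right_le_imp_le[of "n g" "n g" C]
    by (cases "n g = 0") (auto simp: power2_eq_square n_def order_less_le)
  then show ?thesis using eq g(1) by (auto simp: n_def)
qed


section \<open>The operator \<open>T(\<tau>) \<P> div\<close>\<close>

text \<open>The maximum with 0 makes multiplication by the constant monotone without inspecting the
  estimate it comes from.\<close>

definition const_of :: "constants \<Rightarrow> real \<Rightarrow> real \<Rightarrow> real" where
  "const_of K p q = max 0 (the (K (p, q)))"

lemma const_of_nonneg [simp]: "0 \<le> const_of K p q"
  by (simp add: const_of_def)

locale stokes_estimates =
  fixes \<Omega> :: "(real^3) set" and \<epsilon> :: real and T :: "real \<Rightarrow> 3 field \<Rightarrow> 3 field" and K1 K2 :: constants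
  assumes open_\<Omega>: "open \<Omega>" and \<epsilon>: "\<epsilon> > 0"
    and generator: "\<And>p. admissible_exponent \<epsilon> p \<Longrightarrow> neg_generates_bounded_analytic p \<Omega> (stokes p \<Omega>) T"
    and E1: "estimate_E1 \<epsilon> \<Omega> T K1" and E2: "estimate_E2 \<epsilon> \<Omega> T K2"
begin

lemma \<Omega>_sets: "\<Omega> \<in> sets lebesgue"
  using open_\<Omega> by auto

lemma admissible_gt_1: "admissible_exponent \<epsilon> p \<Longrightarrow> p > 1"
  by (simp add: admissible_exponent_def)

lemma admissible_2: "admissible_exponent \<epsilon> 2"
  using \<epsilon> by (simp add: admissible_exponent_def)

text \<open>For these p the distance of 1/p from 1/2 is at most 1/6, with equality at p = 3; the
  slack is \<epsilon>.\<close>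

lemma admissible_between_2_and_3:
  assumes "2 \<le> p" "p \<le> 3"
  shows "admissible_exponent \<epsilon> p"
proof -
  have "1/3 \<le> 1/p" "1/p \<le> 1/2" using assms by (simp_all add: field_simps)
  then have "\<bar>1/p - 1/2\<bar> \<le> 1/6" by linarith
  then show ?thesis using \<epsilon> assms unfolding admissible_exponent_def by linarith
qed

lemma T_bound:
  assumes "admissible_exponent \<epsilon> p" "admissible_exponent \<epsilon> q" "p \<le> q" "t > 0" "f \<in> Lp_sigma p \<Omega>"
  shows "T t f \<in> Lp_sigma q \<Omega>"
    and "Lp_norm q \<Omega> (T t f) \<le> const_of K1 p q * t powr (- (3/2) * (1/p - 1/q)) * Lp_norm p \<Omega> f"
proof -
  have "(p, q) \<in> dom K1" using E1 assms unfolding estimate_E1_def by blast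
  then have *: "T t f \<in> Lp_sigma q \<Omega> \<and> Lp_norm q \<Omega> (T t f)
          \<le> the (K1 (p, q)) * t powr (- (3/2) * (1/p - 1/q)) * Lp_norm p \<Omega> f"
    using E1 assms unfolding estimate_E1_def by blast
  then show "T t f \<in> Lp_sigma q \<Omega>" by blast
  have "the (K1 (p, q)) * t powr (- (3/2) * (1/p - 1/q)) * Lp_norm p \<Omega> f
     \<le> const_of K1 p q * t powr (- (3/2) * (1/p - 1/q)) * Lp_norm p \<Omega> f"
    by (intro mult_right_mono) (auto simp: const_of_def)
  with * show "Lp_norm q \<Omega> (T t f) \<le> const_of K1 p q * t powr (- (3/2) * (1/p - 1/q)) * Lp_norm p \<Omega> f"
    by linarith
qed

lemma semigroup:
  assumes "admissible_exponent \<epsilon> p"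
  shows "Lp_semigroup p \<Omega> T (stokes p \<Omega>)"
  by unfold_locales (use \<Omega>_sets admissible_gt_1[OF assms] T_bound(1)[OF assms assms] generator[OF assms] in auto)

lemma solenoidal: "p > 1 \<Longrightarrow> solenoidal_Lp p \<Omega>"
  by unfold_locales (use \<Omega>_sets in auto)

lemma T_measurable:
  "t > 0 \<Longrightarrow> f \<in> Lp_sigma 2 \<Omega> \<Longrightarrow> T t f \<in> borel_measurable (lebesgue_on \<Omega>)"
  using T_bound(1)[OF admissible_2 admissible_2] Lp_sigma_measurable by blast

text \<open>\<open>weak_gradient\<close> chooses among all weak gradients, whereas this choice also
  carries membership in L^q and the bound of (E2) from L^2.\<close>

definition grad :: "real \<Rightarrow> real \<Rightarrow> 3 field \<Rightarrow> real^3 \<Rightarrow> complex^3^3" where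
  "grad q t f = (SOME G. G \<in> Lp q \<Omega> \<and> has_weak_gradient \<Omega> (T t f) G \<and>
     Lp_norm q \<Omega> G \<le> const_of K2 2 q * t powr (- (1/2) - (3/2) * (1/2 - 1/q)) * Lp_norm 2 \<Omega> f)"

lemma grad:
  assumes "2 \<le> q" "q < 3" "t > 0" "f \<in> Lp_sigma 2 \<Omega>"
  shows "grad q t f \<in> Lp q \<Omega>" "has_weak_gradient \<Omega> (T t f) (grad q t f)"
    "Lp_norm q \<Omega> (grad q t f) \<le> const_of K2 2 q * t powr (- (1/2) - (3/2) * (1/2 - 1/q)) * Lp_norm 2 \<Omega> f"
proof -
  have "admissible_exponent \<epsilon> q" using admissible_between_2_and_3 assms by simp
  then have d: "(2, q) \<in> dom K2" using E2 assms admissible_2 unfolding estimate_E2_def by auto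
  have "\<forall>(p, q) \<in> dom K2. \<forall>t>0. \<forall>f \<in> Lp_sigma p \<Omega>.
        \<exists>G \<in> Lp q \<Omega>. has_weak_gradient \<Omega> (T t f) G \<and>
        Lp_norm q \<Omega> G
          \<le> the (K2 (p, q)) * t powr (- (1/2) - (3/2) * (1/p - 1/q)) * Lp_norm p \<Omega> f"
    using E2 unfolding estimate_E2_def by blast
  from bspec[OF this d] assms(3,4) obtain G where G: "G \<in> Lp q \<Omega>" "has_weak_gradient \<Omega> (T t f) G"
      "Lp_norm q \<Omega> G \<le> the (K2 (2, q)) * t powr (- (1/2) - (3/2) * (1/2 - 1/q)) * Lp_norm 2 \<Omega> f"
    by blast
  have "the (K2 (2, q)) * t powr (- (1/2) - (3/2) * (1/2 - 1/q)) * Lp_norm 2 \<Omega> f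
     \<le> const_of K2 2 q * t powr (- (1/2) - (3/2) * (1/2 - 1/q)) * Lp_norm 2 \<Omega> f"
    by (intro mult_right_mono) (auto simp: const_of_def)
  with G have "\<exists>G. G \<in> Lp q \<Omega> \<and> has_weak_gradient \<Omega> (T t f) G \<and>
     Lp_norm q \<Omega> G \<le> const_of K2 2 q * t powr (- (1/2) - (3/2) * (1/2 - 1/q)) * Lp_norm 2 \<Omega> f"
    by (meson order_trans)
  from someI_ex[OF this] show "grad q t f \<in> Lp q \<Omega>" "has_weak_gradient \<Omega> (T t f) (grad q t f)"
    "Lp_norm q \<Omega> (grad q t f) \<le> const_of K2 2 q * t powr (- (1/2) - (3/2) * (1/2 - 1/q)) * Lp_norm 2 \<Omega> f"
    unfolding grad_def by blast+
qed

end

text \<open>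
  For \<open>F \<in> L\<^sup>m\<close> with \<open>3/2 < m < 2\<close> the functional \<open>\<phi> \<mapsto> - \<langle>F, \<nabla> T(\<tau>) \<phi>\<rangle>\<close> is bounded on \<open>L\<^sup>2\<^sub>\<sigma>\<close>, hence
  represented by some \<open>half_step \<tau> F \<in> L\<^sup>2\<^sub>\<sigma>\<close>; a further step of the semigroup then lands in every
  \<open>L\<^sup>p\<^sub>\<sigma>\<close> with \<open>p \<ge> 2\<close>.  In this way no Helmholtz projection on \<open>L\<^sup>p\<close> is needed.
\<close>

locale stokes_proj_div = stokes_estimates +
  fixes m :: real
  assumes m_gt: "3/2 < m" and m_lt: "m < 2"
begin

definition m' :: real where "m' = m / (m - 1)"

text \<open>3/2 < m is exactly what puts the dual exponent below 3, the limit of (E2), and m < 2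
  puts it above the starting exponent 2.\<close>

lemma m'_bounds: "2 \<le> m'" "m' < 3"
  using m_gt m_lt by (simp_all add: m'_def field_simps)

lemma conj_m: "1/m + 1/m' = 1"
  using m_gt by (simp add: m'_def field_simps)

sublocale conjugate_exponents m m'
  by unfold_locales (use m_gt m'_bounds conj_m in auto)

lemmas grad_m = grad[OF m'_bounds]

lemma grad_eqI:
  assumes "\<tau> > 0" "f \<in> Lp_sigma 2 \<Omega>" "has_weak_gradient \<Omega> v H" "ae_eq \<Omega> (T \<tau> f) v"
    "v \<in> borel_measurable (lebesgue_on \<Omega>)"
  shows "ae_eq \<Omega> (grad m' \<tau> f) H"
  by (rule has_weak_gradient_unique[OF open_\<Omega> grad_m(2)[OF assms(1,2)] assms(3,4) T_measurable[OF assms(1,2)] assms(5)])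

definition functional :: "real \<Rightarrow> (real^3 \<Rightarrow> complex^3^3) \<Rightarrow> 3 field \<Rightarrow> real" where
  "functional \<tau> F \<phi> = - pairing \<Omega> F (grad m' \<tau> \<phi>)"

text \<open>Any suitable gradient of any function almost everywhere equal to T(\<tau>) f may replace
  the chosen one. Linearity and the semigroup law of the functional all rest on this.\<close>

lemma functional_eqI:
  assumes "\<tau> > 0" "f \<in> Lp_sigma 2 \<Omega>" "has_weak_gradient \<Omega> v H" "ae_eq \<Omega> (T \<tau> f) v"
    "v \<in> borel_measurable (lebesgue_on \<Omega>)" "F \<in> Lp m \<Omega>" "H \<in> Lp m' \<Omega>"
  shows "functional \<tau> F f = - pairing \<Omega> F H"
  unfolding functional_def
  using pairing_cong[OF ae_eq_refl grad_eqI[OF assms(1-5)]] assms(6,7) Lp_measurable grad_m(1)[OF assms(1,2)]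
  by (metis (no_types, lifting))

lemma functional_add:
  assumes "\<tau> > 0" "F \<in> Lp m \<Omega>" "f \<in> Lp_sigma 2 \<Omega>" "g \<in> Lp_sigma 2 \<Omega>"
  shows "functional \<tau> F (\<lambda>x. f x + g x) = functional \<tau> F f + functional \<tau> F g"
proof -
  interpret s: Lp_semigroup 2 \<Omega> T "stokes 2 \<Omega>" by (rule semigroup[OF admissible_2])
  have "functional \<tau> F (\<lambda>x. f x + g x) = - pairing \<Omega> F (\<lambda>x. grad m' \<tau> f x + grad m' \<tau> g x)"
    by (rule functional_eqI[OF assms(1) s.add[OF assms(3,4)] has_weak_gradient_add[OF grad_m(2) grad_m(2)] s.T_add])
       (use assms T_measurable grad_m(1) \<Omega>_sets m'_bounds in \<open>auto intro!: Lp_add\<close>)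
  then show ?thesis using assms grad_m(1) by (simp add: functional_def pairing_add_right)
qed

lemma functional_scaleR:
  assumes "\<tau> > 0" "F \<in> Lp m \<Omega>" "f \<in> Lp_sigma 2 \<Omega>"
  shows "functional \<tau> F (\<lambda>x. c *\<^sub>R f x) = c * functional \<tau> F f"
proof -
  interpret s: Lp_semigroup 2 \<Omega> T "stokes 2 \<Omega>" by (rule semigroup[OF admissible_2])
  have e: "(\<lambda>x. \<chi> i. c *\<^sub>R (grad m' \<tau> f x $ i)) = (\<lambda>x. c *\<^sub>R grad m' \<tau> f x)"
    by (simp add: vec_eq_iff fun_eq_iff)
  have "functional \<tau> F (\<lambda>x. c *\<^sub>R f x) = - pairing \<Omega> F (\<lambda>x. \<chi> i. c *\<^sub>R (grad m' \<tau> f x $ i))"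
    by (rule functional_eqI[OF assms(1) s.scaleR[OF assms(3)] has_weak_gradient_linear[OF grad_m(2) bounded_linear_scaleR_right] s.T_scaleR])
       (use assms T_measurable grad_m(1) \<Omega>_sets in \<open>auto intro!: Lp_scaleR simp: e\<close>)
  then show ?thesis by (simp add: functional_def e)
qed

text \<open>Supplies the imaginary part of the duality identity that defines T(\<tau>) P
  div.\<close>

lemma functional_rows_scale:
  assumes "\<tau> > 0" "F \<in> Lp m \<Omega>" "f \<in> Lp_sigma 2 \<Omega>"
  shows "functional \<tau> F (\<lambda>x. \<i> *s f x) = - pairing \<Omega> F (\<lambda>x. \<chi> i. \<i> *s grad m' \<tau> f x $ i)"
proof -
  interpret s: Lp_semigroup 2 \<Omega> T "stokes 2 \<Omega>" by (rule semigroup[OF admissible_2])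
  have "(\<lambda>x. \<i> *s T \<tau> f x) \<in> Lp 2 \<Omega>" using s.invariant[OF assms(1,3)] Lp_sigma_Lp Lp_vector_scale by blast
  then have "(\<lambda>x. \<i> *s T \<tau> f x) \<in> borel_measurable (lebesgue_on \<Omega>)" by (rule Lp_measurable)
  then show ?thesis
    by (rule functional_eqI[OF assms(1) s.vector_scale[OF assms(3)]
          has_weak_gradient_linear[OF grad_m(2)[OF assms(1,3)] bounded_linear_vector_scale \<Omega>_sets] s.T_vector_scale[OF assms(1,3)] _ assms(2)
          Lp_rows_vector_scale[OF grad_m(1)[OF assms(1,3)]]])
qed

text \<open>Allows a part of the time to be moved from the functional to its argument, which later
  merges the two half steps.\<close>

lemma functional_semigroup:
  assumes "\<sigma> > 0" "h > 0" "F \<in> Lp m \<Omega>" "f \<in> Lp_sigma 2 \<Omega>"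
  shows "functional (\<sigma> + h) F f = functional \<sigma> F (T h f)"
proof -
  interpret s: Lp_semigroup 2 \<Omega> T "stokes 2 \<Omega>" by (rule semigroup[OF admissible_2])
  have Th: "T h f \<in> Lp_sigma 2 \<Omega>" using s.invariant assms by blast
  have "functional (\<sigma> + h) F f = - pairing \<Omega> F (grad m' \<sigma> (T h f))"
    by (rule functional_eqI[OF _ assms(4) grad_m(2)[OF assms(1) Th] s.T_semigroup[OF assms(1,2,4)] T_measurable[OF assms(1) Th] assms(3)
          grad_m(1)[OF assms(1) Th]]) (use assms in auto)
  then show ?thesis by (simp add: functional_def)
qed

definition half_step :: "real \<Rightarrow> (real^3 \<Rightarrow> complex^3^3) \<Rightarrow> 3 field" where
  "half_step \<tau> F = (SOME g. g \<in> Lp_sigma 2 \<Omega> \<and> (\<forall>\<phi> \<in> Lp_sigma 2 \<Omega>. pairing \<Omega> g \<phi> = functional \<tau> F \<phi>) \<and>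
     Lp_norm 2 \<Omega> g \<le> const_of K2 2 m' * \<tau> powr (- (1/2) - (3/2) * (1/2 - 1/m')) * Lp_norm m \<Omega> F)"

lemma half_step:
  assumes "\<tau> > 0" "F \<in> Lp m \<Omega>"
  shows "half_step \<tau> F \<in> Lp_sigma 2 \<Omega>"
    "\<And>\<phi>. \<phi> \<in> Lp_sigma 2 \<Omega> \<Longrightarrow> pairing \<Omega> (half_step \<tau> F) \<phi> = functional \<tau> F \<phi>"
    "Lp_norm 2 \<Omega> (half_step \<tau> F) \<le> const_of K2 2 m' * \<tau> powr (- (1/2) - (3/2) * (1/2 - 1/m')) * Lp_norm m \<Omega> F"
proof -
  define C where "C = const_of K2 2 m' * \<tau> powr (- (1/2) - (3/2) * (1/2 - 1/m')) * Lp_norm m \<Omega> F"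
  have "\<exists>g \<in> Lp_sigma 2 \<Omega>. (\<forall>\<phi> \<in> Lp_sigma 2 \<Omega>. pairing \<Omega> g \<phi> = functional \<tau> F \<phi>) \<and> Lp_norm 2 \<Omega> g \<le> C"
  proof (rule Riesz_L2_sigma[OF \<Omega>_sets functional_add[OF assms] functional_scaleR[OF assms]])
    fix \<phi> assume \<phi>: "\<phi> \<in> Lp_sigma 2 \<Omega>"
    have "\<bar>functional \<tau> F \<phi>\<bar> \<le> Lp_norm m \<Omega> F * Lp_norm m' \<Omega> (grad m' \<tau> \<phi>)"
      unfolding functional_def using pairing_le[OF assms(2) grad_m(1)[OF assms(1) \<phi>]] by simp
    also have "\<dots> \<le> Lp_norm m \<Omega> F * (const_of K2 2 m' * \<tau> powr (- (1/2) - (3/2) * (1/2 - 1/m')) * Lp_norm 2 \<Omega> \<phi>)"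
      by (intro mult_left_mono grad_m(3) assms \<phi>) simp
    finally show "\<bar>functional \<tau> F \<phi>\<bar> \<le> C * Lp_norm 2 \<Omega> \<phi>" by (simp add: C_def mult_ac)
  qed (auto simp: C_def)
  then have "\<exists>g. g \<in> Lp_sigma 2 \<Omega> \<and> (\<forall>\<phi> \<in> Lp_sigma 2 \<Omega>. pairing \<Omega> g \<phi> = functional \<tau> F \<phi>) \<and>
     Lp_norm 2 \<Omega> g \<le> const_of K2 2 m' * \<tau> powr (- (1/2) - (3/2) * (1/2 - 1/m')) * Lp_norm m \<Omega> F"
    unfolding C_def by blast
  from someI_ex[OF this] show "half_step \<tau> F \<in> Lp_sigma 2 \<Omega>"
    "\<And>\<phi>. \<phi> \<in> Lp_sigma 2 \<Omega> \<Longrightarrow> pairing \<Omega> (half_step \<tau> F) \<phi> = functional \<tau> F \<phi>"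
    "Lp_norm 2 \<Omega> (half_step \<tau> F) \<le> const_of K2 2 m' * \<tau> powr (- (1/2) - (3/2) * (1/2 - 1/m')) * Lp_norm m \<Omega> F"
    unfolding half_step_def by blast+
qed

definition proj_div :: "real \<Rightarrow> (real^3 \<Rightarrow> complex^3^3) \<Rightarrow> 3 field" where
  "proj_div \<tau> F = T (\<tau>/2) (half_step (\<tau>/2) F)"

text \<open>Scaling exponent of T(\<tau>) P div from L^m to L^p: 1/2 for the derivative and 3/2 (1/m
  - 1/p) for the change of integrability.\<close>

definition smoothing_exponent :: "real \<Rightarrow> real" where
  "smoothing_exponent p = 1/2 + (3/2) * (1/m - 1/p)"

text \<open>The power of 2 comes from evaluating both half steps at time \<tau>/2.\<close>

definition smoothing_const :: "real \<Rightarrow> real" where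
  "smoothing_const p = const_of K1 2 p * const_of K2 2 m' * 2 powr smoothing_exponent p"

lemma smoothing_const_nonneg [simp]: "0 \<le> smoothing_const p"
  by (simp add: smoothing_const_def)

lemma proj_div_bound:
  assumes "\<tau> > 0" "F \<in> Lp m \<Omega>" "admissible_exponent \<epsilon> p" "p \<ge> 2"
  shows "proj_div \<tau> F \<in> Lp_sigma p \<Omega>"
    and "Lp_norm p \<Omega> (proj_div \<tau> F) \<le> smoothing_const p * \<tau> powr (- smoothing_exponent p) * Lp_norm m \<Omega> F"
proof -
  have t2: "\<tau>/2 > 0" using assms by simp
  note H = half_step[OF t2 assms(2)]
  show "proj_div \<tau> F \<in> Lp_sigma p \<Omega>"
    unfolding proj_div_def by (rule T_bound(1)[OF admissible_2 assms(3,4) t2 H(1)])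
  \<comment> \<open>The exponents of the two half steps add up, and the intermediate exponent 2
    cancels because 1/m' = 1 - 1/m.\<close>
  have e: "(- (3/2) * (1/2 - 1/p)) + (- (1/2) - (3/2) * (1/2 - 1/m')) = - smoothing_exponent p"
  proof -
    have e: "1/m' = 1 - 1/m" using conj_m by linarith
    show ?thesis unfolding e smoothing_exponent_def by algebra
  qed
  have "Lp_norm p \<Omega> (proj_div \<tau> F) \<le> const_of K1 2 p * (\<tau>/2) powr (- (3/2) * (1/2 - 1/p)) * Lp_norm 2 \<Omega> (half_step (\<tau>/2) F)"
    unfolding proj_div_def by (rule T_bound(2)[OF admissible_2 assms(3,4) t2 H(1)])
  also have "\<dots> \<le> const_of K1 2 p * (\<tau>/2) powr (- (3/2) * (1/2 - 1/p)) *
      (const_of K2 2 m' * (\<tau>/2) powr (- (1/2) - (3/2) * (1/2 - 1/m')) * Lp_norm m \<Omega> F)"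
    by (intro mult_left_mono H) auto
  also have "\<dots> = const_of K1 2 p * const_of K2 2 m' * ((\<tau>/2) powr (- (3/2) * (1/2 - 1/p)) * (\<tau>/2) powr (- (1/2) - (3/2) * (1/2 - 1/m'))) * Lp_norm m \<Omega> F"
    by (simp only: mult_ac)
  also have "\<dots> = const_of K1 2 p * const_of K2 2 m' * (\<tau>/2) powr (- smoothing_exponent p) * Lp_norm m \<Omega> F"
    by (simp only: powr_add[symmetric] e)
  also have "(\<tau>/2) powr (- smoothing_exponent p) = 2 powr smoothing_exponent p * \<tau> powr (- smoothing_exponent p)"
    using assms(1) by (simp add: powr_divide powr_minus_divide)
  finally show "Lp_norm p \<Omega> (proj_div \<tau> F) \<le> smoothing_const p * \<tau> powr (- smoothing_exponent p) * Lp_norm m \<Omega> F"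
    by (simp only: smoothing_const_def mult_ac)
qed

text \<open>Symmetry moves the outer T(\<tau>/2) onto the test element, where it merges with the
  inner half step. So the splitting leaves no trace in the duality formula.\<close>

lemma pairing_proj_div:
  assumes "\<tau> > 0" "F \<in> Lp m \<Omega>" "\<phi> \<in> Lp_sigma 2 \<Omega>"
  shows "pairing \<Omega> (proj_div \<tau> F) \<phi> = functional \<tau> F \<phi>"
proof -
  interpret s: Lp_semigroup 2 \<Omega> T "stokes 2 \<Omega>" by (rule semigroup[OF admissible_2])
  have t2: "\<tau>/2 > 0" using assms by simp
  note H = half_step[OF t2 assms(2)]
  have "pairing \<Omega> (proj_div \<tau> F) \<phi> = pairing \<Omega> (half_step (\<tau>/2) F) (T (\<tau>/2) \<phi>)"
    unfolding proj_div_def by (rule stokes_semigroup_symmetric[OF s.Lp_semigroup_axioms t2 H(1) assms(3)])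
  also have "\<dots> = functional (\<tau>/2) F (T (\<tau>/2) \<phi>)" by (rule H(2)[OF s.invariant[OF t2 assms(3)]])
  also have "\<dots> = functional (\<tau>/2 + \<tau>/2) F \<phi>" by (rule functional_semigroup[OF t2 t2 assms(2,3), symmetric])
  finally show ?thesis by simp
qed

lemma proj_div_L2: "\<tau> > 0 \<Longrightarrow> F \<in> Lp m \<Omega> \<Longrightarrow> proj_div \<tau> F \<in> Lp_sigma 2 \<Omega>"
  by (rule proj_div_bound(1)[OF _ _ admissible_2]) auto

text \<open>Both sides lie in L^2_\<sigma> and have the same pairings with it, which determines them
  despite the choices in \<open>half_step\<close>.\<close>

lemma proj_div_diff:
  assumes "\<tau> > 0" "F \<in> Lp m \<Omega>" "G \<in> Lp m \<Omega>"
  shows "ae_eq \<Omega> (proj_div \<tau> (\<lambda>x. F x - G x)) (\<lambda>x. proj_div \<tau> F x - proj_div \<tau> G x)"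
proof -
  interpret s: solenoidal_Lp 2 \<Omega> by (rule solenoidal) simp
  interpret c: conjugate_exponents 2 2 by (rule conjugate_two)
  have FG: "(\<lambda>x. F x - G x) \<in> Lp m \<Omega>" using assms m_gt by (intro Lp_diff) auto
  show ?thesis
  proof (rule s.uniqueness_L2[OF refl])
    fix \<phi> assume \<phi>: "\<phi> \<in> Lp_sigma 2 \<Omega>"
    have "pairing \<Omega> (\<lambda>x. proj_div \<tau> F x - proj_div \<tau> G x) \<phi> = functional \<tau> F \<phi> - functional \<tau> G \<phi>"
      using proj_div_L2 assms \<phi> by (subst c.pairing_diff_left) (auto intro!: Lp_sigma_Lp simp: pairing_proj_div)
    also have "\<dots> = functional \<tau> (\<lambda>x. F x - G x) \<phi>"
      unfolding functional_def by (subst pairing_diff_left[OF assms(2,3) grad_m(1)[OF assms(1) \<phi>]]) simp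
    finally show "pairing \<Omega> (proj_div \<tau> (\<lambda>x. F x - G x)) \<phi> = pairing \<Omega> (\<lambda>x. proj_div \<tau> F x - proj_div \<tau> G x) \<phi>"
      using pairing_proj_div[OF assms(1) FG \<phi>] by simp
  qed (use proj_div_L2 assms FG in \<open>auto intro: s.diff\<close>)
qed

lemma proj_div_diff_bound:
  assumes "\<tau> > 0" "F \<in> Lp m \<Omega>" "G \<in> Lp m \<Omega>" "admissible_exponent \<epsilon> p" "p \<ge> 2"
  shows "Lp_norm p \<Omega> (\<lambda>x. proj_div \<tau> F x - proj_div \<tau> G x)
     \<le> smoothing_const p * \<tau> powr (- smoothing_exponent p) * Lp_norm m \<Omega> (\<lambda>x. F x - G x)"
proof -
  interpret s: solenoidal_Lp p \<Omega> by (rule solenoidal) (use assms in simp)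
  have FG: "(\<lambda>x. F x - G x) \<in> Lp m \<Omega>" using assms m_gt by (intro Lp_diff) auto
  have "Lp_norm p \<Omega> (\<lambda>x. proj_div \<tau> F x - proj_div \<tau> G x) = Lp_norm p \<Omega> (proj_div \<tau> (\<lambda>x. F x - G x))"
    by (rule s.norm_cong[OF ae_eq_sym[OF proj_div_diff[OF assms(1-3)]]])
       (use proj_div_bound(1) assms FG in \<open>auto intro!: Lp_sigma_Lp s.diff\<close>)
  then show ?thesis using proj_div_bound(2)[OF assms(1) FG assms(4,5)] by simp
qed

text \<open>Proved by comparing pairings; it reduces continuity in time to strong continuity of the
  semigroup.\<close>

lemma proj_div_semigroup:
  assumes "\<sigma> > 0" "h > 0" "F \<in> Lp m \<Omega>"
  shows "ae_eq \<Omega> (proj_div (\<sigma> + h) F) (T h (proj_div \<sigma> F))"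
proof -
  interpret s: Lp_semigroup 2 \<Omega> T "stokes 2 \<Omega>" by (rule semigroup[OF admissible_2])
  have P: "proj_div \<sigma> F \<in> Lp_sigma 2 \<Omega>" "proj_div (\<sigma> + h) F \<in> Lp_sigma 2 \<Omega>"
    using assms proj_div_L2 by auto
  show ?thesis
  proof (rule s.uniqueness_L2[OF refl P(2) s.invariant[OF assms(2) P(1)]])
    fix \<phi> assume \<phi>: "\<phi> \<in> Lp_sigma 2 \<Omega>"
    have "pairing \<Omega> (T h (proj_div \<sigma> F)) \<phi> = pairing \<Omega> (proj_div \<sigma> F) (T h \<phi>)"
      by (rule stokes_semigroup_symmetric[OF s.Lp_semigroup_axioms assms(2) P(1) \<phi>])
    also have "\<dots> = functional (\<sigma> + h) F \<phi>"
      using pairing_proj_div[OF assms(1,3) s.invariant[OF assms(2) \<phi>]] functional_semigroup[OF assms \<phi>] by simp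
    finally show "pairing \<Omega> (proj_div (\<sigma> + h) F) \<phi> = pairing \<Omega> (T h (proj_div \<sigma> F)) \<phi>"
      using pairing_proj_div[OF _ assms(3) \<phi>, of "\<sigma> + h"] assms by simp
  qed
qed

text \<open>Changing the field costs the difference bound. Changing the time is strong continuity of
  the semigroup on the fixed element \<open>proj_div \<sigma> F\<close> with \<sigma> =
  \<tau>/2.\<close>

lemma proj_div_tendsto:
  assumes "\<tau> > 0" "F \<in> Lp m \<Omega>" "admissible_exponent \<epsilon> p" "p \<ge> 2"
    "(t \<longlongrightarrow> \<tau>) \<F>" "\<forall>\<^sub>F k in \<F>. G k \<in> Lp m \<Omega>" "((\<lambda>k. Lp_norm m \<Omega> (\<lambda>x. G k x - F x)) \<longlongrightarrow> 0) \<F>"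
  shows "((\<lambda>k. Lp_norm p \<Omega> (\<lambda>x. proj_div (t k) (G k) x - proj_div \<tau> F x)) \<longlongrightarrow> 0) \<F>"
proof -
  interpret s: Lp_semigroup p \<Omega> T "stokes p \<Omega>" by (rule semigroup[OF assms(3)])
  define \<sigma> where "\<sigma> = \<tau>/2"
  have \<sigma>: "\<sigma> > 0" "\<tau> - \<sigma> > 0" using assms(1) by (auto simp: \<sigma>_def)
  have P: "proj_div \<sigma> F \<in> Lp_sigma p \<Omega>" by (rule proj_div_bound(1)[OF \<sigma>(1) assms(2-4)])
  have ev: "\<forall>\<^sub>F k in \<F>. t k > \<sigma>"
    using assms(5) \<sigma> by (intro order_tendstoD(1)) (auto simp: \<sigma>_def)
  \<comment> \<open>The full neighbourhood filter is taken since \<open>t k\<close> may equal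
    \<tau>; at the centre itself the norm is 0.\<close>
  have T0: "((\<lambda>r. Lp_norm p \<Omega> (\<lambda>x. T r (proj_div \<sigma> F) x - T (\<tau> - \<sigma>) (proj_div \<sigma> F) x)) \<longlongrightarrow> 0) (nhds (\<tau> - \<sigma>))"
    using s.T_continuous[OF \<sigma>(2) P]
      tendsto_at_iff_tendsto_nhds[of "\<lambda>r. Lp_norm p \<Omega> (\<lambda>x. T r (proj_div \<sigma> F) x - T (\<tau> - \<sigma>) (proj_div \<sigma> F) x)" "\<tau> - \<sigma>"]
    by simp
  have T1: "((\<lambda>k. Lp_norm p \<Omega> (\<lambda>x. T (t k - \<sigma>) (proj_div \<sigma> F) x - T (\<tau> - \<sigma>) (proj_div \<sigma> F) x)) \<longlongrightarrow> 0) \<F>"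
    by (rule filterlim_compose[OF T0]) (intro tendsto_intros assms(5))
  have lim: "((\<lambda>k. smoothing_const p * t k powr (- smoothing_exponent p) * Lp_norm m \<Omega> (\<lambda>x. G k x - F x) +
      Lp_norm p \<Omega> (\<lambda>x. T (t k - \<sigma>) (proj_div \<sigma> F) x - T (\<tau> - \<sigma>) (proj_div \<sigma> F) x)) \<longlongrightarrow>
      smoothing_const p * \<tau> powr (- smoothing_exponent p) * 0 + 0) \<F>"
    by (intro tendsto_intros assms T1) (use assms in auto)
  show ?thesis
  proof (rule Lim_null_comparison)
    show "\<forall>\<^sub>F k in \<F>. norm (Lp_norm p \<Omega> (\<lambda>x. proj_div (t k) (G k) x - proj_div \<tau> F x)) \<le>
       smoothing_const p * t k powr (- smoothing_exponent p) * Lp_norm m \<Omega> (\<lambda>x. G k x - F x) +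
       Lp_norm p \<Omega> (\<lambda>x. T (t k - \<sigma>) (proj_div \<sigma> F) x - T (\<tau> - \<sigma>) (proj_div \<sigma> F) x)"
      using ev assms(6)
    proof eventually_elim
      case (elim k)
      have tk: "t k > 0" "t k - \<sigma> > 0" using elim \<sigma> by auto
      have L: "proj_div (t k) (G k) \<in> Lp p \<Omega>" "proj_div (t k) F \<in> Lp p \<Omega>" "proj_div \<tau> F \<in> Lp p \<Omega>"
        "T (t k - \<sigma>) (proj_div \<sigma> F) \<in> Lp p \<Omega>" "T (\<tau> - \<sigma>) (proj_div \<sigma> F) \<in> Lp p \<Omega>"
        using proj_div_bound(1)[OF _ _ assms(3,4)] tk elim assms s.invariant \<sigma> P by (auto intro!: Lp_sigma_Lp)
      have "ae_eq \<Omega> (\<lambda>x. proj_div (t k) F x - proj_div \<tau> F x)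
          (\<lambda>x. T (t k - \<sigma>) (proj_div \<sigma> F) x - T (\<tau> - \<sigma>) (proj_div \<sigma> F) x)"
        using proj_div_semigroup[OF \<sigma>(1) tk(2) assms(2)] proj_div_semigroup[OF \<sigma> assms(2)]
        unfolding ae_eq_def by eventually_elim simp
      then have "Lp_norm p \<Omega> (\<lambda>x. proj_div (t k) F x - proj_div \<tau> F x) =
          Lp_norm p \<Omega> (\<lambda>x. T (t k - \<sigma>) (proj_div \<sigma> F) x - T (\<tau> - \<sigma>) (proj_div \<sigma> F) x)"
        by (rule s.norm_cong) (intro Lp_diff L s.p_ge_1)+
      moreover have "Lp_norm p \<Omega> (\<lambda>x. proj_div (t k) (G k) x - proj_div \<tau> F x) \<le>
         Lp_norm p \<Omega> (\<lambda>x. proj_div (t k) (G k) x - proj_div (t k) F x) + Lp_norm p \<Omega> (\<lambda>x. proj_div (t k) F x - proj_div \<tau> F x)"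
        by (intro Lp_norm_triangle_via L s.p_ge_1)
      ultimately show ?case
        using proj_div_diff_bound[OF tk(1) elim(2) assms(2-4)] by simp
    qed
  qed (use lim in simp)
qed

text \<open>The real identity \<open>pairing_proj_div\<close> for \<phi> and for \<i> \<phi> gives
  the real and the imaginary part of the complex one.\<close>

lemma proj_div_semigroup_proj_div:
  assumes "\<tau> > 0" "F \<in> Lp m \<Omega>" "admissible_exponent \<epsilon> p" "p \<ge> 2"
  shows "semigroup_proj_div p \<Omega> T \<tau> F (proj_div \<tau> F)"
  unfolding semigroup_proj_div_def
proof (intro conjI ballI)
  show P: "proj_div \<tau> F \<in> Lp_sigma p \<Omega>" by (rule proj_div_bound(1)[OF assms])
  fix \<phi> assume t: "\<phi> \<in> solenoidal_tests \<Omega>"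
  interpret s: solenoidal_Lp 2 \<Omega> by (rule solenoidal) simp
  define p' where "p' = p / (p - 1)"
  interpret c: conjugate_exponents p p'
    by unfold_locales (use assms(4) in \<open>auto simp: p'_def field_simps\<close>)
  have \<phi>: "\<phi> \<in> Lp_sigma 2 \<Omega>" by (rule s.tests_Lp_sigma[OF t])
  have \<phi>': "\<phi> \<in> Lp p' \<Omega>" using solenoidal_tests_Lp[OF t \<Omega>_sets] c.q1 by simp
  note g = grad_m[OF assms(1) \<phi>]
  show "\<exists>G. has_weak_gradient \<Omega> (T \<tau> \<phi>) G \<and>
        integrable (lebesgue_on \<Omega>) (\<lambda>x. mat_cdot (F x) (G x)) \<and>
        (LINT x|lebesgue_on \<Omega>. cdot (proj_div \<tau> F x) (\<phi> x)) =
          - (LINT x|lebesgue_on \<Omega>. mat_cdot (F x) (G x))"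
  proof (intro exI[of _ "grad m' \<tau> \<phi>"] conjI g(2))
    show "integrable (lebesgue_on \<Omega>) (\<lambda>x. mat_cdot (F x) (grad m' \<tau> \<phi> x))"
      by (rule integrable_mat_cdot[OF assms(2) g(1) Lp_rows_vector_scale[OF g(1)]])
    have "(LINT x|lebesgue_on \<Omega>. cdot (proj_div \<tau> F x) (\<phi> x)) =
        complex_of_real (functional \<tau> F \<phi>) + \<i> * complex_of_real (functional \<tau> F (\<lambda>x. \<i> *s \<phi> x))"
      using c.integral_cdot[OF Lp_sigma_Lp[OF P] \<phi>'] pairing_proj_div[OF assms(1,2) \<phi>]
        pairing_proj_div[OF assms(1,2) s.vector_scale[OF \<phi>]] by simp
    also have "\<dots> = - (LINT x|lebesgue_on \<Omega>. mat_cdot (F x) (grad m' \<tau> \<phi> x))"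
      unfolding integral_mat_cdot[OF assms(2) g(1) Lp_rows_vector_scale[OF g(1)]] functional_rows_scale[OF assms(1,2) \<phi>]
      by (simp add: functional_def)
    finally show "(LINT x|lebesgue_on \<Omega>. cdot (proj_div \<tau> F x) (\<phi> x)) =
          - (LINT x|lebesgue_on \<Omega>. mat_cdot (F x) (grad m' \<tau> \<phi> x))" .
  qed
qed

end

section \<open>Integrals of continuous functions with values in \<open>L\<^sup>p\<^sub>\<sigma>\<close>\<close>

text \<open>In contrast to \<open>continuous_Lp_sigma\<close> this admits any set of times and also
  matrix fields, so it covers the quadratic term and open time intervals.\<close>

definition norm_continuous :: "real \<Rightarrow> 'a::euclidean_space set \<Rightarrow> real set \<Rightarrow> (real \<Rightarrow> 'a \<Rightarrow> 'b::euclidean_space) \<Rightarrow> bool" where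
  "norm_continuous p \<Omega> S v \<longleftrightarrow>
     (\<forall>s\<in>S. v s \<in> Lp p \<Omega> \<and> ((\<lambda>r. Lp_norm p \<Omega> (\<lambda>x. v r x - v s x)) \<longlongrightarrow> 0) (at s within S))"

lemma norm_continuous_Lp: "norm_continuous p \<Omega> S v \<Longrightarrow> s \<in> S \<Longrightarrow> v s \<in> Lp p \<Omega>"
  by (simp add: norm_continuous_def)

lemma norm_continuous_subset:
  "norm_continuous p \<Omega> S v \<Longrightarrow> R \<subseteq> S \<Longrightarrow> norm_continuous p \<Omega> R v"
  unfolding norm_continuous_def by (meson subsetD tendsto_within_subset)

lemma norm_continuous_const: "f \<in> Lp p \<Omega> \<Longrightarrow> norm_continuous p \<Omega> S (\<lambda>_. f)"
  by (simp add: norm_continuous_def)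

lemma norm_continuous_diff:
  assumes "norm_continuous p \<Omega> S v" "norm_continuous p \<Omega> S u" "p \<ge> 1"
  shows "norm_continuous p \<Omega> S (\<lambda>s x. v s x - u s x)"
  unfolding norm_continuous_def
proof (intro ballI conjI)
  fix s assume s: "s \<in> S"
  have L: "v r \<in> Lp p \<Omega>" "u r \<in> Lp p \<Omega>" if "r \<in> S" for r
    using assms that norm_continuous_Lp by blast+
  then show "(\<lambda>x. v s x - u s x) \<in> Lp p \<Omega>" using s assms(3) by (intro Lp_diff)
  have lim: "((\<lambda>r. Lp_norm p \<Omega> (\<lambda>x. v r x - v s x) + Lp_norm p \<Omega> (\<lambda>x. u r x - u s x)) \<longlongrightarrow> 0) (at s within S)"
    using assms(1,2) s tendsto_add[of "\<lambda>r. Lp_norm p \<Omega> (\<lambda>x. v r x - v s x)" 0 "at s within S" "\<lambda>r. Lp_norm p \<Omega> (\<lambda>x. u r x - u s x)" 0]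
    by (simp add: norm_continuous_def)
  show "((\<lambda>r. Lp_norm p \<Omega> (\<lambda>x. (v r x - u r x) - (v s x - u s x))) \<longlongrightarrow> 0) (at s within S)"
  proof (rule Lim_null_comparison[OF _ lim])
    show "\<forall>\<^sub>F r in at s within S. norm (Lp_norm p \<Omega> (\<lambda>x. (v r x - u r x) - (v s x - u s x))) \<le>
        Lp_norm p \<Omega> (\<lambda>x. v r x - v s x) + Lp_norm p \<Omega> (\<lambda>x. u r x - u s x)"
      unfolding eventually_at_filter
    proof (intro always_eventually allI impI)
      fix r assume r: "r \<in> S"
      have "(\<lambda>x. (v r x - u r x) - (v s x - u s x)) = (\<lambda>x. (v r x - v s x) - (u r x - u s x))" by auto
      then show "norm (Lp_norm p \<Omega> (\<lambda>x. (v r x - u r x) - (v s x - u s x))) \<le>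
          Lp_norm p \<Omega> (\<lambda>x. v r x - v s x) + Lp_norm p \<Omega> (\<lambda>x. u r x - u s x)"
        using Lp_norm_diff_le[OF Lp_diff[OF L(1)[OF r] L(1)[OF s] assms(3)] Lp_diff[OF L(2)[OF r] L(2)[OF s] assms(3)] assms(3)]
        by simp
    qed
  qed
qed

lemma continuous_on_Lp_norm:
  assumes "norm_continuous p \<Omega> S v" "p \<ge> 1"
  shows "continuous_on S (\<lambda>s. Lp_norm p \<Omega> (v s))"
  unfolding continuous_on_def
proof
  fix s assume s: "s \<in> S"
  show "((\<lambda>r. Lp_norm p \<Omega> (v r)) \<longlongrightarrow> Lp_norm p \<Omega> (v s)) (at s within S)"
  proof (rule LIM_zero_cancel, rule Lim_null_comparison)
    show "\<forall>\<^sub>F r in at s within S. norm (Lp_norm p \<Omega> (v r) - Lp_norm p \<Omega> (v s)) \<le> Lp_norm p \<Omega> (\<lambda>x. v r x - v s x)"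
      unfolding eventually_at_filter
    proof (intro always_eventually allI impI)
      fix r assume r: "r \<in> S"
      have L: "v r \<in> Lp p \<Omega>" "v s \<in> Lp p \<Omega>" using assms r s norm_continuous_Lp by blast+
      show "norm (Lp_norm p \<Omega> (v r) - Lp_norm p \<Omega> (v s)) \<le> Lp_norm p \<Omega> (\<lambda>x. v r x - v s x)"
        using Lp_norm_triangle_sub[OF L assms(2)] Lp_norm_triangle_sub[OF L(2,1) assms(2)]
          Lp_norm_minus_commute[of p \<Omega> "v r" "v s"] by simp
    qed
    show "((\<lambda>r. Lp_norm p \<Omega> (\<lambda>x. v r x - v s x)) \<longlongrightarrow> 0) (at s within S)"
      using assms(1) s by (simp add: norm_continuous_def)
  qed
qed

lemma (in conjugate_exponents) continuous_on_pairing: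
  assumes "norm_continuous p \<Omega> S v" "\<phi> \<in> Lp q \<Omega>"
  shows "continuous_on S (\<lambda>s. pairing \<Omega> (v s) \<phi>)"
  unfolding continuous_on_def
proof
  fix s assume s: "s \<in> S"
  show "((\<lambda>r. pairing \<Omega> (v r) \<phi>) \<longlongrightarrow> pairing \<Omega> (v s) \<phi>) (at s within S)"
    using assms s
    by (intro tendsto_pairing) (auto simp: norm_continuous_def eventually_at_filter)
qed

section \<open>The singular kernel in time and its integral\<close>

definition abel_kernel :: "real \<Rightarrow> real \<Rightarrow> real \<Rightarrow> real \<Rightarrow> real" where
  "abel_kernel \<beta> \<gamma> t s = (t - s) powr (-\<beta>) * s powr (-\<gamma>)"

text \<open>The integral of the kernel over (0,1); for a general upper limit t, scaling splits off a
  power of t.\<close>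

definition kernel_mass :: "real \<Rightarrow> real \<Rightarrow> real" where
  "kernel_mass \<beta> \<gamma> = Beta (1 - \<gamma>) (1 - \<beta>)"

lemma kernel_nonneg [simp]: "0 \<le> abel_kernel \<beta> \<gamma> t s"
  by (simp add: abel_kernel_def)

lemma integrable_lebesgue_on_iff:
  fixes f :: "'a::euclidean_space \<Rightarrow> 'b::euclidean_space"
  assumes "S \<in> sets lebesgue"
  shows "integrable (lebesgue_on S) f \<longleftrightarrow> f absolutely_integrable_on S"
  using assms by (simp add: set_integrable_def integrable_restrict_space)

lemma
  fixes f :: "real \<Rightarrow> real"
  assumes "t > 0"
  shows integrable_rescale: "integrable (lebesgue_on {0<..<t}) f \<longleftrightarrow> integrable (lebesgue_on {0<..<1}) (\<lambda>\<sigma>. t * f (t * \<sigma>))"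
    and integral_rescale: "integrable (lebesgue_on {0<..<t}) f \<Longrightarrow>
       (LINT s|lebesgue_on {0<..<t}. f s) = (LINT \<sigma>|lebesgue_on {0<..<1}. t * f (t * \<sigma>))"
proof -
  have img: "(\<lambda>\<sigma>. t * \<sigma>) ` {0<..<1} = {0<..<t}"
  proof (intro equalityI subsetI)
    fix x assume "x \<in> {0<..<t}"
    then show "x \<in> (\<lambda>\<sigma>. t * \<sigma>) ` {0<..<1}" using assms by (intro image_eqI[of _ _ "x / t"]) auto
  qed (use assms in auto)
  have "(\<lambda>x. \<bar>t\<bar> * f (t * x)) absolutely_integrable_on {0<..<1} \<and>
           integral {0<..<1} (\<lambda>x. \<bar>t\<bar> * f (t * x)) = b
     \<longleftrightarrow> f absolutely_integrable_on ((\<lambda>\<sigma>. t * \<sigma>) ` {0<..<1}) \<and> integral ((\<lambda>\<sigma>. t * \<sigma>) ` {0<..<1}) f = b" for b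
    by (rule has_absolute_integral_change_of_variables_1'[where g' = "\<lambda>_. t"])
       (use assms in \<open>auto intro!: derivative_eq_intros inj_onI\<close>)
  then have *: "(\<lambda>x. t * f (t * x)) absolutely_integrable_on {0<..<1} \<and> integral {0<..<1} (\<lambda>x. t * f (t * x)) = b
     \<longleftrightarrow> f absolutely_integrable_on {0<..<t} \<and> integral {0<..<t} f = b" for b
    using assms by (simp add: img)
  have e1: "integrable (lebesgue_on {0<..<t}) f \<longleftrightarrow> f absolutely_integrable_on {0<..<t}"
    by (rule integrable_lebesgue_on_iff) simp
  have e2: "integrable (lebesgue_on {0<..<1}) (\<lambda>\<sigma>. t * f (t * \<sigma>)) \<longleftrightarrow> (\<lambda>\<sigma>. t * f (t * \<sigma>)) absolutely_integrable_on {0<..<1}"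
    by (rule integrable_lebesgue_on_iff) simp
  show iff: "integrable (lebesgue_on {0<..<t}) f \<longleftrightarrow> integrable (lebesgue_on {0<..<1}) (\<lambda>\<sigma>. t * f (t * \<sigma>))"
    unfolding e1 e2 using *[of "integral {0<..<t} f"] *[of "integral {0<..<1} (\<lambda>\<sigma>. t * f (t * \<sigma>))"] by blast
  assume f: "integrable (lebesgue_on {0<..<t}) f"
  then have f1: "integrable (lebesgue_on {0<..<1}) (\<lambda>\<sigma>. t * f (t * \<sigma>))" using iff by blast
  have "integral {0<..<1} (\<lambda>\<sigma>. t * f (t * \<sigma>)) = integral {0<..<t} f"
    using *[of "integral {0<..<t} f"] f unfolding e1 by blast
  then show "(LINT s|lebesgue_on {0<..<t}. f s) = (LINT \<sigma>|lebesgue_on {0<..<1}. t * f (t * \<sigma>))"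
    using lebesgue_integral_eq_integral[OF f] lebesgue_integral_eq_integral[OF f1] by simp
qed

lemma kernel_rescale:
  assumes "t > 0" "0 < \<sigma>" "\<sigma> < 1"
  shows "t * abel_kernel \<beta> \<gamma> t (t * \<sigma>) = t powr (1 - \<beta> - \<gamma>) * abel_kernel \<beta> \<gamma> 1 \<sigma>"
proof -
  have "t - t * \<sigma> = t * (1 - \<sigma>)" by (simp add: algebra_simps)
  then have "t * abel_kernel \<beta> \<gamma> t (t * \<sigma>) = (t powr 1 * t powr (-\<beta>) * t powr (-\<gamma>)) * abel_kernel \<beta> \<gamma> 1 \<sigma>"
    using assms by (simp add: abel_kernel_def powr_mult)
  then show ?thesis by (simp only: powr_add[symmetric]) simp
qed

lemma
  assumes "\<beta> < 1" "\<gamma> < 1"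
  shows kernel_integrable_1: "integrable (lebesgue_on {0<..<1}) (abel_kernel \<beta> \<gamma> 1)"
    and kernel_integral_1: "(LINT s|lebesgue_on {0<..<1}. abel_kernel \<beta> \<gamma> 1 s) = kernel_mass \<beta> \<gamma>"
proof -
  have h: "(abel_kernel \<beta> \<gamma> 1 has_integral kernel_mass \<beta> \<gamma>) {0<..<1}"
    using has_integral_Beta_real[of "1 - \<gamma>" "1 - \<beta>"] assms
    by (simp add: has_integral_Icc_iff_Ioo abel_kernel_def[abs_def] kernel_mass_def mult.commute)
  then have "abel_kernel \<beta> \<gamma> 1 absolutely_integrable_on {0<..<1}"
    by (intro nonnegative_absolutely_integrable_1) auto
  then show i: "integrable (lebesgue_on {0<..<1}) (abel_kernel \<beta> \<gamma> 1)" by (simp add: integrable_lebesgue_on_iff)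
  show "(LINT s|lebesgue_on {0<..<1}. abel_kernel \<beta> \<gamma> 1 s) = kernel_mass \<beta> \<gamma>"
    using h i by (simp add: lebesgue_integral_eq_integral integral_unique)
qed

lemma
  assumes "\<beta> < 1" "\<gamma> < 1" "t > 0"
  shows kernel_integrable: "integrable (lebesgue_on {0<..<t}) (abel_kernel \<beta> \<gamma> t)"
    and kernel_integral: "(LINT s|lebesgue_on {0<..<t}. abel_kernel \<beta> \<gamma> t s) = t powr (1 - \<beta> - \<gamma>) * kernel_mass \<beta> \<gamma>"
proof -
  have "integrable (lebesgue_on {0<..<1}) (\<lambda>\<sigma>. t powr (1 - \<beta> - \<gamma>) * abel_kernel \<beta> \<gamma> 1 \<sigma>)"
    using kernel_integrable_1[OF assms(1,2)] by simp
  then have "integrable (lebesgue_on {0<..<1}) (\<lambda>\<sigma>. t * abel_kernel \<beta> \<gamma> t (t * \<sigma>))"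
    by (rule Bochner_Integration.integrable_cong[THEN iffD1, rotated 2]) (use kernel_rescale[OF assms(3)] in auto)
  then show i: "integrable (lebesgue_on {0<..<t}) (abel_kernel \<beta> \<gamma> t)"
    using integrable_rescale[OF assms(3)] by blast
  have "(LINT s|lebesgue_on {0<..<t}. abel_kernel \<beta> \<gamma> t s) = (LINT \<sigma>|lebesgue_on {0<..<1}. t powr (1 - \<beta> - \<gamma>) * abel_kernel \<beta> \<gamma> 1 \<sigma>)"
    unfolding integral_rescale[OF assms(3) i]
    by (rule Bochner_Integration.integral_cong) (use kernel_rescale[OF assms(3)] in auto)
  then show "(LINT s|lebesgue_on {0<..<t}. abel_kernel \<beta> \<gamma> t s) = t powr (1 - \<beta> - \<gamma>) * kernel_mass \<beta> \<gamma>"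
    using kernel_integral_1[OF assms(1,2)] by simp
qed

lemma kernel_mass_nonneg: "\<beta> < 1 \<Longrightarrow> \<gamma> < 1 \<Longrightarrow> 0 \<le> kernel_mass \<beta> \<gamma>"
  using kernel_integral_1[of \<beta> \<gamma>] integral_nonneg_AE[of "abel_kernel \<beta> \<gamma> 1" "lebesgue_on {0<..<1}"] by simp

lemma kernel_mass_mono: "\<beta> < 1 \<Longrightarrow> \<gamma> < 1 \<Longrightarrow> \<gamma>' \<le> \<gamma> \<Longrightarrow> kernel_mass \<beta> \<gamma>' \<le> kernel_mass \<beta> \<gamma>"
  unfolding kernel_mass_def by (intro Beta_real_mono) auto

text \<open>Left-endpoint Riemann sums over the cells \<open>[t(j+1)/(k+2), t(j+2)/(k+2))\<close>; the first cell is left out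
  because the integrand may be singular at \<open>0\<close>.\<close>

definition node :: "real \<Rightarrow> nat \<Rightarrow> nat \<Rightarrow> real" where
  "node t k j = t * (real j + 1) / (real k + 2)"

definition cell :: "real \<Rightarrow> nat \<Rightarrow> nat \<Rightarrow> real set" where
  "cell t k j = {node t k j..<node t k (Suc j)}"

definition riemann_sum :: "real \<Rightarrow> (real \<Rightarrow> 'a \<Rightarrow> 'b::real_vector) \<Rightarrow> nat \<Rightarrow> 'a \<Rightarrow> 'b" where
  "riemann_sum t g k x = (\<Sum>j<Suc k. (t / (real k + 2)) *\<^sub>R g (node t k j) x)"

definition step_function :: "real \<Rightarrow> (real \<Rightarrow> 'a \<Rightarrow> 'b::real_vector) \<Rightarrow> nat \<Rightarrow> real \<Rightarrow> 'a \<Rightarrow> 'b" where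
  "step_function t g k s x = (\<Sum>j<Suc k. indicat_real (cell t k j) s *\<^sub>R g (node t k j) x)"

text \<open>The bound by twice the left node is the gain from leaving out the first cell: on the
  remaining cells s^(-\<gamma>) is comparable to its value at the node.\<close>

lemma node_bounds:
  assumes "t > 0" "j < Suc k"
  shows "0 < node t k j" "node t k j < t" "node t k (Suc j) \<le> t" "node t k (Suc j) \<le> 2 * node t k j"
    "node t k (Suc j) - node t k j = t / (real k + 2)" "node t k j < node t k (Suc j)"
proof -
  have k: "real k + 2 > 0" "real j \<le> real k" using assms by auto
  show "0 < node t k j" using assms k by (simp add: node_def zero_less_divide_iff add_nonneg_pos)
  have "t * (real j + 1) < t * (real k + 2)" "t * (real (Suc j) + 1) \<le> t * (real k + 2)" using assms k by auto
  then show "node t k j < t" "node t k (Suc j) \<le> t"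
    unfolding node_def using k by (simp_all only: pos_divide_less_eq pos_divide_le_eq)
  have "t * (real (Suc j) + 1) \<le> 2 * (t * (real j + 1))" using assms by (simp add: algebra_simps)
  then show "node t k (Suc j) \<le> 2 * node t k j"
    unfolding node_def using k by (simp add: divide_right_mono)
  show e: "node t k (Suc j) - node t k j = t / (real k + 2)"
    unfolding node_def by (simp add: diff_divide_distrib[symmetric] algebra_simps)
  have "t / (real k + 2) > 0" using assms k by simp
  with e show "node t k j < node t k (Suc j)" by linarith
qed

lemma cell_subset: "t > 0 \<Longrightarrow> j < Suc k \<Longrightarrow> cell t k j \<subseteq> {0<..<t}"
  using node_bounds[of t j k] unfolding cell_def by auto

lemma cell_lmeasurable: "cell t k j \<in> lmeasurable"
  unfolding cell_def by (intro bounded_set_imp_lmeasurable) (auto intro: bounded_subset[OF bounded_closed_interval])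

lemma cell_measure: "t > 0 \<Longrightarrow> j < Suc k \<Longrightarrow> measure lebesgue (cell t k j) = t / (real k + 2)"
  using node_bounds[of t j k] unfolding cell_def by simp

lemma cell_unique:
  assumes "t > 0" "s \<in> cell t k i" "s \<in> cell t k j"
  shows "i = j"
proof -
  have mono: "node t k a \<le> node t k b" if "a \<le> b" for a b
    using assms(1) that by (auto simp: node_def intro!: divide_right_mono mult_left_mono)
  show ?thesis
  proof (rule ccontr)
    assume "i \<noteq> j"
    then consider "Suc i \<le> j" | "Suc j \<le> i" by linarith
    then show False using mono[of "Suc i" j] mono[of "Suc j" i] assms(2,3) by cases (auto simp: cell_def)
  qed
qed

lemma indicator_cell: "t > 0 \<Longrightarrow> s \<in> cell t k j \<Longrightarrow> indicat_real (cell t k i) s = (if i = j then 1 else 0)"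
  using cell_unique[of t s k i j] by (cases "i = j") (auto simp: indicator_def)

lemma step_function_cell:
  assumes "t > 0" "j < Suc k" "s \<in> cell t k j"
  shows "step_function t g k s = g (node t k j)"
proof
  fix x
  have "step_function t g k s x = (\<Sum>i<Suc k. if i = j then g (node t k j) x else 0)"
    unfolding step_function_def indicator_cell[OF assms(1,3)] by (intro sum.cong) auto
  then show "step_function t g k s x = g (node t k j) x" using assms(2) by simp
qed

lemma step_function_initial:
  assumes "t > 0" "s < node t k 0"
  shows "step_function t g k s = (\<lambda>_. 0)"
proof
  fix x
  have "s \<notin> cell t k i" for i
  proof -
    have "node t k 0 \<le> node t k i" using assms(1) by (auto simp: node_def intro!: divide_right_mono mult_left_mono)
    then show ?thesis using assms(2) by (auto simp: cell_def)
  qed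
  then show "step_function t g k s x = 0" by (simp add: step_function_def)
qed

lemma cell_cases:
  assumes "t > 0" "0 < s" "s < t"
  shows "s < node t k 0 \<or> (\<exists>j<Suc k. s \<in> cell t k j)"
proof (cases "s < node t k 0")
  case False
  \<comment> \<open>s lies in part n of the k + 2 equal parts, counted from 0. Its cell has index n
    - 1 because part 0 is left out.\<close>
  define n where "n = nat \<lfloor>s * (real k + 2) / t\<rfloor>"
  have k: "real k + 2 > 0" by simp
  have pos: "s * (real k + 2) / t \<ge> 0" using assms by simp
  have n: "real n \<le> s * (real k + 2) / t" "s * (real k + 2) / t < real n + 1"
    using pos unfolding n_def by linarith+
  have "1 \<le> s * (real k + 2) / t" using False assms by (simp add: node_def field_simps)
  then have n1: "n \<ge> 1" using n(2) by linarith
  then obtain j where j: "n = Suc j" by (cases n) auto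
  have "s * (real k + 2) < t * (real k + 2)" using assms(3) k by (rule mult_strict_right_mono)
  then have "s * (real k + 2) / t < real k + 2" using assms(1) by (simp add: pos_divide_less_eq mult.commute)
  then have "real n < real k + 2" using n(1) by linarith
  then have jk: "j < Suc k" using j by simp
  have "node t k j \<le> s" using n(1) j assms k by (simp add: node_def field_simps)
  moreover have "s < node t k (Suc j)" using n(2) j assms k by (simp add: node_def field_simps)
  ultimately show ?thesis using jk by (auto simp: cell_def)
qed auto

section \<open>Integrals as limits of Riemann sums: existence, estimates, continuity in the upper
  limit\<close>

context solenoidal_Lp
begin

definition p' :: real where "p' = p / (p - 1)"

lemma conj_p': "conjugate_exponents p p'"
  by unfold_locales (use p1 in \<open>auto simp: p'_def field_simps\<close>)

text \<open>Three descriptions of one integral are kept together. The Bochner integral is what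
  \<open>mild_solution\<close> asks for, the Riemann sums identify the integral across exponents,
  and the scalar integrals yield estimates and continuity.\<close>

definition is_integral :: "real \<Rightarrow> (real \<Rightarrow> 'n field) \<Rightarrow> 'n field \<Rightarrow> bool" where
  "is_integral t g w \<longleftrightarrow> w \<in> Lp_sigma p \<Omega> \<and> has_Lp_bochner_integral p \<Omega> {0<..<t} g w \<and>
     (\<lambda>k. Lp_norm p \<Omega> (\<lambda>x. riemann_sum t g k x - w x)) \<longlonglongrightarrow> 0 \<and>
     (\<forall>\<phi> \<in> Lp p' \<Omega>. integrable (lebesgue_on {0<..<t}) (\<lambda>s. pairing \<Omega> (g s) \<phi>) \<and>
        pairing \<Omega> w \<phi> = (LINT s|lebesgue_on {0<..<t}. pairing \<Omega> (g s) \<phi>))"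

text \<open>The node lies to the left of s, so passing to s only increases (t - s)^(-\<beta>), while
  s^(-\<gamma>) loses at most 2^\<gamma> \<le> 2 because s is at most twice the node.\<close>

lemma step_function_bound:
  assumes "t > 0" "0 \<le> \<beta>" "0 \<le> \<gamma>" "\<gamma> < 1" "C \<ge> 0"
    "\<And>s. 0 < s \<Longrightarrow> s < t \<Longrightarrow> Lp_norm p \<Omega> (g s) \<le> C * abel_kernel \<beta> \<gamma> t s" "0 < s" "s < t"
  shows "Lp_norm p \<Omega> (step_function t g k s) \<le> 2 * C * abel_kernel \<beta> \<gamma> t s"
proof (cases "s < node t k 0")
  case True
  then show ?thesis using step_function_initial[OF assms(1) True, of g] assms(5) by simp
next
  case False
  then obtain j where j: "j < Suc k" "s \<in> cell t k j" using cell_cases[OF assms(1,7,8)] by blast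
  define a where "a = node t k j"
  have a: "0 < a" "a \<le> s" "s \<le> 2 * a" "a < t"
    using node_bounds[OF assms(1) j(1)] j(2) unfolding a_def cell_def by auto
  have "a powr (-\<gamma>) \<le> (s/2) powr (-\<gamma>)" using a assms by (intro powr_mono2') auto
  also have "\<dots> = 2 powr \<gamma> * s powr (-\<gamma>)" using assms by (simp add: powr_divide powr_minus_divide)
  also have "\<dots> \<le> 2 powr 1 * s powr (-\<gamma>)" using assms by (intro mult_right_mono powr_mono) auto
  finally have 1: "a powr (-\<gamma>) \<le> 2 * s powr (-\<gamma>)" by simp
  have 2: "(t - a) powr (-\<beta>) \<le> (t - s) powr (-\<beta>)" using a assms by (intro powr_mono2') auto
  have "abel_kernel \<beta> \<gamma> t a \<le> (t - s) powr (-\<beta>) * (2 * s powr (-\<gamma>))"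
    unfolding abel_kernel_def by (intro mult_mono 1 2) auto
  then have "C * abel_kernel \<beta> \<gamma> t a \<le> C * (2 * abel_kernel \<beta> \<gamma> t s)"
    using assms(5) by (intro mult_left_mono) (auto simp: abel_kernel_def)
  then show ?thesis
    using assms(6)[OF a(1,4)] step_function_cell[OF assms(1) j, of g] by (simp add: a_def)
qed

text \<open>A finite sum of indicators times continuous functions of s, from which measurability of
  the error is read off.\<close>

lemma step_function_error_eq:
  assumes "t > 0" "0 < s" "s < t"
  shows "Lp_norm p \<Omega> (\<lambda>x. g s x - step_function t g k s x) =
    (\<Sum>j<Suc k. indicat_real (cell t k j) s * Lp_norm p \<Omega> (\<lambda>x. g s x - g (node t k j) x))
      + indicat_real {..<node t k 0} s * Lp_norm p \<Omega> (g s)"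
proof (cases "s < node t k 0")
  case True
  have "s \<notin> cell t k i" for i
  proof -
    have "node t k 0 \<le> node t k i" using assms(1) by (auto simp: node_def intro!: divide_right_mono mult_left_mono)
    then show ?thesis using True by (auto simp: cell_def)
  qed
  then show ?thesis using True step_function_initial[OF assms(1) True, of g] by simp
next
  case False
  then obtain j where j: "j < Suc k" "s \<in> cell t k j" using cell_cases[OF assms] by blast
  have "(\<Sum>i<Suc k. indicat_real (cell t k i) s * Lp_norm p \<Omega> (\<lambda>x. g s x - g (node t k i) x)) =
      (\<Sum>i<Suc k. if i = j then Lp_norm p \<Omega> (\<lambda>x. g s x - g (node t k j) x) else 0)"
    unfolding indicator_cell[OF assms(1) j(2)] by (intro sum.cong) auto
  then show ?thesis using j False step_function_cell[OF assms(1) j, of g] by simp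
qed

text \<open>The error \<open>D k\<close> of the step functions tends to 0 pointwise below a multiple
  of the kernel, so its integral tends to 0. By duality the Riemann sums are then Cauchy, and their
  limit is the integral.\<close>

lemma is_integral_exists:
  assumes t: "t > 0" and \<beta>: "0 \<le> \<beta>" "\<beta> < 1" and \<gamma>: "0 \<le> \<gamma>" "\<gamma> < 1" and C: "C \<ge> 0"
    and g: "\<And>s. 0 < s \<Longrightarrow> s < t \<Longrightarrow> g s \<in> Lp_sigma p \<Omega>"
    and cont: "norm_continuous p \<Omega> {0<..<t} g"
    and bound: "\<And>s. 0 < s \<Longrightarrow> s < t \<Longrightarrow> Lp_norm p \<Omega> (g s) \<le> C * abel_kernel \<beta> \<gamma> t s"
  shows "\<exists>w. is_integral t g w"
proof -
  interpret c: conjugate_exponents p p' by (rule conj_p')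
  define M where "M = lebesgue_on {0<..<t}"
  define D where "D k s = Lp_norm p \<Omega> (\<lambda>x. g s x - step_function t g k s x)" for k s
  have gL: "g s \<in> Lp p \<Omega>" if "0 < s" "s < t" for s using g[OF that] by (rule Lp_sigma_Lp)
  have nodeL: "g (node t k j) \<in> Lp p \<Omega>" if "j < Suc k" for k j
    using gL node_bounds(1,2)[OF t that] by blast
  have stepL: "step_function t g k s \<in> Lp p \<Omega>" for k s
    unfolding step_function_def by (rule Lp_sum[OF Lp_scaleR[OF nodeL] p_ge_1]) auto
  have kint: "integrable M (\<lambda>s. C * abel_kernel \<beta> \<gamma> t s)"
    unfolding M_def using kernel_integrable[OF \<beta>(2) \<gamma>(2) t] by simp
  have meas_cont: "f \<in> borel_measurable M" if "continuous_on {0<..<t} f" for f :: "real \<Rightarrow> real"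
    unfolding M_def by (rule continuous_imp_measurable_on_sets_lebesgue[OF that]) simp
  have cellM[measurable]: "cell t k j \<in> sets M" if "j < Suc k" for k j
    unfolding M_def using cell_subset[OF t that] by (auto simp: sets_restrict_space_iff cell_def)
  have initM[measurable]: "{..<node t k 0} \<inter> {0<..<t} \<in> sets M" for k
    unfolding M_def by (auto simp: sets_restrict_space_iff)
  have Dm: "D k \<in> borel_measurable M" for k
  proof -
    have "(\<lambda>s. (\<Sum>j<Suc k. indicat_real (cell t k j) s * Lp_norm p \<Omega> (\<lambda>x. g s x - g (node t k j) x))
      + indicat_real ({..<node t k 0} \<inter> {0<..<t}) s * Lp_norm p \<Omega> (g s)) \<in> borel_measurable M"
      by (intro borel_measurable_add borel_measurable_sum borel_measurable_times borel_measurable_indicator cellM initM meas_cont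
          continuous_on_Lp_norm norm_continuous_diff cont norm_continuous_const nodeL p_ge_1) auto
    then show ?thesis
      by (rule measurable_cong[THEN iffD1, rotated])
         (auto simp: M_def D_def step_function_error_eq[OF t] indicator_def)
  qed
  \<comment> \<open>One share for g and two for its step function.\<close>
  have Dbound: "D k s \<le> 3 * (C * abel_kernel \<beta> \<gamma> t s)" if s: "0 < s" "s < t" for k s
    using Lp_norm_diff_le[OF gL[OF s] stepL p_ge_1, of k s] bound[OF s] step_function_bound[OF t \<beta>(1) \<gamma> C bound s, of k]
    by (simp add: D_def)
  have D0: "0 \<le> D k s" for k s by (simp add: D_def)
  have Dint: "integrable M (D k)" for k
  proof (rule Bochner_Integration.integrable_bound[OF integrable_mult_right[OF kint, of 3] Dm])
    show "AE s in M. norm (D k s) \<le> norm (3 * (C * abel_kernel \<beta> \<gamma> t s))"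
      using Dbound D0 C by (intro AE_I2) (auto simp: M_def)
  qed
  have Dlim: "(\<lambda>k. D k s) \<longlonglongrightarrow> 0" if s: "0 < s" "s < t" for s
  proof (rule LIMSEQ_I)
    fix e :: real assume e: "e > 0"
    have "((\<lambda>r. Lp_norm p \<Omega> (\<lambda>x. g r x - g s x)) \<longlongrightarrow> 0) (at s within {0<..<t})"
      using cont s by (simp add: norm_continuous_def)
    then have "\<forall>\<^sub>F r in at s within {0<..<t}. Lp_norm p \<Omega> (\<lambda>x. g r x - g s x) < e"
      using order_tendstoD(2) e by blast
    then obtain d where d: "d > 0" "\<And>r. r \<in> {0<..<t} \<Longrightarrow> r \<noteq> s \<Longrightarrow> dist r s < d \<Longrightarrow> Lp_norm p \<Omega> (\<lambda>x. g r x - g s x) < e"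
      unfolding eventually_at by blast
    \<comment> \<open>Beyond N the mesh is below s, so s is not in the omitted first cell, and below
      d, so the node of its cell is close to s.\<close>
    obtain N where N: "t / min s d < real N" using reals_Archimedean2 by blast
    have "norm (D k s - 0) < e" if k: "k \<ge> N" for k
    proof -
      have "t / min s d < real k + 2" using N k by linarith
      moreover have "min s d > 0" "real k + 2 > 0" using s d(1) by auto
      ultimately have tk: "t / (real k + 2) < min s d" by (simp only: pos_divide_less_eq mult.commute)
      then have "\<not> s < node t k 0" by (simp add: node_def)
      then obtain j where j: "j < Suc k" "s \<in> cell t k j" using cell_cases[OF t s] by blast
      have nb: "node t k j \<in> {0<..<t}" "dist (node t k j) s < d"
        using node_bounds[OF t j(1)] j(2) tk by (auto simp: cell_def dist_real_def)
      have "D k s = Lp_norm p \<Omega> (\<lambda>x. g s x - g (node t k j) x)"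
        using step_function_cell[OF t j, of g] by (simp add: D_def)
      also have "\<dots> = Lp_norm p \<Omega> (\<lambda>x. g (node t k j) x - g s x)" by (rule Lp_norm_minus_commute)
      also have "\<dots> < e"
        using d(2)[OF nb(1) _ nb(2)] e by (cases "node t k j = s") auto
      finally show ?thesis using D0 by simp
    qed
    then show "\<exists>no. \<forall>k\<ge>no. norm (D k s - 0) < e" by blast
  qed
  have DI: "(\<lambda>k. LINT s|M. D k s) \<longlonglongrightarrow> 0"
  proof -
    have "(\<lambda>k. LINT s|M. D k s) \<longlonglongrightarrow> (LINT s|M. 0)"
    proof (rule integral_dominated_convergence[where w = "\<lambda>s. 3 * (C * abel_kernel \<beta> \<gamma> t s)"])
      show "integrable M (\<lambda>s. 3 * (C * abel_kernel \<beta> \<gamma> t s))" using kint by simp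
      show "AE s in M. (\<lambda>k. D k s) \<longlonglongrightarrow> 0" using Dlim by (intro AE_I2) (auto simp: M_def)
      show "AE s in M. norm (D k s) \<le> 3 * (C * abel_kernel \<beta> \<gamma> t s)" for k
        using Dbound D0 by (intro AE_I2) (auto simp: M_def)
    qed (use Dm in auto)
    then show ?thesis by simp
  qed
  define W where "W = riemann_sum t g"
  have WL: "W k \<in> Lp p \<Omega>" for k
    unfolding W_def riemann_sum_def by (rule Lp_sum[OF Lp_scaleR[OF nodeL] p_ge_1]) auto
  have W\<sigma>: "W k \<in> Lp_sigma p \<Omega>" for k
    unfolding W_def riemann_sum_def by (rule sum[OF scaleR[OF g]]) (use node_bounds(1,2)[OF t] in auto)
  have pair_step: "integrable M (\<lambda>s. pairing \<Omega> (step_function t g k s) \<phi>)"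
      "pairing \<Omega> (W k) \<phi> = (LINT s|M. pairing \<Omega> (step_function t g k s) \<phi>)" if \<phi>: "\<phi> \<in> Lp p' \<Omega>" for k \<phi>
  proof -
    have e: "pairing \<Omega> (step_function t g k s) \<phi> = (\<Sum>j<Suc k. indicat_real (cell t k j) s * pairing \<Omega> (g (node t k j)) \<phi>)" for s
      unfolding step_function_def by (subst c.pairing_sum_left[OF Lp_scaleR[OF nodeL] \<phi>]) auto
    have ci: "integrable M (indicat_real (cell t k j))" "(LINT s|M. indicat_real (cell t k j) s) = t / (real k + 2)"
      if "j < Suc k" for j
    proof -
      have fin: "finite_measure M" unfolding M_def by (rule finite_measure_lebesgue_on) simp
      then have "emeasure M (cell t k j) < \<infinity>"
        by (simp add: finite_measure.emeasure_finite less_top[symmetric])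
      then show "integrable M (indicat_real (cell t k j))" using cellM[OF that] by (simp add: integrable_indicator_iff)
      have "(LINT s|M. indicat_real (cell t k j) s) = measure M (cell t k j)"
        using sets.sets_into_space[OF cellM[OF that]] by (simp add: Int_absorb2)
      also have "\<dots> = measure lebesgue (cell t k j)"
        unfolding M_def using cell_subset[OF t that] by (simp add: measure_restrict_space)
      finally show "(LINT s|M. indicat_real (cell t k j) s) = t / (real k + 2)" using cell_measure[OF t that] by simp
    qed
    show "integrable M (\<lambda>s. pairing \<Omega> (step_function t g k s) \<phi>)"
      unfolding e by (intro Bochner_Integration.integrable_sum integrable_mult_left ci) auto
    have "(LINT s|M. pairing \<Omega> (step_function t g k s) \<phi>) = (\<Sum>j<Suc k. t / (real k + 2) * pairing \<Omega> (g (node t k j)) \<phi>)"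
    proof -
      have "(LINT s|M. pairing \<Omega> (step_function t g k s) \<phi>) =
          (\<Sum>j<Suc k. (LINT s|M. indicat_real (cell t k j) s * pairing \<Omega> (g (node t k j)) \<phi>))"
        unfolding e by (rule Bochner_Integration.integral_sum) (auto intro!: integrable_mult_left ci)
      also have "\<dots> = (\<Sum>j<Suc k. t / (real k + 2) * pairing \<Omega> (g (node t k j)) \<phi>)"
        by (rule sum.cong[OF refl]) (simp only: integral_mult_left_zero ci(2) lessThan_iff)
      finally show ?thesis .
    qed
    also have "\<dots> = pairing \<Omega> (W k) \<phi>"
      unfolding W_def riemann_sum_def by (subst c.pairing_sum_left[OF Lp_scaleR[OF nodeL] \<phi>]) auto
    finally show "pairing \<Omega> (W k) \<phi> = (LINT s|M. pairing \<Omega> (step_function t g k s) \<phi>)" by simp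
  qed
  have pair_g: "integrable M (\<lambda>s. pairing \<Omega> (g s) \<phi>)" if \<phi>: "\<phi> \<in> Lp p' \<Omega>" for \<phi>
  proof (rule Bochner_Integration.integrable_bound[OF integrable_mult_left[OF kint, of "Lp_norm p' \<Omega> \<phi>"]])
    show "(\<lambda>s. pairing \<Omega> (g s) \<phi>) \<in> borel_measurable M" by (rule meas_cont[OF c.continuous_on_pairing[OF cont \<phi>]])
    have "\<bar>pairing \<Omega> (g s) \<phi>\<bar> \<le> \<bar>C * abel_kernel \<beta> \<gamma> t s * Lp_norm p' \<Omega> \<phi>\<bar>" if s: "0 < s" "s < t" for s
    proof -
      have "\<bar>pairing \<Omega> (g s) \<phi>\<bar> \<le> Lp_norm p \<Omega> (g s) * Lp_norm p' \<Omega> \<phi>" by (rule c.pairing_le[OF gL[OF s] \<phi>])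
      also have "\<dots> \<le> C * abel_kernel \<beta> \<gamma> t s * Lp_norm p' \<Omega> \<phi>" by (intro mult_right_mono bound s) auto
      finally show ?thesis by simp
    qed
    then show "AE s in M. norm (pairing \<Omega> (g s) \<phi>) \<le> norm (C * abel_kernel \<beta> \<gamma> t s * Lp_norm p' \<Omega> \<phi>)"
      by (intro AE_I2) (auto simp: M_def)
  qed
  have approx: "\<bar>pairing \<Omega> (W k) \<phi> - (LINT s|M. pairing \<Omega> (g s) \<phi>)\<bar> \<le> (LINT s|M. D k s) * Lp_norm p' \<Omega> \<phi>"
    if \<phi>: "\<phi> \<in> Lp p' \<Omega>" for k \<phi>
  proof -
    have "pairing \<Omega> (W k) \<phi> - (LINT s|M. pairing \<Omega> (g s) \<phi>) =
       (LINT s|M. pairing \<Omega> (step_function t g k s) \<phi> - pairing \<Omega> (g s) \<phi>)"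
      using pair_step[OF \<phi>] pair_g[OF \<phi>] by simp
    also have "\<bar>\<dots>\<bar> \<le> (LINT s|M. \<bar>pairing \<Omega> (step_function t g k s) \<phi> - pairing \<Omega> (g s) \<phi>\<bar>)"
      by (rule integral_abs_bound)
    also have "\<dots> \<le> (LINT s|M. D k s * Lp_norm p' \<Omega> \<phi>)"
    proof (rule integral_mono)
      show "integrable M (\<lambda>s. \<bar>pairing \<Omega> (step_function t g k s) \<phi> - pairing \<Omega> (g s) \<phi>\<bar>)"
        using pair_step(1)[OF \<phi>] pair_g[OF \<phi>] by auto
      show "integrable M (\<lambda>s. D k s * Lp_norm p' \<Omega> \<phi>)" using Dint by auto
      fix s assume "s \<in> space M"
      then have s: "0 < s" "s < t" by (auto simp: M_def)
      have "\<bar>pairing \<Omega> (\<lambda>x. g s x - step_function t g k s x) \<phi>\<bar> \<le> D k s * Lp_norm p' \<Omega> \<phi>"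
        unfolding D_def by (rule c.pairing_le[OF Lp_diff[OF gL[OF s] stepL p_ge_1] \<phi>])
      then show "\<bar>pairing \<Omega> (step_function t g k s) \<phi> - pairing \<Omega> (g s) \<phi>\<bar> \<le> D k s * Lp_norm p' \<Omega> \<phi>"
        by (simp add: c.pairing_diff_left[OF gL[OF s] stepL \<phi>] abs_minus_commute)
    qed
    finally show ?thesis by simp
  qed
  \<comment> \<open>Each Riemann sum, tested with \<phi>, differs from the same scalar integral by
    at most the integral of its error.\<close>
  have WW: "Lp_norm p \<Omega> (\<lambda>x. W j x - W k x) \<le> (LINT s|M. D j s) + (LINT s|M. D k s)" for j k
  proof (rule c.Lp_norm_le_by_duality[OF Lp_diff[OF WL WL p_ge_1]])
    fix \<phi> :: "'n field" assume \<phi>: "\<phi> \<in> Lp p' \<Omega>" "Lp_norm p' \<Omega> \<phi> \<le> 1"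
    have "(LINT s|M. D i s) * Lp_norm p' \<Omega> \<phi> \<le> (LINT s|M. D i s)" for i
      using \<phi>(2) D0 by (intro mult_left_le) (auto intro!: integral_nonneg_AE)
    then show "pairing \<Omega> (\<lambda>x. W j x - W k x) \<phi> \<le> (LINT s|M. D j s) + (LINT s|M. D k s)"
      using approx[OF \<phi>(1), of j] approx[OF \<phi>(1), of k] c.pairing_diff_left[OF WL WL \<phi>(1), of j k]
      by (smt (verit))
  qed
  have Cauchy: "\<exists>K. \<forall>j\<ge>K. \<forall>k\<ge>K. Lp_norm p \<Omega> (\<lambda>x. W j x - W k x) < e" if e: "e > 0" for e
  proof -
    have "\<forall>\<^sub>F k in sequentially. (LINT s|M. D k s) < e/2"
      using order_tendstoD(2)[OF DI, of "e/2"] e by simp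
    then obtain K where K: "\<And>k. k \<ge> K \<Longrightarrow> (LINT s|M. D k s) < e/2" unfolding eventually_sequentially by blast
    have "Lp_norm p \<Omega> (\<lambda>x. W j x - W k x) < e" if "j \<ge> K" "k \<ge> K" for j k
      using WW[of j k] K[OF that(1)] K[OF that(2)] by simp
    then show ?thesis by blast
  qed
  from complete[OF W\<sigma> Cauchy] obtain w where w: "w \<in> Lp_sigma p \<Omega>" "(\<lambda>k. Lp_norm p \<Omega> (\<lambda>x. W k x - w x)) \<longlonglongrightarrow> 0"
    by blast
  have pettis: "pairing \<Omega> w \<phi> = (LINT s|M. pairing \<Omega> (g s) \<phi>)" if \<phi>: "\<phi> \<in> Lp p' \<Omega>" for \<phi>
  proof -
    have 1: "(\<lambda>k. pairing \<Omega> (W k) \<phi>) \<longlonglongrightarrow> pairing \<Omega> w \<phi>"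
      by (rule c.tendsto_pairing[OF Lp_sigma_Lp[OF w(1)] \<phi> _ _ w(2)]) (use WL \<phi> in auto)
    have 2: "(\<lambda>k. pairing \<Omega> (W k) \<phi>) \<longlonglongrightarrow> (LINT s|M. pairing \<Omega> (g s) \<phi>)"
    proof (rule LIM_zero_cancel, rule Lim_null_comparison)
      show "\<forall>\<^sub>F k in sequentially. norm (pairing \<Omega> (W k) \<phi> - (LINT s|M. pairing \<Omega> (g s) \<phi>)) \<le> (LINT s|M. D k s) * Lp_norm p' \<Omega> \<phi>"
        using approx[OF \<phi>] by simp
      show "(\<lambda>k. (LINT s|M. D k s) * Lp_norm p' \<Omega> \<phi>) \<longlonglongrightarrow> 0" using tendsto_mult_left_zero[OF DI] by simp
    qed
    show ?thesis using LIMSEQ_unique[OF 1 2] .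
  qed
  \<comment> \<open>The Bochner integral is defined with sets for every j; indices beyond k get the
    empty set.\<close>
  define E where "E k j = (if j < Suc k then cell t k j else {})" for k j
  have bochner: "has_Lp_bochner_integral p \<Omega> {0<..<t} g w"
    unfolding has_Lp_bochner_integral_def
  proof (intro conjI ballI)
    show "w \<in> Lp p \<Omega>" using w Lp_sigma_Lp by blast
    show "g s \<in> Lp p \<Omega>" if "s \<in> {0<..<t}" for s using that gL by simp
    have sum1: "(\<Sum>j<Suc k. indicat_real (E k j) s *\<^sub>R (if j < Suc k then g (node t k j) else (\<lambda>_. 0)) x) = step_function t g k s x" for k s x
      unfolding step_function_def E_def by (intro sum.cong) auto
    have sum2: "(\<Sum>j<Suc k. measure lebesgue (E k j) *\<^sub>R (if j < Suc k then g (node t k j) else (\<lambda>_. 0)) x) = W k x" for k x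
      unfolding W_def riemann_sum_def E_def by (intro sum.cong) (auto simp: cell_measure[OF t])
    have "(\<lambda>k. Lp_norm p \<Omega> (\<lambda>x. w x - W k x)) \<longlonglongrightarrow> 0" using w(2) Lp_norm_minus_commute[of p \<Omega> w] by simp
    then show "\<exists>(m :: nat \<Rightarrow> nat) (E :: nat \<Rightarrow> nat \<Rightarrow> real set) (c :: nat \<Rightarrow> nat \<Rightarrow> 'n field).
        (\<forall>k j. E k j \<in> lmeasurable \<and> E k j \<subseteq> {0<..<t} \<and> c k j \<in> Lp p \<Omega>) \<and>
        (\<forall>k. integrable (lebesgue_on {0<..<t})
           (\<lambda>s. Lp_norm p \<Omega> (\<lambda>x. g s x - (\<Sum>j<m k. indicat_real (E k j) s *\<^sub>R c k j x)))) \<and>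
        (\<lambda>k. LINT s|lebesgue_on {0<..<t}.
           Lp_norm p \<Omega> (\<lambda>x. g s x - (\<Sum>j<m k. indicat_real (E k j) s *\<^sub>R c k j x))) \<longlonglongrightarrow> 0 \<and>
        (\<lambda>k. Lp_norm p \<Omega> (\<lambda>x. w x - (\<Sum>j<m k. measure lebesgue (E k j) *\<^sub>R c k j x))) \<longlonglongrightarrow> 0"
      apply (intro exI[of _ Suc] exI[of _ E] exI[of _ "\<lambda>k j. if j < Suc k then g (node t k j) else (\<lambda>_. 0)"])
      unfolding sum1 sum2
      using Dint DI nodeL cell_subset[OF t] cell_lmeasurable by (auto simp: E_def D_def[abs_def] M_def)
  qed
  show ?thesis
    unfolding is_integral_def using w bochner pettis pair_g
    by (intro exI[of _ w] conjI ballI) (simp_all add: W_def M_def)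
qed

text \<open>Against a test function of norm at most 1 the integrand is at most h, and such test
  functions determine the norm.\<close>

lemma is_integral_norm_le:
  assumes "is_integral t g w" "\<And>s. 0 < s \<Longrightarrow> s < t \<Longrightarrow> g s \<in> Lp p \<Omega>"
    "integrable (lebesgue_on {0<..<t}) h" "\<And>s. 0 < s \<Longrightarrow> s < t \<Longrightarrow> Lp_norm p \<Omega> (g s) \<le> h s"
  shows "Lp_norm p \<Omega> w \<le> (LINT s|lebesgue_on {0<..<t}. h s)"
proof -
  interpret c: conjugate_exponents p p' by (rule conj_p')
  have "w \<in> Lp p \<Omega>" using assms(1) Lp_sigma_Lp by (auto simp: is_integral_def)
  then show ?thesis
  proof (rule c.Lp_norm_le_by_duality)
    fix \<phi> :: "'n field" assume \<phi>: "\<phi> \<in> Lp p' \<Omega>" "Lp_norm p' \<Omega> \<phi> \<le> 1"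
    have "pairing \<Omega> (g s) \<phi> \<le> h s" if s: "0 < s" "s < t" for s
    proof -
      have "pairing \<Omega> (g s) \<phi> \<le> Lp_norm p \<Omega> (g s) * Lp_norm p' \<Omega> \<phi>"
        using c.pairing_le[OF assms(2)[OF s] \<phi>(1)] by linarith
      also have "\<dots> \<le> Lp_norm p \<Omega> (g s) * 1" using \<phi>(2) by (intro mult_left_mono) auto
      finally show ?thesis using assms(4)[OF s] by simp
    qed
    then show "pairing \<Omega> w \<phi> \<le> (LINT s|lebesgue_on {0<..<t}. h s)"
      using assms(1,3) \<phi>(1) unfolding is_integral_def by (auto intro!: integral_mono)
  qed
qed

lemma is_integral_diff_le:
  assumes "is_integral t g w" "is_integral t g' w'"
    "\<And>s. 0 < s \<Longrightarrow> s < t \<Longrightarrow> g s \<in> Lp p \<Omega>" "\<And>s. 0 < s \<Longrightarrow> s < t \<Longrightarrow> g' s \<in> Lp p \<Omega>"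
    "integrable (lebesgue_on {0<..<t}) h" "\<And>s. 0 < s \<Longrightarrow> s < t \<Longrightarrow> Lp_norm p \<Omega> (\<lambda>x. g s x - g' s x) \<le> h s"
  shows "Lp_norm p \<Omega> (\<lambda>x. w x - w' x) \<le> (LINT s|lebesgue_on {0<..<t}. h s)"
proof -
  interpret c: conjugate_exponents p p' by (rule conj_p')
  have L: "w \<in> Lp p \<Omega>" "w' \<in> Lp p \<Omega>" using assms(1,2) Lp_sigma_Lp by (auto simp: is_integral_def)
  show ?thesis
  proof (rule c.Lp_norm_le_by_duality[OF Lp_diff[OF L p_ge_1]])
    fix \<phi> :: "'n field" assume \<phi>: "\<phi> \<in> Lp p' \<Omega>" "Lp_norm p' \<Omega> \<phi> \<le> 1"
    have i: "integrable (lebesgue_on {0<..<t}) (\<lambda>s. pairing \<Omega> (g s) \<phi>)" "integrable (lebesgue_on {0<..<t}) (\<lambda>s. pairing \<Omega> (g' s) \<phi>)"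
      using assms(1,2) \<phi> unfolding is_integral_def by blast+
    have le: "pairing \<Omega> (g s) \<phi> - pairing \<Omega> (g' s) \<phi> \<le> h s" if s: "0 < s" "s < t" for s
    proof -
      have "pairing \<Omega> (g s) \<phi> - pairing \<Omega> (g' s) \<phi> \<le> Lp_norm p \<Omega> (\<lambda>x. g s x - g' s x) * Lp_norm p' \<Omega> \<phi>"
        using c.pairing_le[OF Lp_diff[OF assms(3)[OF s] assms(4)[OF s] p_ge_1] \<phi>(1)]
          c.pairing_diff_left[OF assms(3)[OF s] assms(4)[OF s] \<phi>(1)] by linarith
      also have "\<dots> \<le> Lp_norm p \<Omega> (\<lambda>x. g s x - g' s x) * 1" using \<phi>(2) by (intro mult_left_mono) auto
      finally show ?thesis using assms(6)[OF s] by simp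
    qed
    have "pairing \<Omega> (\<lambda>x. w x - w' x) \<phi> = (LINT s|lebesgue_on {0<..<t}. pairing \<Omega> (g s) \<phi> - pairing \<Omega> (g' s) \<phi>)"
      using assms(1,2) \<phi>(1) i c.pairing_diff_left[OF L \<phi>(1)] unfolding is_integral_def by simp
    also have "\<dots> \<le> (LINT s|lebesgue_on {0<..<t}. h s)"
      using le i assms(5) by (intro integral_mono) auto
    finally show "pairing \<Omega> (\<lambda>x. w x - w' x) \<phi> \<le> (LINT s|lebesgue_on {0<..<t}. h s)" .
  qed
qed

text \<open>Both the interval and the integrand change with the upper limit. Rescaled to (0,1), the
  integrands converge pointwise and share a majorant, a multiple of the kernel for t = 1.\<close>

lemma is_integral_continuous:
  assumes t0: "t0 > 0" and X: "X \<longlonglongrightarrow> t0" "\<And>n::nat. X n > 0"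
    and w: "\<And>n. is_integral (X n) (g (X n)) (w (X n))" "is_integral t0 (g t0) (w t0)"
    and par: "\<beta> < 1" "\<gamma> < 1" "C \<ge> 0"
    and gcont: "\<And>n. norm_continuous p \<Omega> {0<..<X n} (g (X n))" "norm_continuous p \<Omega> {0<..<t0} (g t0)"
    and bound: "\<And>n s. 0 < s \<Longrightarrow> s < X n \<Longrightarrow> Lp_norm p \<Omega> (g (X n) s) \<le> C * abel_kernel \<beta> \<gamma> (X n) s"
      "\<And>s. 0 < s \<Longrightarrow> s < t0 \<Longrightarrow> Lp_norm p \<Omega> (g t0 s) \<le> C * abel_kernel \<beta> \<gamma> t0 s"
    and lim: "\<And>\<sigma>. 0 < \<sigma> \<Longrightarrow> \<sigma> < 1 \<Longrightarrow> (\<lambda>n. Lp_norm p \<Omega> (\<lambda>x. g (X n) (X n * \<sigma>) x - g t0 (t0 * \<sigma>) x)) \<longlonglongrightarrow> 0"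
  shows "(\<lambda>n. Lp_norm p \<Omega> (\<lambda>x. w (X n) x - w t0 x)) \<longlonglongrightarrow> 0"
proof -
  interpret c: conjugate_exponents p p' by (rule conj_p')
  define M :: "real measure" where "M = lebesgue_on {0<..<1}"
  define G where "G t \<sigma> = (\<lambda>x. t *\<^sub>R g t (t * \<sigma>) x)" for t \<sigma>
  define H where "H n \<sigma> = Lp_norm p \<Omega> (\<lambda>x. G (X n) \<sigma> x - G t0 \<sigma> x)" for n \<sigma>
  have Gcont: "norm_continuous p \<Omega> {0<..<1} (G t)" if t: "t > 0" and g: "norm_continuous p \<Omega> {0<..<t} (g t)" for t
    unfolding norm_continuous_def
  proof (intro ballI conjI)
    fix \<sigma> :: real assume \<sigma>: "\<sigma> \<in> {0<..<1}"
    then have ts: "t * \<sigma> \<in> {0<..<t}" using t by auto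
    show "G t \<sigma> \<in> Lp p \<Omega>" unfolding G_def using norm_continuous_Lp[OF g ts] by (rule Lp_scaleR)
    have "((\<lambda>r. Lp_norm p \<Omega> (\<lambda>x. g t r x - g t (t * \<sigma>) x)) \<longlongrightarrow> 0) (at (t * \<sigma>) within {0<..<t})"
      using g ts by (simp add: norm_continuous_def)
    moreover have "filterlim (\<lambda>r. t * r) (at (t * \<sigma>) within {0<..<t}) (at \<sigma> within {0<..<1})"
      using t by (auto simp: filterlim_at eventually_at_filter intro!: tendsto_eq_intros)
    ultimately have "((\<lambda>r. Lp_norm p \<Omega> (\<lambda>x. g t (t * r) x - g t (t * \<sigma>) x)) \<longlongrightarrow> 0) (at \<sigma> within {0<..<1})"
      by (rule filterlim_compose)
    then have "((\<lambda>r. t * Lp_norm p \<Omega> (\<lambda>x. g t (t * r) x - g t (t * \<sigma>) x)) \<longlongrightarrow> 0) (at \<sigma> within {0<..<1})"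
      by (rule tendsto_mult_right_zero)
    moreover have "Lp_norm p \<Omega> (\<lambda>x. G t r x - G t \<sigma> x) = t * Lp_norm p \<Omega> (\<lambda>x. g t (t * r) x - g t (t * \<sigma>) x)" for r
      using Lp_norm_scaleR[OF p_pos, of \<Omega> t "\<lambda>x. g t (t * r) x - g t (t * \<sigma>) x"] t by (simp add: G_def scaleR_diff_right)
    ultimately show "((\<lambda>r. Lp_norm p \<Omega> (\<lambda>x. G t r x - G t \<sigma> x)) \<longlongrightarrow> 0) (at \<sigma> within {0<..<1})" by simp
  qed
  have GcX: "norm_continuous p \<Omega> {0<..<1} (G (X n))" for n by (rule Gcont[OF X(2) gcont(1)])
  have Gc0: "norm_continuous p \<Omega> {0<..<1} (G t0)" by (rule Gcont[OF t0 gcont(2)])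
  have Gb: "Lp_norm p \<Omega> (G t \<sigma>) \<le> C * t powr (1 - \<beta> - \<gamma>) * abel_kernel \<beta> \<gamma> 1 \<sigma>"
    if t: "t > 0" and b: "\<And>s. 0 < s \<Longrightarrow> s < t \<Longrightarrow> Lp_norm p \<Omega> (g t s) \<le> C * abel_kernel \<beta> \<gamma> t s" and \<sigma>: "0 < \<sigma>" "\<sigma> < 1" for t \<sigma>
  proof -
    have "Lp_norm p \<Omega> (G t \<sigma>) = t * Lp_norm p \<Omega> (g t (t * \<sigma>))"
      unfolding G_def using Lp_norm_scaleR[OF p_pos, of \<Omega> t "g t (t * \<sigma>)"] t by simp
    also have "\<dots> \<le> t * (C * abel_kernel \<beta> \<gamma> t (t * \<sigma>))" using t \<sigma> by (intro mult_left_mono b) auto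
    also have "\<dots> = C * (t * abel_kernel \<beta> \<gamma> t (t * \<sigma>))" by (simp only: mult_ac)
    also have "\<dots> = C * t powr (1 - \<beta> - \<gamma>) * abel_kernel \<beta> \<gamma> 1 \<sigma>" unfolding kernel_rescale[OF t \<sigma>] by (simp only: mult_ac)
    finally show ?thesis .
  qed
  have Xlim: "(\<lambda>n. X n powr (1 - \<beta> - \<gamma>)) \<longlonglongrightarrow> t0 powr (1 - \<beta> - \<gamma>)"
    by (intro tendsto_intros X) (use t0 in simp)
  \<comment> \<open>The scaling factors converge and hence are bounded, which makes the majorant
    uniform in n.\<close>
  then obtain B where B: "\<And>n. X n powr (1 - \<beta> - \<gamma>) \<le> B"
    using convergent_imp_Bseq[of "\<lambda>n. X n powr (1 - \<beta> - \<gamma>)"] unfolding Bseq_def convergent_def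
    by (auto simp: abs_le_iff)
  have B0: "t0 powr (1 - \<beta> - \<gamma>) \<le> B" by (rule LIMSEQ_le_const2[OF Xlim]) (use B in auto)
  have Hm: "H n \<in> borel_measurable M" for n
    unfolding M_def H_def
    by (rule continuous_imp_measurable_on_sets_lebesgue[OF continuous_on_Lp_norm[OF norm_continuous_diff[OF GcX Gc0 p_ge_1] p_ge_1]]) simp
  have GL: "G (X n) \<sigma> \<in> Lp p \<Omega>" "G t0 \<sigma> \<in> Lp p \<Omega>" if "0 < \<sigma>" "\<sigma> < 1" for n \<sigma>
    using norm_continuous_Lp[OF GcX] norm_continuous_Lp[OF Gc0] that by auto
  have Hb: "H n \<sigma> \<le> 2 * C * B * abel_kernel \<beta> \<gamma> 1 \<sigma>" if \<sigma>: "0 < \<sigma>" "\<sigma> < 1" for n \<sigma>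
  proof -
    have "H n \<sigma> \<le> Lp_norm p \<Omega> (G (X n) \<sigma>) + Lp_norm p \<Omega> (G t0 \<sigma>)"
      unfolding H_def by (rule Lp_norm_diff_le[OF GL[OF \<sigma>] p_ge_1])
    also have "\<dots> \<le> C * X n powr (1 - \<beta> - \<gamma>) * abel_kernel \<beta> \<gamma> 1 \<sigma> + C * t0 powr (1 - \<beta> - \<gamma>) * abel_kernel \<beta> \<gamma> 1 \<sigma>"
      by (intro add_mono Gb X t0 bound \<sigma>)
    also have "\<dots> \<le> C * B * abel_kernel \<beta> \<gamma> 1 \<sigma> + C * B * abel_kernel \<beta> \<gamma> 1 \<sigma>"
      using par by (intro add_mono mult_right_mono mult_left_mono B B0) auto
    finally show ?thesis by (simp add: mult_ac)
  qed
  have H0: "0 \<le> H n \<sigma>" for n \<sigma> by (simp add: H_def)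
  have kint: "integrable M (\<lambda>\<sigma>. 2 * C * B * abel_kernel \<beta> \<gamma> 1 \<sigma>)" unfolding M_def using kernel_integrable_1[OF par(1,2)] by simp
  have Hint: "integrable M (H n)" for n
  proof (rule Bochner_Integration.integrable_bound[OF kint Hm], rule AE_I2)
    fix \<sigma> :: real assume "\<sigma> \<in> space M"
    then have "H n \<sigma> \<le> 2 * C * B * abel_kernel \<beta> \<gamma> 1 \<sigma>" by (intro Hb) (auto simp: M_def)
    then show "norm (H n \<sigma>) \<le> norm (2 * C * B * abel_kernel \<beta> \<gamma> 1 \<sigma>)" using H0[of n \<sigma>] unfolding real_norm_def by linarith
  qed
  have Hlim: "(\<lambda>n. H n \<sigma>) \<longlonglongrightarrow> 0" if \<sigma>: "0 < \<sigma>" "\<sigma> < 1" for \<sigma>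
  proof (rule Lim_null_comparison)
    have gL: "g (X n) (X n * \<sigma>) \<in> Lp p \<Omega>" "g t0 (t0 * \<sigma>) \<in> Lp p \<Omega>" for n
    proof -
      have "X n * \<sigma> \<in> {0<..<X n}" "t0 * \<sigma> \<in> {0<..<t0}" 
        using mult_strict_left_mono[OF \<sigma>(2) X(2)[of n]] mult_strict_left_mono[OF \<sigma>(2) t0]
          mult_pos_pos[OF X(2)[of n] \<sigma>(1)] mult_pos_pos[OF t0 \<sigma>(1)] by simp_all
      then show "g (X n) (X n * \<sigma>) \<in> Lp p \<Omega>" "g t0 (t0 * \<sigma>) \<in> Lp p \<Omega>"
        using norm_continuous_Lp[OF gcont(1)[of n]] norm_continuous_Lp[OF gcont(2)] by auto
    qed
    show "\<forall>\<^sub>F n in sequentially. norm (H n \<sigma>) \<le> X n * Lp_norm p \<Omega> (\<lambda>x. g (X n) (X n * \<sigma>) x - g t0 (t0 * \<sigma>) x) +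
        \<bar>X n - t0\<bar> * Lp_norm p \<Omega> (g t0 (t0 * \<sigma>))"
    proof (intro always_eventually allI)
      fix n
      have "(\<lambda>x. G (X n) \<sigma> x - G t0 \<sigma> x) = (\<lambda>x. X n *\<^sub>R (g (X n) (X n * \<sigma>) x - g t0 (t0 * \<sigma>) x) + (X n - t0) *\<^sub>R g t0 (t0 * \<sigma>) x)"
        by (simp add: G_def fun_eq_iff algebra_simps)
      then have "H n \<sigma> \<le> Lp_norm p \<Omega> (\<lambda>x. X n *\<^sub>R (g (X n) (X n * \<sigma>) x - g t0 (t0 * \<sigma>) x)) + Lp_norm p \<Omega> (\<lambda>x. (X n - t0) *\<^sub>R g t0 (t0 * \<sigma>) x)"
        unfolding H_def using Lp_norm_triangle[OF Lp_scaleR[OF Lp_diff[OF gL p_ge_1]] Lp_scaleR[OF gL(2)] p_ge_1] by simp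
      then show "norm (H n \<sigma>) \<le> X n * Lp_norm p \<Omega> (\<lambda>x. g (X n) (X n * \<sigma>) x - g t0 (t0 * \<sigma>) x) +
        \<bar>X n - t0\<bar> * Lp_norm p \<Omega> (g t0 (t0 * \<sigma>))"
        using X(2)[of n] H0[of n \<sigma>] by (simp add: Lp_norm_scaleR[OF p_pos])
    qed
    have "(\<lambda>n. X n * Lp_norm p \<Omega> (\<lambda>x. g (X n) (X n * \<sigma>) x - g t0 (t0 * \<sigma>) x) +
        \<bar>X n - t0\<bar> * Lp_norm p \<Omega> (g t0 (t0 * \<sigma>))) \<longlonglongrightarrow> t0 * 0 + \<bar>t0 - t0\<bar> * Lp_norm p \<Omega> (g t0 (t0 * \<sigma>))"
      by (intro tendsto_intros X lim \<sigma>)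
    then show "(\<lambda>n. X n * Lp_norm p \<Omega> (\<lambda>x. g (X n) (X n * \<sigma>) x - g t0 (t0 * \<sigma>) x) +
        \<bar>X n - t0\<bar> * Lp_norm p \<Omega> (g t0 (t0 * \<sigma>))) \<longlonglongrightarrow> 0" by simp
  qed
  have HI: "(\<lambda>n. LINT \<sigma>|M. H n \<sigma>) \<longlonglongrightarrow> 0"
  proof -
    have "(\<lambda>n. LINT \<sigma>|M. H n \<sigma>) \<longlonglongrightarrow> (LINT \<sigma>|M. 0)"
    proof (rule integral_dominated_convergence[OF _ Hm kint])
      show "AE \<sigma> in M. (\<lambda>n. H n \<sigma>) \<longlonglongrightarrow> 0" using Hlim by (intro AE_I2) (auto simp: M_def)
      show "AE \<sigma> in M. norm (H n \<sigma>) \<le> 2 * C * B * abel_kernel \<beta> \<gamma> 1 \<sigma>" for n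
        using Hb H0 by (intro AE_I2) (auto simp: M_def)
    qed simp
    then show ?thesis by simp
  qed
  have pettis: "integrable M (\<lambda>\<sigma>. pairing \<Omega> (G t \<sigma>) \<phi>) \<and> pairing \<Omega> (w t) \<phi> = (LINT \<sigma>|M. pairing \<Omega> (G t \<sigma>) \<phi>)"
    if t: "t > 0" "is_integral t (g t) (w t)" and \<phi>: "\<phi> \<in> Lp p' \<Omega>" for t \<phi>
  proof -
    have i: "integrable (lebesgue_on {0<..<t}) (\<lambda>s. pairing \<Omega> (g t s) \<phi>)"
       "pairing \<Omega> (w t) \<phi> = (LINT s|lebesgue_on {0<..<t}. pairing \<Omega> (g t s) \<phi>)"
      using t(2) \<phi> unfolding is_integral_def by blast+
    then show ?thesis
      using integrable_rescale[OF t(1), of "\<lambda>s. pairing \<Omega> (g t s) \<phi>"] integral_rescale[OF t(1) i(1)]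
      unfolding M_def G_def by simp
  qed
  have "Lp_norm p \<Omega> (\<lambda>x. w (X n) x - w t0 x) \<le> (LINT \<sigma>|M. H n \<sigma>)" for n
  proof -
    have L: "w (X n) \<in> Lp p \<Omega>" "w t0 \<in> Lp p \<Omega>"
      using w Lp_sigma_Lp unfolding is_integral_def by blast+
    show ?thesis
    proof (rule c.Lp_norm_le_by_duality[OF Lp_diff[OF L p_ge_1]])
      fix \<phi> :: "'n field" assume \<phi>: "\<phi> \<in> Lp p' \<Omega>" "Lp_norm p' \<Omega> \<phi> \<le> 1"
      note 1 = pettis[OF X(2) w(1) \<phi>(1), of n] and 2 = pettis[OF t0 w(2) \<phi>(1)]
      have le: "pairing \<Omega> (G (X n) \<sigma>) \<phi> - pairing \<Omega> (G t0 \<sigma>) \<phi> \<le> H n \<sigma>" if \<sigma>: "0 < \<sigma>" "\<sigma> < 1" for \<sigma>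
      proof -
        have "pairing \<Omega> (G (X n) \<sigma>) \<phi> - pairing \<Omega> (G t0 \<sigma>) \<phi> \<le> H n \<sigma> * Lp_norm p' \<Omega> \<phi>"
          using c.pairing_le[OF Lp_diff[OF GL[OF \<sigma>] p_ge_1] \<phi>(1), of n] c.pairing_diff_left[OF GL[OF \<sigma>] \<phi>(1), of n]
          unfolding H_def by linarith
        also have "\<dots> \<le> H n \<sigma> * 1" using \<phi>(2) H0 by (intro mult_left_mono) auto
        finally show ?thesis by simp
      qed
      have "pairing \<Omega> (\<lambda>x. w (X n) x - w t0 x) \<phi> = (LINT \<sigma>|M. pairing \<Omega> (G (X n) \<sigma>) \<phi> - pairing \<Omega> (G t0 \<sigma>) \<phi>)"
        using 1 2 c.pairing_diff_left[OF L \<phi>(1)] by simp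
      also have "\<dots> \<le> (LINT \<sigma>|M. H n \<sigma>)"
        using 1 2 Hint le by (intro integral_mono) (auto simp: M_def)
      finally show "pairing \<Omega> (\<lambda>x. w (X n) x - w t0 x) \<phi> \<le> (LINT \<sigma>|M. H n \<sigma>)" .
    qed
  qed
  then show ?thesis by (intro Lim_null_comparison[OF _ HI]) simp
qed

end

text \<open>The Riemann sums are the same functions in both spaces, so their two limits agree almost
  everywhere.\<close>

lemma is_integral_unique:
  assumes "solenoidal_Lp p \<Omega>" "solenoidal_Lp q \<Omega>"
    "solenoidal_Lp.is_integral p \<Omega> t g w" "solenoidal_Lp.is_integral q \<Omega> t g v"
    "t > 0" "\<And>s. 0 < s \<Longrightarrow> s < t \<Longrightarrow> g s \<in> Lp p \<Omega>" "\<And>s. 0 < s \<Longrightarrow> s < t \<Longrightarrow> g s \<in> Lp q \<Omega>"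
  shows "ae_eq \<Omega> w v"
proof -
  interpret p: solenoidal_Lp p \<Omega> by fact
  interpret q: solenoidal_Lp q \<Omega> by fact
  have L: "riemann_sum t g k \<in> Lp p \<Omega>" "riemann_sum t g k \<in> Lp q \<Omega>" for k
    unfolding riemann_sum_def
    by (rule Lp_sum[OF Lp_scaleR]; use assms node_bounds(1,2)[OF assms(5)] p.p_ge_1 q.p_ge_1 in auto)+
  show ?thesis
    by (rule Lp_limit_unique[OF L _ _ p.p_ge_1 q.p_ge_1])
       (use assms(3,4) Lp_sigma_Lp in \<open>auto simp: p.is_integral_def q.is_integral_def\<close>)
qed

section \<open>The quadratic term\<close>

lemma norm_tensor: "norm (tensor v w) = norm v * norm w"
proof -
  have "norm (tensor v w $ i) = cmod (v $ i) * norm w" for i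
    using norm_vector_scale[of "v $ i" w] by (simp add: tensor_def vector_scalar_mult_def)
  then have "norm (tensor v w) = L2_set (\<lambda>i. norm w * cmod (v $ i)) UNIV"
    unfolding norm_vec_def[of "tensor v w"] by (simp add: mult.commute)
  also have "\<dots> = norm w * norm v"
    unfolding norm_vec_def[of v] by (rule L2_set_right_distrib[symmetric]) simp
  finally show ?thesis by (simp add: mult.commute)
qed

lemma tensor_measurable:
  assumes "f \<in> borel_measurable M" "g \<in> borel_measurable M"
  shows "(\<lambda>x. tensor (f x) (g x)) \<in> borel_measurable M"
  by (rule borel_measurable_continuous_Pair[OF assms]) (unfold tensor_def, intro continuous_intros)

lemma
  assumes "f \<in> Lp q \<Omega>" "g \<in> Lp q \<Omega>" "q > 0"
  shows tensor_Lp: "(\<lambda>x. tensor (f x) (g x)) \<in> Lp (q/2) \<Omega>"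
    and Lp_norm_tensor: "Lp_norm (q/2) \<Omega> (\<lambda>x. tensor (f x) (g x)) \<le> Lp_norm q \<Omega> f * Lp_norm q \<Omega> g"
proof -
  have m: "(\<lambda>x. tensor (f x) (g x)) \<in> borel_measurable (lebesgue_on \<Omega>)"
    using assms Lp_measurable by (intro tensor_measurable) blast+
  show "(\<lambda>x. tensor (f x) (g x)) \<in> Lp (q/2) \<Omega>"
    "Lp_norm (q/2) \<Omega> (\<lambda>x. tensor (f x) (g x)) \<le> Lp_norm q \<Omega> f * Lp_norm q \<Omega> g"
    by (rule Lp_Hoelder_product[OF assms m]; simp add: norm_tensor)+
qed

text \<open>Insert the mixed product: f \<otimes> f - g \<otimes> g = f \<otimes> (f - g) + (f - g)
  \<otimes> g.\<close>

lemma Lp_norm_tensor_diff: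
  assumes "f \<in> Lp q \<Omega>" "g \<in> Lp q \<Omega>" "q \<ge> 2"
  shows "Lp_norm (q/2) \<Omega> (\<lambda>x. tensor (f x) (f x) - tensor (g x) (g x))
    \<le> (Lp_norm q \<Omega> f + Lp_norm q \<Omega> g) * Lp_norm q \<Omega> (\<lambda>x. f x - g x)"
proof -
  have q: "q > 0" "q/2 \<ge> 1" using assms by auto
  have d: "(\<lambda>x. f x - g x) \<in> Lp q \<Omega>" using assms by (intro Lp_diff) auto
  have "(\<lambda>x. tensor (f x) (f x) - tensor (g x) (g x)) = (\<lambda>x. tensor (f x) (f x - g x) + tensor (f x - g x) (g x))"
    by (simp add: tensor_def fun_eq_iff vec_eq_iff algebra_simps)
  then have "Lp_norm (q/2) \<Omega> (\<lambda>x. tensor (f x) (f x) - tensor (g x) (g x)) \<le>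
      Lp_norm (q/2) \<Omega> (\<lambda>x. tensor (f x) (f x - g x)) + Lp_norm (q/2) \<Omega> (\<lambda>x. tensor (f x - g x) (g x))"
    using Lp_norm_triangle[OF tensor_Lp[OF assms(1) d q(1)] tensor_Lp[OF d assms(2) q(1)] q(2)] by simp
  also have "\<dots> \<le> Lp_norm q \<Omega> f * Lp_norm q \<Omega> (\<lambda>x. f x - g x) + Lp_norm q \<Omega> (\<lambda>x. f x - g x) * Lp_norm q \<Omega> g"
    by (intro add_mono Lp_norm_tensor assms d q)
  finally show ?thesis by (simp add: algebra_simps)
qed

lemma norm_continuous_tendsto:
  assumes "norm_continuous p \<Omega> S v" "s \<in> S" "\<forall>\<^sub>F k in \<F>. r k \<in> S" "(r \<longlongrightarrow> s) \<F>" "p > 0"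
  shows "((\<lambda>k. Lp_norm p \<Omega> (\<lambda>x. v (r k) x - v s x)) \<longlongrightarrow> 0) \<F>"
proof -
  have "((\<lambda>r. Lp_norm p \<Omega> (\<lambda>x. v r x - v s x)) \<longlongrightarrow> Lp_norm p \<Omega> (\<lambda>x. v s x - v s x)) (at s within S)"
    using assms(1,2) by (simp add: norm_continuous_def)
  then have "continuous (at s within S) (\<lambda>r. Lp_norm p \<Omega> (\<lambda>x. v r x - v s x))"
    by (simp add: continuous_within)
  from continuous_within_tendsto_compose[OF this assms(3,4)] show ?thesis by simp
qed

lemma norm_continuous_tensor:
  assumes "norm_continuous q \<Omega> S u" "q \<ge> 2"
  shows "norm_continuous (q/2) \<Omega> S (\<lambda>s x. tensor (u s x) (u s x))"
  unfolding norm_continuous_def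
proof (intro ballI conjI)
  fix s assume s: "s \<in> S"
  have L: "u r \<in> Lp q \<Omega>" if "r \<in> S" for r using norm_continuous_Lp[OF assms(1) that] .
  show "(\<lambda>x. tensor (u s x) (u s x)) \<in> Lp (q/2) \<Omega>" using L[OF s] assms(2) by (intro tensor_Lp) auto
  have c: "((\<lambda>r. Lp_norm q \<Omega> (u r)) \<longlongrightarrow> Lp_norm q \<Omega> (u s)) (at s within S)"
    using continuous_on_Lp_norm[OF assms(1)] assms(2) s by (auto simp: continuous_on_def)
  have d: "((\<lambda>r. Lp_norm q \<Omega> (\<lambda>x. u r x - u s x)) \<longlongrightarrow> 0) (at s within S)"
    using assms(1) s by (simp add: norm_continuous_def)
  have "((\<lambda>r. (Lp_norm q \<Omega> (u r) + Lp_norm q \<Omega> (u s)) * Lp_norm q \<Omega> (\<lambda>x. u r x - u s x)) \<longlongrightarrow>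
      (Lp_norm q \<Omega> (u s) + Lp_norm q \<Omega> (u s)) * 0) (at s within S)"
    by (intro tendsto_intros c d)
  then have lim: "((\<lambda>r. (Lp_norm q \<Omega> (u r) + Lp_norm q \<Omega> (u s)) * Lp_norm q \<Omega> (\<lambda>x. u r x - u s x)) \<longlongrightarrow> 0) (at s within S)"
    by simp
  show "((\<lambda>r. Lp_norm (q/2) \<Omega> (\<lambda>x. tensor (u r x) (u r x) - tensor (u s x) (u s x))) \<longlongrightarrow> 0) (at s within S)"
  proof (rule Lim_null_comparison[OF _ lim])
    show "\<forall>\<^sub>F r in at s within S. norm (Lp_norm (q/2) \<Omega> (\<lambda>x. tensor (u r x) (u r x) - tensor (u s x) (u s x))) \<le>
      (Lp_norm q \<Omega> (u r) + Lp_norm q \<Omega> (u s)) * Lp_norm q \<Omega> (\<lambda>x. u r x - u s x)"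
      unfolding eventually_at_filter
      by (intro always_eventually allI impI) (use Lp_norm_tensor_diff[OF L L[OF s] assms(2)] in simp)
  qed
qed


section \<open>The Duhamel term\<close>

text \<open>3 < q < 4 is the range 3/2 < m < 2 for m = q/2; q itself has to be admissible so that
  T(t) leads into L^q.\<close>

locale kato = stokes_estimates +
  fixes q :: real
  assumes q_gt: "3 < q" and q_lt: "q < 4" and q_adm: "admissible_exponent \<epsilon> q"
begin

sublocale stokes_proj_div \<Omega> \<epsilon> T K1 K2 "q/2"
  by unfold_locales (use q_gt q_lt in auto)

lemma q_ge: "q \<ge> 2" "q \<ge> 1" "q > 0" "q > 1"
  using q_gt by auto

lemma smoothing_exponent_eq: "smoothing_exponent p = 1/2 + 3/q - 3/(2*p)"
  by (simp add: smoothing_exponent_def algebra_simps)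

lemma smoothing_exponent_nonneg:
  assumes "p \<ge> 2"
  shows "0 \<le> smoothing_exponent p"
proof -
  have "1/4 \<le> 1/q" "1/p \<le> 1/2" using q_gt q_lt assms by (simp_all add: field_simps)
  then show ?thesis unfolding smoothing_exponent_def by (simp add: field_simps)
qed

text \<open>The closed ball of radius A in Kato's space of curves with weight s^\<alpha> over
  J.\<close>

definition path :: "real set \<Rightarrow> (real \<Rightarrow> 3 field) \<Rightarrow> real \<Rightarrow> real \<Rightarrow> bool" where
  "path J u \<alpha> A \<longleftrightarrow> (\<forall>s\<in>J. u s \<in> Lp_sigma q \<Omega>) \<and> norm_continuous q \<Omega> J u \<and>
     (\<forall>s\<in>J. Lp_norm q \<Omega> (u s) \<le> A * s powr (-\<alpha>))"

lemma path_subset: "path J u \<alpha> A \<Longrightarrow> J' \<subseteq> J \<Longrightarrow> path J' u \<alpha> A"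
  unfolding path_def by (meson norm_continuous_subset subsetD)

lemma path_Lp: "path J u \<alpha> A \<Longrightarrow> s \<in> J \<Longrightarrow> u s \<in> Lp q \<Omega>"
  unfolding path_def using Lp_sigma_Lp by blast

definition quadratic :: "(real \<Rightarrow> 3 field) \<Rightarrow> real \<Rightarrow> real^3 \<Rightarrow> complex^3^3" where
  "quadratic u s x = tensor (u s x) (u s x)"

definition integrand :: "(real \<Rightarrow> 3 field) \<Rightarrow> real \<Rightarrow> real \<Rightarrow> 3 field" where
  "integrand u t s = proj_div (t - s) (quadratic u s)"

text \<open>p names the space in which the integral is taken; by \<open>duhamel_ae_eq\<close>
  another exponent gives almost everywhere the same function.\<close>

definition duhamel :: "real \<Rightarrow> (real \<Rightarrow> 3 field) \<Rightarrow> real \<Rightarrow> 3 field" where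
  "duhamel p u t = (SOME w. solenoidal_Lp.is_integral p \<Omega> t (integrand u t) w)"

lemma quadratic_Lp:
  assumes "path J u \<alpha> A" "s \<in> J"
  shows "quadratic u s \<in> Lp (q/2) \<Omega>"
  unfolding quadratic_def[abs_def] by (rule tensor_Lp[OF path_Lp path_Lp q_ge(3)]) (use assms in auto)

lemma norm_continuous_quadratic: "path J u \<alpha> A \<Longrightarrow> norm_continuous (q/2) \<Omega> J (quadratic u)"
  unfolding quadratic_def[abs_def] using norm_continuous_tensor q_ge(1) by (auto simp: path_def)

end

text \<open>The curve u is always measured in L^q, and p is the exponent in which the integral term
  is measured. The last condition makes the kernel integrable at s = t.\<close>

locale kato_exponent = kato +
  fixes p :: real
  assumes p_adm: "admissible_exponent \<epsilon> p" and p_ge_2: "p \<ge> 2" and exponent_less: "smoothing_exponent p < 1"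
begin

sublocale P: solenoidal_Lp p \<Omega>
  by (rule solenoidal) (use p_ge_2 in simp)

abbreviation "\<beta> \<equiv> smoothing_exponent p"
abbreviation "\<kappa> \<equiv> smoothing_const p"

lemma \<beta>0: "0 \<le> \<beta>"
  by (rule smoothing_exponent_nonneg[OF p_ge_2])

lemma integrand_Lp_sigma:
  assumes "path J u \<alpha> A" "s \<in> J" "s < t"
  shows "integrand u t s \<in> Lp_sigma p \<Omega>"
  unfolding integrand_def by (rule proj_div_bound(1)[OF _ quadratic_Lp[OF assms(1,2)] p_adm p_ge_2]) (use assms in auto)

lemma integrand_Lp:
  assumes "path {0<..<t} u \<alpha> A" "0 < s" "s < t"
  shows "integrand u t s \<in> Lp p \<Omega>"
  by (rule Lp_sigma_Lp[OF integrand_Lp_sigma[OF assms(1)]]) (use assms in auto)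

lemma integrand_bound:
  assumes "u s \<in> Lp q \<Omega>" "s < t" "0 < s" "Lp_norm q \<Omega> (u s) \<le> A * s powr (-\<alpha>)" "Lp_norm q \<Omega> (u s) \<le> A' * s powr (-\<alpha>')"
  shows "Lp_norm p \<Omega> (integrand u t s) \<le> \<kappa> * A * A' * abel_kernel \<beta> (\<alpha> + \<alpha>') t s"
proof -
  have Q: "quadratic u s \<in> Lp (q/2) \<Omega>"
    unfolding quadratic_def[abs_def] by (rule tensor_Lp[OF assms(1,1) q_ge(3)])
  have "Lp_norm (q/2) \<Omega> (quadratic u s) \<le> Lp_norm q \<Omega> (u s) * Lp_norm q \<Omega> (u s)"
    unfolding quadratic_def[abs_def] by (rule Lp_norm_tensor[OF assms(1,1) q_ge(3)])
  also have "\<dots> \<le> (A * s powr (-\<alpha>)) * (A' * s powr (-\<alpha>'))"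
    using order_trans[OF Lp_norm_nonneg assms(4)] by (intro mult_mono assms(4,5)) auto
  also have "\<dots> = A * A' * (s powr (-\<alpha>) * s powr (-\<alpha>'))" by (simp only: mult_ac)
  also have "\<dots> = A * A' * s powr (- (\<alpha> + \<alpha>'))" by (simp add: powr_add[symmetric])
  finally have *: "Lp_norm (q/2) \<Omega> (quadratic u s) \<le> A * A' * s powr (- (\<alpha> + \<alpha>'))" .
  have "Lp_norm p \<Omega> (integrand u t s) \<le> \<kappa> * (t - s) powr (-\<beta>) * Lp_norm (q/2) \<Omega> (quadratic u s)"
    unfolding integrand_def by (rule proj_div_bound(2)[OF _ Q p_adm p_ge_2]) (use assms in simp)
  also have "\<dots> \<le> \<kappa> * (t - s) powr (-\<beta>) * (A * A' * s powr (- (\<alpha> + \<alpha>')))"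
    by (intro mult_left_mono *) auto
  finally show ?thesis by (simp add: abel_kernel_def mult_ac)
qed

lemma integrand_diff_bound:
  assumes "u s \<in> Lp q \<Omega>" "v s \<in> Lp q \<Omega>" "s < t" "0 < s"
    "Lp_norm q \<Omega> (u s) \<le> A * s powr (-\<alpha>)" "Lp_norm q \<Omega> (v s) \<le> A * s powr (-\<alpha>)"
    "Lp_norm q \<Omega> (\<lambda>x. u s x - v s x) \<le> d * s powr (-\<alpha>)"
  shows "Lp_norm p \<Omega> (\<lambda>x. integrand u t s x - integrand v t s x) \<le> \<kappa> * (2 * A * d) * abel_kernel \<beta> (2 * \<alpha>) t s"
proof -
  have Q: "quadratic u s \<in> Lp (q/2) \<Omega>" "quadratic v s \<in> Lp (q/2) \<Omega>"
    unfolding quadratic_def[abs_def] by (rule tensor_Lp[OF _ _ q_ge(3)]; use assms in simp)+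
  have "Lp_norm (q/2) \<Omega> (\<lambda>x. quadratic u s x - quadratic v s x) \<le>
      (Lp_norm q \<Omega> (u s) + Lp_norm q \<Omega> (v s)) * Lp_norm q \<Omega> (\<lambda>x. u s x - v s x)"
    unfolding quadratic_def by (rule Lp_norm_tensor_diff[OF assms(1,2) q_ge(1)])
  also have "\<dots> \<le> (A * s powr (-\<alpha>) + A * s powr (-\<alpha>)) * (d * s powr (-\<alpha>))"
    using order_trans[OF Lp_norm_nonneg assms(5)] by (intro mult_mono add_mono assms) auto
  also have "\<dots> = 2 * A * d * (s powr (-\<alpha>) * s powr (-\<alpha>))" by (simp add: algebra_simps)
  also have "\<dots> = 2 * A * d * s powr (- (2 * \<alpha>))" by (simp add: powr_add[symmetric])
  finally have *: "Lp_norm (q/2) \<Omega> (\<lambda>x. quadratic u s x - quadratic v s x) \<le> 2 * A * d * s powr (- (2 * \<alpha>))" .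
  have "Lp_norm p \<Omega> (\<lambda>x. integrand u t s x - integrand v t s x) \<le>
      \<kappa> * (t - s) powr (-\<beta>) * Lp_norm (q/2) \<Omega> (\<lambda>x. quadratic u s x - quadratic v s x)"
    unfolding integrand_def by (rule proj_div_diff_bound[OF _ Q p_adm p_ge_2]) (use assms in simp)
  also have "\<dots> \<le> \<kappa> * (t - s) powr (-\<beta>) * (2 * A * d * s powr (- (2 * \<alpha>)))"
    by (intro mult_left_mono *) auto
  finally show ?thesis by (simp add: abel_kernel_def mult_ac)
qed

lemma integrand_continuous:
  assumes "path {0<..<t} u \<alpha> A"
  shows "norm_continuous p \<Omega> {0<..<t} (integrand u t)"
  unfolding norm_continuous_def
proof (intro ballI conjI)
  fix s assume s: "s \<in> {0<..<t}"
  then show "integrand u t s \<in> Lp p \<Omega>" using integrand_Lp[OF assms] by auto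
  show "((\<lambda>r. Lp_norm p \<Omega> (\<lambda>x. integrand u t r x - integrand u t s x)) \<longlongrightarrow> 0) (at s within {0<..<t})"
    unfolding integrand_def
  proof (rule proj_div_tendsto[OF _ quadratic_Lp[OF assms s] p_adm p_ge_2])
    show "((\<lambda>r. Lp_norm (q/2) \<Omega> (\<lambda>x. quadratic u r x - quadratic u s x)) \<longlongrightarrow> 0) (at s within {0<..<t})"
      using norm_continuous_quadratic[OF assms] s by (simp add: norm_continuous_def)
    show "\<forall>\<^sub>F r in at s within {0<..<t}. quadratic u r \<in> Lp (q/2) \<Omega>"
      unfolding eventually_at_filter using quadratic_Lp[OF assms] by (intro always_eventually) auto
    show "((\<lambda>r. t - r) \<longlongrightarrow> t - s) (at s within {0<..<t})" by (intro tendsto_intros)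
  qed (use s in simp)
qed

text \<open>\<alpha> < 1/2 makes the square singularity s^(-2 \<alpha>) integrable at 0.\<close>

lemma duhamel_is_integral:
  assumes "path {0<..<t} u \<alpha> A" "t > 0" "0 \<le> \<alpha>" "\<alpha> < 1/2"
  shows "P.is_integral t (integrand u t) (duhamel p u t)"
proof -
  have "\<exists>w. P.is_integral t (integrand u t) w"
  proof (rule P.is_integral_exists[OF assms(2) \<beta>0 exponent_less])
    show "norm_continuous p \<Omega> {0<..<t} (integrand u t)" by (rule integrand_continuous[OF assms(1)])
    show "integrand u t s \<in> Lp_sigma p \<Omega>" if "0 < s" "s < t" for s
      by (rule integrand_Lp_sigma[OF assms(1)]) (use that in auto)
    show "Lp_norm p \<Omega> (integrand u t s) \<le> \<kappa> * A * A * abel_kernel \<beta> (\<alpha> + \<alpha>) t s" if "0 < s" "s < t" for s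
      by (rule integrand_bound) (use assms(1) that path_Lp[OF assms(1)] in \<open>auto simp: path_def\<close>)
    show "0 \<le> \<kappa> * A * A" by (simp add: mult.assoc)
  qed (use assms in auto)
  then show ?thesis unfolding duhamel_def by (rule someI_ex)
qed

lemma duhamel_Lp_sigma:
  assumes "path {0<..<t} u \<alpha> A" "t > 0" "0 \<le> \<alpha>" "\<alpha> < 1/2"
  shows "duhamel p u t \<in> Lp_sigma p \<Omega>"
  using duhamel_is_integral[OF assms] by (simp add: P.is_integral_def)

lemma duhamel_bound:
  assumes u: "path {0<..<t} u \<alpha> A" "t > 0" "0 \<le> \<alpha>" "\<alpha> < 1/2"
    and b: "\<And>s. 0 < s \<Longrightarrow> s < t \<Longrightarrow> Lp_norm q \<Omega> (u s) \<le> B * s powr (-\<gamma>)"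
      "\<And>s. 0 < s \<Longrightarrow> s < t \<Longrightarrow> Lp_norm q \<Omega> (u s) \<le> B' * s powr (-\<gamma>')" "\<gamma> + \<gamma>' < 1"
  shows "Lp_norm p \<Omega> (duhamel p u t) \<le> \<kappa> * B * B' * (t powr (1 - \<beta> - (\<gamma> + \<gamma>')) * kernel_mass \<beta> (\<gamma> + \<gamma>'))"
proof -
  have "Lp_norm p \<Omega> (duhamel p u t) \<le> (LINT s|lebesgue_on {0<..<t}. \<kappa> * B * B' * abel_kernel \<beta> (\<gamma> + \<gamma>') t s)"
  proof (rule P.is_integral_norm_le[OF duhamel_is_integral[OF u]])
    show "integrand u t s \<in> Lp p \<Omega>" if "0 < s" "s < t" for s
      using integrand_Lp[OF u(1)] that by auto
    show "integrable (lebesgue_on {0<..<t}) (\<lambda>s. \<kappa> * B * B' * abel_kernel \<beta> (\<gamma> + \<gamma>') t s)"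
      using kernel_integrable[OF exponent_less b(3) u(2)] by simp
    show "Lp_norm p \<Omega> (integrand u t s) \<le> \<kappa> * B * B' * abel_kernel \<beta> (\<gamma> + \<gamma>') t s" if "0 < s" "s < t" for s
      by (rule integrand_bound) (use that b path_Lp[OF u(1)] in auto)
  qed
  then show ?thesis using kernel_integral[OF exponent_less b(3) u(2)] by simp
qed

lemma duhamel_diff_bound:
  assumes u: "path {0<..<t} u \<alpha> A" "path {0<..<t} v \<alpha> A" "t > 0" "0 \<le> \<alpha>" "\<alpha> < 1/2"
    and d: "\<And>s. 0 < s \<Longrightarrow> s < t \<Longrightarrow> Lp_norm q \<Omega> (\<lambda>x. u s x - v s x) \<le> d * s powr (-\<alpha>)"
  shows "Lp_norm p \<Omega> (\<lambda>x. duhamel p u t x - duhamel p v t x)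
    \<le> \<kappa> * (2 * A * d) * (t powr (1 - \<beta> - 2 * \<alpha>) * kernel_mass \<beta> (2 * \<alpha>))"
proof -
  have a: "2 * \<alpha> < 1" using u by simp
  have "Lp_norm p \<Omega> (\<lambda>x. duhamel p u t x - duhamel p v t x) \<le>
      (LINT s|lebesgue_on {0<..<t}. \<kappa> * (2 * A * d) * abel_kernel \<beta> (2 * \<alpha>) t s)"
  proof (rule P.is_integral_diff_le[OF duhamel_is_integral[OF u(1,3-5)] duhamel_is_integral[OF u(2,3-5)]])
    show "integrand u t s \<in> Lp p \<Omega>" "integrand v t s \<in> Lp p \<Omega>" if "0 < s" "s < t" for s
      using integrand_Lp[OF u(1)] integrand_Lp[OF u(2)] that by auto
    show "integrable (lebesgue_on {0<..<t}) (\<lambda>s. \<kappa> * (2 * A * d) * abel_kernel \<beta> (2 * \<alpha>) t s)"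
      using kernel_integrable[OF exponent_less a u(3)] by simp
    show "Lp_norm p \<Omega> (\<lambda>x. integrand u t s x - integrand v t s x) \<le> \<kappa> * (2 * A * d) * abel_kernel \<beta> (2 * \<alpha>) t s"
      if "0 < s" "s < t" for s
      by (rule integrand_diff_bound) (use that d u(1,2) path_Lp[OF u(1)] path_Lp[OF u(2)] in \<open>auto simp: path_def\<close>)
  qed
  then show ?thesis using kernel_integral[OF exponent_less a u(3)] by simp
qed

text \<open>J has to contain all earlier positive times because the integral at t runs over them.
  After rescaling, the integrands converge by joint continuity of \<open>proj_div\<close> in time
  and field.\<close>

lemma duhamel_continuous:
  assumes u: "path J u \<alpha> A" "0 \<le> \<alpha>" "\<alpha> < 1/2"
    and J: "\<And>t. t \<in> J \<Longrightarrow> t > 0" "\<And>t. t \<in> J \<Longrightarrow> {0<..<t} \<subseteq> J"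
  shows "norm_continuous p \<Omega> J (duhamel p u)"
  unfolding norm_continuous_def
proof (intro ballI conjI)
  fix t0 assume t0: "t0 \<in> J"
  have pt: "path {0<..<t} u \<alpha> A" if "t \<in> J" for t using path_subset[OF u(1) J(2)[OF that]] .
  show "duhamel p u t0 \<in> Lp p \<Omega>" using duhamel_Lp_sigma[OF pt[OF t0] J(1)[OF t0] u(2,3)] by (rule Lp_sigma_Lp)
  show "((\<lambda>t. Lp_norm p \<Omega> (\<lambda>x. duhamel p u t x - duhamel p u t0 x)) \<longlongrightarrow> 0) (at t0 within J)"
    unfolding tendsto_at_iff_sequentially o_def
  proof (intro allI impI)
    fix X :: "nat \<Rightarrow> real" assume X: "\<forall>i. X i \<in> J - {t0}" "X \<longlonglongrightarrow> t0"
    then have XJ: "X n \<in> J" for n by auto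
    have b: "Lp_norm p \<Omega> (integrand u t s) \<le> \<kappa> * A * A * abel_kernel \<beta> (2 * \<alpha>) t s" if "t \<in> J" "0 < s" "s < t" for t s
    proof -
      have "Lp_norm p \<Omega> (integrand u t s) \<le> \<kappa> * A * A * abel_kernel \<beta> (\<alpha> + \<alpha>) t s"
        by (rule integrand_bound) (use pt[OF that(1)] that path_Lp[OF pt[OF that(1)]] in \<open>auto simp: path_def\<close>)
      then show ?thesis by (simp only: mult_2)
    qed
    show "(\<lambda>n. Lp_norm p \<Omega> (\<lambda>x. duhamel p u (X n) x - duhamel p u t0 x)) \<longlonglongrightarrow> 0"
    proof (rule P.is_integral_continuous[OF J(1)[OF t0] X(2) J(1)[OF XJ], of "integrand u" "duhamel p u" \<beta> "2 * \<alpha>" "\<kappa> * A * A"])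
      show "P.is_integral (X n) (integrand u (X n)) (duhamel p u (X n))" for n
        by (rule duhamel_is_integral[OF pt[OF XJ] J(1)[OF XJ] u(2,3)])
      show "P.is_integral t0 (integrand u t0) (duhamel p u t0)"
        by (rule duhamel_is_integral[OF pt[OF t0] J(1)[OF t0] u(2,3)])
      show "norm_continuous p \<Omega> {0<..<X n} (integrand u (X n))" for n by (rule integrand_continuous[OF pt[OF XJ]])
      show "norm_continuous p \<Omega> {0<..<t0} (integrand u t0)" by (rule integrand_continuous[OF pt[OF t0]])
      show "0 \<le> \<kappa> * A * A" by (simp add: mult.assoc)
    next
      fix \<sigma> :: real assume \<sigma>: "0 < \<sigma>" "\<sigma> < 1"
      have in_J: "t * \<sigma> \<in> J" if "t \<in> J" for t
      proof -
        have "t * \<sigma> \<in> {0<..<t}" using mult_strict_left_mono[OF \<sigma>(2) J(1)[OF that]] mult_pos_pos[OF J(1)[OF that] \<sigma>(1)] by simp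
        then show ?thesis using J(2)[OF that] by blast
      qed
      have pos: "t0 - t0 * \<sigma> > 0" using mult_strict_left_mono[OF \<sigma>(2) J(1)[OF t0]] by simp
      show "(\<lambda>n. Lp_norm p \<Omega> (\<lambda>x. integrand u (X n) (X n * \<sigma>) x - integrand u t0 (t0 * \<sigma>) x)) \<longlonglongrightarrow> 0"
        unfolding integrand_def
      proof (rule proj_div_tendsto[OF pos quadratic_Lp[OF u(1) in_J[OF t0]] p_adm p_ge_2])
        show "(\<lambda>n. X n - X n * \<sigma>) \<longlonglongrightarrow> t0 - t0 * \<sigma>" by (intro tendsto_intros X)
        show "\<forall>\<^sub>F n in sequentially. quadratic u (X n * \<sigma>) \<in> Lp (q/2) \<Omega>"
          using quadratic_Lp[OF u(1) in_J[OF XJ]] by simp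
        show "(\<lambda>n. Lp_norm (q/2) \<Omega> (\<lambda>x. quadratic u (X n * \<sigma>) x - quadratic u (t0 * \<sigma>) x)) \<longlonglongrightarrow> 0"
          by (rule norm_continuous_tendsto[OF norm_continuous_quadratic[OF u(1)] in_J[OF t0]])
             (use in_J[OF XJ] q_ge in \<open>auto intro!: tendsto_intros X\<close>)
      qed
    qed (use b XJ t0 u exponent_less in auto)
  qed
qed

lemma duhamel_mild:
  assumes "path {0<..<t} u \<alpha> A" "t > 0" "0 \<le> \<alpha>" "\<alpha> < 1/2" "0 < s" "s < t"
  shows "semigroup_proj_div p \<Omega> T (t - s) (\<lambda>x. tensor (u s x) (u s x)) (integrand u t s)"
  using proj_div_semigroup_proj_div[OF _ quadratic_Lp[OF assms(1)] p_adm p_ge_2, of "t - s" s] assms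
  unfolding integrand_def quadratic_def[abs_def] by simp

end

section \<open>Independence of the exponent, and the Picard iteration\<close>

context kato
begin

lemma duhamel_ae_eq:
  assumes "kato_exponent \<Omega> \<epsilon> T K1 K2 q p" "kato_exponent \<Omega> \<epsilon> T K1 K2 q r"
    "path {0<..<t} u \<alpha> A" "t > 0" "0 \<le> \<alpha>" "\<alpha> < 1/2"
  shows "ae_eq \<Omega> (duhamel p u t) (duhamel r u t)"
proof -
  interpret p: kato_exponent \<Omega> \<epsilon> T K1 K2 q p by fact
  interpret r: kato_exponent \<Omega> \<epsilon> T K1 K2 q r by fact
  show ?thesis
    by (rule is_integral_unique[OF p.P.solenoidal_Lp_axioms r.P.solenoidal_Lp_axioms
          p.duhamel_is_integral[OF assms(3-6)] r.duhamel_is_integral[OF assms(3-6)] assms(4)])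
       (use p.integrand_Lp[OF assms(3)] r.integrand_Lp[OF assms(3)] in auto)
qed

text \<open>For p = q the smoothing exponent is 1/2 + 3/(2q), which is below 1 because q >
  3.\<close>

lemma kato_exponent_q: "kato_exponent \<Omega> \<epsilon> T K1 K2 q q"
proof
  have "3/(2*q) < 1/2" using q_gt by (simp add: field_simps)
  then show "smoothing_exponent q < 1" by (simp add: smoothing_exponent_eq)
qed (use q_adm q_ge in auto)

text \<open>The \<open>n\<close>-th and \<open>(n+1)\<close>-st Picard iterates differ by at most \<open>\<Lambda> 2\<^sup>-\<^sup>n s\<^sup>-\<^sup>\<alpha>\<close>.  Every weighted bound
  with a smaller singularity that \<open>U\<close> satisfies on an initial time interval is inherited by the limit.\<close>

theorem kato_iteration:
  fixes U :: "real \<Rightarrow> 3 field"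
  assumes J: "\<And>t. t \<in> J \<Longrightarrow> t > 0" "\<And>t. t \<in> J \<Longrightarrow> {0<..<t} \<subseteq> J"
    and U: "path J U \<alpha> \<Lambda>" and \<alpha>: "0 \<le> \<alpha>" "\<alpha> < 1/2" and \<Lambda>: "0 \<le> \<Lambda>"
    and small: "\<And>t. t \<in> J \<Longrightarrow> 8 * (smoothing_const q * kernel_mass (smoothing_exponent q) (2 * \<alpha>) * \<Lambda> *
        t powr (1 - smoothing_exponent q - \<alpha>)) \<le> 1"
  shows "\<exists>u. path J u \<alpha> (2 * \<Lambda>) \<and> (\<forall>t\<in>J. ae_eq \<Omega> (u t) (\<lambda>x. U t x - duhamel q u t x)) \<and>
    (\<forall>\<gamma> B \<tau>. 0 \<le> \<gamma> \<and> \<gamma> \<le> \<alpha> \<and> 0 \<le> B \<and> (\<forall>s\<in>J. s < \<tau> \<longrightarrow> Lp_norm q \<Omega> (U s) \<le> B * s powr (-\<gamma>)) \<longrightarrow>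
      (\<forall>s\<in>J. s < \<tau> \<longrightarrow> Lp_norm q \<Omega> (u s) \<le> 2 * B * s powr (-\<gamma>)))"
proof -
  interpret e: kato_exponent \<Omega> \<epsilon> T K1 K2 q q by (rule kato_exponent_q)
  define \<beta> where "\<beta> = smoothing_exponent q"
  define \<kappa> where "\<kappa> = smoothing_const q"
  define m where "m = kernel_mass \<beta> (2 * \<alpha>)"
  have \<beta>1: "\<beta> < 1" unfolding \<beta>_def by (rule e.exponent_less)
  have \<kappa>0: "\<kappa> \<ge> 0" by (simp add: \<kappa>_def)
  have m0: "m \<ge> 0" unfolding m_def using kernel_mass_nonneg[OF \<beta>1] \<alpha> by simp
  have small': "8 * (\<kappa> * m * \<Lambda> * t powr (1 - \<beta> - \<alpha>)) \<le> 1" if "t \<in> J" for t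
    using small[OF that] by (simp add: \<kappa>_def m_def \<beta>_def)
  \<comment> \<open>All weights, constants and time limits are quantified at once, so a single
    induction propagates every bound that U satisfies.\<close>
  define bounded_by where "bounded_by v c \<longleftrightarrow> (\<forall>\<gamma> B \<tau>. 0 \<le> \<gamma> \<and> \<gamma> \<le> \<alpha> \<and> 0 \<le> B \<and>
      (\<forall>s\<in>J. s < \<tau> \<longrightarrow> Lp_norm q \<Omega> (U s) \<le> B * s powr (-\<gamma>)) \<longrightarrow>
      (\<forall>s\<in>J. s < \<tau> \<longrightarrow> Lp_norm q \<Omega> (v s) \<le> c * B * s powr (-\<gamma>)))" for v :: "real \<Rightarrow> 3 field" and c :: real
  define good where "good v \<longleftrightarrow> (\<forall>s\<in>J. v s \<in> Lp_sigma q \<Omega>) \<and> norm_continuous q \<Omega> J v \<and> bounded_by v 2" for v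
  have UB: "Lp_norm q \<Omega> (U s) \<le> \<Lambda> * s powr (-\<alpha>)" if "s \<in> J" for s using U that by (simp add: path_def)
  have UL: "U s \<in> Lp_sigma q \<Omega>" if "s \<in> J" for s using U that by (simp add: path_def)
  have good_path: "path J v \<alpha> (2 * \<Lambda>)" if v: "good v" for v
  proof -
    have "Lp_norm q \<Omega> (v s) \<le> 2 * \<Lambda> * s powr (-\<alpha>)" if "s \<in> J" for s
    proof -
      have "\<forall>s\<in>J. s < s + 1 \<longrightarrow> Lp_norm q \<Omega> (U s) \<le> \<Lambda> * s powr (-\<alpha>)" using UB by blast
      then show ?thesis
        using v that \<alpha> \<Lambda> UB unfolding good_def bounded_by_def by (meson less_add_one order_refl)
    qed
    then show ?thesis using v by (auto simp: path_def good_def)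
  qed
  have sub: "path {0<..<t} v \<alpha> (2 * \<Lambda>)" if "good v" "t \<in> J" for v t
    using path_subset[OF good_path[OF that(1)] J(2)[OF that(2)]] .
  define step where "step v t = (\<lambda>x. U t x - duhamel q v t x)" for v t
  have dS: "duhamel q v t \<in> Lp_sigma q \<Omega>" if "good v" "t \<in> J" for v t
    by (rule e.duhamel_Lp_sigma[OF sub[OF that] J(1)[OF that(2)] \<alpha>])
  have stepS: "step v t \<in> Lp_sigma q \<Omega>" if "good v" "t \<in> J" for v t
    unfolding step_def by (rule e.P.diff[OF UL[OF that(2)] dS[OF that]])
  have split: "t powr (1 - \<beta> - (\<alpha> + \<gamma>)) = t powr (1 - \<beta> - \<alpha>) * t powr (-\<gamma>)" for t \<gamma>
    by (simp add: powr_add[symmetric] algebra_simps)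
  have dbound: "Lp_norm q \<Omega> (duhamel q v t) \<le> (1/2) * B * t powr (-\<gamma>)"
    if v: "good v" and t: "t \<in> J" "t < \<tau>" and \<gamma>: "0 \<le> \<gamma>" "\<gamma> \<le> \<alpha>" and B: "0 \<le> B"
      "\<forall>s\<in>J. s < \<tau> \<longrightarrow> Lp_norm q \<Omega> (U s) \<le> B * s powr (-\<gamma>)" for v t \<gamma> B \<tau>
  proof -
    have s: "s \<in> J" "s < \<tau>" if "0 < s" "s < t" for s using J(2)[OF t(1)] t(2) that by auto
    have vB: "Lp_norm q \<Omega> (v s) \<le> 2 * B * s powr (-\<gamma>)" if "0 < s" "s < t" for s
      using v \<gamma> B s[OF that] unfolding good_def bounded_by_def by blast
    \<comment> \<open>One factor of the quadratic term takes the bound 2 \<Lambda> s^(-\<alpha>),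
      the other the bound 2 B s^(-\<gamma>).\<close>
    have "Lp_norm q \<Omega> (duhamel q v t) \<le> \<kappa> * (2 * \<Lambda>) * (2 * B) * (t powr (1 - \<beta> - (\<alpha> + \<gamma>)) * kernel_mass \<beta> (\<alpha> + \<gamma>))"
      unfolding \<beta>_def \<kappa>_def
      by (rule e.duhamel_bound[OF sub[OF v t(1)] J(1)[OF t(1)] \<alpha>])
         (use good_path[OF v] s vB \<alpha> \<gamma> in \<open>auto simp: path_def\<close>)
    also have "\<dots> \<le> \<kappa> * (2 * \<Lambda>) * (2 * B) * (t powr (1 - \<beta> - (\<alpha> + \<gamma>)) * m)"
      unfolding m_def using \<kappa>0 \<Lambda> B(1) \<alpha> \<gamma> \<beta>1 by (intro mult_left_mono kernel_mass_mono) auto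
    \<comment> \<open>2 \<Lambda> times 2 B is 8 \<Lambda> times B/2: the 8 in the smallness
      hypothesis makes the integral term cost half of B.\<close>
    also have "\<dots> = (8 * (\<kappa> * m * \<Lambda> * t powr (1 - \<beta> - \<alpha>))) * ((1/2) * B * t powr (-\<gamma>))"
      unfolding split by (simp add: algebra_simps)
    also have "\<dots> \<le> 1 * ((1/2) * B * t powr (-\<gamma>))"
      using B(1) by (intro mult_right_mono small'[OF t(1)]) auto
    finally show ?thesis by simp
  qed
  \<comment> \<open>The bound of U and the half from the integral term add up to 3/2, so the class
    with constant 2 is invariant.\<close>
  have step_bound: "bounded_by (step v) (3/2)" if v: "good v" for v
    unfolding bounded_by_def
  proof (intro allI impI ballI)
    fix \<gamma> B \<tau> s assume h: "0 \<le> \<gamma> \<and> \<gamma> \<le> \<alpha> \<and> 0 \<le> B \<and> (\<forall>s\<in>J. s < \<tau> \<longrightarrow> Lp_norm q \<Omega> (U s) \<le> B * s powr (-\<gamma>))" "s \<in> J" "s < \<tau>"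
    have "Lp_norm q \<Omega> (step v s) \<le> Lp_norm q \<Omega> (U s) + Lp_norm q \<Omega> (duhamel q v s)"
      unfolding step_def by (rule Lp_norm_diff_le[OF Lp_sigma_Lp[OF UL[OF h(2)]] Lp_sigma_Lp[OF dS[OF v h(2)]] q_ge(2)])
    also have "\<dots> \<le> B * s powr (-\<gamma>) + (1/2) * B * s powr (-\<gamma>)"
      using h dbound[OF v h(2,3)] by (intro add_mono) auto
    finally show "Lp_norm q \<Omega> (step v s) \<le> 3/2 * B * s powr (-\<gamma>)" by (simp add: algebra_simps)
  qed
  have weaken: "bounded_by v 2" if "bounded_by v c" "c \<le> 2" for v c
    unfolding bounded_by_def
  proof (intro allI impI ballI)
    fix \<gamma> B \<tau> s assume h: "0 \<le> \<gamma> \<and> \<gamma> \<le> \<alpha> \<and> 0 \<le> B \<and> (\<forall>s\<in>J. s < \<tau> \<longrightarrow> Lp_norm q \<Omega> (U s) \<le> B * s powr (-\<gamma>))" "s \<in> J" "s < \<tau>"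
    then have "Lp_norm q \<Omega> (v s) \<le> c * B * s powr (-\<gamma>)" using that(1) unfolding bounded_by_def by blast
    also have "\<dots> \<le> 2 * B * s powr (-\<gamma>)" using h that(2) by (intro mult_right_mono) auto
    finally show "Lp_norm q \<Omega> (v s) \<le> 2 * B * s powr (-\<gamma>)" .
  qed
  have good_step: "good (step v)" if v: "good v" for v
    unfolding good_def
  proof (intro conjI ballI)
    show "step v s \<in> Lp_sigma q \<Omega>" if "s \<in> J" for s by (rule stepS[OF v that])
    show "norm_continuous q \<Omega> J (step v)"
      unfolding step_def
      by (rule norm_continuous_diff[OF _ e.duhamel_continuous[OF good_path[OF v] \<alpha> J] q_ge(2)]) (use U in \<open>auto simp: path_def\<close>)
    show "bounded_by (step v) 2" by (rule weaken[OF step_bound[OF v]]) simp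
  qed
  have good_U: "good U"
    unfolding good_def using U weaken[of U 1] by (auto simp: path_def bounded_by_def)
  define it where "it n = (step ^^ n) U" for n
  have it0: "it 0 = U" and itS: "it (Suc n) = step (it n)" for n by (simp_all add: it_def)
  have good_it: "good (it n)" for n by (induction n) (simp_all add: it0 itS good_U good_step)
  have itL: "it n s \<in> Lp q \<Omega>" if "s \<in> J" for n s
    using good_it[of n] that unfolding good_def by (blast intro: Lp_sigma_Lp)
  \<comment> \<open>The difference of the squares costs twice 2 \<Lambda> d, again 8 \<Lambda> times
    d/2, so a step contracts by the factor 1/2.\<close>
  have contract: "Lp_norm q \<Omega> (\<lambda>x. step u t x - step v t x) \<le> d / 2 * t powr (-\<alpha>)"
    if uv: "good u" "good v" and d: "\<And>s. s \<in> J \<Longrightarrow> Lp_norm q \<Omega> (\<lambda>x. u s x - v s x) \<le> d * s powr (-\<alpha>)" "0 \<le> d" and t: "t \<in> J"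
    for u v d t
  proof -
    have "(\<lambda>x. step u t x - step v t x) = (\<lambda>x. duhamel q v t x - duhamel q u t x)" by (simp add: step_def)
    then have "Lp_norm q \<Omega> (\<lambda>x. step u t x - step v t x) = Lp_norm q \<Omega> (\<lambda>x. duhamel q u t x - duhamel q v t x)"
      using Lp_norm_minus_commute[of q \<Omega> "duhamel q u t" "duhamel q v t"] by simp
    also have "\<dots> \<le> \<kappa> * (2 * (2 * \<Lambda>) * d) * (t powr (1 - \<beta> - 2 * \<alpha>) * m)"
      unfolding \<kappa>_def \<beta>_def m_def
      by (rule e.duhamel_diff_bound[OF sub[OF uv(1) t] sub[OF uv(2) t] J(1)[OF t] \<alpha>]) (use d J(2)[OF t] in auto)
    also have "\<dots> = (8 * (\<kappa> * m * \<Lambda> * t powr (1 - \<beta> - \<alpha>))) * (d / 2 * t powr (-\<alpha>))"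
      using split[of t \<alpha>] by (simp add: algebra_simps)
    also have "\<dots> \<le> 1 * (d / 2 * t powr (-\<alpha>))" using d(2) by (intro mult_right_mono small'[OF t]) auto
    finally show ?thesis by simp
  qed
  have incr: "\<forall>s\<in>J. Lp_norm q \<Omega> (\<lambda>x. it (Suc n) s x - it n s x) \<le> \<Lambda> * (1/2)^n * s powr (-\<alpha>)" for n
  proof (induction n)
    case 0
    show ?case
    proof
      fix s assume s: "s \<in> J"
      have "Lp_norm q \<Omega> (\<lambda>x. it (Suc 0) s x - it 0 s x) = Lp_norm q \<Omega> (duhamel q U s)"
        unfolding itS it0 step_def by simp
      also have "\<dots> \<le> (1/2) * \<Lambda> * s powr (-\<alpha>)"
        by (rule dbound[OF good_U s, of "s + 1"]) (use \<alpha> \<Lambda> UB in auto)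
      also have "\<dots> \<le> \<Lambda> * (1/2)^0 * s powr (-\<alpha>)" using \<Lambda> by (intro mult_right_mono) auto
      finally show "Lp_norm q \<Omega> (\<lambda>x. it (Suc 0) s x - it 0 s x) \<le> \<Lambda> * (1/2)^0 * s powr (-\<alpha>)" .
    qed
  next
    case (Suc n)
    show ?case
    proof
      fix s assume s: "s \<in> J"
      have "Lp_norm q \<Omega> (\<lambda>x. step (it (Suc n)) s x - step (it n) s x) \<le> \<Lambda> * (1/2)^n / 2 * s powr (-\<alpha>)"
        by (rule contract[OF good_it good_it _ _ s]) (use Suc \<Lambda> in auto)
      then show "Lp_norm q \<Omega> (\<lambda>x. it (Suc (Suc n)) s x - it (Suc n) s x) \<le> \<Lambda> * (1/2)^Suc n * s powr (-\<alpha>)"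
        by (simp add: itS)
    qed
  qed
  \<comment> \<open>2 - 2 (1/2)^k is the exact geometric sum of the increments, kept in this form
    for the induction on k.\<close>
  have tail: "Lp_norm q \<Omega> (\<lambda>x. it (n + k) s x - it n s x) \<le> (2 - 2 * (1/2)^k) * (\<Lambda> * (1/2)^n * s powr (-\<alpha>))"
    if s: "s \<in> J" for n k s
  proof (induction k)
    case (Suc k)
    have "Lp_norm q \<Omega> (\<lambda>x. it (n + Suc k) s x - it n s x) \<le>
        Lp_norm q \<Omega> (\<lambda>x. it (Suc (n + k)) s x - it (n + k) s x) + Lp_norm q \<Omega> (\<lambda>x. it (n + k) s x - it n s x)"
      using Lp_norm_triangle_via[OF itL[OF s] itL[OF s] itL[OF s] q_ge(2), of "n + Suc k" n "n + k"] by simp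
    also have "\<dots> \<le> \<Lambda> * (1/2)^(n + k) * s powr (-\<alpha>) + (2 - 2 * (1/2)^k) * (\<Lambda> * (1/2)^n * s powr (-\<alpha>))"
      using incr s Suc by (intro add_mono) auto
    also have "\<dots> = (2 - 2 * (1/2)^Suc k) * (\<Lambda> * (1/2)^n * s powr (-\<alpha>))"
      by (simp add: power_add algebra_simps)
    finally show ?case .
  qed simp
  define r where "r n s = 2 * (\<Lambda> * (1/2)^n * s powr (-\<alpha>))" for n :: nat and s
  have rlim: "(\<lambda>n. r n s) \<longlonglongrightarrow> 0" for s
  proof -
    have "(\<lambda>n. 2 * (\<Lambda> * (1/2)^n * s powr (-\<alpha>))) \<longlonglongrightarrow> 2 * (\<Lambda> * 0 * s powr (-\<alpha>))"
      by (intro tendsto_intros LIMSEQ_realpow_zero) auto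
    then show ?thesis by (simp add: r_def)
  qed
  have tail': "Lp_norm q \<Omega> (\<lambda>x. it (n + k) s x - it n s x) \<le> r n s" if s: "s \<in> J" for n k s
  proof -
    have "(2 - 2 * (1/2)^k) * (\<Lambda> * (1/2)^n * s powr (-\<alpha>)) \<le> 2 * (\<Lambda> * (1/2)^n * s powr (-\<alpha>))"
      using \<Lambda> by (intro mult_right_mono) auto
    then show ?thesis using tail[OF s, of n k] unfolding r_def by linarith
  qed
  have "\<exists>w \<in> Lp_sigma q \<Omega>. (\<lambda>n. Lp_norm q \<Omega> (\<lambda>x. it n s x - w x)) \<longlonglongrightarrow> 0" if s: "s \<in> J" for s
  proof (rule e.P.complete)
    show "it n s \<in> Lp_sigma q \<Omega>" for n using good_it s by (simp add: good_def)
    fix e :: real assume e: "e > 0"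
    then have "\<forall>\<^sub>F n in sequentially. r n s < e / 2" using order_tendstoD(2)[OF rlim, of "e/2"] by simp
    then obtain K where K: "r K s < e / 2" using eventually_happens'[OF sequentially_bot] by blast
    have "Lp_norm q \<Omega> (\<lambda>x. it i s x - it j s x) < e" if ij: "i \<ge> K" "j \<ge> K" for i j
    proof -
      have "Lp_norm q \<Omega> (\<lambda>x. it i s x - it j s x) \<le> Lp_norm q \<Omega> (\<lambda>x. it i s x - it K s x) + Lp_norm q \<Omega> (\<lambda>x. it K s x - it j s x)"
        by (rule Lp_norm_triangle_via[OF itL[OF s] itL[OF s] itL[OF s] q_ge(2)])
      moreover have "Lp_norm q \<Omega> (\<lambda>x. it i s x - it K s x) \<le> r K s"
        using tail'[OF s, of K "i - K"] ij by simp
      moreover have "Lp_norm q \<Omega> (\<lambda>x. it K s x - it j s x) \<le> r K s"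
        using tail'[OF s, of K "j - K"] ij Lp_norm_minus_commute[of q \<Omega> "it K s"] by simp
      ultimately show ?thesis using K by linarith
    qed
    then show "\<exists>K. \<forall>m\<ge>K. \<forall>n\<ge>K. Lp_norm q \<Omega> (\<lambda>x. it m s x - it n s x) < e" by blast
  qed
  then have "\<forall>s\<in>J. \<exists>w. w \<in> Lp_sigma q \<Omega> \<and> (\<lambda>n. Lp_norm q \<Omega> (\<lambda>x. it n s x - w x)) \<longlonglongrightarrow> 0" by blast
  from bchoice[OF this] obtain u where u: "\<And>s. s \<in> J \<Longrightarrow> u s \<in> Lp_sigma q \<Omega>"
      "\<And>s. s \<in> J \<Longrightarrow> (\<lambda>n. Lp_norm q \<Omega> (\<lambda>x. it n s x - u s x)) \<longlonglongrightarrow> 0" by blast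
  have uL: "u s \<in> Lp q \<Omega>" if "s \<in> J" for s using u(1)[OF that] by (rule Lp_sigma_Lp)
  have close: "Lp_norm q \<Omega> (\<lambda>x. it n s x - u s x) \<le> r n s" if s: "s \<in> J" for n s
  proof (rule LIMSEQ_le_const)
    show "(\<lambda>k. r n s + Lp_norm q \<Omega> (\<lambda>x. it (n + k) s x - u s x)) \<longlonglongrightarrow> r n s"
      using tendsto_add[OF tendsto_const[of "r n s"] LIMSEQ_ignore_initial_segment[OF u(2)[OF s], of n]]
      by (simp add: add.commute)
    have "Lp_norm q \<Omega> (\<lambda>x. it n s x - u s x) \<le> r n s + Lp_norm q \<Omega> (\<lambda>x. it (n + k) s x - u s x)" for k
    proof -
      have "Lp_norm q \<Omega> (\<lambda>x. it n s x - u s x) \<le> Lp_norm q \<Omega> (\<lambda>x. it n s x - it (n + k) s x) + Lp_norm q \<Omega> (\<lambda>x. it (n + k) s x - u s x)"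
        by (rule Lp_norm_triangle_via[OF itL[OF s] uL[OF s] itL[OF s] q_ge(2)])
      then show ?thesis using tail'[OF s, of n k] Lp_norm_minus_commute[of q \<Omega> "it n s" "it (n + k) s"] by linarith
    qed
    then show "\<exists>N. \<forall>k\<ge>N. Lp_norm q \<Omega> (\<lambda>x. it n s x - u s x) \<le> r n s + Lp_norm q \<Omega> (\<lambda>x. it (n + k) s x - u s x)" by blast
  qed
  have u_cont: "norm_continuous q \<Omega> J u"
    unfolding norm_continuous_def
  proof (intro ballI conjI uL)
    fix s assume s: "s \<in> J"
    show "((\<lambda>t. Lp_norm q \<Omega> (\<lambda>x. u t x - u s x)) \<longlongrightarrow> 0) (at s within J)"
    proof (rule tendstoI)
      fix e :: real assume e: "e > 0"
      have "\<forall>\<^sub>F n in sequentially. r n (s/2) < e / 3" using order_tendstoD(2)[OF rlim, of "e/3"] e by simp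
      then obtain n where n: "r n (s/2) < e / 3" using eventually_happens'[OF sequentially_bot] by blast
      \<comment> \<open>r decreases in time, so its value at s/2 serves all t near s. The
        convergence is thus locally uniform, and continuity passes to the limit.\<close>
      have rle: "r n t \<le> r n (s/2)" if "t > s/2" for t
        unfolding r_def using that J(1)[OF s] \<alpha> \<Lambda> by (intro mult_left_mono powr_mono2') auto
      have "((\<lambda>t. Lp_norm q \<Omega> (\<lambda>x. it n t x - it n s x)) \<longlongrightarrow> 0) (at s within J)"
        using good_it[of n] s by (simp add: good_def norm_continuous_def)
      then have "\<forall>\<^sub>F t in at s within J. Lp_norm q \<Omega> (\<lambda>x. it n t x - it n s x) < e / 3"
        by (rule order_tendstoD(2)) (use e in simp)
      moreover have "\<forall>\<^sub>F t in at s within J. t > s/2"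
        using order_tendstoD(1)[OF tendsto_ident_at, of "s/2" s J] J(1)[OF s] by simp
      moreover have "\<forall>\<^sub>F t in at s within J. t \<in> J" by (simp add: eventually_at_filter)
      ultimately show "\<forall>\<^sub>F t in at s within J. dist (Lp_norm q \<Omega> (\<lambda>x. u t x - u s x)) 0 < e"
      proof eventually_elim
        case (elim t)
        have "Lp_norm q \<Omega> (\<lambda>x. u t x - u s x) \<le> Lp_norm q \<Omega> (\<lambda>x. u t x - it n t x) + Lp_norm q \<Omega> (\<lambda>x. it n t x - u s x)"
          by (rule Lp_norm_triangle_via[OF uL[OF elim(3)] uL[OF s] itL[OF elim(3)] q_ge(2)])
        moreover have "Lp_norm q \<Omega> (\<lambda>x. it n t x - u s x) \<le> Lp_norm q \<Omega> (\<lambda>x. it n t x - it n s x) + Lp_norm q \<Omega> (\<lambda>x. it n s x - u s x)"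
          by (rule Lp_norm_triangle_via[OF itL[OF elim(3)] uL[OF s] itL[OF s] q_ge(2)])
        moreover have "Lp_norm q \<Omega> (\<lambda>x. u t x - it n t x) \<le> r n (s/2)"
          using close[OF elim(3), of n] rle[OF elim(2)] Lp_norm_minus_commute[of q \<Omega> "u t"] by simp
        moreover have "Lp_norm q \<Omega> (\<lambda>x. it n s x - u s x) \<le> r n (s/2)"
          using close[OF s, of n] rle[of s] J(1)[OF s] by simp
        ultimately have "Lp_norm q \<Omega> (\<lambda>x. u t x - u s x) < e" using n elim(1) by linarith
        then show ?case by simp
      qed
    qed
  qed
  have u_bound: "bounded_by u 2"
    unfolding bounded_by_def
  proof (intro allI impI ballI)
    fix \<gamma> B \<tau> s assume h: "0 \<le> \<gamma> \<and> \<gamma> \<le> \<alpha> \<and> 0 \<le> B \<and> (\<forall>s\<in>J. s < \<tau> \<longrightarrow> Lp_norm q \<Omega> (U s) \<le> B * s powr (-\<gamma>))" "s \<in> J" "s < \<tau>"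
    show "Lp_norm q \<Omega> (u s) \<le> 2 * B * s powr (-\<gamma>)"
    proof (rule LIMSEQ_le_const)
      show "(\<lambda>n. 2 * B * s powr (-\<gamma>) + r n s) \<longlonglongrightarrow> 2 * B * s powr (-\<gamma>)"
        using tendsto_add[OF tendsto_const[of "2 * B * s powr (-\<gamma>)"] rlim[of s]] by simp
      have "Lp_norm q \<Omega> (u s) \<le> 2 * B * s powr (-\<gamma>) + r n s" for n
      proof -
        have "Lp_norm q \<Omega> (u s) \<le> Lp_norm q \<Omega> (it n s) + Lp_norm q \<Omega> (\<lambda>x. u s x - it n s x)"
          by (rule Lp_norm_triangle_sub[OF uL[OF h(2)] itL[OF h(2)] q_ge(2)])
        moreover have "Lp_norm q \<Omega> (it n s) \<le> 2 * B * s powr (-\<gamma>)"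
          using good_it[of n] h unfolding good_def bounded_by_def by blast
        ultimately show ?thesis using close[OF h(2), of n] Lp_norm_minus_commute[of q \<Omega> "u s"] by simp
      qed
      then show "\<exists>N. \<forall>n\<ge>N. Lp_norm q \<Omega> (u s) \<le> 2 * B * s powr (-\<gamma>) + r n s" by blast
    qed
  qed
  have good_u: "good u" using u(1) u_cont u_bound by (simp add: good_def)
  \<comment> \<open>The iterate of index n + 1 is close to u as an iterate, and close to the step of
    u by contraction from index n.\<close>
  have eq: "ae_eq \<Omega> (u t) (step u t)" if t: "t \<in> J" for t
  proof -
    have sL: "step u t \<in> Lp q \<Omega>" using stepS[OF good_u t] by (rule Lp_sigma_Lp)
    have "Lp_norm q \<Omega> (\<lambda>x. u t x - step u t x) \<le> 0"
    proof (rule LIMSEQ_le_const)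
      show "(\<lambda>n. r (Suc n) t + r n t) \<longlonglongrightarrow> 0"
        using tendsto_add[OF LIMSEQ_Suc[OF rlim[of t]] rlim[of t]] by simp
      have "Lp_norm q \<Omega> (\<lambda>x. u t x - step u t x) \<le> r (Suc n) t + r n t" for n
      proof -
        have "Lp_norm q \<Omega> (\<lambda>x. u t x - step u t x) \<le> Lp_norm q \<Omega> (\<lambda>x. u t x - it (Suc n) t x) + Lp_norm q \<Omega> (\<lambda>x. it (Suc n) t x - step u t x)"
          by (rule Lp_norm_triangle_via[OF uL[OF t] sL itL[OF t] q_ge(2)])
        moreover have "Lp_norm q \<Omega> (\<lambda>x. step (it n) t x - step u t x) \<le> 2 * (\<Lambda> * (1/2)^n) / 2 * t powr (-\<alpha>)"
          by (rule contract[OF good_it good_u _ _ t]) (use close \<Lambda> in \<open>auto simp: r_def mult.assoc\<close>)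
        moreover have "2 * (\<Lambda> * (1/2)^n) / 2 * t powr (-\<alpha>) \<le> r n t"
          using \<Lambda> by (simp add: r_def)
        ultimately show ?thesis
          using close[OF t, of "Suc n"] Lp_norm_minus_commute[of q \<Omega> "u t" "it (Suc n) t"] unfolding itS by linarith
      qed
      then show "\<exists>N. \<forall>n\<ge>N. Lp_norm q \<Omega> (\<lambda>x. u t x - step u t x) \<le> r (Suc n) t + r n t" by blast
    qed
    then have "Lp_norm q \<Omega> (\<lambda>x. u t x - step u t x) = 0" by (intro antisym) auto
    then show ?thesis using e.P.norm_diff_eq_0[OF uL[OF t] sL] by blast
  qed
  show ?thesis
    using good_path[OF good_u] eq u_bound unfolding step_def bounded_by_def by (intro exI[of _ u]) blast
qed

end

section \<open>Regularity of mild solutions\<close>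

lemma norm_continuous_cong:
  assumes "norm_continuous p \<Omega> S v" "\<And>s. s \<in> S \<Longrightarrow> ae_eq \<Omega> (v s) (u s)" "\<And>s. s \<in> S \<Longrightarrow> u s \<in> Lp p \<Omega>"
  shows "norm_continuous p \<Omega> S u"
  unfolding norm_continuous_def
proof (intro ballI conjI assms(3))
  fix s assume s: "s \<in> S"
  have "\<forall>\<^sub>F r in at s within S. Lp_norm p \<Omega> (\<lambda>x. v r x - v s x) = Lp_norm p \<Omega> (\<lambda>x. u r x - u s x)"
    unfolding eventually_at_filter
  proof (intro always_eventually allI impI)
    fix r assume r: "r \<in> S"
    have m: "v r \<in> borel_measurable (lebesgue_on \<Omega>)" "v s \<in> borel_measurable (lebesgue_on \<Omega>)"
      "u r \<in> borel_measurable (lebesgue_on \<Omega>)" "u s \<in> borel_measurable (lebesgue_on \<Omega>)"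
      using norm_continuous_Lp[OF assms(1)] assms(3) r s by (blast intro: Lp_measurable)+
    have "ae_eq \<Omega> (\<lambda>x. v r x - v s x) (\<lambda>x. u r x - u s x)"
      using assms(2)[OF r] assms(2)[OF s] unfolding ae_eq_def by eventually_elim simp
    then show "Lp_norm p \<Omega> (\<lambda>x. v r x - v s x) = Lp_norm p \<Omega> (\<lambda>x. u r x - u s x)"
      by (rule Lp_norm_cong) (intro borel_measurable_diff m)+
  qed
  moreover have "((\<lambda>r. Lp_norm p \<Omega> (\<lambda>x. v r x - v s x)) \<longlongrightarrow> 0) (at s within S)"
    using assms(1) s by (simp add: norm_continuous_def)
  ultimately show "((\<lambda>r. Lp_norm p \<Omega> (\<lambda>x. u r x - u s x)) \<longlongrightarrow> 0) (at s within S)"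
    using tendsto_cong by fast
qed

lemma norm_continuous_scaleR:
  assumes "norm_continuous p \<Omega> S v" "continuous_on S c" "p \<ge> 1"
  shows "norm_continuous p \<Omega> S (\<lambda>s x. c s *\<^sub>R v s x)"
  unfolding norm_continuous_def
proof (intro ballI conjI)
  fix s assume s: "s \<in> S"
  have L: "v r \<in> Lp p \<Omega>" if "r \<in> S" for r using norm_continuous_Lp[OF assms(1) that] .
  then show "(\<lambda>x. c s *\<^sub>R v s x) \<in> Lp p \<Omega>" using s by (intro Lp_scaleR)
  have "((\<lambda>r. \<bar>c r\<bar> * Lp_norm p \<Omega> (\<lambda>x. v r x - v s x) + \<bar>c r - c s\<bar> * Lp_norm p \<Omega> (v s)) \<longlongrightarrow>
      \<bar>c s\<bar> * 0 + \<bar>c s - c s\<bar> * Lp_norm p \<Omega> (v s)) (at s within S)"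
    using assms(1,2) s by (intro tendsto_intros) (auto simp: norm_continuous_def continuous_on_def)
  then have lim: "((\<lambda>r. \<bar>c r\<bar> * Lp_norm p \<Omega> (\<lambda>x. v r x - v s x) + \<bar>c r - c s\<bar> * Lp_norm p \<Omega> (v s)) \<longlongrightarrow> 0) (at s within S)"
    by simp
  show "((\<lambda>r. Lp_norm p \<Omega> (\<lambda>x. c r *\<^sub>R v r x - c s *\<^sub>R v s x)) \<longlongrightarrow> 0) (at s within S)"
  proof (rule Lim_null_comparison[OF _ lim])
    show "\<forall>\<^sub>F r in at s within S. norm (Lp_norm p \<Omega> (\<lambda>x. c r *\<^sub>R v r x - c s *\<^sub>R v s x)) \<le>
        \<bar>c r\<bar> * Lp_norm p \<Omega> (\<lambda>x. v r x - v s x) + \<bar>c r - c s\<bar> * Lp_norm p \<Omega> (v s)"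
      unfolding eventually_at_filter
    proof (intro always_eventually allI impI)
      fix r assume r: "r \<in> S"
      have "(\<lambda>x. c r *\<^sub>R v r x - c s *\<^sub>R v s x) = (\<lambda>x. c r *\<^sub>R (v r x - v s x) + (c r - c s) *\<^sub>R v s x)"
        by (simp add: fun_eq_iff algebra_simps)
      then have "Lp_norm p \<Omega> (\<lambda>x. c r *\<^sub>R v r x - c s *\<^sub>R v s x) \<le>
          Lp_norm p \<Omega> (\<lambda>x. c r *\<^sub>R (v r x - v s x)) + Lp_norm p \<Omega> (\<lambda>x. (c r - c s) *\<^sub>R v s x)"
        using Lp_norm_triangle[OF Lp_scaleR[OF Lp_diff[OF L[OF r] L[OF s] assms(3)]] Lp_scaleR[OF L[OF s]] assms(3)] by simp
      then show "norm (Lp_norm p \<Omega> (\<lambda>x. c r *\<^sub>R v r x - c s *\<^sub>R v s x)) \<le>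
          \<bar>c r\<bar> * Lp_norm p \<Omega> (\<lambda>x. v r x - v s x) + \<bar>c r - c s\<bar> * Lp_norm p \<Omega> (v s)"
        using assms(3) by (simp add: Lp_norm_scaleR)
    qed
  qed
qed

text \<open>The pointwise inequality \<open>|f|\<^sup>q \<le> |f|\<^sup>p + |f|\<^sup>r\<close> replaces the sharper interpolation inequality.\<close>

lemma Lp_norm_interpolation:
  assumes "f \<in> Lp p \<Omega>" "f \<in> Lp r \<Omega>" "0 < p" "p \<le> q" "q \<le> r"
  shows "Lp_norm q \<Omega> f \<le> (Lp_norm p \<Omega> f powr p + Lp_norm r \<Omega> f powr r) powr (1 / q)"
proof -
  have le: "norm (f x) powr q \<le> norm (f x) powr p + norm (f x) powr r" for x
  proof (cases "norm (f x) \<le> 1")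
    case True
    then have "norm (f x) powr q \<le> norm (f x) powr p" using assms by (intro powr_mono') auto
    then show ?thesis by (simp add: add_increasing2)
  next
    case False
    then have "norm (f x) powr q \<le> norm (f x) powr r" using assms by (intro powr_mono) auto
    then show ?thesis by (simp add: add_increasing)
  qed
  note [measurable] = Lp_measurable[OF assms(1)]
  have i: "integrable (lebesgue_on \<Omega>) (\<lambda>x. norm (f x) powr p + norm (f x) powr r)"
    using Lp_integrable[OF assms(1)] Lp_integrable[OF assms(2)] by simp
  have iq: "integrable (lebesgue_on \<Omega>) (\<lambda>x. norm (f x) powr q)"
    by (rule Bochner_Integration.integrable_bound[OF i]) (use le in auto)
  have "(LINT x|lebesgue_on \<Omega>. norm (f x) powr q) \<le> (LINT x|lebesgue_on \<Omega>. norm (f x) powr p + norm (f x) powr r)"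
    by (intro integral_mono iq i le)
  also have "\<dots> = Lp_norm p \<Omega> f powr p + Lp_norm r \<Omega> f powr r"
    using assms Lp_integrable[OF assms(1)] Lp_integrable[OF assms(2)] by (simp add: Lp_norm_powr)
  finally show ?thesis
    unfolding Lp_norm_def[of q] using assms by (intro powr_mono2) (auto intro: integral_nonneg_AE)
qed

text \<open>The decay exponent in (E1), and at the same time the power of t in the weighted norms of
  the theorem.\<close>

definition weight :: "real \<Rightarrow> real \<Rightarrow> real" where
  "weight p q = (3/2) * (1/p - 1/q)"

lemma weight_nonneg: "0 < p \<Longrightarrow> p \<le> q \<Longrightarrow> 0 \<le> weight p q"
  by (simp add: weight_def frac_le)

lemma weight_pos: "0 < p \<Longrightarrow> p < q \<Longrightarrow> 0 < weight p q"
  by (simp add: weight_def frac_less2)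

context stokes_estimates
begin

lemma T_weight_bound:
  assumes "admissible_exponent \<epsilon> p" "admissible_exponent \<epsilon> q" "p \<le> q" "t > 0" "f \<in> Lp_sigma p \<Omega>"
  shows "Lp_norm q \<Omega> (T t f) \<le> const_of K1 p q * Lp_norm p \<Omega> f * t powr (- weight p q)"
proof -
  have "- (3/2) * (1/p - 1/q) = - weight p q" by (simp add: weight_def)
  then show ?thesis using T_bound(2)[OF assms] by (simp only: mult_ac)
qed

text \<open>a lies in L^r only, but T(h) a lies in L^p, so near a positive time the orbit is one
  that starts in L^p at an earlier time h.\<close>

lemma T_orbit_continuous:
  assumes "admissible_exponent \<epsilon> r" "admissible_exponent \<epsilon> p" "r \<le> p" "a \<in> Lp_sigma r \<Omega>"
  shows "norm_continuous p \<Omega> {0<..} (\<lambda>t. T t a)"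
  unfolding norm_continuous_def
proof (intro ballI conjI)
  interpret r: Lp_semigroup r \<Omega> T "stokes r \<Omega>" by (rule semigroup[OF assms(1)])
  interpret p: Lp_semigroup p \<Omega> T "stokes p \<Omega>" by (rule semigroup[OF assms(2)])
  have TL: "T t a \<in> Lp p \<Omega>" if "t > 0" for t using T_bound(1)[OF assms(1-3) that assms(4)] by (rule Lp_sigma_Lp)
  fix t0 :: real assume "t0 \<in> {0<..}"
  then have t0: "t0 > 0" by simp
  show "T t0 a \<in> Lp p \<Omega>" by (rule TL[OF t0])
  define h where "h = t0/2"
  define b where "b = T h a"
  have h: "h > 0" "t0 - h > 0" using t0 by (auto simp: h_def)
  have b: "b \<in> Lp_sigma p \<Omega>" unfolding b_def by (rule T_bound(1)[OF assms(1-3) h(1) assms(4)])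
  have f: "filterlim (\<lambda>t. t - h) (at (t0 - h)) (at t0 within {0<..})"
    by (auto simp: filterlim_at eventually_at_filter intro!: tendsto_eq_intros)
  have lim: "((\<lambda>t. Lp_norm p \<Omega> (\<lambda>x. T (t - h) b x - T (t0 - h) b x)) \<longlongrightarrow> 0) (at t0 within {0<..})"
    by (rule filterlim_compose[OF p.T_continuous[OF h(2) b] f])
  have "\<forall>\<^sub>F t in at t0 within {0<..}. t > h"
    using order_tendstoD(1)[OF tendsto_ident_at, of h t0 "{0<..}"] t0 by (simp add: h_def)
  then have "\<forall>\<^sub>F t in at t0 within {0<..}. Lp_norm p \<Omega> (\<lambda>x. T (t - h) b x - T (t0 - h) b x) = Lp_norm p \<Omega> (\<lambda>x. T t a x - T t0 a x)"
  proof eventually_elim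
    case (elim t)
    then have th: "t - h > 0" "t > 0" using h by auto
    have "ae_eq \<Omega> (\<lambda>x. T (t - h) b x - T (t0 - h) b x) (\<lambda>x. T t a x - T t0 a x)"
      using r.T_semigroup[OF th(1) h(1) assms(4)] r.T_semigroup[OF h(2,1) assms(4)]
      unfolding ae_eq_def b_def by eventually_elim simp
    then show ?case
      by (rule p.norm_cong) (intro Lp_diff TL th t0 p.p_ge_1 Lp_sigma_Lp[OF p.invariant[OF th(1) b]] Lp_sigma_Lp[OF p.invariant[OF h(2) b]])+
  qed
  with lim show "((\<lambda>t. Lp_norm p \<Omega> (\<lambda>x. T t a x - T t0 a x)) \<longlongrightarrow> 0) (at t0 within {0<..})"
    using tendsto_cong by fast
qed

text \<open>For a test function the L^p norm stays bounded, so the positive power of t wins. Test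
  functions are dense in L^r_\<sigma>, and (E1) bounds the remainder uniformly in t.\<close>

lemma T_vanish:
  assumes "admissible_exponent \<epsilon> r" "admissible_exponent \<epsilon> p" "r < p" "a \<in> Lp_sigma r \<Omega>"
  shows "((\<lambda>t. t powr weight r p * Lp_norm p \<Omega> (T t a)) \<longlongrightarrow> 0) (at_right 0)"
proof (rule tendstoI)
  interpret r: Lp_semigroup r \<Omega> T "stokes r \<Omega>" by (rule semigroup[OF assms(1)])
  interpret p: Lp_semigroup p \<Omega> T "stokes p \<Omega>" by (rule semigroup[OF assms(2)])
  have w: "weight r p > 0" using weight_pos assms r.p1 by simp
  fix e :: real assume e: "e > 0"
  \<comment> \<open>The 1 makes k positive, so that it can be divided by.\<close>
  define k where "k = const_of K1 r p + 1"
  have k: "k > 0" by (simp add: k_def add_nonneg_pos)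
  obtain \<phi> where \<phi>: "\<phi> \<in> solenoidal_tests \<Omega>" "Lp_norm r \<Omega> (\<lambda>x. \<phi> x - a x) < e / (2 * k)"
    using Lp_sigma_approx[OF assms(4), of "e / (2 * k)"] e k by auto
  have \<phi>r: "\<phi> \<in> Lp_sigma r \<Omega>" "\<phi> \<in> Lp_sigma p \<Omega>" using r.tests_Lp_sigma p.tests_Lp_sigma \<phi>(1) by auto
  have d: "(\<lambda>x. a x - \<phi> x) \<in> Lp_sigma r \<Omega>" by (rule r.diff[OF assms(4) \<phi>r(1)])
  have lim: "((\<lambda>t. t powr weight r p * (const_of K1 p p * Lp_norm p \<Omega> \<phi>)) \<longlongrightarrow> 0 powr weight r p * (const_of K1 p p * Lp_norm p \<Omega> \<phi>)) (at_right 0)"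
    using w by (intro tendsto_intros tendsto_powr2) (auto intro!: eventually_at_rightI[of 0 1])
  have "\<forall>\<^sub>F t in at_right 0. t powr weight r p * (const_of K1 p p * Lp_norm p \<Omega> \<phi>) < e / 2"
    by (rule order_tendstoD(2)[OF lim]) (use e w in simp)
  moreover have "\<forall>\<^sub>F t in at_right (0::real). t > 0" by (simp add: eventually_at_filter)
  ultimately show "\<forall>\<^sub>F t in at_right 0. dist (t powr weight r p * Lp_norm p \<Omega> (T t a)) 0 < e"
  proof eventually_elim
    case (elim t)
    have L: "T t (\<lambda>x. a x - \<phi> x) \<in> Lp p \<Omega>" "T t \<phi> \<in> Lp p \<Omega>" "T t a \<in> Lp p \<Omega>"
      using T_bound(1)[OF assms(1,2) less_imp_le[OF assms(3)] elim(2)] d \<phi>r(1) assms(4) by (auto intro: Lp_sigma_Lp)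
    have "ae_eq \<Omega> (\<lambda>x. T t (\<lambda>x. a x - \<phi> x) x + T t \<phi> x) (T t a)"
      using r.T_diff[OF elim(2) assms(4) \<phi>r(1)] unfolding ae_eq_def by eventually_elim simp
    then have "Lp_norm p \<Omega> (T t a) = Lp_norm p \<Omega> (\<lambda>x. T t (\<lambda>x. a x - \<phi> x) x + T t \<phi> x)"
      using p.norm_cong[OF _ Lp_add[OF L(1,2) p.p_ge_1] L(3)] by simp
    also have "\<dots> \<le> Lp_norm p \<Omega> (T t (\<lambda>x. a x - \<phi> x)) + Lp_norm p \<Omega> (T t \<phi>)"
      by (rule Lp_norm_triangle[OF L(1,2) p.p_ge_1])
    also have "\<dots> \<le> const_of K1 r p * Lp_norm r \<Omega> (\<lambda>x. a x - \<phi> x) * t powr (- weight r p) + const_of K1 p p * Lp_norm p \<Omega> \<phi> * t powr (- weight p p)"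
      using assms by (intro add_mono T_weight_bound elim d \<phi>r) auto
    finally have "t powr weight r p * Lp_norm p \<Omega> (T t a) \<le> t powr weight r p *
        (const_of K1 r p * Lp_norm r \<Omega> (\<lambda>x. a x - \<phi> x) * t powr (- weight r p) + const_of K1 p p * Lp_norm p \<Omega> \<phi> * t powr (- weight p p))"
      by (rule mult_left_mono) simp
    also have "\<dots> = (t powr weight r p * t powr (- weight r p)) * (const_of K1 r p * Lp_norm r \<Omega> (\<lambda>x. a x - \<phi> x)) +
        t powr weight r p * (const_of K1 p p * Lp_norm p \<Omega> \<phi>)"
      using elim(2) by (simp add: weight_def algebra_simps)
    also have "t powr weight r p * t powr (- weight r p) = 1" using elim(2) by (simp add: powr_add[symmetric])
    finally have 1: "t powr weight r p * Lp_norm p \<Omega> (T t a) \<le> const_of K1 r p * Lp_norm r \<Omega> (\<lambda>x. a x - \<phi> x) +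
        t powr weight r p * (const_of K1 p p * Lp_norm p \<Omega> \<phi>)" by simp
    have "const_of K1 r p * Lp_norm r \<Omega> (\<lambda>x. a x - \<phi> x) \<le> k * Lp_norm r \<Omega> (\<lambda>x. \<phi> x - a x)"
      using Lp_norm_minus_commute[of r \<Omega> a \<phi>] by (simp add: k_def mult_right_mono)
    also have "\<dots> < k * (e / (2 * k))" using \<phi>(2) k by (intro mult_strict_left_mono)
    also have "\<dots> = e / 2" using k by simp
    finally have "t powr weight r p * Lp_norm p \<Omega> (T t a) < e" using 1 elim(1) by linarith
    then show ?case by simp
  qed
qed

end

section \<open>Positive times, and continuity up to time 0\<close>

definition times :: "ereal \<Rightarrow> real set" where
  "times T0 = {t. 0 < t \<and> ereal t < T0}"

lemma times_pos: "t \<in> times T0 \<Longrightarrow> t > 0"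
  by (simp add: times_def)

lemma times_initial: "t \<in> times T0 \<Longrightarrow> {0<..<t} \<subseteq> times T0"
  by (auto simp: times_def) (meson ereal_less_eq(3) less_imp_le order_le_less_trans)

lemma open_times: "open (times T0)"
proof -
  consider c where "T0 = ereal c" | "T0 = \<infinity>" | "T0 = -\<infinity>" by (cases T0) auto
  then show ?thesis
  proof cases
    case (1 c)
    then have "times T0 = {0<..<c}" by (auto simp: times_def)
    then show ?thesis by simp
  next
    case 2
    then have "times T0 = {0<..}" by (auto simp: times_def)
    then show ?thesis by simp
  qed (simp add: times_def)
qed

lemma time_interval_eq: "T0 > 0 \<Longrightarrow> time_interval T0 = insert 0 (times T0)"
  by (auto simp: time_interval_def times_def simp flip: zero_ereal_def)

lemma eventually_times:
  assumes "T0 > 0"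
  shows "\<forall>\<^sub>F t in at_right 0. t \<in> times T0"
proof (cases T0)
  case (real c)
  then have "c > 0" using assms by simp
  then show ?thesis using real by (intro eventually_at_rightI[of 0 c]) (auto simp: times_def)
next
  case PInf
  then show ?thesis by (intro eventually_at_rightI[of 0 1]) (auto simp: times_def)
qed (use assms in auto)

lemma tendsto_time_interval_0:
  assumes "(f \<longlongrightarrow> l) (at_right 0)" "T0 > 0"
  shows "(f \<longlongrightarrow> l) (at 0 within time_interval T0)"
proof (rule tendsto_mono[OF _ assms(1)])
  show "at 0 within time_interval T0 \<le> at_right (0::real)"
    unfolding at_within_def time_interval_eq[OF assms(2)] by (intro inf_mono) (auto simp: times_def)
qed

lemma at_within_time_interval:
  assumes "t \<in> times T0" "T0 > 0"
  shows "at t within time_interval T0 = at t within times T0"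
  by (rule at_within_nhd[OF assms(1) open_times]) (auto simp: time_interval_eq[OF assms(2)])

lemma continuous_Lp_sigmaI:
  assumes "T0 > 0" "norm_continuous p \<Omega> (times T0) v" "\<And>t. t \<in> time_interval T0 \<Longrightarrow> v t \<in> Lp_sigma p \<Omega>"
    "((\<lambda>s. Lp_norm p \<Omega> (\<lambda>x. v s x - v 0 x)) \<longlongrightarrow> 0) (at_right 0)"
  shows "continuous_Lp_sigma p \<Omega> T0 v"
  unfolding continuous_Lp_sigma_def
proof (intro ballI conjI assms(3))
  fix t assume t: "t \<in> time_interval T0"
  show "((\<lambda>s. Lp_norm p \<Omega> (\<lambda>x. v s x - v t x)) \<longlongrightarrow> 0) (at t within time_interval T0)"
  proof (cases "t = 0")
    case True
    then show ?thesis using tendsto_time_interval_0[OF assms(4,1)] by simp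
  next
    case False
    then have "t \<in> times T0" using t time_interval_eq[OF assms(1)] by simp
    then show ?thesis using assms(2) at_within_time_interval[OF _ assms(1)] by (simp add: norm_continuous_def)
  qed
qed

text \<open>The equation is solved in L^q. Since the integral taken in L^p is almost everywhere the
  same function, the solution lies in L^p as well.\<close>

lemma (in kato_exponent) solution_Lp_sigma:
  assumes "path {0<..<t} u \<alpha> A" "t > 0" "0 \<le> \<alpha>" "\<alpha> < 1/2"
    and eq: "ae_eq \<Omega> (u t) (\<lambda>x. U x - duhamel q u t x)" and U: "U \<in> Lp_sigma p \<Omega>" and ut: "u t \<in> Lp q \<Omega>"
  shows "ae_eq \<Omega> (\<lambda>x. U x - duhamel p u t x) (u t)" "u t \<in> Lp_sigma p \<Omega>"
    "Lp_norm p \<Omega> (u t) \<le> Lp_norm p \<Omega> U + Lp_norm p \<Omega> (duhamel p u t)"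
proof -
  have d: "duhamel p u t \<in> Lp_sigma p \<Omega>" by (rule duhamel_Lp_sigma[OF assms(1-4)])
  show e: "ae_eq \<Omega> (\<lambda>x. U x - duhamel p u t x) (u t)"
    using eq duhamel_ae_eq[OF kato_exponent_axioms kato_exponent_q assms(1-4)] unfolding ae_eq_def by eventually_elim simp
  show s: "u t \<in> Lp_sigma p \<Omega>" by (rule P.cong[OF e P.diff[OF U d] Lp_measurable[OF ut]])
  show "Lp_norm p \<Omega> (u t) \<le> Lp_norm p \<Omega> U + Lp_norm p \<Omega> (duhamel p u t)"
    using Lp_norm_diff_le[OF Lp_sigma_Lp[OF U] Lp_sigma_Lp[OF d] P.p_ge_1]
      P.norm_cong[OF e Lp_sigma_Lp[OF P.diff[OF U d]] Lp_sigma_Lp[OF s]] by simp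
qed

text \<open>Part (1) is reduced to two facts about the integral term, its weighted boundedness and
  its decay at t = 0. The orbit T(t)a contributes through (E1), \<open>T_vanish\<close> and strong
  continuity.\<close>

lemma (in kato) solution_properties:
  assumes T0: "T0 > 0" and r: "admissible_exponent \<epsilon> r" "3 \<le> r" and a: "a \<in> Lp_sigma r \<Omega>"
    and u: "path (times T0) u \<alpha> A" "0 \<le> \<alpha>" "\<alpha> < 1/2"
    and eq: "\<And>t. t \<in> times T0 \<Longrightarrow> ae_eq \<Omega> (u t) (\<lambda>x. T t a x - duhamel q u t x)"
    and kp: "kato_exponent \<Omega> \<epsilon> T K1 K2 q p" "r \<le> p"
    and van: "((\<lambda>t. t powr weight r p * Lp_norm p \<Omega> (duhamel p u t)) \<longlongrightarrow> 0) (at_right 0)"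
    and bdd: "\<And>t. t \<in> times T0 \<Longrightarrow> t powr weight r p * Lp_norm p \<Omega> (duhamel p u t) \<le> M"
    and u'_def: "u' = (\<lambda>t. if t = 0 then a else u t)"
  shows "BC_Lp_sigma p \<Omega> T0 (\<lambda>t x. time_weight (weight r p) t *\<^sub>R u' t x)"
    and "p > r \<Longrightarrow> ((\<lambda>t. t powr weight r p * Lp_norm p \<Omega> (u' t)) \<longlongrightarrow> 0) (at_right 0)"
    and "p = r \<Longrightarrow> ((\<lambda>t. Lp_norm r \<Omega> (\<lambda>x. u' t x - a x)) \<longlongrightarrow> 0) (at_right 0)"
    and "p = r \<Longrightarrow> mild_solution \<Omega> T r a T0 u'"
proof -
  interpret e: kato_exponent \<Omega> \<epsilon> T K1 K2 q p by fact
  interpret rs: Lp_semigroup r \<Omega> T "stokes r \<Omega>" by (rule semigroup[OF r(1)])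
  define J where "J = times T0"
  have J: "t > 0" "{0<..<t} \<subseteq> J" if "t \<in> J" for t
    using that times_pos times_initial unfolding J_def by blast+
  have sub: "path {0<..<t} u \<alpha> A" if "t \<in> J" for t using path_subset[OF u(1)] J(2)[OF that] unfolding J_def by blast
  have TS: "T t a \<in> Lp_sigma p \<Omega>" if "t > 0" for t by (rule T_bound(1)[OF r(1) e.p_adm kp(2) that a])
  have dS: "duhamel p u t \<in> Lp_sigma p \<Omega>" if "t \<in> J" for t by (rule e.duhamel_Lp_sigma[OF sub[OF that] J(1)[OF that] u(2,3)])
  note sol = e.solution_Lp_sigma[OF sub J(1) u(2,3) eq[folded J_def] TS[OF J(1)] path_Lp[OF u(1)[folded J_def]]]
  have eqp: "ae_eq \<Omega> (\<lambda>x. T t a x - duhamel p u t x) (u t)" if t: "t \<in> J" for t by (rule sol(1)) (rule t)+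
  have uS: "u t \<in> Lp_sigma p \<Omega>" if t: "t \<in> J" for t by (rule sol(2)) (rule t)+
  have uN: "Lp_norm p \<Omega> (u t) \<le> Lp_norm p \<Omega> (T t a) + Lp_norm p \<Omega> (duhamel p u t)" if t: "t \<in> J" for t
    by (rule sol(3)) (rule t)+
  have ucont: "norm_continuous p \<Omega> J u"
  proof (rule norm_continuous_cong[OF _ eqp])
    show "norm_continuous p \<Omega> J (\<lambda>t x. T t a x - duhamel p u t x)"
    proof (rule norm_continuous_diff[OF _ _ e.P.p_ge_1])
      show "norm_continuous p \<Omega> J (\<lambda>t. T t a)"
        by (rule norm_continuous_subset[OF T_orbit_continuous[OF r(1) e.p_adm kp(2) a]]) (use J in auto)
      show "norm_continuous p \<Omega> J (duhamel p u)"
        by (rule e.duhamel_continuous[OF _ u(2,3) J]) (use u(1) in \<open>auto simp: J_def\<close>)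
    qed
  qed (use uS Lp_sigma_Lp in blast)+
  define w where "w = weight r p"
  have w0: "w \<ge> 0" unfolding w_def using weight_nonneg kp(2) r by simp
  have wT: "t powr w * Lp_norm p \<Omega> (T t a) \<le> const_of K1 r p * Lp_norm r \<Omega> a" if t: "t > 0" for t
  proof -
    have "t powr w * Lp_norm p \<Omega> (T t a) \<le> t powr w * (const_of K1 r p * Lp_norm r \<Omega> a * t powr (-w))"
      unfolding w_def by (intro mult_left_mono T_weight_bound r e.p_adm kp a t) auto
    also have "\<dots> = (t powr w * t powr (-w)) * (const_of K1 r p * Lp_norm r \<Omega> a)" by (simp only: mult_ac)
    also have "\<dots> = const_of K1 r p * Lp_norm r \<Omega> a" using t by (simp add: powr_add[symmetric])
    finally show ?thesis .
  qed
  have ev: "\<forall>\<^sub>F t in at_right 0. t \<in> J" unfolding J_def by (rule eventually_times[OF T0])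
  have lim_pos: "((\<lambda>t. t powr w * Lp_norm p \<Omega> (u' t)) \<longlongrightarrow> 0) (at_right 0)" if "p > r"
  proof (rule Lim_null_comparison)
    show "((\<lambda>t. t powr w * Lp_norm p \<Omega> (T t a) + t powr w * Lp_norm p \<Omega> (duhamel p u t)) \<longlongrightarrow> 0) (at_right 0)"
      using tendsto_add[OF T_vanish[OF r(1) e.p_adm that a] van] by (simp add: w_def)
    show "\<forall>\<^sub>F t in at_right 0. norm (t powr w * Lp_norm p \<Omega> (u' t)) \<le>
        t powr w * Lp_norm p \<Omega> (T t a) + t powr w * Lp_norm p \<Omega> (duhamel p u t)"
      using ev
    proof eventually_elim
      case (elim t)
      have "t powr w * Lp_norm p \<Omega> (u t) \<le> t powr w * (Lp_norm p \<Omega> (T t a) + Lp_norm p \<Omega> (duhamel p u t))"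
        by (intro mult_left_mono uN elim) simp
      then show ?case using J(1)[OF elim] by (simp add: u'_def distrib_left)
    qed
  qed
  then show "p > r \<Longrightarrow> ((\<lambda>t. t powr weight r p * Lp_norm p \<Omega> (u' t)) \<longlongrightarrow> 0) (at_right 0)" by (simp add: w_def)
  have lim_a: "((\<lambda>t. Lp_norm p \<Omega> (\<lambda>x. u' t x - a x)) \<longlongrightarrow> 0) (at_right 0)" if pr: "p = r"
  proof (rule Lim_null_comparison)
    have "((\<lambda>t. t powr w * Lp_norm p \<Omega> (duhamel p u t)) \<longlongrightarrow> 0) (at_right 0)" using van by (simp add: w_def)
    moreover have "\<forall>\<^sub>F t in at_right 0. t powr w * Lp_norm p \<Omega> (duhamel p u t) = Lp_norm p \<Omega> (duhamel p u t)"
      using ev by eventually_elim (use J pr in \<open>auto simp: w_def weight_def\<close>)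
    ultimately have "((\<lambda>t. Lp_norm p \<Omega> (duhamel p u t)) \<longlongrightarrow> 0) (at_right 0)" using tendsto_cong by fast
    from tendsto_add[OF rs.T_initial[OF a] this]
    show "((\<lambda>t. Lp_norm p \<Omega> (\<lambda>x. T t a x - a x) + Lp_norm p \<Omega> (duhamel p u t)) \<longlongrightarrow> 0) (at_right 0)" by (simp add: pr)
    show "\<forall>\<^sub>F t in at_right 0. norm (Lp_norm p \<Omega> (\<lambda>x. u' t x - a x)) \<le> Lp_norm p \<Omega> (\<lambda>x. T t a x - a x) + Lp_norm p \<Omega> (duhamel p u t)"
      using ev
    proof eventually_elim
      case (elim t)
      have L: "T t a \<in> Lp p \<Omega>" "duhamel p u t \<in> Lp p \<Omega>" "a \<in> Lp p \<Omega>" "u t \<in> Lp p \<Omega>"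
        using TS[OF J(1)[OF elim]] dS[OF elim] uS[OF elim] a pr by (auto intro: Lp_sigma_Lp)
      have "ae_eq \<Omega> (\<lambda>x. (T t a x - a x) - duhamel p u t x) (\<lambda>x. u t x - a x)"
        using eqp[OF elim] unfolding ae_eq_def by eventually_elim (simp add: algebra_simps)
      then have "Lp_norm p \<Omega> (\<lambda>x. u t x - a x) = Lp_norm p \<Omega> (\<lambda>x. (T t a x - a x) - duhamel p u t x)"
        using e.P.norm_cong[OF _ Lp_diff[OF Lp_diff[OF L(1,3) e.P.p_ge_1] L(2) e.P.p_ge_1] Lp_diff[OF L(4,3) e.P.p_ge_1]] by simp
      then show ?case
        using Lp_norm_diff_le[OF Lp_diff[OF L(1,3) e.P.p_ge_1] L(2) e.P.p_ge_1] J(1)[OF elim] by (simp add: u'_def)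
    qed
  qed
  then show "p = r \<Longrightarrow> ((\<lambda>t. Lp_norm r \<Omega> (\<lambda>x. u' t x - a x)) \<longlongrightarrow> 0) (at_right 0)" by simp
  define V where "V t x = time_weight w t *\<^sub>R u' t x" for t x
  \<comment> \<open>The weight is 0 only for p = r. Then 0^0 = 1 keeps the initial value a, whereas
    for p > r the weighted curve starts at 0.\<close>
  have w_cases: "(w = 0 \<and> p = r) \<or> (w > 0 \<and> p > r)"
    unfolding w_def using kp(2) r weight_pos[of r p] by (cases "p = r") (auto simp: weight_def)
  have VJ: "V t = (\<lambda>x. t powr w *\<^sub>R u t x)" if "t \<in> J" for t
    using J(1)[OF that] by (auto simp: V_def u'_def time_weight_def)
  have Vcont: "continuous_Lp_sigma p \<Omega> T0 V"
  proof (rule continuous_Lp_sigmaI[OF T0])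
    have "norm_continuous p \<Omega> J (\<lambda>t x. t powr w *\<^sub>R u t x)"
      using J by (intro norm_continuous_scaleR[OF ucont _ e.P.p_ge_1] continuous_intros) (auto simp: less_imp_neq)
    then show "norm_continuous p \<Omega> (times T0) V"
      unfolding J_def[symmetric] by (rule norm_continuous_cong) (use VJ uS in \<open>auto intro: Lp_sigma_Lp[OF e.P.scaleR]\<close>)
    show "V t \<in> Lp_sigma p \<Omega>" if "t \<in> time_interval T0" for t
    proof (cases "t = 0")
      case True
      show ?thesis
      proof (cases "p = r")
        case True
        then have "V 0 = a" using w_cases by (auto simp: V_def time_weight_def u'_def)
        then show ?thesis using \<open>t = 0\<close> a True by simp
      next
        case False
        then have "V 0 = (\<lambda>_. 0)" using w_cases by (auto simp: V_def time_weight_def)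
        then show ?thesis using \<open>t = 0\<close> e.P.tests_Lp_sigma[OF zero_solenoidal_test] by simp
      qed
    next
      case False
      then have "t \<in> J" using that time_interval_eq[OF T0] by (simp add: J_def)
      then show ?thesis using VJ uS e.P.scaleR by simp
    qed
    show "((\<lambda>s. Lp_norm p \<Omega> (\<lambda>x. V s x - V 0 x)) \<longlongrightarrow> 0) (at_right 0)"
    proof (cases "p = r")
      case True
      then have "V = u'" using w_cases by (auto simp: V_def time_weight_def fun_eq_iff)
      then show ?thesis using lim_a[OF True] by (simp add: u'_def)
    next
      case False
      then have w: "w > 0" "p > r" using w_cases by auto
      have "\<forall>\<^sub>F t in at_right 0. t powr w * Lp_norm p \<Omega> (u' t) = Lp_norm p \<Omega> (\<lambda>x. V t x - V 0 x)"
        using ev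
      proof eventually_elim
        case (elim t)
        have "(\<lambda>x. V t x - V 0 x) = (\<lambda>x. t powr w *\<^sub>R u' t x)"
          using w J(1)[OF elim] by (simp add: V_def time_weight_def)
        then show ?case using Lp_norm_scaleR[OF e.P.p_pos, of \<Omega> "t powr w" "u' t"] by simp
      qed
      then show ?thesis using lim_pos[OF w(2)] tendsto_cong by fast
    qed
  qed
  have "\<exists>M. \<forall>t\<in>time_interval T0. Lp_norm p \<Omega> (V t) \<le> M"
  proof (intro exI ballI)
    fix t assume t: "t \<in> time_interval T0"
    \<comment> \<open>The estimates concern positive times; the maximum takes care of time
      0.\<close>
    show "Lp_norm p \<Omega> (V t) \<le> max (const_of K1 r p * Lp_norm r \<Omega> a + M) (Lp_norm p \<Omega> (V 0))"
    proof (cases "t = 0")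
      case False
      then have tJ: "t \<in> J" using t time_interval_eq[OF T0] by (simp add: J_def)
      have "Lp_norm p \<Omega> (V t) = t powr w * Lp_norm p \<Omega> (u t)"
        unfolding VJ[OF tJ] using Lp_norm_scaleR[OF e.P.p_pos, of \<Omega> "t powr w" "u t"] by simp
      also have "\<dots> \<le> t powr w * (Lp_norm p \<Omega> (T t a) + Lp_norm p \<Omega> (duhamel p u t))"
        by (intro mult_left_mono uN tJ) simp
      also have "\<dots> \<le> const_of K1 r p * Lp_norm r \<Omega> a + M"
        using wT[OF J(1)[OF tJ]] bdd[of t] tJ by (simp add: distrib_left w_def J_def)
      finally show ?thesis by simp
    qed simp
  qed
  with Vcont show "BC_Lp_sigma p \<Omega> T0 (\<lambda>t x. time_weight (weight r p) t *\<^sub>R u' t x)"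
    unfolding BC_Lp_sigma_def V_def w_def by blast
  show "mild_solution \<Omega> T r a T0 u'" if pr: "p = r"
    unfolding mild_solution_def
  proof (intro conjI allI impI)
    have "V = u'" using w_cases pr by (auto simp: V_def time_weight_def fun_eq_iff)
    then show "continuous_Lp_sigma r \<Omega> T0 u'" using Vcont pr by simp
    show "ae_eq \<Omega> (u' 0) a" by (simp add: u'_def)
    fix t assume t: "0 < t \<and> ereal t < T0"
    then have tJ: "t \<in> J" by (simp add: J_def times_def)
    note I = sub[OF tJ] J(1)[OF tJ] u(2,3)
    show "\<exists>g w. (\<forall>s. 0 < s \<and> s < t \<longrightarrow> semigroup_proj_div r \<Omega> T (t - s) (\<lambda>x. tensor (u' s x) (u' s x)) (g s)) \<and>
           has_Lp_bochner_integral r \<Omega> {0<..<t} g w \<and> ae_eq \<Omega> (u' t) (\<lambda>x. T t a x - w x)"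
    proof (intro exI conjI allI impI)
      show "semigroup_proj_div r \<Omega> T (t - s) (\<lambda>x. tensor (u' s x) (u' s x)) (integrand u t s)" if "0 < s \<and> s < t" for s
        using e.duhamel_mild[OF I, of s] that pr by (simp add: u'_def)
      show "has_Lp_bochner_integral r \<Omega> {0<..<t} (integrand u t) (duhamel p u t)"
        using e.duhamel_is_integral[OF I] unfolding e.P.is_integral_def unfolding pr by blast
      show "ae_eq \<Omega> (u' t) (\<lambda>x. T t a x - duhamel p u t x)"
        using ae_eq_sym[OF eqp[OF tJ]] t by (simp add: u'_def)
    qed
  qed
qed

text \<open>In the resulting power of t the exponents p and q cancel. What remains depends on r, the
  space of the data, and on \<rho>, whose scaling bounds u.\<close>

lemma (in kato_exponent) duhamel_weighted_bound:
  assumes "path {0<..<t} u \<alpha> A" "t > 0" "0 \<le> \<alpha>" "\<alpha> < 1/2" "weight \<rho> q < 1/2"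
    "\<And>s. 0 < s \<Longrightarrow> s < t \<Longrightarrow> Lp_norm q \<Omega> (u s) \<le> B * s powr (- weight \<rho> q)"
  shows "t powr weight r p * Lp_norm p \<Omega> (duhamel p u t)
    \<le> \<kappa> * B * B * kernel_mass \<beta> (2 * weight \<rho> q) * t powr (1/2 + 3/(2*r) - 3/\<rho>)"
proof -
  define w where "w = weight \<rho> q"
  have "Lp_norm p \<Omega> (duhamel p u t) \<le> \<kappa> * B * B * (t powr (1 - \<beta> - (w + w)) * kernel_mass \<beta> (w + w))"
    unfolding w_def by (rule duhamel_bound[OF assms(1-4) assms(6,6)]) (use assms(5) in auto)
  then have "t powr weight r p * Lp_norm p \<Omega> (duhamel p u t) \<le> t powr weight r p * (\<kappa> * B * B * (t powr (1 - \<beta> - (w + w)) * kernel_mass \<beta> (w + w)))"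
    by (rule mult_left_mono) simp
  also have "\<dots> = \<kappa> * B * B * kernel_mass \<beta> (2 * w) * (t powr weight r p * t powr (1 - \<beta> - (w + w)))"
    unfolding mult_2 by (simp only: mult_ac)
  also have "t powr weight r p * t powr (1 - \<beta> - (w + w)) = t powr (weight r p + (1 - \<beta> - (w + w)))" by (simp only: powr_add)
  also have "weight r p + (1 - \<beta> - (w + w)) = 1/2 + 3/(2*r) - 3/\<rho>"
  proof -
    define x y z v where "x = 1/p" and "y = 1/r" and "z = 1/q" and "v = 1/\<rho>"
    have e: "3/(2*p) = 3/2 * x" "3/(2*r) = 3/2 * y" "3/q = 3 * z" "3/\<rho> = 3 * v"
      by (simp_all add: x_def y_def z_def v_def)
    show ?thesis
      unfolding w_def weight_def smoothing_exponent_eq e x_def[symmetric] y_def[symmetric] z_def[symmetric] v_def[symmetric]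
      by (simp add: field_simps)
  qed
  finally show ?thesis by (simp only: w_def)
qed

section \<open>Local and global solutions\<close>

text \<open>The locale constants are taken with K1 and K2 as arguments, so the value depends on the
  estimates alone. The absolute value and the 1 make it positive and at least the factor in the
  smallness condition.\<close>

definition picard_const :: "constants \<Rightarrow> constants \<Rightarrow> real \<Rightarrow> real \<Rightarrow> real" where
  "picard_const K1 K2 \<rho> q = 1 + \<bar>8 * (stokes_proj_div.smoothing_const K1 K2 (q/2) q *
     kernel_mass (stokes_proj_div.smoothing_exponent (q/2) q) (2 * weight \<rho> q))\<bar>"

lemma picard_const_pos: "picard_const K1 K2 \<rho> q > 0"
  by (simp add: picard_const_def add_pos_nonneg)

text \<open>The constants of the theorem may depend on the estimates only, so the auxiliary exponent is read off
  the domain of \<open>K1\<close>, which encodes the admissible exponents.\<close>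

definition base_exponent :: "constants \<Rightarrow> real" where
  "base_exponent K1 = (SOME q. 3 < q \<and> q < 4 \<and> (q, q) \<in> dom K1 \<and>
     (\<forall>p. 3 \<le> p \<and> p < 4 \<and> (p, p) \<in> dom K1 \<longrightarrow> 2/q - 1/p < 1/3))"

text \<open>The auxiliary exponent is raised to r if necessary, because (E1) never lowers the
  exponent. The 1 keeps the constant positive.\<close>

definition local_const :: "constants \<Rightarrow> constants \<Rightarrow> real \<Rightarrow> real" where
  "local_const K1 K2 r = picard_const K1 K2 r (max (base_exponent K1) r) *
     (1 + const_of K1 r (max (base_exponent K1) r))"

text \<open>At exponent 3 the smallness condition contains no power of t, so it becomes a bound on
  the norm of a alone.\<close>

definition smallness_const :: "constants \<Rightarrow> constants \<Rightarrow> real" where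
  "smallness_const K1 K2 = 1 / local_const K1 K2 3"

text \<open>Adds the bound of T(t)a and that of the integral term for u in the ball of radius 2
  \<Lambda>; the absolute value and the 1 make it positive.\<close>

definition decay_const :: "real \<Rightarrow> constants \<Rightarrow> constants \<Rightarrow> real" where
  "decay_const p K1 K2 = (let q = base_exponent K1; \<Lambda> = const_of K1 3 q * smallness_const K1 K2 in
     1 + \<bar>const_of K1 3 p * smallness_const K1 K2 + stokes_proj_div.smoothing_const K1 K2 (q/2) p * (2 * \<Lambda>) * (2 * \<Lambda>) *
       kernel_mass (stokes_proj_div.smoothing_exponent (q/2) p) (2 * weight 3 q)\<bar>)"

lemma local_const_pos: "local_const K1 K2 r > 0"
  unfolding local_const_def by (intro mult_pos_pos picard_const_pos add_pos_nonneg) auto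

lemma smallness_const_pos: "smallness_const K1 K2 > 0"
  by (simp add: smallness_const_def local_const_pos)

lemma decay_const_pos: "decay_const p K1 K2 > 0"
  by (simp add: decay_const_def Let_def add_pos_nonneg)

lemma weight_less_half:
  assumes "3 \<le> \<rho>" "\<rho> \<le> q" "q < 4"
  shows "weight \<rho> q < 1/2"
proof -
  have "1/\<rho> \<le> 1/3" "1/4 < 1/q" using assms by (simp_all add: field_simps)
  then show ?thesis unfolding weight_def by argo
qed

lemma weight_antimono:
  assumes "0 < r" "r \<le> \<rho>"
  shows "weight \<rho> q \<le> weight r q"
proof -
  have "1/\<rho> \<le> 1/r" using assms by (intro divide_left_mono) auto
  then show ?thesis unfolding weight_def by argo
qed

section \<open>Choice of the auxiliary exponent\<close>

context stokes_estimates
begin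

lemma diagonal_dom: "(p, p) \<in> dom K1 \<longleftrightarrow> admissible_exponent \<epsilon> p"
  using E1 by (simp add: estimate_E1_def)

text \<open>Since (1/3 - \<epsilon>) (3 + \<epsilon>) = 1 - \<epsilon> (8/3 + \<epsilon>) is below
  1, the range p < 3 + \<epsilon> of the theorem lies within 1/p > 1/3 - \<epsilon>.\<close>

lemma admissible_above_3:
  assumes "3 \<le> p" "p < 3 + \<epsilon>"
  shows "admissible_exponent \<epsilon> p"
proof -
  have "(1/3 - \<epsilon>) * p < 1"
  proof (cases "\<epsilon> \<le> 1/3")
    case True
    then have "(1/3 - \<epsilon>) * p \<le> (1/3 - \<epsilon>) * (3 + \<epsilon>)" using assms by (intro mult_left_mono) auto
    also have "\<dots> = 1 - \<epsilon> * (8/3 + \<epsilon>)" by (simp add: algebra_simps)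
    also have "\<dots> < 1" using \<epsilon> by simp
    finally show ?thesis .
  next
    case False
    then have "(1/3 - \<epsilon>) * p \<le> 0" using assms by (intro mult_nonpos_nonneg) auto
    then show ?thesis by simp
  qed
  then have "1/3 - \<epsilon> < 1/p" using assms by (simp add: pos_less_divide_eq)
  moreover have "1/p \<le> 1/3" using assms by (simp add: field_simps)
  ultimately show ?thesis using assms unfolding admissible_exponent_def by auto
qed

text \<open>2/q - 1/p < 1/3 says that the smoothing exponent 1/2 + 3/q - 3/(2p) is below 1. One q
  serves all p: each 1/p exceeds 1/3 - \<delta>, and 1/q is put halfway between that value and
  1/3.\<close>

lemma base_exponent:
  shows "3 < base_exponent K1" "base_exponent K1 < 4" "admissible_exponent \<epsilon> (base_exponent K1)"
    and "\<And>p. 3 \<le> p \<Longrightarrow> p < 4 \<Longrightarrow> admissible_exponent \<epsilon> p \<Longrightarrow> 2 / base_exponent K1 - 1/p < 1/3"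
proof -
  \<comment> \<open>1/12 = 1/3 - 1/4 stands for p < 4, and \<epsilon> for admissibility.\<close>
  define \<delta> where "\<delta> = min (1/12) \<epsilon>"
  have \<delta>: "0 < \<delta>" "\<delta> \<le> 1/12" "\<delta> \<le> \<epsilon>" using \<epsilon> by (auto simp: \<delta>_def)
  define q where "q = 1 / (1/3 - \<delta>/2)"
  have q: "1/q = 1/3 - \<delta>/2" by (simp add: q_def)
  have q34: "3 < q" "q < 4" using \<delta> unfolding q_def by (simp_all add: field_simps)
  have adm: "admissible_exponent \<epsilon> q" unfolding admissible_exponent_def q using \<delta> q34 by auto
  have "2/q - 1/p < 1/3" if "3 \<le> p" "p < 4" "admissible_exponent \<epsilon> p" for p
  proof -
    have "1/p > 1/4" using that by (simp add: field_simps)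
    moreover have "1/p > 1/3 - \<epsilon>" using that(3) unfolding admissible_exponent_def by linarith
    ultimately have "1/p > 1/3 - \<delta>" by (auto simp: \<delta>_def min_def)
    moreover have "2/q = 2 * (1/q)" by simp
    ultimately show ?thesis using q by linarith
  qed
  then have "\<exists>q. 3 < q \<and> q < 4 \<and> (q, q) \<in> dom K1 \<and>
     (\<forall>p. 3 \<le> p \<and> p < 4 \<and> (p, p) \<in> dom K1 \<longrightarrow> 2/q - 1/p < 1/3)"
    using q34 adm unfolding diagonal_dom by blast
  from someI_ex[OF this, folded base_exponent_def, unfolded diagonal_dom]
  show "3 < base_exponent K1" "base_exponent K1 < 4" "admissible_exponent \<epsilon> (base_exponent K1)"
    "\<And>p. 3 \<le> p \<Longrightarrow> p < 4 \<Longrightarrow> admissible_exponent \<epsilon> p \<Longrightarrow> 2 / base_exponent K1 - 1/p < 1/3"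
    by blast+
qed

text \<open>Raising q above the base exponent only lowers 3/q, hence the smoothing exponent.\<close>

lemma kato_exponent_above_base:
  assumes "base_exponent K1 \<le> q" "q < 4" "admissible_exponent \<epsilon> q" "3 \<le> p" "p < 4" "admissible_exponent \<epsilon> p"
  shows "kato_exponent \<Omega> \<epsilon> T K1 K2 q p"
proof -
  interpret kato \<Omega> \<epsilon> T K1 K2 q by unfold_locales (use assms base_exponent(1) in auto)
  show ?thesis
  proof
    have "3/q \<le> 3 / base_exponent K1" using assms base_exponent(1) by (intro divide_left_mono) auto
    then show "smoothing_exponent p < 1"
      using base_exponent(4)[OF assms(4-6)] unfolding smoothing_exponent_eq by simp
  qed (use assms in auto)
qed

definition regular_solution :: "real \<Rightarrow> 3 field \<Rightarrow> ereal \<Rightarrow> (real \<Rightarrow> 3 field) \<Rightarrow> bool" where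
  "regular_solution r a T0 u \<longleftrightarrow> T0 > 0 \<and> mild_solution \<Omega> T r a T0 u \<and>
     (\<forall>p. r \<le> p \<and> p < min (3 + \<epsilon>) 4 \<longrightarrow>
        BC_Lp_sigma p \<Omega> T0 (\<lambda>t x. time_weight (weight r p) t *\<^sub>R u t x) \<and>
        (p > r \<longrightarrow> ((\<lambda>t. t powr weight r p * Lp_norm p \<Omega> (u t)) \<longlongrightarrow> 0) (at_right 0))) \<and>
     ((\<lambda>t. Lp_norm r \<Omega> (\<lambda>x. u t x - a x)) \<longlongrightarrow> 0) (at_right 0)"

end

section \<open>From the iteration to solutions with the properties of part (1)\<close>

context kato
begin

text \<open>Iteration with U(t) = T(t)a and \<alpha> the weight between \<rho> and q. The power of t
  in the smallness condition becomes 1/2 - 3/(2 \<rho>), which is 0 in the critical case \<rho> =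
  3.\<close>

lemma kato_solution:
  assumes \<rho>: "3 \<le> \<rho>" "\<rho> \<le> q" "admissible_exponent \<epsilon> \<rho>" and a: "a \<in> Lp_sigma \<rho> \<Omega>" and \<Lambda>: "0 \<le> \<Lambda>"
    and bound: "\<And>t. t \<in> times T0 \<Longrightarrow> Lp_norm q \<Omega> (T t a) \<le> \<Lambda> * t powr (- weight \<rho> q)"
    and small: "\<And>t. t \<in> times T0 \<Longrightarrow> picard_const K1 K2 \<rho> q * \<Lambda> * t powr (1/2 - 3/(2*\<rho>)) \<le> 1"
  shows "\<exists>u. path (times T0) u (weight \<rho> q) (2 * \<Lambda>) \<and> (\<forall>t\<in>times T0. ae_eq \<Omega> (u t) (\<lambda>x. T t a x - duhamel q u t x)) \<and>
    (\<forall>\<gamma> B \<tau>. 0 \<le> \<gamma> \<and> \<gamma> \<le> weight \<rho> q \<and> 0 \<le> B \<and> (\<forall>s\<in>times T0. s < \<tau> \<longrightarrow> Lp_norm q \<Omega> (T s a) \<le> B * s powr (-\<gamma>)) \<longrightarrow>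
      (\<forall>s\<in>times T0. s < \<tau> \<longrightarrow> Lp_norm q \<Omega> (u s) \<le> 2 * B * s powr (-\<gamma>)))"
proof (rule kato_iteration)
  show w: "0 \<le> weight \<rho> q" "weight \<rho> q < 1/2" using weight_nonneg weight_less_half \<rho> q_lt by auto
  show "path (times T0) (\<lambda>t. T t a) (weight \<rho> q) \<Lambda>"
    unfolding path_def
  proof (intro conjI ballI bound)
    show "T s a \<in> Lp_sigma q \<Omega>" if "s \<in> times T0" for s
      by (rule T_bound(1)[OF \<rho>(3) q_adm \<rho>(2) times_pos[OF that] a])
    show "norm_continuous q \<Omega> (times T0) (\<lambda>t. T t a)"
      by (rule norm_continuous_subset[OF T_orbit_continuous[OF \<rho>(3) q_adm \<rho>(2) a]]) (use times_pos in auto)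
  qed
  fix t assume t: "t \<in> times T0"
  show "t > 0" by (rule times_pos[OF t])
  show "{0<..<t} \<subseteq> times T0" by (rule times_initial[OF t])
  have e: "1 - smoothing_exponent q - weight \<rho> q = 1/2 - 3/(2*\<rho>)"
    unfolding smoothing_exponent_eq weight_def using q_gt \<rho> by (simp add: field_simps)
  define c where "c = 8 * (smoothing_const q * kernel_mass (smoothing_exponent q) (2 * weight \<rho> q))"
  have "8 * (smoothing_const q * kernel_mass (smoothing_exponent q) (2 * weight \<rho> q) * \<Lambda> *
      t powr (1 - smoothing_exponent q - weight \<rho> q)) = c * (\<Lambda> * t powr (1/2 - 3/(2*\<rho>)))"
    unfolding e c_def by simp
  also have "\<dots> \<le> picard_const K1 K2 \<rho> q * (\<Lambda> * t powr (1/2 - 3/(2*\<rho>)))"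
    using \<Lambda> by (intro mult_right_mono) (auto simp: picard_const_def c_def)
  also have "\<dots> \<le> 1" using small[OF t] by (simp only: mult.assoc)
  finally show "8 * (smoothing_const q * kernel_mass (smoothing_exponent q) (2 * weight \<rho> q) * \<Lambda> *
      t powr (1 - smoothing_exponent q - weight \<rho> q)) \<le> 1" .
qed (rule \<Lambda>)

text \<open>In the L^3 scaling the leftover power of t is 1/2 + 1/2 - 1 = 0, so the integral term
  decays at the same rate as T(t)a.\<close>

lemma solution_decay:
  assumes kp: "kato_exponent \<Omega> \<epsilon> T K1 K2 q p" "3 \<le> p" and a: "a \<in> Lp_sigma 3 \<Omega>"
    and u: "path {0<..<t} u (weight 3 q) A" "t > 0" "0 \<le> weight 3 q" "weight 3 q < 1/2"
    and eq: "ae_eq \<Omega> (u t) (\<lambda>x. T t a x - duhamel q u t x)" "u t \<in> Lp q \<Omega>"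
    and bound: "\<And>s. s > 0 \<Longrightarrow> Lp_norm q \<Omega> (u s) \<le> B * s powr (- weight 3 q)"
  shows "u t \<in> Lp_sigma p \<Omega>"
    and "Lp_norm p \<Omega> (u t) \<le> Lp_norm p \<Omega> (T t a) +
      smoothing_const p * B * B * kernel_mass (smoothing_exponent p) (2 * weight 3 q) * t powr (- weight 3 p)"
proof -
  interpret e: kato_exponent \<Omega> \<epsilon> T K1 K2 q p by (rule kp)
  have adm3: "admissible_exponent \<epsilon> 3" by (rule admissible_between_2_and_3) auto
  note sol = e.solution_Lp_sigma[OF u eq(1) T_bound(1)[OF adm3 e.p_adm kp(2) u(2) a] eq(2)]
  show "u t \<in> Lp_sigma p \<Omega>" by (rule sol(2))
  define c where "c = e.\<kappa> * B * B * kernel_mass e.\<beta> (2 * weight 3 q)"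
  have "t powr weight 3 p * Lp_norm p \<Omega> (duhamel p u t) \<le> c * t powr (1/2 + 3/(2*3) - 3/3)"
    unfolding c_def by (rule e.duhamel_weighted_bound[OF u u(4)]) (use bound in auto)
  then have "Lp_norm p \<Omega> (duhamel p u t) \<le> c * t powr (- weight 3 p)"
    using u(2) by (simp add: powr_minus_divide field_simps)
  then show "Lp_norm p \<Omega> (u t) \<le> Lp_norm p \<Omega> (T t a) +
      smoothing_const p * B * B * kernel_mass (smoothing_exponent p) (2 * weight 3 q) * t powr (- weight 3 p)"
    using sol(3) unfolding c_def by linarith
qed

text \<open>\<open>\<rho>\<close> is the exponent whose scaling governs \<open>u\<close> near \<open>t = 0\<close>: it is \<open>r\<close>, except for a global
  solution with \<open>q < r\<close>, where \<open>\<rho> = q\<close>.  The long-time bound is the one with \<open>\<rho> = 3\<close>.\<close>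

lemma regular_solutionI:
  assumes T0: "T0 > 0" and r: "3 \<le> r" "r < min (3 + \<epsilon>) 4" and a: "a \<in> Lp_sigma r \<Omega>" and base: "base_exponent K1 \<le> q"
    and u: "path (times T0) u \<alpha> A" "0 \<le> \<alpha>" "\<alpha> < 1/2"
    and eq: "\<And>t. t \<in> times T0 \<Longrightarrow> ae_eq \<Omega> (u t) (\<lambda>x. T t a x - duhamel q u t x)"
    and \<rho>: "3 \<le> \<rho>" "\<rho> \<le> q" and B: "0 \<le> B"
    and bound: "\<And>s. s \<in> times T0 \<Longrightarrow> Lp_norm q \<Omega> (u s) \<le> B * s powr (- weight \<rho> q)"
    and \<eta>: "0 \<le> \<eta>" "\<eta> = 1/2 + 3/(2*r) - 3/\<rho>"
    and small: "0 < \<eta> \<or> (\<forall>b>0. \<exists>\<tau>>0. \<forall>s\<in>times T0. s < \<tau> \<longrightarrow> Lp_norm q \<Omega> (u s) \<le> b * s powr (- weight \<rho> q))"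
    and long: "(\<exists>c. T0 \<le> ereal c) \<or> (\<forall>s\<in>times T0. Lp_norm q \<Omega> (u s) \<le> B' * s powr (- weight 3 q))"
  shows "regular_solution r a T0 (\<lambda>t. if t = 0 then a else u t)"
proof -
  define u' where "u' = (\<lambda>t. if t = 0 then a else u t)"
  have radm: "admissible_exponent \<epsilon> r" by (rule admissible_above_3) (use r in auto)
  have w: "weight \<rho> q < 1/2" "weight 3 q < 1/2" using weight_less_half \<rho> q_lt q_gt by auto
  have sub: "path {0<..<t} u \<alpha> A" if "t \<in> times T0" for t by (rule path_subset[OF u(1) times_initial[OF that]])
  have init: "s \<in> times T0" if "t \<in> times T0" "0 < s" "s < t" for s t using times_initial[OF that(1)] that by auto
  have props: "BC_Lp_sigma p \<Omega> T0 (\<lambda>t x. time_weight (weight r p) t *\<^sub>R u' t x)"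
    "p > r \<Longrightarrow> ((\<lambda>t. t powr weight r p * Lp_norm p \<Omega> (u' t)) \<longlongrightarrow> 0) (at_right 0)"
    "p = r \<Longrightarrow> ((\<lambda>t. Lp_norm r \<Omega> (\<lambda>x. u' t x - a x)) \<longlongrightarrow> 0) (at_right 0)"
    "p = r \<Longrightarrow> mild_solution \<Omega> T r a T0 u'"
    if p: "r \<le> p" "p < min (3 + \<epsilon>) 4" for p
  proof -
    have padm: "admissible_exponent \<epsilon> p" by (rule admissible_above_3) (use p r in auto)
    have kp: "kato_exponent \<Omega> \<epsilon> T K1 K2 q p"
      by (rule kato_exponent_above_base[OF base q_lt q_adm _ _ padm]) (use p r in auto)
    interpret e: kato_exponent \<Omega> \<epsilon> T K1 K2 q p by (rule kp)
    define c where "c = e.\<kappa> * kernel_mass e.\<beta> (2 * weight \<rho> q)"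
    have c: "c \<ge> 0" unfolding c_def using w kernel_mass_nonneg[OF e.exponent_less] by simp
    have duh: "t powr weight r p * Lp_norm p \<Omega> (duhamel p u t) \<le> c * (b * b) * t powr \<eta>"
      if "t \<in> times T0" "\<And>s. 0 < s \<Longrightarrow> s < t \<Longrightarrow> Lp_norm q \<Omega> (u s) \<le> b * s powr (- weight \<rho> q)" for t b
      using e.duhamel_weighted_bound[OF sub[OF that(1)] times_pos[OF that(1)] u(2,3) w(1) that(2), of r]
      unfolding \<eta>(2) c_def by (simp add: mult_ac)
    have duhB: "t powr weight r p * Lp_norm p \<Omega> (duhamel p u t) \<le> c * (B * B) * t powr \<eta>" if "t \<in> times T0" for t
      by (rule duh[OF that bound[OF init[OF that]]])
    have van: "((\<lambda>t. t powr weight r p * Lp_norm p \<Omega> (duhamel p u t)) \<longlongrightarrow> 0) (at_right 0)"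
    \<comment> \<open>A positive power of t tends to 0 by itself. For \<eta> = 0 the bound is c b^2,
      with b arbitrarily small near t = 0.\<close>
    proof (cases "0 < \<eta>")
      case True
      show ?thesis
      proof (rule Lim_null_comparison)
        have "((\<lambda>t. c * (B * B) * t powr \<eta>) \<longlongrightarrow> c * (B * B) * 0 powr \<eta>) (at_right 0)"
          using True by (intro tendsto_intros tendsto_powr2) (auto intro!: eventually_at_rightI[of 0 1])
        then show "((\<lambda>t. c * (B * B) * t powr \<eta>) \<longlongrightarrow> 0) (at_right 0)" using True by simp
        show "\<forall>\<^sub>F t in at_right 0. norm (t powr weight r p * Lp_norm p \<Omega> (duhamel p u t)) \<le> c * (B * B) * t powr \<eta>"
          using eventually_times[OF T0] by eventually_elim (use duhB in simp)
      qed
    next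
      case False
      show ?thesis
      proof (rule tendstoI)
        fix e :: real assume e: "e > 0"
        \<comment> \<open>As b \<le> 1, c b^2 is at most c e / (2 (c + 1)), which is below e; the 1
          covers c = 0.\<close>
        define b where "b = min 1 (e / (2 * (c + 1)))"
        have b: "b > 0" "b \<le> 1" using e c by (auto simp: b_def)
        obtain \<tau> where \<tau>: "\<tau> > 0" "\<And>s. s \<in> times T0 \<Longrightarrow> s < \<tau> \<Longrightarrow> Lp_norm q \<Omega> (u s) \<le> b * s powr (- weight \<rho> q)"
          using small False b(1) by blast
        have "\<forall>\<^sub>F t in at_right 0. t < \<tau>" using \<tau>(1) by (auto intro!: eventually_at_rightI[of 0 \<tau>])
        then show "\<forall>\<^sub>F t in at_right 0. dist (t powr weight r p * Lp_norm p \<Omega> (duhamel p u t)) 0 < e"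
          using eventually_times[OF T0]
        proof eventually_elim
          case (elim t)
          have "t powr weight r p * Lp_norm p \<Omega> (duhamel p u t) \<le> c * (b * b) * t powr \<eta>"
            by (rule duh[OF elim(2) \<tau>(2)]) (use init[OF elim(2)] elim(1) in auto)
          also have "\<dots> = c * (b * b)" using False \<eta>(1) times_pos[OF elim(2)] by simp
          also have "\<dots> \<le> c * (1 * (e / (2 * (c + 1))))" using b c by (intro mult_left_mono mult_mono) (auto simp: b_def)
          also have "\<dots> < e" using c e by (simp add: field_simps) (simp add: add_strict_increasing2 mult_nonneg_nonneg)
          finally show ?case by simp
        qed
      qed
    qed
    \<comment> \<open>On a bounded interval t^\<eta> is bounded. On an unbounded one the \<rho>
      bound serves up to t = 1, and later the L^3 scaling, whose power 1/2 + 3/(2r) - 1 is not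
      positive.\<close>
    obtain M where bdd: "\<And>t. t \<in> times T0 \<Longrightarrow> t powr weight r p * Lp_norm p \<Omega> (duhamel p u t) \<le> M"
      using long
    proof
      assume "\<exists>c. T0 \<le> ereal c"
      then obtain C where C: "T0 \<le> ereal C" ..
      show thesis
      proof (rule that)
        fix t assume t: "t \<in> times T0"
        then have "ereal t < T0" by (simp add: times_def)
        from order_less_le_trans[OF this C] have "t < C" by simp
        then have "c * (B * B) * t powr \<eta> \<le> c * (B * B) * C powr \<eta>"
          using times_pos[OF t] \<eta>(1) c by (intro mult_left_mono powr_mono2) auto
        then show "t powr weight r p * Lp_norm p \<Omega> (duhamel p u t) \<le> c * (B * B) * C powr \<eta>"
          using duhB[OF t] by linarith
      qed
    next
      assume long: "\<forall>s\<in>times T0. Lp_norm q \<Omega> (u s) \<le> B' * s powr (- weight 3 q)"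
      define c' where "c' = e.\<kappa> * B' * B' * kernel_mass e.\<beta> (2 * weight 3 q)"
      have c': "c' \<ge> 0" 
        unfolding c'_def mult.assoc[of _ B' B'] using kernel_mass_nonneg[OF e.exponent_less] w
        by (intro mult_nonneg_nonneg[of "e.\<kappa> * (B' * B')"] mult_nonneg_nonneg[of "e.\<kappa>" "B' * B'"]) auto
      show thesis
      proof (rule that)
        fix t assume t: "t \<in> times T0"
        show "t powr weight r p * Lp_norm p \<Omega> (duhamel p u t) \<le> c * (B * B) + c'"
        proof (cases "t \<le> 1")
          case True
          then have "t powr \<eta> \<le> 1" using times_pos[OF t] \<eta>(1) powr_mono2[of \<eta> t 1] by simp
          then have "c * (B * B) * t powr \<eta> \<le> c * (B * B) * 1" using c by (intro mult_left_mono) auto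
          then show ?thesis using duhB[OF t] c' by linarith
        next
          case False
          have "3/(2*r) \<le> 3/(2*3)" using r by (intro divide_left_mono) auto
          then have "t powr (1/2 + 3/(2*r) - 3/3) \<le> t powr 0" using False by (intro powr_mono) auto
          then have "c' * t powr (1/2 + 3/(2*r) - 3/3) \<le> c' * 1" using c' False by (intro mult_left_mono) auto
          moreover have "t powr weight r p * Lp_norm p \<Omega> (duhamel p u t) \<le> c' * t powr (1/2 + 3/(2*r) - 3/3)"
            unfolding c'_def by (rule e.duhamel_weighted_bound[OF sub[OF t] times_pos[OF t] u(2,3) w(2)])
              (use long init[OF t] in auto)
          moreover have "0 \<le> c * (B * B)" using c by simp
          ultimately show ?thesis by linarith
        qed
      qed
    qed
    note P = solution_properties[OF T0 radm r(1) a u eq kp p(1) van bdd u'_def]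
    show "BC_Lp_sigma p \<Omega> T0 (\<lambda>t x. time_weight (weight r p) t *\<^sub>R u' t x)"
      "p > r \<Longrightarrow> ((\<lambda>t. t powr weight r p * Lp_norm p \<Omega> (u' t)) \<longlongrightarrow> 0) (at_right 0)"
      "p = r \<Longrightarrow> ((\<lambda>t. Lp_norm r \<Omega> (\<lambda>x. u' t x - a x)) \<longlongrightarrow> 0) (at_right 0)"
      "p = r \<Longrightarrow> mild_solution \<Omega> T r a T0 u'"
      by (rule P; assumption)+
  qed
  show ?thesis
    unfolding regular_solution_def u'_def[symmetric] using props r T0 by blast
qed

end

section \<open>Supercritical, critical and global solutions\<close>

context stokes_estimates
begin

text \<open>With \<theta> = 1/2 - 3/(2r) the existence time solves c N \<tau>^\<theta> = 1, N being
  the norm of a. Since 1/\<theta> = 2r/(r - 3), this is the power in part (2).\<close>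

lemma local_solution_supercritical:
  assumes r: "3 < r" "r < min (3 + \<epsilon>) 4" and a: "a \<in> Lp_sigma r \<Omega>"
  shows "\<exists>T0 u. regular_solution r a T0 u \<and>
    T0 \<ge> ereal (local_const K1 K2 r powr (- (2 * r / (r - 3))) * Lp_norm r \<Omega> a powr (- (2 * r / (r - 3))))"
proof -
  define q where "q = max (base_exponent K1) r"
  have radm: "admissible_exponent \<epsilon> r" by (rule admissible_above_3) (use r in auto)
  have q: "base_exponent K1 \<le> q" "q < 4" "admissible_exponent \<epsilon> q" "r \<le> q" "3 < q"
    using base_exponent r radm by (auto simp: q_def max_def)
  interpret kato \<Omega> \<epsilon> T K1 K2 q by unfold_locales (use q in auto)
  define N where "N = Lp_norm r \<Omega> a"
  define k where "k = const_of K1 r q"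
  define c where "c = local_const K1 K2 r"
  define \<theta> where "\<theta> = 1/2 - 3/(2*r)"
  have \<theta>: "\<theta> > 0" "2 * r / (r - 3) = 1/\<theta>" using r by (simp_all add: \<theta>_def field_simps)
  have c: "c > 0" unfolding c_def by (rule local_const_pos)
  have N: "N \<ge> 0" by (simp add: N_def)
  have k: "k \<ge> 0" by (simp add: k_def)
  have Dk: "picard_const K1 K2 r q * k \<le> c"
    unfolding c_def local_const_def q_def[symmetric] k_def[symmetric] using picard_const_pos[of K1 K2 r q] by (simp add: distrib_left)
  define \<tau> where "\<tau> = (if N = 0 then 1 else (c * N) powr (- (1/\<theta>)))"
  have \<tau>: "\<tau> > 0" using c N by (auto simp: \<tau>_def)
  have tm: "t > 0 \<and> t < \<tau>" if "t \<in> times (ereal \<tau>)" for t using that by (simp add: times_def)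
  have w: "0 \<le> weight r q" "weight r q < 1/2" using weight_nonneg weight_less_half q r by auto
  have small: "picard_const K1 K2 r q * (k * N) * t powr (1/2 - 3/(2*r)) \<le> 1" if t: "t \<in> times (ereal \<tau>)" for t
  proof (cases "N = 0")
    case False
    then have cN: "c * N > 0" using c N by simp
    have "t powr \<theta> \<le> \<tau> powr \<theta>" using tm[OF t] \<theta> by (intro powr_mono2) auto
    also have "\<dots> = 1 / (c * N)" 
    proof -
      have "((c * N) powr (- (1/\<theta>))) powr \<theta> = (c * N) powr (- 1)" unfolding powr_powr using \<theta> by simp
      then show ?thesis using False cN by (simp add: \<tau>_def powr_minus_divide)
    qed
    finally have 1: "t powr \<theta> \<le> 1 / (c * N)" .
    have "picard_const K1 K2 r q * (k * N) * t powr \<theta> \<le> (c * N) * (1 / (c * N))"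
      unfolding mult.assoc[symmetric, of _ k]
      by (rule mult_mono[OF mult_right_mono[OF Dk N] 1]) (use N c in auto)
    also have "(c * N) * (1 / (c * N)) = 1" using less_imp_neq[OF cN] by (metis times_divide_eq_right mult_1_right divide_self)
    finally show ?thesis by (simp only: \<theta>_def)
  qed simp
  have bound: "Lp_norm q \<Omega> (T t a) \<le> k * N * t powr (- weight r q)" if "t \<in> times (ereal \<tau>)" for t
    unfolding k_def N_def by (rule T_weight_bound[OF radm q(3,4) times_pos[OF that] a])
  obtain u where u: "path (times (ereal \<tau>)) u (weight r q) (2 * (k * N))"
      "\<forall>t\<in>times (ereal \<tau>). ae_eq \<Omega> (u t) (\<lambda>x. T t a x - duhamel q u t x)"
    using kato_solution[OF less_imp_le[OF r(1)] q(4) radm a mult_nonneg_nonneg[OF k N] bound small] by blast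
  have "regular_solution r a (ereal \<tau>) (\<lambda>t. if t = 0 then a else u t)"
  \<comment> \<open>With \<rho> = r the exponent 1/2 + 3/(2r) - 3/\<rho> equals \<theta>, which is
    positive.\<close>
  proof (rule regular_solutionI[OF _ _ r(2) a q(1) u(1) w _ _ q(4), where \<eta> = \<theta> and B = "2 * (k * N)"])
    show "ereal \<tau> > 0" using \<tau> by (simp add: zero_ereal_def)
    show "ae_eq \<Omega> (u t) (\<lambda>x. T t a x - duhamel q u t x)" if "t \<in> times (ereal \<tau>)" for t using u(2) that by blast
    show "Lp_norm q \<Omega> (u s) \<le> 2 * (k * N) * s powr (- weight r q)" if "s \<in> times (ereal \<tau>)" for s
      using u(1) that by (simp add: path_def)
  qed (use r \<theta> k N in \<open>auto simp: \<theta>_def\<close>)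
  moreover have "ereal \<tau> \<ge> ereal (c powr (- (2 * r / (r - 3))) * N powr (- (2 * r / (r - 3))))"
    unfolding \<theta>(2) using c N by (auto simp: \<tau>_def powr_mult)
  ultimately show ?thesis unfolding c_def N_def by blast
qed

text \<open>At r = 3 no power of t helps. Instead \<open>T_vanish\<close> provides an interval on
  which the weighted L^q norm of T(t)a is at most \<Lambda>.\<close>

lemma local_solution_critical:
  assumes a: "a \<in> Lp_sigma 3 \<Omega>"
  shows "\<exists>T0 u. regular_solution 3 a T0 u"
proof -
  define q where "q = base_exponent K1"
  have q: "3 < q" "q < 4" "admissible_exponent \<epsilon> q" using base_exponent by (auto simp: q_def)
  interpret kato \<Omega> \<epsilon> T K1 K2 q by unfold_locales (use q in auto)
  have adm3: "admissible_exponent \<epsilon> 3" by (rule admissible_between_2_and_3) auto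
  \<comment> \<open>With this value the smallness condition holds with equality, its power of t
    being t^0.\<close>
  define \<Lambda> where "\<Lambda> = 1 / picard_const K1 K2 3 q"
  have \<Lambda>: "\<Lambda> > 0" by (simp add: \<Lambda>_def picard_const_pos)
  have w: "0 \<le> weight 3 q" "weight 3 q < 1/2" using weight_nonneg weight_less_half q by auto
  have vanish: "\<exists>\<tau>>0. \<forall>t. 0 < t \<longrightarrow> t < \<tau> \<longrightarrow> Lp_norm q \<Omega> (T t a) \<le> b * t powr (- weight 3 q)" if b: "b > 0" for b
  proof -
    have "\<forall>\<^sub>F t in at_right 0. t powr weight 3 q * Lp_norm q \<Omega> (T t a) < b"
      by (rule order_tendstoD(2)[OF T_vanish[OF adm3 q(3,1) a] b])
    then obtain \<tau> where \<tau>: "\<tau> > 0" "\<And>t. 0 < t \<Longrightarrow> t < \<tau> \<Longrightarrow> t powr weight 3 q * Lp_norm q \<Omega> (T t a) < b"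
      unfolding eventually_at_right_field by blast
    have "Lp_norm q \<Omega> (T t a) \<le> b * t powr (- weight 3 q)" if "0 < t" "t < \<tau>" for t
      using \<tau>(2)[OF that] that(1) by (simp add: powr_minus_divide field_simps)
    then show ?thesis using \<tau>(1) by blast
  qed
  obtain \<tau> where \<tau>: "\<tau> > 0" "\<And>t. 0 < t \<Longrightarrow> t < \<tau> \<Longrightarrow> Lp_norm q \<Omega> (T t a) \<le> \<Lambda> * t powr (- weight 3 q)"
    using vanish[OF \<Lambda>] by blast
  have tm: "t > 0 \<and> t < \<tau>" if "t \<in> times (ereal \<tau>)" for t using that by (simp add: times_def)
  have "\<exists>u. path (times (ereal \<tau>)) u (weight 3 q) (2 * \<Lambda>) \<and> (\<forall>t\<in>times (ereal \<tau>). ae_eq \<Omega> (u t) (\<lambda>x. T t a x - duhamel q u t x)) \<and>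
    (\<forall>\<gamma> B \<sigma>. 0 \<le> \<gamma> \<and> \<gamma> \<le> weight 3 q \<and> 0 \<le> B \<and> (\<forall>s\<in>times (ereal \<tau>). s < \<sigma> \<longrightarrow> Lp_norm q \<Omega> (T s a) \<le> B * s powr (-\<gamma>)) \<longrightarrow>
      (\<forall>s\<in>times (ereal \<tau>). s < \<sigma> \<longrightarrow> Lp_norm q \<Omega> (u s) \<le> 2 * B * s powr (-\<gamma>)))"
  proof (rule kato_solution[OF _ _ adm3 a])
    fix t assume "t \<in> times (ereal \<tau>)"
    then have t: "t > 0" "t < \<tau>" using tm by auto
    show "Lp_norm q \<Omega> (T t a) \<le> \<Lambda> * t powr (- weight 3 q)" by (rule \<tau>(2)[OF t])
    show "picard_const K1 K2 3 q * \<Lambda> * t powr (1/2 - 3/(2*3)) \<le> 1"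
      using t picard_const_pos[of K1 K2 3 q] by (simp add: \<Lambda>_def)
  qed (use q \<Lambda> in auto)
  then obtain u where u: "path (times (ereal \<tau>)) u (weight 3 q) (2 * \<Lambda>)"
      "\<forall>t\<in>times (ereal \<tau>). ae_eq \<Omega> (u t) (\<lambda>x. T t a x - duhamel q u t x)"
      and inherit: "\<And>\<gamma> B \<sigma>. 0 \<le> \<gamma> \<Longrightarrow> \<gamma> \<le> weight 3 q \<Longrightarrow> 0 \<le> B \<Longrightarrow> (\<forall>s\<in>times (ereal \<tau>). s < \<sigma> \<longrightarrow> Lp_norm q \<Omega> (T s a) \<le> B * s powr (-\<gamma>)) \<Longrightarrow>
      (\<forall>s\<in>times (ereal \<tau>). s < \<sigma> \<longrightarrow> Lp_norm q \<Omega> (u s) \<le> 2 * B * s powr (-\<gamma>))"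
    by blast
  have "regular_solution 3 a (ereal \<tau>) (\<lambda>t. if t = 0 then a else u t)"
  proof (rule regular_solutionI[OF _ _ _ a _ u(1) w, where \<eta> = 0 and B = "2 * \<Lambda>" and \<rho> = 3])
    show "ereal \<tau> > 0" using \<tau> by (simp add: zero_ereal_def)
    show "ae_eq \<Omega> (u t) (\<lambda>x. T t a x - duhamel q u t x)" if "t \<in> times (ereal \<tau>)" for t using u(2) that by blast
    show "Lp_norm q \<Omega> (u s) \<le> 2 * \<Lambda> * s powr (- weight 3 q)" if "s \<in> times (ereal \<tau>)" for s
      using u(1) that by (simp add: path_def)
    \<comment> \<open>The iteration passes on bounds that hold on a short initial interval only, so
      u inherits the vanishing of T(t)a up to the factor 2.\<close>
    have "\<exists>\<sigma>>0. \<forall>s\<in>times (ereal \<tau>). s < \<sigma> \<longrightarrow> Lp_norm q \<Omega> (u s) \<le> b * s powr (- weight 3 q)" if b: "b > 0" for b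
    proof -
      obtain \<sigma> where \<sigma>: "\<sigma> > 0" "\<And>t. 0 < t \<Longrightarrow> t < \<sigma> \<Longrightarrow> Lp_norm q \<Omega> (T t a) \<le> b / 2 * t powr (- weight 3 q)"
        using vanish[of "b / 2"] b by auto
      have "\<forall>s\<in>times (ereal \<tau>). s < \<sigma> \<longrightarrow> Lp_norm q \<Omega> (u s) \<le> 2 * (b / 2) * s powr (- weight 3 q)"
        by (rule inherit) (use \<sigma>(2) b w tm in auto)
      then show ?thesis using \<sigma>(1) by auto
    qed
    then show "0 < (0::real) \<or> (\<forall>b>0. \<exists>\<sigma>>0. \<forall>s\<in>times (ereal \<tau>). s < \<sigma> \<longrightarrow> Lp_norm q \<Omega> (u s) \<le> b * s powr (- weight 3 q))" by blast
  qed (use q \<Lambda> \<epsilon> in \<open>auto simp: q_def\<close>)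
  then show ?thesis by blast
qed

text \<open>In the L^3 scaling the smallness condition is free of t, so the iteration runs on all
  positive times. The behaviour at t = 0 in the L^r scaling is inherited from T(t)a.\<close>

lemma global_solution:
  assumes r: "3 \<le> r" "r < min (3 + \<epsilon>) 4" and a: "a \<in> Lp_sigma r \<Omega>" "a \<in> Lp_sigma 3 \<Omega>"
    and less: "Lp_norm 3 \<Omega> a < smallness_const K1 K2"
  shows "\<exists>u. regular_solution r a \<infinity> u \<and> (\<forall>p. 3 \<le> p \<and> p < min (3 + \<epsilon>) 4 \<longrightarrow>
    (\<forall>t>0. u t \<in> Lp_sigma p \<Omega> \<and> Lp_norm p \<Omega> (u t) \<le> decay_const p K1 K2 * t powr (- weight 3 p)))"
proof -
  define q where "q = base_exponent K1"
  have q: "3 < q" "q < 4" "admissible_exponent \<epsilon> q" "base_exponent K1 \<le> q" using base_exponent by (auto simp: q_def)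
  interpret kato \<Omega> \<epsilon> T K1 K2 q by unfold_locales (use q in auto)
  have adm3: "admissible_exponent \<epsilon> 3" by (rule admissible_between_2_and_3) auto
  have radm: "admissible_exponent \<epsilon> r" by (rule admissible_above_3) (use r in auto)
  have w: "0 \<le> weight 3 q" "weight 3 q < 1/2" using weight_nonneg weight_less_half q by auto
  define C where "C = smallness_const K1 K2"
  have C: "C > 0" unfolding C_def by (rule smallness_const_pos)
  define k where "k = const_of K1 3 q"
  have k: "k \<ge> 0" by (simp add: k_def)
  define \<Lambda> where "\<Lambda> = k * C"
  have \<Lambda>: "\<Lambda> \<ge> 0" using k C by (simp add: \<Lambda>_def)
  have tm: "t \<in> times \<infinity> \<longleftrightarrow> t > 0" for t by (simp add: times_def)
  have T3: "Lp_norm p \<Omega> (T t a) \<le> const_of K1 3 p * C * t powr (- weight 3 p)" if "admissible_exponent \<epsilon> p" "3 \<le> p" "t > 0" for p t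
  proof -
    have "Lp_norm p \<Omega> (T t a) \<le> const_of K1 3 p * Lp_norm 3 \<Omega> a * t powr (- weight 3 p)"
      by (rule T_weight_bound[OF adm3 that a(2)])
    also have "\<dots> \<le> const_of K1 3 p * C * t powr (- weight 3 p)" using less by (intro mult_right_mono mult_left_mono) (auto simp: C_def)
    finally show ?thesis .
  qed
  have "\<exists>u. path (times \<infinity>) u (weight 3 q) (2 * \<Lambda>) \<and> (\<forall>t\<in>times \<infinity>. ae_eq \<Omega> (u t) (\<lambda>x. T t a x - duhamel q u t x)) \<and>
    (\<forall>\<gamma> B \<sigma>. 0 \<le> \<gamma> \<and> \<gamma> \<le> weight 3 q \<and> 0 \<le> B \<and> (\<forall>s\<in>times \<infinity>. s < \<sigma> \<longrightarrow> Lp_norm q \<Omega> (T s a) \<le> B * s powr (-\<gamma>)) \<longrightarrow>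
      (\<forall>s\<in>times \<infinity>. s < \<sigma> \<longrightarrow> Lp_norm q \<Omega> (u s) \<le> 2 * B * s powr (-\<gamma>)))"
  proof (rule kato_solution[OF _ _ adm3 a(2) \<Lambda>])
    fix t :: real assume "t \<in> times \<infinity>"
    then have t: "t > 0" using tm by auto
    show "Lp_norm q \<Omega> (T t a) \<le> \<Lambda> * t powr (- weight 3 q)"
      unfolding \<Lambda>_def k_def using T3[OF q(3) _ t] q by simp
    \<comment> \<open>\<open>local_const\<close> at exponent 3 uses the larger of the base exponent
      and 3, which is q.\<close>
    have "max q 3 = q" using q by simp
    then have "C = 1 / (picard_const K1 K2 3 q * (1 + k))"
      by (simp add: C_def smallness_const_def local_const_def q_def[symmetric] k_def)
    then show "picard_const K1 K2 3 q * \<Lambda> * t powr (1/2 - 3/(2*3)) \<le> 1"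
      using t k picard_const_pos[of K1 K2 3 q] by (simp add: \<Lambda>_def)
  qed (use q in auto)
  then obtain u where u: "path (times \<infinity>) u (weight 3 q) (2 * \<Lambda>)"
      "\<forall>t\<in>times \<infinity>. ae_eq \<Omega> (u t) (\<lambda>x. T t a x - duhamel q u t x)"
      and inherit: "\<And>\<gamma> B \<sigma>. 0 \<le> \<gamma> \<Longrightarrow> \<gamma> \<le> weight 3 q \<Longrightarrow> 0 \<le> B \<Longrightarrow> (\<forall>s\<in>times \<infinity>. s < \<sigma> \<longrightarrow> Lp_norm q \<Omega> (T s a) \<le> B * s powr (-\<gamma>)) \<Longrightarrow>
      (\<forall>s\<in>times \<infinity>. s < \<sigma> \<longrightarrow> Lp_norm q \<Omega> (u s) \<le> 2 * B * s powr (-\<gamma>))"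
    by blast
  have eq: "ae_eq \<Omega> (u t) (\<lambda>x. T t a x - duhamel q u t x)" if "t \<in> times \<infinity>" for t using u(2) that by blast
  have uB: "Lp_norm q \<Omega> (u s) \<le> 2 * \<Lambda> * s powr (- weight 3 q)" if "s > 0" for s
    using u(1) that tm by (simp add: path_def)
  have inherit': "Lp_norm q \<Omega> (u s) \<le> 2 * B * s powr (-\<gamma>)"
    if "0 \<le> \<gamma>" "\<gamma> \<le> weight 3 q" "0 \<le> B" "\<And>s. s > 0 \<Longrightarrow> Lp_norm q \<Omega> (T s a) \<le> B * s powr (-\<gamma>)" "s > 0" for \<gamma> B s
    using inherit[OF that(1-3), of "s + 1"] that(4,5) tm by auto
  define u' where "u' = (\<lambda>t. if t = 0 then a else u t)"
  have "regular_solution r a \<infinity> u'"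
  proof (cases "r \<le> q")
    case True
    \<comment> \<open>(E1) from L^r to L^q gives a singularity no stronger than that of the L^3
      scaling, so u inherits this bound.\<close>
    define B where "B = const_of K1 r q * Lp_norm r \<Omega> a"
    have B: "B \<ge> 0" by (simp add: B_def)
    have wr: "0 \<le> weight r q" "weight r q \<le> weight 3 q" using weight_nonneg weight_antimono r True by auto
    have h: "3/(2*r) \<le> 1/2" "3/r = 2 * (3/(2*r))" using r by (simp_all add: field_simps)
    have h': "0 \<le> 1/2 + 3/(2*r) - 3/r" using h by linarith
    have b: "Lp_norm q \<Omega> (u s) \<le> 2 * B * s powr (- weight r q)" if "s > 0" for s
      by (rule inherit'[OF wr B _ that]) (use T_weight_bound[OF radm q(3) True _ a(1)] in \<open>simp add: B_def\<close>)
    have small: "0 < 1/2 + 3/(2*r) - 3/r \<or>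
        (\<forall>b>0. \<exists>\<tau>>0. \<forall>s\<in>times \<infinity>. s < \<tau> \<longrightarrow> Lp_norm q \<Omega> (u s) \<le> b * s powr (- weight r q))"
    proof (cases "r = 3")
      case True
      have "\<exists>\<sigma>>0. \<forall>s\<in>times \<infinity>. s < \<sigma> \<longrightarrow> Lp_norm q \<Omega> (u s) \<le> b * s powr (- weight 3 q)" if b: "b > 0" for b
      proof -
        have "\<forall>\<^sub>F t in at_right 0. t powr weight 3 q * Lp_norm q \<Omega> (T t a) < b/2"
          by (rule order_tendstoD(2)[OF T_vanish[OF adm3 q(3,1) a(2)]]) (use b in simp)
        then obtain \<tau> where \<tau>: "\<tau> > 0" "\<And>t. 0 < t \<Longrightarrow> t < \<tau> \<Longrightarrow> t powr weight 3 q * Lp_norm q \<Omega> (T t a) < b/2"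
          unfolding eventually_at_right_field by blast
        have "Lp_norm q \<Omega> (T t a) \<le> b/2 * t powr (- weight 3 q)" if "0 < t" "t < \<tau>" for t
          using \<tau>(2)[OF that] that(1) by (simp add: powr_minus_divide field_simps)
        then have "\<forall>s\<in>times \<infinity>. s < \<tau> \<longrightarrow> Lp_norm q \<Omega> (u s) \<le> 2 * (b/2) * s powr (- weight 3 q)"
          by (intro inherit) (use b w tm in auto)
        then show ?thesis using \<tau>(1) by auto
      qed
      then show ?thesis using True by simp
    next
      case False
      then have "3/(2*r) < 1/2" using r by (simp add: field_simps)
      then show ?thesis using h by linarith
    qed
    show ?thesis unfolding u'_def
      by (rule regular_solutionI[OF _ r a(1) q(4) u(1) w eq r(1) True _ b _ refl small, where B' = "2 * \<Lambda>"])
        (use B tm h' uB in auto)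
  next
    case False
    \<comment> \<open>For q < r, (E1) does not lead from L^r to L^q. But T(s)a is bounded in L^3 and
      in L^r, hence in L^q without singularity at 0; so \<rho> = q, whose weight is 0.\<close>
    define B where "B = ((const_of K1 3 3 * Lp_norm 3 \<Omega> a) powr 3 + (const_of K1 r r * Lp_norm r \<Omega> a) powr r) powr (1/q)"
    have TB: "Lp_norm q \<Omega> (T s a) \<le> B * s powr (- 0)" if s: "s > 0" for s
    proof -
      have "Lp_norm q \<Omega> (T s a) \<le> (Lp_norm 3 \<Omega> (T s a) powr 3 + Lp_norm r \<Omega> (T s a) powr r) powr (1/q)"
        by (rule Lp_norm_interpolation) (use T_bound(1)[OF adm3 adm3 _ s a(2)] T_bound(1)[OF radm radm _ s a(1)] q False in \<open>auto intro: Lp_sigma_Lp\<close>)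
      also have "\<dots> \<le> B"
        unfolding B_def using T_weight_bound[OF adm3 adm3 _ s a(2)] T_weight_bound[OF radm radm _ s a(1)] s r q
        by (intro powr_mono2 add_mono) (auto simp: weight_def)
      finally show ?thesis using s by simp
    qed
    have wq: "weight q q = 0" by (simp add: weight_def)
    have b: "Lp_norm q \<Omega> (u s) \<le> 2 * B * s powr (- weight q q)" if "s > 0" for s
      unfolding wq by (rule inherit'[OF _ _ _ TB that]) (use w in \<open>auto simp: B_def\<close>)
    \<comment> \<open>The property of the base exponent, read at p = r, is the positivity of \<eta>
      for \<rho> = q.\<close>
    have "2/q - 1/r < 1/3" using base_exponent(4)[of r] r radm by (simp add: q_def)
    then have \<eta>: "0 < 1/2 + 3/(2*r) - 3/q" by (simp add: field_simps)
    show ?thesis unfolding u'_def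
      by (rule regular_solutionI[OF _ r a(1) q(4) u(1) w eq _ _ _ b _ refl, where B' = "2 * \<Lambda>"])
        (use tm \<eta> uB q in \<open>auto simp: B_def\<close>)
  qed
  moreover have "u' t \<in> Lp_sigma p \<Omega> \<and> Lp_norm p \<Omega> (u' t) \<le> decay_const p K1 K2 * t powr (- weight 3 p)"
    if p: "3 \<le> p" "p < min (3 + \<epsilon>) 4" and t: "t > 0" for p t
  proof -
    have padm: "admissible_exponent \<epsilon> p" by (rule admissible_above_3) (use p in auto)
    have kp: "kato_exponent \<Omega> \<epsilon> T K1 K2 q p"
      by (rule kato_exponent_above_base[OF q(4,2,3) p(1) _ padm]) (use p in auto)
    have tt: "t \<in> times \<infinity>" using t tm by simp
    note D = solution_decay[OF kp p(1) a(2) path_subset[OF u(1) times_initial[OF tt]] t w eq[OF tt] path_Lp[OF u(1) tt] uB]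
    have "Lp_norm p \<Omega> (u t) \<le> const_of K1 3 p * C * t powr (- weight 3 p) +
        smoothing_const p * (2 * \<Lambda>) * (2 * \<Lambda>) * kernel_mass (smoothing_exponent p) (2 * weight 3 q) * t powr (- weight 3 p)"
      using D(2) T3[OF padm p(1) t] by simp
    also have "\<dots> \<le> decay_const p K1 K2 * t powr (- weight 3 p)"
      unfolding decay_const_def Let_def q_def[symmetric] k_def[symmetric] C_def[symmetric] \<Lambda>_def[symmetric] distrib_right[symmetric]
      by (intro mult_right_mono) auto
    finally show ?thesis using D(1) t by (simp add: u'_def)
  qed
  ultimately show ?thesis by blast
qed

end

section \<open>Assembling the three parts of the theorem\<close>

lemma open_exterior_lipschitz_domain: "exterior_lipschitz_domain \<Omega> \<Longrightarrow> open \<Omega>"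
  by (auto simp: exterior_lipschitz_domain_def)

theorem theorem1p3:
  shows "\<exists>(C :: real \<Rightarrow> real \<Rightarrow> constants \<Rightarrow> constants \<Rightarrow> real)
           (C1 :: real \<Rightarrow> constants \<Rightarrow> constants \<Rightarrow> real)
           (C2 :: real \<Rightarrow> constants \<Rightarrow> constants \<Rightarrow> real).
    (\<forall>r p K1 K2. C r p K1 K2 > 0 \<and> C1 p K1 K2 > 0 \<and> C2 p K1 K2 > 0) \<and>
    (\<forall>(\<Omega> :: (real^3) set) (\<epsilon> :: real) (T :: real \<Rightarrow> 3 field \<Rightarrow> 3 field) (K1 :: constants) (K2 :: constants).
       exterior_lipschitz_domain \<Omega> \<and> \<epsilon> > 0 \<and>
       (\<forall>p. admissible_exponent \<epsilon> p \<longrightarrow>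
          neg_generates_bounded_analytic p \<Omega> (stokes p \<Omega>) T \<and> stokes_domain_embeds p \<Omega>) \<and>
       estimate_E1 \<epsilon> \<Omega> T K1 \<and> estimate_E2 \<epsilon> \<Omega> T K2 \<longrightarrow>
       (\<forall>(r :: real) (a :: 3 field). 3 \<le> r \<and> r < min (3 + \<epsilon>) 4 \<and> a \<in> Lp_sigma r \<Omega> \<longrightarrow>
          (\<exists>(T0 :: ereal) (u :: real \<Rightarrow> 3 field).
             \<comment> \<open>(1)\<close>
             T0 > 0 \<and> mild_solution \<Omega> T r a T0 u \<and>
             (\<forall>p. r \<le> p \<and> p < min (3 + \<epsilon>) 4 \<longrightarrow>
                BC_Lp_sigma p \<Omega> T0 (\<lambda>t x. time_weight ((3/2) * (1/r - 1/p)) t *\<^sub>R u t x) \<and>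
                (p > r \<longrightarrow>
                  ((\<lambda>t. t powr ((3/2) * (1/r - 1/p)) * Lp_norm p \<Omega> (u t)) \<longlongrightarrow> 0) (at_right 0))) \<and>
             ((\<lambda>t. Lp_norm r \<Omega> (\<lambda>x. u t x - a x)) \<longlongrightarrow> 0) (at_right 0) \<and>
             \<comment> \<open>(2)\<close>
             (r > 3 \<longrightarrow> (\<forall>p. r \<le> p \<and> p < min (3 + \<epsilon>) 4 \<longrightarrow>
                T0 \<ge> ereal (C r p K1 K2 * Lp_norm r \<Omega> a powr (- (2 * r / (r - 3)))))) \<and>
             \<comment> \<open>(3)\<close>
             (\<forall>p. 3 \<le> p \<and> p < min (3 + \<epsilon>) 4 \<longrightarrow>
                a \<in> Lp_sigma 3 \<Omega> \<and> Lp_norm 3 \<Omega> a < C1 p K1 K2 \<longrightarrow>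
                T0 = \<infinity> \<and>
                (\<forall>t>0. u t \<in> Lp_sigma p \<Omega> \<and>
                   Lp_norm p \<Omega> (u t) \<le> C2 p K1 K2 * t powr (- (3/2) * (1/3 - 1/p)))))))"
proof -
  have pos: "\<forall>r p K1 K2. local_const K1 K2 r powr (- (2 * r / (r - 3))) > 0 \<and> smallness_const K1 K2 > 0 \<and> decay_const p K1 K2 > 0"
    by (simp add: local_const_pos[THEN less_imp_neq, symmetric] smallness_const_pos decay_const_pos)
  show ?thesis
  \<comment> \<open>One lower-bound constant and one smallness constant serve all p, since a single
    auxiliary exponent does.\<close>
  proof (rule exI[of _ "\<lambda>r p K1 K2. local_const K1 K2 r powr (- (2 * r / (r - 3)))"],
      rule exI[of _ "\<lambda>p. smallness_const"], rule exI[of _ decay_const], rule conjI[OF pos], intro allI impI)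
    fix \<Omega> :: "(real^3) set" and \<epsilon> :: real and T :: "real \<Rightarrow> 3 field \<Rightarrow> 3 field" and K1 K2 :: constants
      and r :: real and a :: "3 field"
    assume H: "exterior_lipschitz_domain \<Omega> \<and> \<epsilon> > 0 \<and>
         (\<forall>p. admissible_exponent \<epsilon> p \<longrightarrow>
            neg_generates_bounded_analytic p \<Omega> (stokes p \<Omega>) T \<and> stokes_domain_embeds p \<Omega>) \<and>
         estimate_E1 \<epsilon> \<Omega> T K1 \<and> estimate_E2 \<epsilon> \<Omega> T K2"
      and r: "3 \<le> r \<and> r < min (3 + \<epsilon>) 4 \<and> a \<in> Lp_sigma r \<Omega>"
    interpret stokes_estimates \<Omega> \<epsilon> T K1 K2
      by unfold_locales (use H open_exterior_lipschitz_domain in auto)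
    define R where "R T0 u \<longleftrightarrow> regular_solution r a T0 u \<and>
        (r > 3 \<longrightarrow> T0 \<ge> ereal (local_const K1 K2 r powr (- (2 * r / (r - 3))) * Lp_norm r \<Omega> a powr (- (2 * r / (r - 3))))) \<and>
        (\<forall>p. 3 \<le> p \<and> p < min (3 + \<epsilon>) 4 \<longrightarrow> a \<in> Lp_sigma 3 \<Omega> \<and> Lp_norm 3 \<Omega> a < smallness_const K1 K2 \<longrightarrow>
          T0 = \<infinity> \<and> (\<forall>t>0. u t \<in> Lp_sigma p \<Omega> \<and>
            Lp_norm p \<Omega> (u t) \<le> decay_const p K1 K2 * t powr (- weight 3 p)))" for T0 u
    have "\<exists>T0 u. R T0 u"
    \<comment> \<open>The size of a in L^3 decides which solution is taken: the global one satisfies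
      (2) trivially, and for a local one the premise of (3) fails.\<close>
    proof (cases "a \<in> Lp_sigma 3 \<Omega> \<and> Lp_norm 3 \<Omega> a < smallness_const K1 K2")
      case True
      then obtain u where "regular_solution r a \<infinity> u \<and> (\<forall>p. 3 \<le> p \<and> p < min (3 + \<epsilon>) 4 \<longrightarrow>
          (\<forall>t>0. u t \<in> Lp_sigma p \<Omega> \<and> Lp_norm p \<Omega> (u t) \<le> decay_const p K1 K2 * t powr (- weight 3 p)))"
        using global_solution[of r a] r by blast
      then have "R \<infinity> u" by (simp add: R_def)
      then show ?thesis by blast
    next
      case False
      show ?thesis
      proof (cases "r = 3")
        case True
        then show ?thesis using local_solution_critical[of a] r False unfolding R_def by auto
      next
        case r3: False
        then show ?thesis using local_solution_supercritical[of r a] r False unfolding R_def by auto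
      qed
    qed
    then obtain T0 u where R: "R T0 u" by blast
    show "\<exists>(T0 :: ereal) (u :: real \<Rightarrow> 3 field).
               T0 > 0 \<and> mild_solution \<Omega> T r a T0 u \<and>
               (\<forall>p. r \<le> p \<and> p < min (3 + \<epsilon>) 4 \<longrightarrow>
                  BC_Lp_sigma p \<Omega> T0 (\<lambda>t x. time_weight ((3/2) * (1/r - 1/p)) t *\<^sub>R u t x) \<and>
                  (p > r \<longrightarrow>
                    ((\<lambda>t. t powr ((3/2) * (1/r - 1/p)) * Lp_norm p \<Omega> (u t)) \<longlongrightarrow> 0) (at_right 0))) \<and>
               ((\<lambda>t. Lp_norm r \<Omega> (\<lambda>x. u t x - a x)) \<longlongrightarrow> 0) (at_right 0) \<and>
               (r > 3 \<longrightarrow> (\<forall>p. r \<le> p \<and> p < min (3 + \<epsilon>) 4 \<longrightarrow>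
                  T0 \<ge> ereal (local_const K1 K2 r powr (- (2 * r / (r - 3))) * Lp_norm r \<Omega> a powr (- (2 * r / (r - 3)))))) \<and>
               (\<forall>p. 3 \<le> p \<and> p < min (3 + \<epsilon>) 4 \<longrightarrow>
                  a \<in> Lp_sigma 3 \<Omega> \<and> Lp_norm 3 \<Omega> a < smallness_const K1 K2 \<longrightarrow>
                  T0 = \<infinity> \<and>
                  (\<forall>t>0. u t \<in> Lp_sigma p \<Omega> \<and>
                     Lp_norm p \<Omega> (u t) \<le> decay_const p K1 K2 * t powr (- (3/2) * (1/3 - 1/p))))"
      using R unfolding R_def regular_solution_def weight_def mult_minus_left by blast
  qed
qed

end
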